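(* Let $(E,\tau,M,\rho)$ be a Lie algebroid. The Schouten-Nijenhuis bracket on $A(M,E)$ has the following properties. 1. For $f,g\in A^0(M,E)=C^\infty(M,\mathbb{R})$, $[f,g]=0$. 2. For $V\in A^1(M,E)$, $q\in\mathbb{Z}$ and $Q\in A^q(M,E)$, $[V,Q]=\mathcal{L}_\rho(V)Q$, the Lie derivative of the multivector $Q$ with respect to $V$. 3. For $V,W\in A^1(M,E)$, $[V,W]=\{V,W\}$, the bracket in the right hand side being the Lie algebroid bracket. 4. For all $p,q\in\mathbb{Z}$, $P\in A^p(M,E)$, $Q\in A^q(M,E)$, $$[P,Q]=-(-1)^{(p-1)(q-1)}[Q,P].$$ 5. Let $p\in\mathbb{Z}$, $P\in A^p(M,E)$. The map $Q\mapsto[P,Q]$ is a derivation of degree $p-1$ of the graded exterior algebra $A(M,E)$; in other words, for $q_1,q_2\in\mathbb{Z}$, $Q_1\in A^{q_1}(M,E)$ and $Q_2\in A^{q_2}(M,E)$, $$[P,Q_1\wedge Q_2]=[P,Q_1]\wedge Q_2+(-1)^{(p-1)q_1}Q_1\wedge[P,Q_2].$$ 6. Let $p,q,r\in\mathbb{Z}$, $P\in A^p(M,E)$, $Q\in A^q(M,E)$ and $R\in A^r(M,E)$. The Schouten-Nijenhuis bracket satisfies the graded Jacobi identity: $$(-1)^{(p-1)(r-1)}\bigl[[P,Q],R\bigr]+(-1)^{(q-1)(p-1)}\bigl[[Q,R],P\bigr]+(-1)^{(r-1)(q-1)}\bigl[[R,P],Q\bigr]=0.$$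
   Context: A Lie algebroid $(E,\tau,M,\rho)$ is a smooth real vector bundle $(E,\tau,M)$ of finite rank over a smooth manifold $M$ (with projection $\tau:E\to M$), equipped with a Lie algebra bracket $(s_1,s_2)\mapsto\{s_1,s_2\}$ on the space of smooth sections of $\tau$ and a smooth vector bundle map $\rho:E\to TM$ (the anchor), such that $s\mapsto\rho\circ s$ is a Lie algebra homomorphism into the Lie algebra of smooth vector fields on $M$, and $\{s_1,fs_2\}=f\{s_1,s_2\}+\langle df,\rho\circ s_1\rangle s_2$ for all smooth sections $s_1,s_2$ and all $f\in C^\infty(M,\mathbb{R})$. For $p\in\mathbb{Z}$, $A^p(M,E)$ is the space of smooth sections of $\bigwedge^pE$ and $\Omega^p(M,E)$ the space of smooth sections of $\bigwedge^pE^*$, with degree-$0$ parts equal to $C^\infty(M,\mathbb{R})$ and zero for $p<0$; $A(M,E)=\oplus_pA^p(M,E)$ and $\Omega(M,E)=\oplus_p\Omega^p(M,E)$ are graded algebras for the exterior product. An element of $\Omega^p(M,E)$ is identified with a skew-symmetric $C^\infty(M,\mathbb{R})$-multilinear map $A^1(M,E)^p\to C^\infty(M,\mathbb{R})$. Interior product: for $V\in A^1(M,E)$ and $\eta\in\Omega^p(M,E)$, $i(V)\eta=0$ if $p\le0$ and $i(V)\eta(V_1,\ldots,V_{p-1})=\eta(V,V_1,\ldots,V_{p-1})$ if $p\ge1$. For $f\in A^0(M,E)$, $i(f)\eta=f\eta$; for $p\ge1$, $i(P_1\wedge\cdots\wedge P_p)=i(P_1)\circ\cdots\circ i(P_p)$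 with $P_j\in A^1(M,E)$; extended by linearity to $A(M,E)$. $d_\rho:\Omega(M,E)\to\Omega(M,E)$ is the $\mathbb{R}$-linear, degree $1$ map with $\langle d_\rho f,V\rangle=\langle df,\rho\circ V\rangle$ for functions $f$ and, for $\eta\in\Omega^p(M,E)$, $p\ge1$, $d_\rho\eta(V_0,\ldots,V_p)=\sum_{i=0}^p(-1)^i\langle d(\eta(V_0,\ldots,\widehat{V}_i,\ldots,V_p)),\rho\circ V_i\rangle+\sum_{0\le i<j\le p}(-1)^{i+j}\eta(\{V_i,V_j\},V_0,\ldots,\widehat{V}_i,\ldots,\widehat{V}_j,\ldots,V_p)$ (hats denote omitted terms). The graded bracket of two homogeneous linear endomorphisms $F,G$ of $\Omega(M,E)$ of degrees $d_1,d_2$ is $[F,G]=F\circ G-(-1)^{d_1d_2}G\circ F$ (here $i(P)$ has degree $-p$ for $P\in A^p(M,E)$). The Schouten-Nijenhuis bracket of $P\in A^p(M,E)$ and $Q\in A^q(M,E)$ is the unique $[P,Q]\in A^{p+q-1}(M,E)$ such that $i([P,Q])=\bigl[[i(P),d_\rho],i(Q)\bigr]$; it is extended bilinearly to $A(M,E)$. Lie derivative of multivectors: on forms, for $V\in A^1(M,E)$, $\mathcal{L}_\rho(V)f=\langle df,\rho\circ V\rangle$ for functions and $(\mathcal{L}_\rho(V)\eta)(V_1,\ldots,V_p)=\mathcal{L}_\rho(V)(\eta(V_1,\ldots,V_p))-\sum_{i=1}^p\eta(V_1,\ldots,\{V,V_i\},\ldots,V_p)$ for $\eta\in\Omega^p(M,E)$,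 $p>0$; on multivectors, $\mathcal{L}_\rho(V)$ has the same value on functions and, for $P\in A^p(M,E)$, $p\ge1$, $\mathcal{L}_\rho(V)P\in A^p(M,E)$ is determined by $\langle\eta,\mathcal{L}_\rho(V)P\rangle=\mathcal{L}_\rho(V)(\langle\eta,P\rangle)-\langle\mathcal{L}_\rho(V)\eta,P\rangle$ for all $\eta\in\Omega^p(M,E)$, where the pairing is the $C^\infty(M,\mathbb{R})$-bilinear one with $\langle\eta,v_1\wedge\cdots\wedge v_p\rangle=\eta(v_1,\ldots,v_p)$. *)

theory Defs
  imports "HOL-Analysis.Analysis" "HOL-Library.Function_Algebras"
begin

instantiation "fun" :: (type, real_vector) real_vector
begin

definition scaleR_fun :: "real \<Rightarrow> ('a \<Rightarrow> 'b) \<Rightarrow> 'a \<Rightarrow> 'b"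
  where "scaleR_fun c f = (\<lambda>x. c *\<^sub>R f x)"

instance
  by standard
    (auto simp: scaleR_fun_def plus_fun_def fun_eq_iff scaleR_add_right scaleR_add_left)

end

lemma scaleR_fun_apply [simp]: "(c *\<^sub>R f) x = c *\<^sub>R f x"
  by (simp add: scaleR_fun_def)

section \<open>Smooth manifolds\<close>

text \<open>
  The model space is \<open>Euclidean_space n\<close>, i.e. the sequences vanishing from index
  \<open>n\<close> on, so that dimension 0 is included. A function on an open subset of it
  is \<open>C\<^sup>k\<close> if its partial derivatives up to order \<open>k\<close> exist and are continuous.
\<close>

fun Ck_on :: "nat \<Rightarrow> nat \<Rightarrow> (nat \<Rightarrow> real) set \<Rightarrow> ((nat \<Rightarrow> real) \<Rightarrow> real) \<Rightarrow> bool" where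
  "Ck_on n 0 S f \<longleftrightarrow> continuous_on S f"
| "Ck_on n (Suc k) S f \<longleftrightarrow> continuous_on S f \<and>
     (\<exists>D. \<forall>i<n. (\<forall>x\<in>S. ((\<lambda>t. f (x(i := t))) has_real_derivative D i x) (at (x i))) \<and>
               Ck_on n k S (D i))"

definition Cinf_on :: "nat \<Rightarrow> (nat \<Rightarrow> real) set \<Rightarrow> ((nat \<Rightarrow> real) \<Rightarrow> real) \<Rightarrow> bool"
  where "Cinf_on n S f \<longleftrightarrow> (\<forall>k. Ck_on n k S f)"

text \<open>
  The manifold is the whole type \<open>'m\<close>; a chart is a pair of its domain and its
  coordinate map. The atlas need not be maximal.
\<close>

record 'm manifold =
  mdim :: nat
  charts :: "('m set \<times> ('m \<Rightarrow> nat \<Rightarrow> real)) set"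

definition smooth_on :: "'m manifold \<Rightarrow> 'm set \<Rightarrow> ('m \<Rightarrow> real) \<Rightarrow> bool"
  where "smooth_on M W f \<longleftrightarrow>
    (\<forall>(U, \<phi>)\<in>charts M. Cinf_on (mdim M) (\<phi> ` (U \<inter> W)) (f \<circ> the_inv_into U \<phi>))"

abbreviation smooth_functions :: "'m manifold \<Rightarrow> ('m \<Rightarrow> real) set" (\<open>C\<^sup>\<infinity>\<close>)
  where "C\<^sup>\<infinity> M \<equiv> {f. smooth_on M UNIV f}"

locale smooth_manifold =
  fixes M :: "'m::{t2_space, second_countable_topology} manifold"
  assumes chart_domain: "(U, \<phi>) \<in> charts M \<Longrightarrow> open U"
    and chart_image: "(U, \<phi>) \<in> charts M \<Longrightarrow> openin (Euclidean_space (mdim M)) (\<phi> ` U)"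
    and chart_homeomorphic: "(U, \<phi>) \<in> charts M \<Longrightarrow>
      homeomorphic_map (top_of_set U) (subtopology (Euclidean_space (mdim M)) (\<phi> ` U)) \<phi>"
    and chart_cover: "(\<Union>(U, \<phi>)\<in>charts M. U) = UNIV"
    and chart_transition: "\<lbrakk>(U, \<phi>) \<in> charts M; (V, \<psi>) \<in> charts M; i < mdim M\<rbrakk> \<Longrightarrow>
      Cinf_on (mdim M) (\<phi> ` (U \<inter> V)) (\<lambda>y. \<psi> (the_inv_into U \<phi> y) i)"

section \<open>Vector bundles\<close>

text \<open>
  Every fibre is a linear subspace of one real vector space \<open>'v\<close> (which loses no generality:
  the fibres embed in their product). The linear local trivialization
  \<open>(x, c) \<mapsto> \<Sum>\<^sub>i c\<^sub>i e\<^sub>i(x)\<close> over \<open>W\<close> is given by the pair of \<open>W\<close> and its frame \<open>e\<close>.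
\<close>

record ('m, 'v, 'i) vbundle =
  fibre :: "'m \<Rightarrow> 'v set"
  indices :: "'i set"
  frames :: "('m set \<times> ('i \<Rightarrow> 'm \<Rightarrow> 'v)) set"

locale vector_bundle = smooth_manifold M
  for M :: "'m::{t2_space, second_countable_topology} manifold" +
  fixes E :: "('m, 'v::real_vector, 'i) vbundle"
  assumes fibre_subspace: "subspace (fibre E x)"
    and finite_rank: "finite (indices E)"
    and frame_domain: "(W, e) \<in> frames E \<Longrightarrow> open W"
    and frame_inj: "\<lbrakk>(W, e) \<in> frames E; x \<in> W\<rbrakk> \<Longrightarrow> inj_on (\<lambda>i. e i x) (indices E)"
    and frame_independent: "\<lbrakk>(W, e) \<in> frames E; x \<in> W\<rbrakk> \<Longrightarrow>
      independent ((\<lambda>i. e i x) ` indices E)"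
    and frame_span: "\<lbrakk>(W, e) \<in> frames E; x \<in> W\<rbrakk> \<Longrightarrow>
      span ((\<lambda>i. e i x) ` indices E) = fibre E x"
    and frame_cover: "(\<Union>(W, e)\<in>frames E. W) = UNIV"
    and frame_transition: "\<lbrakk>(W, e) \<in> frames E; (W', e') \<in> frames E\<rbrakk> \<Longrightarrow>
      \<exists>a. (\<forall>i\<in>indices E. \<forall>j\<in>indices E. smooth_on M (W \<inter> W') (a i j)) \<and>
          (\<forall>x\<in>W \<inter> W'. \<forall>j\<in>indices E. e' j x = (\<Sum>i\<in>indices E. a i j x *\<^sub>R e i x))"

definition sections :: "'m manifold \<Rightarrow> ('m, 'v::real_vector, 'i) vbundle \<Rightarrow> ('m \<Rightarrow> 'v) set"
  where "sections M E = {s. (\<forall>x. s x \<in> fibre E x) \<and>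
    (\<forall>(W, e)\<in>frames E. \<exists>c. (\<forall>i\<in>indices E. smooth_on M W (c i)) \<and>
       (\<forall>x\<in>W. s x = (\<Sum>i\<in>indices E. c i x *\<^sub>R e i x)))}"

text \<open>Smooth vector bundle maps over the identity of the base.\<close>

definition bundle_map ::
  "'m manifold \<Rightarrow> ('m, 'v::real_vector, 'i) vbundle \<Rightarrow> ('m, 'w::real_vector, 'j) vbundle \<Rightarrow>
   ('m \<Rightarrow> 'v \<Rightarrow> 'w) \<Rightarrow> bool"
  where "bundle_map M E F h \<longleftrightarrow>
    (\<forall>x. \<forall>v\<in>fibre E x. h x v \<in> fibre F x) \<and>
    (\<forall>x. \<forall>v\<in>fibre E x. \<forall>w\<in>fibre E x. \<forall>a b. h x (a *\<^sub>R v + b *\<^sub>R w) = a *\<^sub>R h x v + b *\<^sub>R h x w) \<and>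
    (\<forall>(W, e)\<in>frames E. \<forall>(W', e')\<in>frames F.
      \<exists>a. (\<forall>i\<in>indices F. \<forall>j\<in>indices E. smooth_on M (W \<inter> W') (a i j)) \<and>
          (\<forall>x\<in>W \<inter> W'. \<forall>j\<in>indices E. h x (e j x) = (\<Sum>i\<in>indices F. a i j x *\<^sub>R e' i x)))"

section \<open>The tangent bundle\<close>

text \<open>
  Tangent vectors at \<open>x\<close> are the derivations of \<open>C\<^sup>\<infinity> M\<close> at \<open>x\<close>, set to 0 on non-smooth
  functions. The frames are the coordinate vector fields of the charts.
\<close>

type_synonym 'm tangent = "('m \<Rightarrow> real) \<Rightarrow> real"

definition derivations_at :: "'m manifold \<Rightarrow> 'm \<Rightarrow> 'm tangent set"
  where "derivations_at M x = {v. (\<forall>f. f \<notin> C\<^sup>\<infinity> M \<longrightarrow> v f = 0) \<and>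
    (\<forall>f\<in>C\<^sup>\<infinity> M. \<forall>g\<in>C\<^sup>\<infinity> M.
      (\<forall>a b. v (\<lambda>y. a * f y + b * g y) = a * v f + b * v g) \<and>
      v (\<lambda>y. f y * g y) = f x * v g + g x * v f)}"

definition coord_vector ::
  "'m manifold \<Rightarrow> 'm set \<Rightarrow> ('m \<Rightarrow> nat \<Rightarrow> real) \<Rightarrow> nat \<Rightarrow> 'm \<Rightarrow> 'm tangent"
  where "coord_vector M U \<phi> i x = (\<lambda>f. if f \<in> C\<^sup>\<infinity> M
    then deriv (\<lambda>t. f (the_inv_into U \<phi> ((\<phi> x)(i := t)))) (\<phi> x i) else 0)"

definition tangent_bundle :: "'m manifold \<Rightarrow> ('m, 'm tangent, nat) vbundle"
  where "tangent_bundle M =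
    \<lparr>fibre = derivations_at M, indices = {..<mdim M},
     frames = {(U, coord_vector M U \<phi>) | U \<phi>. (U, \<phi>) \<in> charts M}\<rparr>"

definition vf_bracket :: "('m \<Rightarrow> 'm tangent) \<Rightarrow> ('m \<Rightarrow> 'm tangent) \<Rightarrow> 'm \<Rightarrow> 'm tangent"
  where "vf_bracket X Y = (\<lambda>x f. X x (\<lambda>y. Y y f) - Y x (\<lambda>y. X y f))"

section \<open>Lie algebroids\<close>

record ('m, 'v) algebroid =
  base :: "'m manifold"
  bun :: "('m, 'v, nat) vbundle"
  anchor :: "'m \<Rightarrow> 'v \<Rightarrow> 'm tangent"
  brk :: "('m \<Rightarrow> 'v) \<Rightarrow> ('m \<Rightarrow> 'v) \<Rightarrow> 'm \<Rightarrow> 'v"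

abbreviation secs :: "('m, 'v::real_vector) algebroid \<Rightarrow> ('m \<Rightarrow> 'v) set" (\<open>\<Gamma>\<close>)
  where "\<Gamma> L \<equiv> sections (base L) (bun L)"

text \<open>\<open>anchor_deriv L V f\<close> is the function \<open>\<langle>df, \<rho> \<circ> V\<rangle>\<close>.\<close>

definition anchor_deriv :: "('m, 'v) algebroid \<Rightarrow> ('m \<Rightarrow> 'v) \<Rightarrow> ('m \<Rightarrow> real) \<Rightarrow> 'm \<Rightarrow> real"
  where "anchor_deriv L V f = (\<lambda>x. anchor L x (V x) f)"

locale lie_algebroid =
  fixes L :: "('m::{t2_space, second_countable_topology}, 'v::real_vector) algebroid"
  assumes is_bundle: "vector_bundle (base L) (bun L)"
    and brk_closed: "\<lbrakk>s \<in> \<Gamma> L; t \<in> \<Gamma> L\<rbrakk> \<Longrightarrow> brk L s t \<in> \<Gamma> L"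
    and brk_linear: "\<lbrakk>s \<in> \<Gamma> L; t \<in> \<Gamma> L; u \<in> \<Gamma> L\<rbrakk> \<Longrightarrow>
      brk L (a *\<^sub>R s + b *\<^sub>R t) u = a *\<^sub>R brk L s u + b *\<^sub>R brk L t u"
    and brk_skew: "\<lbrakk>s \<in> \<Gamma> L; t \<in> \<Gamma> L\<rbrakk> \<Longrightarrow> brk L s t = - brk L t s"
    and brk_jacobi: "\<lbrakk>s \<in> \<Gamma> L; t \<in> \<Gamma> L; u \<in> \<Gamma> L\<rbrakk> \<Longrightarrow>
      brk L s (brk L t u) + brk L t (brk L u s) + brk L u (brk L s t) = 0"
    and anchor_map: "bundle_map (base L) (bun L) (tangent_bundle (base L)) (anchor L)"
    and anchor_hom: "\<lbrakk>s \<in> \<Gamma> L; t \<in> \<Gamma> L\<rbrakk> \<Longrightarrow>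
      (\<lambda>x. anchor L x (brk L s t x)) =
      vf_bracket (\<lambda>x. anchor L x (s x)) (\<lambda>x. anchor L x (t x))"
    and brk_leibniz: "\<lbrakk>s \<in> \<Gamma> L; t \<in> \<Gamma> L; f \<in> C\<^sup>\<infinity> (base L)\<rbrakk> \<Longrightarrow>
      brk L s (\<lambda>x. f x *\<^sub>R t x) =
      (\<lambda>x. f x *\<^sub>R brk L s t x + anchor_deriv L s f x *\<^sub>R t x)"

section \<open>Exterior algebra of a vector space\<close>

text \<open>
  A form on \<open>V\<close> takes the list of its arguments. Forms of degree \<open>p\<close> are extended by 0
  to all other lists, so that a single function of lists can carry the direct sum over all
  degrees: its component of degree \<open>p\<close> is its restriction to lists of length \<open>p\<close>.
\<close>

type_synonym 'v form = "'v list \<Rightarrow> real"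

definition alt_forms :: "'v::real_vector set \<Rightarrow> nat \<Rightarrow> 'v form set"
  where "alt_forms V p = {\<eta>.
    (\<forall>vs. \<not> (length vs = p \<and> set vs \<subseteq> V) \<longrightarrow> \<eta> vs = 0) \<and>
    (\<forall>us v w ws a b. length us + length ws + 1 = p \<and> set us \<union> set ws \<union> {v, w} \<subseteq> V \<longrightarrow>
       \<eta> (us @ (a *\<^sub>R v + b *\<^sub>R w) # ws) = a * \<eta> (us @ v # ws) + b * \<eta> (us @ w # ws)) \<and>
    (\<forall>us v zs w ws. \<eta> (us @ w # zs @ v # ws) = - \<eta> (us @ v # zs @ w # ws))}"

definition ext_forms :: "'v::real_vector set \<Rightarrow> 'v form set"
  where "ext_forms V = span (\<Union>p. alt_forms V p)"

text \<open>
  \<open>wedge_list V [v\<^sub>1, \<dots>, v\<^sub>p]\<close> is \<open>v\<^sub>1 \<and> \<dots> \<and> v\<^sub>p\<close>, realized as the functional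
  \<open>\<eta> \<mapsto> \<eta>(v\<^sub>1, \<dots>, v\<^sub>p)\<close> on forms; these functionals span the exterior powers. Hence \<open>P \<eta>\<close> is
  the pairing \<open>\<langle>\<eta>, P\<rangle>\<close>, and for a form \<open>\<lambda>vs. g vs\<close> the value
  \<open>P (\<lambda>vs. g vs)\<close> is the linear extension of \<open>v\<^sub>1 \<and> \<dots> \<and> v\<^sub>p \<mapsto> g [v\<^sub>1, \<dots>, v\<^sub>p]\<close> evaluated at \<open>P\<close>.
\<close>

type_synonym 'v multivector = "'v form \<Rightarrow> real"

definition wedge_list :: "'v::real_vector set \<Rightarrow> 'v list \<Rightarrow> 'v multivector"
  where "wedge_list V vs = (\<lambda>\<eta>. if \<eta> \<in> ext_forms V then \<eta> vs else 0)"

definition ext_power :: "'v::real_vector set \<Rightarrow> nat \<Rightarrow> 'v multivector set"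
  where "ext_power V p = span {wedge_list V vs | vs. length vs = p \<and> set vs \<subseteq> V}"

definition wedge :: "'v::real_vector set \<Rightarrow> 'v multivector \<Rightarrow> 'v multivector \<Rightarrow> 'v multivector"
  where "wedge V P Q =
    (\<lambda>\<eta>. if \<eta> \<in> ext_forms V then P (\<lambda>vs. Q (\<lambda>ws. \<eta> (vs @ ws))) else 0)"

definition contract_vec :: "'v \<Rightarrow> 'v form \<Rightarrow> 'v form"
  where "contract_vec v \<eta> = (\<lambda>ws. \<eta> (v # ws))"

text \<open>Linear extension of \<open>i(v\<^sub>1 \<and> \<dots> \<and> v\<^sub>p) = i(v\<^sub>1) \<circ> \<dots> \<circ> i(v\<^sub>p)\<close>.\<close>

definition contract :: "'v multivector \<Rightarrow> 'v form \<Rightarrow> 'v form"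
  where "contract P \<eta> = (\<lambda>ws. P (\<lambda>vs. foldr contract_vec vs \<eta> ws))"

lemma foldr_contract_vec: "foldr contract_vec vs \<eta> ws = \<eta> (rev vs @ ws)"
  by (induction vs arbitrary: ws) (auto simp: contract_vec_def)

lemma ext_forms_induct [consumes 1, case_names zero step]:
  assumes "\<eta> \<in> ext_forms V" and "P (\<lambda>_. 0)"
    and "\<And>c p \<alpha> \<beta>. \<lbrakk>\<alpha> \<in> alt_forms V p; P \<beta>\<rbrakk> \<Longrightarrow> P (\<lambda>vs. c * \<alpha> vs + \<beta> vs)"
  shows "P \<eta>"
  using assms(1) unfolding ext_forms_def
proof (induction rule: span_induct_alt)
  case base
  then show ?case using assms(2) by (simp add: zero_fun_def)
next
  case (step c x y)
  then obtain p where "x \<in> alt_forms V p" by auto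
  then have "P (\<lambda>vs. c * x vs + y vs)" using step assms(3) by blast
  moreover have "c *\<^sub>R x + y = (\<lambda>vs. c * x vs + y vs)" by (simp add: fun_eq_iff)
  ultimately show ?case by simp
qed

lemma ext_forms_lincomb:
  assumes "\<alpha> \<in> ext_forms V" "\<beta> \<in> ext_forms V"
  shows "(\<lambda>vs. c * \<alpha> vs + \<beta> vs) \<in> ext_forms V"
proof -
  have "c *\<^sub>R \<alpha> + \<beta> \<in> ext_forms V"
    using assms unfolding ext_forms_def by (intro span_add span_scale)
  moreover have "c *\<^sub>R \<alpha> + \<beta> = (\<lambda>vs. c * \<alpha> vs + \<beta> vs)" by (simp add: fun_eq_iff)
  ultimately show ?thesis by simp
qed

lemma ext_forms_zero: "(\<lambda>_. 0) \<in> ext_forms V"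
  using span_zero[of "\<Union>p. alt_forms V p"] by (simp add: ext_forms_def zero_fun_def)

lemma alt_forms_contract_left:
  assumes "\<alpha> \<in> alt_forms V p"
  shows "(\<lambda>ws. \<alpha> (us @ ws)) \<in> ext_forms V"
proof (cases "length us \<le> p \<and> set us \<subseteq> V")
  case True
  have A: "\<And>vs. \<not> (length vs = p \<and> set vs \<subseteq> V) \<Longrightarrow> \<alpha> vs = 0"
    and B: "\<And>us v w ws a b. length us + length ws + 1 = p \<and> set us \<union> set ws \<union> {v, w} \<subseteq> V \<Longrightarrow>
       \<alpha> (us @ (a *\<^sub>R v + b *\<^sub>R w) # ws) = a * \<alpha> (us @ v # ws) + b * \<alpha> (us @ w # ws)"
    and C: "\<And>us v zs w ws. \<alpha> (us @ w # zs @ v # ws) = - \<alpha> (us @ v # zs @ w # ws)"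
    using assms unfolding alt_forms_def by blast+
  have "(\<lambda>ws. \<alpha> (us @ ws)) \<in> alt_forms V (p - length us)"
    unfolding alt_forms_def
  proof (intro CollectI conjI allI impI)
    fix vs assume "\<not> (length vs = p - length us \<and> set vs \<subseteq> V)"
    then show "\<alpha> (us @ vs) = 0" using True by (intro A) auto
  next
    fix us' v w ws and a b :: real
    assume "length us' + length ws + 1 = p - length us \<and> set us' \<union> set ws \<union> {v, w} \<subseteq> V"
    then show "\<alpha> (us @ us' @ (a *\<^sub>R v + b *\<^sub>R w) # ws) =
        a * \<alpha> (us @ us' @ v # ws) + b * \<alpha> (us @ us' @ w # ws)"
      using B[of "us @ us'" ws v w a b] True by auto
  next
    fix us' v zs w ws
    show "\<alpha> (us @ us' @ w # zs @ v # ws) = - \<alpha> (us @ us' @ v # zs @ w # ws)"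
      using C[of "us @ us'" w zs v ws] by simp
  qed
  then show ?thesis unfolding ext_forms_def by (intro span_base) blast
next
  case False
  then have "(\<lambda>ws. \<alpha> (us @ ws)) = (\<lambda>_. 0)"
    using assms unfolding alt_forms_def by (auto simp: fun_eq_iff)
  then show ?thesis by (simp add: ext_forms_zero)
qed

lemma alt_forms_contract_right:
  assumes "\<alpha> \<in> alt_forms V p"
  shows "(\<lambda>ws. \<alpha> (rev ws @ us)) \<in> ext_forms V" "(\<lambda>ws. \<alpha> (ws @ us)) \<in> ext_forms V"
proof -
  have A: "\<And>vs. \<not> (length vs = p \<and> set vs \<subseteq> V) \<Longrightarrow> \<alpha> vs = 0"
    and B: "\<And>us v w ws a b. length us + length ws + 1 = p \<and> set us \<union> set ws \<union> {v, w} \<subseteq> V \<Longrightarrow>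
       \<alpha> (us @ (a *\<^sub>R v + b *\<^sub>R w) # ws) = a * \<alpha> (us @ v # ws) + b * \<alpha> (us @ w # ws)"
    and C: "\<And>us v zs w ws. \<alpha> (us @ w # zs @ v # ws) = - \<alpha> (us @ v # zs @ w # ws)"
    using assms unfolding alt_forms_def by blast+
  have "(\<lambda>ws. \<alpha> (rev ws @ us)) \<in> ext_forms V \<and> (\<lambda>ws. \<alpha> (ws @ us)) \<in> ext_forms V"
  proof (cases "length us \<le> p \<and> set us \<subseteq> V")
    case True
    have "(\<lambda>ws. \<alpha> (rev ws @ us)) \<in> alt_forms V (p - length us)"
      unfolding alt_forms_def
    proof (intro CollectI conjI allI impI)
      fix vs assume "\<not> (length vs = p - length us \<and> set vs \<subseteq> V)"
      then show "\<alpha> (rev vs @ us) = 0" using True by (intro A) auto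
    next
      fix us' v w ws and a b :: real
      assume "length us' + length ws + 1 = p - length us \<and> set us' \<union> set ws \<union> {v, w} \<subseteq> V"
      then show "\<alpha> (rev (us' @ (a *\<^sub>R v + b *\<^sub>R w) # ws) @ us) =
          a * \<alpha> (rev (us' @ v # ws) @ us) + b * \<alpha> (rev (us' @ w # ws) @ us)"
        using B[of "rev ws" "rev us' @ us" v w a b] True by auto
    next
      fix us' v zs w ws
      show "\<alpha> (rev (us' @ w # zs @ v # ws) @ us) = - \<alpha> (rev (us' @ v # zs @ w # ws) @ us)"
        using C[of "rev ws" v "rev zs" w "rev us' @ us"] by simp
    qed
    moreover have "(\<lambda>ws. \<alpha> (ws @ us)) \<in> alt_forms V (p - length us)"
      unfolding alt_forms_def
    proof (intro CollectI conjI allI impI)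
      fix vs assume "\<not> (length vs = p - length us \<and> set vs \<subseteq> V)"
      then show "\<alpha> (vs @ us) = 0" using True by (intro A) auto
    next
      fix us' v w ws and a b :: real
      assume "length us' + length ws + 1 = p - length us \<and> set us' \<union> set ws \<union> {v, w} \<subseteq> V"
      then show "\<alpha> ((us' @ (a *\<^sub>R v + b *\<^sub>R w) # ws) @ us) =
          a * \<alpha> ((us' @ v # ws) @ us) + b * \<alpha> ((us' @ w # ws) @ us)"
        using B[of us' "ws @ us" v w a b] True by auto
    next
      fix us' v zs w ws
      show "\<alpha> ((us' @ w # zs @ v # ws) @ us) = - \<alpha> ((us' @ v # zs @ w # ws) @ us)"
        using C[of us' w zs v "ws @ us"] by simp
    qed
    ultimately show ?thesis unfolding ext_forms_def by (intro conjI span_base) blast+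
  next
    case False
    then have "(\<lambda>ws. \<alpha> (rev ws @ us)) = (\<lambda>_. 0)" "(\<lambda>ws. \<alpha> (ws @ us)) = (\<lambda>_. 0)"
      using A by (auto simp: fun_eq_iff)
    then show ?thesis by (simp add: ext_forms_zero)
  qed
  then show "(\<lambda>ws. \<alpha> (rev ws @ us)) \<in> ext_forms V" "(\<lambda>ws. \<alpha> (ws @ us)) \<in> ext_forms V" by auto
qed

lemma ext_forms_contract:
  assumes "\<eta> \<in> ext_forms V"
  shows "(\<lambda>ws. \<eta> (us @ ws)) \<in> ext_forms V"
    and "(\<lambda>ws. \<eta> (ws @ us)) \<in> ext_forms V"
    and "(\<lambda>ws. \<eta> (rev ws @ us)) \<in> ext_forms V"
  using assms
  by (induction rule: ext_forms_induct)
     (auto intro: ext_forms_zero ext_forms_lincomb alt_forms_contract_left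
        alt_forms_contract_right)

lemma ext_forms_outside:
  assumes "\<eta> \<in> ext_forms V" "\<not> set vs \<subseteq> V"
  shows "\<eta> vs = 0"
  using assms by (induction rule: ext_forms_induct) (auto simp: alt_forms_def)

lemma wedge_wedge_list: "wedge V (wedge_list V us) (wedge_list V vs) = wedge_list V (us @ vs)"
  by (auto simp: wedge_def wedge_list_def fun_eq_iff ext_forms_contract)

lemma contract_wedge_list:
  "\<eta> \<in> ext_forms V \<Longrightarrow> contract (wedge_list V vs) \<eta> = foldr contract_vec vs \<eta>"
  by (auto simp: contract_def wedge_list_def foldr_contract_vec fun_eq_iff ext_forms_contract)

section \<open>Multivectors and forms on a Lie algebroid\<close>

definition multi_indices :: "nat set \<Rightarrow> nat \<Rightarrow> nat list set"
  where "multi_indices K p = {I. sorted_wrt (<) I \<and> length I = p \<and> set I \<subseteq> K}"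

text \<open>The frame of \<open>\<And>\<^sup>pE\<close> induced by \<open>e\<close> consists of \<open>e\<^bsub>i\<^sub>1\<^esub> \<and> \<dots> \<and> e\<^bsub>i\<^sub>p\<^esub>\<close> with \<open>i\<^sub>1 < \<dots> < i\<^sub>p\<close>.\<close>

definition ext_bundle ::
  "('m, 'v::real_vector, nat) vbundle \<Rightarrow> nat \<Rightarrow> ('m, 'v multivector, nat list) vbundle"
  where "ext_bundle E p =
    \<lparr>fibre = (\<lambda>x. ext_power (fibre E x) p),
     indices = multi_indices (indices E) p,
     frames = {(W, \<lambda>I x. wedge_list (fibre E x) (map (\<lambda>i. e i x) I)) | W e. (W, e) \<in> frames E}\<rparr>"

type_synonym ('m, 'v) mvfield = "'m \<Rightarrow> 'v multivector"
type_synonym ('m, 'v) formfield = "'m \<Rightarrow> 'v form"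

definition mvfields ::
  "('m, 'v::real_vector) algebroid \<Rightarrow> int \<Rightarrow> ('m, 'v) mvfield set" (\<open>A\<^sup>\<bullet>\<close>)
  where "A\<^sup>\<bullet> L p = (if p < 0 then {0} else sections (base L) (ext_bundle (bun L) (nat p)))"

text \<open>
  Smoothness of a form is expressed by its components \<open>\<eta>(e\<^bsub>i\<^sub>1\<^esub>, \<dots>, e\<^bsub>i\<^sub>p\<^esub>)\<close> in the frame of
  \<open>\<And>\<^sup>pE\<^sup>*\<close> dual to the one above.
\<close>

definition formfields ::
  "('m, 'v::real_vector) algebroid \<Rightarrow> int \<Rightarrow> ('m, 'v) formfield set" (\<open>\<Omega>\<^sup>\<bullet>\<close>)
  where "\<Omega>\<^sup>\<bullet> L p = (if p < 0 then {0} else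
    {\<eta>. (\<forall>x. \<eta> x \<in> alt_forms (fibre (bun L) x) (nat p)) \<and>
        (\<forall>(W, e)\<in>frames (bun L). \<forall>I\<in>multi_indices (indices (bun L)) (nat p).
           smooth_on (base L) W (\<lambda>x. \<eta> x (map (\<lambda>i. e i x) I)))})"

definition all_mvfields :: "('m, 'v::real_vector) algebroid \<Rightarrow> ('m, 'v) mvfield set" (\<open>\<A>\<close>)
  where "\<A> L = span (\<Union>p. A\<^sup>\<bullet> L p)"

definition all_formfields :: "('m, 'v::real_vector) algebroid \<Rightarrow> ('m, 'v) formfield set" (\<open>\<Omega>\<close>)
  where "\<Omega> L = span (\<Union>p. \<Omega>\<^sup>\<bullet> L p)"

text \<open>The identifications of \<open>C\<^sup>\<infinity> M\<close> with \<open>A\<^sup>0\<close> and of \<open>\<Gamma>(E)\<close> with \<open>A\<^sup>1\<close>.\<close>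

definition mv_of_fun :: "('m, 'v::real_vector) algebroid \<Rightarrow> ('m \<Rightarrow> real) \<Rightarrow> ('m, 'v) mvfield"
  where "mv_of_fun L f = (\<lambda>x. f x *\<^sub>R wedge_list (fibre (bun L) x) [])"

definition mv_of_sec :: "('m, 'v::real_vector) algebroid \<Rightarrow> ('m \<Rightarrow> 'v) \<Rightarrow> ('m, 'v) mvfield"
  where "mv_of_sec L V = (\<lambda>x. wedge_list (fibre (bun L) x) [V x])"

definition unit_form :: "('m, 'v) formfield"
  where "unit_form = (\<lambda>x vs. if vs = [] then 1 else 0)"

definition pairing :: "('m, 'v) formfield \<Rightarrow> ('m, 'v) mvfield \<Rightarrow> 'm \<Rightarrow> real"
  where "pairing \<eta> P = (\<lambda>x. P x (\<eta> x))"

definition mv_wedge ::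
  "('m, 'v::real_vector) algebroid \<Rightarrow> ('m, 'v) mvfield \<Rightarrow> ('m, 'v) mvfield \<Rightarrow> ('m, 'v) mvfield"
  where "mv_wedge L P Q = (\<lambda>x. wedge (fibre (bun L) x) (P x) (Q x))"

definition interior_prod :: "('m, 'v) mvfield \<Rightarrow> ('m, 'v) formfield \<Rightarrow> ('m, 'v) formfield"
  where "interior_prod P \<eta> = (\<lambda>x. contract (P x) (\<eta> x))"

definition eval_form :: "('m, 'v) formfield \<Rightarrow> ('m \<Rightarrow> 'v) list \<Rightarrow> 'm \<Rightarrow> real"
  where "eval_form \<eta> Vs = (\<lambda>x. \<eta> x (map (\<lambda>V. V x) Vs))"

text \<open>
  The following formulas are additive in the degree of \<open>\<eta>\<close>, since the length of \<open>Vs\<close> selects the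
  component of \<open>\<eta>\<close> that contributes; for \<open>Vs = [V]\<close> the first one reads
  \<open>\<langle>d\<^sub>\<rho>f, V\<rangle> = \<langle>df, \<rho> \<circ> V\<rangle>\<close>. Note that \<open>nths Vs (- S)\<close> omits the entries with index in \<open>S\<close>.
\<close>

definition ext_deriv ::
  "('m, 'v::real_vector) algebroid \<Rightarrow> ('m, 'v) formfield \<Rightarrow> ('m, 'v) formfield"
  where "ext_deriv L \<eta> = (THE \<omega>. \<omega> \<in> \<Omega> L \<and> (\<forall>Vs. set Vs \<subseteq> \<Gamma> L \<longrightarrow>
    eval_form \<omega> Vs = (\<lambda>x.
      (\<Sum>i<length Vs. (-1) ^ i *
         anchor_deriv L (Vs ! i) (eval_form \<eta> (nths Vs (- {i}))) x) +
      (\<Sum>j<length Vs. \<Sum>i<j. (-1) ^ (i + j) *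
         eval_form \<eta> (brk L (Vs ! i) (Vs ! j) # nths Vs (- {i, j})) x))))"

definition lie_form ::
  "('m, 'v::real_vector) algebroid \<Rightarrow> ('m \<Rightarrow> 'v) \<Rightarrow> ('m, 'v) formfield \<Rightarrow> ('m, 'v) formfield"
  where "lie_form L V \<eta> = (THE \<omega>. \<omega> \<in> \<Omega> L \<and> (\<forall>Vs. set Vs \<subseteq> \<Gamma> L \<longrightarrow>
    eval_form \<omega> Vs = (\<lambda>x. anchor_deriv L V (eval_form \<eta> Vs) x -
      (\<Sum>i<length Vs. eval_form \<eta> (Vs[i := brk L V (Vs ! i)]) x))))"

definition lie_mv ::
  "('m, 'v::real_vector) algebroid \<Rightarrow> ('m \<Rightarrow> 'v) \<Rightarrow> int \<Rightarrow> ('m, 'v) mvfield \<Rightarrow> ('m, 'v) mvfield"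
  where "lie_mv L V p P =
    (if p = 0 then mv_of_fun L (anchor_deriv L V (pairing unit_form P))
     else THE R. R \<in> A\<^sup>\<bullet> L p \<and> (\<forall>\<eta>\<in>\<Omega>\<^sup>\<bullet> L p.
       pairing \<eta> R = (\<lambda>x. anchor_deriv L V (pairing \<eta> P) x - pairing (lie_form L V \<eta>) P x)))"

section \<open>The Schouten-Nijenhuis bracket\<close>

definition graded_commutator ::
  "int \<Rightarrow> int \<Rightarrow> ('a \<Rightarrow> 'a) \<Rightarrow> ('a \<Rightarrow> 'a) \<Rightarrow> 'a \<Rightarrow> 'a::real_vector"
  where "graded_commutator d\<^sub>1 d\<^sub>2 F G = (\<lambda>\<eta>. F (G \<eta>) - ((-1) powi (d\<^sub>1 * d\<^sub>2)) *\<^sub>R G (F \<eta>))"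

definition schouten_hom ::
  "('m, 'v::real_vector) algebroid \<Rightarrow> int \<Rightarrow> int \<Rightarrow> ('m, 'v) mvfield \<Rightarrow> ('m, 'v) mvfield \<Rightarrow>
   ('m, 'v) mvfield"
  where "schouten_hom L p q P Q = (THE R. R \<in> A\<^sup>\<bullet> L (p + q - 1) \<and> (\<forall>\<eta>\<in>\<Omega> L.
    interior_prod R \<eta> =
    graded_commutator (1 - p) (- q)
      (graded_commutator (- p) 1 (interior_prod P) (ext_deriv L)) (interior_prod Q) \<eta>))"

definition mv_part ::
  "('m, 'v::real_vector) algebroid \<Rightarrow> nat \<Rightarrow> ('m, 'v) mvfield \<Rightarrow> ('m, 'v) mvfield"
  where "mv_part L p P = (\<lambda>x \<eta>. if \<eta> \<in> ext_forms (fibre (bun L) x)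
    then P x (\<lambda>vs. if length vs = p then \<eta> vs else 0) else 0)"

text \<open>Biadditive extension to \<open>\<A> L\<close>, whose elements have finitely many nonzero homogeneous parts.\<close>

definition schouten ::
  "('m, 'v::real_vector) algebroid \<Rightarrow> ('m, 'v) mvfield \<Rightarrow> ('m, 'v) mvfield \<Rightarrow> ('m, 'v) mvfield"
  where "schouten L P Q =
    (\<Sum>p | mv_part L p P \<noteq> 0. \<Sum>q | mv_part L q Q \<noteq> 0.
       schouten_hom L (int p) (int q) (mv_part L p P) (mv_part L q Q))"

definition graded_derivation ::
  "('m, 'v::real_vector) algebroid \<Rightarrow> int \<Rightarrow> (('m, 'v) mvfield \<Rightarrow> ('m, 'v) mvfield) \<Rightarrow> bool"
  where "graded_derivation L m D \<longleftrightarrow>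
    (\<forall>Q\<in>\<A> L. \<forall>R\<in>\<A> L. \<forall>a b. D (a *\<^sub>R Q + b *\<^sub>R R) = a *\<^sub>R D Q + b *\<^sub>R D R) \<and>
    (\<forall>q. D ` A\<^sup>\<bullet> L q \<subseteq> A\<^sup>\<bullet> L (q + m)) \<and>
    (\<forall>q\<^sub>1 q\<^sub>2. \<forall>Q\<^sub>1\<in>A\<^sup>\<bullet> L q\<^sub>1. \<forall>Q\<^sub>2\<in>A\<^sup>\<bullet> L q\<^sub>2.
       D (mv_wedge L Q\<^sub>1 Q\<^sub>2) =
       mv_wedge L (D Q\<^sub>1) Q\<^sub>2 + ((-1) powi (m * q\<^sub>1)) *\<^sub>R mv_wedge L Q\<^sub>1 (D Q\<^sub>2))"

end

theory Submission
  imports Defs "HOL-Computational_Algebra.Polynomial"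
begin

text \<open>
  A multivector field is determined by its interior product, so each property of the bracket is an
  identity between operators on forms. With \<open>\<L>\<^sub>P = [i(P), d]\<close> the bracket satisfies
  \<open>i([P, Q]) = [\<L>\<^sub>P, i(Q)]\<close>; skew symmetry and the Leibniz rule follow at once, and \<open>d\<^sup>2 = 0\<close> gives
  \<open>\<L>\<^bsub>[P, Q]\<^esub> = [\<L>\<^sub>P, \<L>\<^sub>Q]\<close>, hence the Jacobi identity.

  The existence of \<open>[P, Q]\<close>, i.e. that \<open>[\<L>\<^sub>P, i(Q)]\<close> is again an interior product, is a local
  question because \<open>d\<close> is a local operator (cutoff functions), and locally every multivector field
  is a sum of products of functions and sections. By skew symmetry and the Leibniz rule only
  functions \<open>f, g\<close> and sections \<open>V, W\<close> remain, where Cartan's formulas give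
  \<open>[f, g] = 0\<close>, \<open>[V, f] = \<L>\<^sub>V f\<close> and \<open>[V, W] = {V, W}\<close>.
\<close>

section \<open>Alternating functions of lists\<close>

text \<open>The bracket of sections and the action of the anchor are differential operators, so the
  sums that define \<open>ext_deriv\<close> and \<open>lie_form\<close> make sense only on global
  sections, while the forms themselves are functions of vectors in one fibre. The calculus is
  therefore done on lists of global sections and carried back to the fibres by tensoriality. For
  this, vectors and local frames must extend to global sections, which takes cutoff functions with
  closed support and hence the Hausdorff property. The definite descriptions in the definitions
  require uniqueness as well as existence. Uniqueness holds pointwise: contracting a p-vector
  completely returns its pairing up to the sign (-1)^(p(p-1)/2), and there are enough global forms
  to separate multivectors at a point. The same uniqueness makes brackets found on small open sets
  agree on overlaps, so that they glue. Skew symmetry of the bracket rests on the graded commutation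
  of i(P) and i(Q) alone; that d squares to 0 enters only in the Jacobi identity.\<close>

definition alternating_on :: "'a set \<Rightarrow> ('a list \<Rightarrow> 'r::comm_ring_1) \<Rightarrow> bool"
  where "alternating_on A \<alpha> \<longleftrightarrow> (\<forall>us v w ws. set us \<union> {v, w} \<union> set ws \<subseteq> A \<longrightarrow>
    \<alpha> (us @ w # v # ws) = - \<alpha> (us @ v # w # ws))"

lemma alternating_onD:
  "\<lbrakk>alternating_on A \<alpha>; set us \<subseteq> A; v \<in> A; w \<in> A; set ws \<subseteq> A\<rbrakk> \<Longrightarrow>
    \<alpha> (us @ w # v # ws) = - \<alpha> (us @ v # w # ws)"
  unfolding alternating_on_def by blast

lemma alternating_on_Cons: "\<lbrakk>alternating_on A \<alpha>; v \<in> A\<rbrakk> \<Longrightarrow> alternating_on A (\<lambda>ws. \<alpha> (v # ws))"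
  unfolding alternating_on_def by (metis Un_insert_left append_Cons insert_subset list.simps(15))

lemma alternating_on_move:
  assumes "alternating_on A \<alpha>" "v \<in> A" "set ws \<subseteq> A"
  shows "\<lbrakk>set us \<subseteq> A; set zs \<subseteq> A\<rbrakk> \<Longrightarrow>
    \<alpha> (us @ zs @ v # ws) = (-1) ^ length zs * \<alpha> (us @ v # zs @ ws)"
proof (induction zs arbitrary: us)
  case (Cons z zs)
  have "\<alpha> ((us @ [z]) @ zs @ v # ws) = (-1) ^ length zs * \<alpha> ((us @ [z]) @ v # zs @ ws)"
    using Cons.prems by (intro Cons.IH) auto
  moreover have "\<alpha> (us @ z # v # (zs @ ws)) = - \<alpha> (us @ v # z # (zs @ ws))"
    using Cons.prems assms by (intro alternating_onD) auto
  ultimately show ?case by simp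
qed simp

text \<open>Moving \<open>v\<close> to the left across \<open>w # zs\<close> costs one sign more
  than moving \<open>w\<close> back across \<open>zs\<close>. The forms in \<open>alt_forms\<close>
  change sign under arbitrary transpositions, whereas \<open>alternating_on\<close> speaks of
  neighbours.\<close>

lemma alternating_on_swap:
  assumes "alternating_on A \<alpha>" "set us \<subseteq> A" "v \<in> A" "set zs \<subseteq> A" "w \<in> A" "set ws \<subseteq> A"
  shows "\<alpha> (us @ w # zs @ v # ws) = - \<alpha> (us @ v # zs @ w # ws)"
proof -
  have "\<alpha> (us @ (w # zs) @ v # ws) = (-1) ^ length (w # zs) * \<alpha> (us @ v # (w # zs) @ ws)"
    using assms by (intro alternating_on_move) auto
  moreover have "\<alpha> ((us @ [v]) @ zs @ w # ws) = (-1) ^ length zs * \<alpha> ((us @ [v]) @ w # zs @ ws)"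
    using assms by (intro alternating_on_move) auto
  ultimately show ?thesis by simp
qed

text \<open>The source of the sign (-1)^(pq) when two interior products are exchanged.\<close>

lemma alternating_on_block:
  assumes "alternating_on A \<alpha>" "set xs \<subseteq> A" "set ws \<subseteq> A"
  shows "\<lbrakk>set us \<subseteq> A; set ys \<subseteq> A\<rbrakk> \<Longrightarrow>
    \<alpha> (us @ xs @ ys @ ws) = (-1) ^ (length xs * length ys) * \<alpha> (us @ ys @ xs @ ws)"
proof (induction ys arbitrary: us)
  case (Cons y ys)
  have "\<alpha> (us @ xs @ y # (ys @ ws)) = (-1) ^ length xs * \<alpha> (us @ y # xs @ (ys @ ws))"
    using Cons.prems assms by (intro alternating_on_move) auto
  moreover have "\<alpha> ((us @ [y]) @ xs @ ys @ ws) =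
      (-1) ^ (length xs * length ys) * \<alpha> ((us @ [y]) @ ys @ xs @ ws)"
    using Cons.prems by (intro Cons.IH) auto
  ultimately show ?case by (simp add: power_add mult.assoc)
qed simp

text \<open>The constant is the sign of a permutation, but only its existence is recorded. It is
  quantified before \<open>f\<close>, \<open>A\<close> and \<alpha>, so that one constant serves all
  points of a frame domain at once and the coefficients built from it stay smooth.\<close>

lemma alternating_on_mset:
  assumes "mset K = mset K'"
  shows "\<exists>c::'r::comm_ring_1. \<forall>(f :: 'b \<Rightarrow> 'a) A \<alpha>. alternating_on A \<alpha> \<longrightarrow> f ` set K \<subseteq> A \<longrightarrow>
    \<alpha> (map f K) = c * \<alpha> (map f K')"
  using assms
proof (induction K arbitrary: K')
  case Nil
  then show ?case by (auto intro!: exI[of _ 1])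
next
  case (Cons a K)
  then have "a \<in> set K'" by (metis list.set_intros(1) mset_eq_setD)
  then obtain xs ys where K': "K' = xs @ a # ys" by (meson split_list)
  with Cons.prems have eq: "mset K = mset (xs @ ys)" by simp
  from Cons.IH[OF eq] obtain c :: 'r where
    c': "\<forall>(f :: 'b \<Rightarrow> 'a) A \<alpha>. alternating_on A \<alpha> \<longrightarrow> f ` set K \<subseteq> A \<longrightarrow>
      \<alpha> (map f K) = c * \<alpha> (map f (xs @ ys))" ..
  note c = c'[rule_format]
  have S: "set K = set xs \<union> set ys" using mset_eq_setD[OF eq] by auto
  \<comment> \<open>The extra factor moves \<open>a\<close> from the front to its place in
    \<open>K'\<close>; a sign is its own inverse, so the direction of the move does not
    matter.\<close>
  have "\<alpha> (map f (a # K)) = (c * (-1) ^ length xs) * \<alpha> (map f K')"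
    if A: "alternating_on A \<alpha>" "f ` set (a # K) \<subseteq> A" for f :: "'b \<Rightarrow> 'a" and A \<alpha>
  proof -
    have "(\<lambda>ws. \<alpha> (f a # ws)) (map f K) = c * (\<lambda>ws. \<alpha> (f a # ws)) (map f (xs @ ys))"
      using A by (intro c[of A "\<lambda>ws. \<alpha> (f a # ws)" f] alternating_on_Cons) auto
    moreover have "\<alpha> ([] @ map f xs @ f a # map f ys) =
        (-1) ^ length (map f xs) * \<alpha> ([] @ f a # map f xs @ map f ys)"
      using A S by (intro alternating_on_move[OF A(1)]) auto
    ultimately show ?thesis
      by (simp add: K' mult.assoc left_minus_one_mult_self)
  qed
  then show ?case by (intro exI[of _ "c * (-1) ^ length xs"]) simp
qed

text \<open>Exchanging the two equal entries gives a value equal to its own negative. The preceding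
  facts allow any commutative ring, because they are applied to real values in a fibre and to
  functions on the manifold alike; this one divides by 2.\<close>

lemma alternating_on_dup:
  fixes \<alpha> :: "'a list \<Rightarrow> real"
  assumes "alternating_on A \<alpha>" "set vs \<subseteq> A" "\<not> distinct vs"
  shows "\<alpha> vs = 0"
proof -
  obtain xs ys zs y where vs: "vs = xs @ [y] @ ys @ [y] @ zs"
    using not_distinct_decomp[OF assms(3)] by blast
  then have "\<alpha> (xs @ y # ys @ y # zs) = - \<alpha> (xs @ y # ys @ y # zs)"
    using assms(2) by (intro alternating_on_swap[OF assms(1)]) auto
  then show ?thesis by (simp add: vs)
qed

text \<open>The frames of the exterior powers are indexed by increasing lists, so products of frame
  vectors in any order have to be rewritten. A repeated index is given the constant 0; a nonzero
  constant thus certifies that sorting keeps the length.\<close>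

lemma alternating_on_sort:
  "\<exists>c::real. (c \<noteq> 0 \<longrightarrow> distinct K) \<and> (\<forall>(f :: 'a::linorder \<Rightarrow> 'b) A \<alpha>.
    alternating_on A \<alpha> \<longrightarrow> f ` set K \<subseteq> A \<longrightarrow>
    \<alpha> (map f K) = c * \<alpha> (map f (sorted_list_of_set (set K))))"
proof (cases "distinct K")
  case True
  then have "mset K = mset (sorted_list_of_set (set K))"
    by (subst set_eq_iff_mset_eq_distinct[symmetric]) simp_all
  from alternating_on_mset[OF this] obtain c :: real where "\<forall>(f :: 'a \<Rightarrow> 'b) A \<alpha>.
    alternating_on A \<alpha> \<longrightarrow> f ` set K \<subseteq> A \<longrightarrow>
    \<alpha> (map f K) = c * \<alpha> (map f (sorted_list_of_set (set K)))" ..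
  with True show ?thesis by (intro exI[of _ c] conjI) simp_all
next
  case False
  have "\<alpha> (map f K) = 0" if "alternating_on A \<alpha>" "f ` set K \<subseteq> A"
    for f :: "'a \<Rightarrow> 'b" and A and \<alpha> :: "'b list \<Rightarrow> real"
    using that False by (intro alternating_on_dup[of A \<alpha>]) (auto simp: distinct_map)
  then show ?thesis using False by (intro exI[of _ 0]) auto
qed

text \<open>This is \<theta> \<and> \<alpha>, defined in all degrees at once by the rule
  i(v)(\<theta> \<and> \<alpha>) = \<theta>(v) \<alpha> - \<theta> \<and> i(v)\<alpha>. It carries
  the terms df \<and> \<alpha> in the Leibniz rules below.\<close>

fun ext_wedge :: "('a \<Rightarrow> 'r::comm_ring_1) \<Rightarrow> ('a list \<Rightarrow> 'r) \<Rightarrow> 'a list \<Rightarrow> 'r" where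
  "ext_wedge \<theta> \<alpha> [] = 0"
| "ext_wedge \<theta> \<alpha> (v # vs) = \<theta> v * \<alpha> vs - ext_wedge \<theta> (\<lambda>ws. \<alpha> (v # ws)) vs"

lemma ext_wedge_cong:
  "(\<And>ws. set ws \<subseteq> set vs \<Longrightarrow> \<alpha> ws = \<beta> ws) \<Longrightarrow> ext_wedge \<theta> \<alpha> vs = ext_wedge \<theta> \<beta> vs"
proof (induction vs arbitrary: \<alpha> \<beta>)
  case (Cons v vs)
  have "ext_wedge \<theta> (\<lambda>ws. \<alpha> (v # ws)) vs = ext_wedge \<theta> (\<lambda>ws. \<beta> (v # ws)) vs"
    by (intro Cons.IH Cons.prems) auto
  moreover have "\<alpha> vs = \<beta> vs" by (intro Cons.prems) auto
  ultimately show ?case by simp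
qed simp

lemma ext_wedge_zero [simp]: "ext_wedge \<theta> (\<lambda>_. 0) vs = 0"
  by (induction vs) auto

lemma ext_wedge_uminus: "ext_wedge \<theta> (\<lambda>ws. - \<alpha> ws) vs = - ext_wedge \<theta> \<alpha> vs"
  by (induction vs arbitrary: \<alpha>) auto

lemma ext_wedge_add:
  "ext_wedge \<theta> (\<lambda>ws. \<alpha> ws + \<beta> ws) vs = ext_wedge \<theta> \<alpha> vs + ext_wedge \<theta> \<beta> vs"
  by (induction vs arbitrary: \<alpha> \<beta>) (auto simp: algebra_simps)

lemma ext_wedge_scale: "ext_wedge \<theta> (\<lambda>ws. c * \<alpha> ws) vs = c * ext_wedge \<theta> \<alpha> vs"
  by (induction vs arbitrary: \<alpha>) (auto simp: algebra_simps)

lemma alternating_on_ext_wedge: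
  assumes "alternating_on A \<alpha>"
  shows "alternating_on A (ext_wedge \<theta> \<alpha>)"
proof -
  have swap: "ext_wedge \<theta> \<alpha> (us @ w # v # ws) = - ext_wedge \<theta> \<alpha> (us @ v # w # ws)"
    if "alternating_on A \<alpha>" "set us \<subseteq> A" "v \<in> A" "w \<in> A" "set ws \<subseteq> A" for us v w ws \<alpha>
    using that
  proof (induction us arbitrary: \<alpha>)
    case Nil
    have "ext_wedge \<theta> (\<lambda>xs. \<alpha> (w # v # xs)) ws = ext_wedge \<theta> (\<lambda>xs. - \<alpha> (v # w # xs)) ws"
    proof (rule ext_wedge_cong)
      fix xs assume "set xs \<subseteq> set ws"
      then show "\<alpha> (w # v # xs) = - \<alpha> (v # w # xs)"
        using alternating_onD[of A \<alpha> "[]" v w xs] Nil by auto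
    qed
    then show ?case by (simp add: ext_wedge_uminus)
  next
    case (Cons u us)
    have "\<alpha> (us @ w # v # ws) = - \<alpha> (us @ v # w # ws)"
      using Cons.prems by (intro alternating_onD) auto
    moreover have "ext_wedge \<theta> (\<lambda>xs. \<alpha> (u # xs)) (us @ w # v # ws) =
        - ext_wedge \<theta> (\<lambda>xs. \<alpha> (u # xs)) (us @ v # w # ws)"
      using Cons.prems by (intro Cons.IH alternating_on_Cons) auto
    ultimately show ?case by simp
  qed
  show ?thesis unfolding alternating_on_def by (intro allI impI swap[OF assms]) auto
qed

lemma ext_wedge_head_add:
  "\<lbrakk>\<theta> (v + w) = \<theta> v + \<theta> w; \<And>ws. set ws \<subseteq> set vs \<Longrightarrow> \<alpha> ((v + w) # ws) = \<alpha> (v # ws) + \<alpha> (w # ws)\<rbrakk> \<Longrightarrow>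
    ext_wedge \<theta> \<alpha> ((v + w) # vs) = ext_wedge \<theta> \<alpha> (v # vs) + ext_wedge \<theta> \<alpha> (w # vs)"
  using ext_wedge_cong[of vs "\<lambda>ws. \<alpha> ((v + w) # ws)" "\<lambda>ws. \<alpha> (v # ws) + \<alpha> (w # ws)" \<theta>]
  by (simp add: ext_wedge_add algebra_simps)

lemma ext_wedge_head_scale:
  "\<lbrakk>\<theta> v' = c * \<theta> v; \<And>ws. set ws \<subseteq> set vs \<Longrightarrow> \<alpha> (v' # ws) = c * \<alpha> (v # ws)\<rbrakk> \<Longrightarrow>
    ext_wedge \<theta> \<alpha> (v' # vs) = c * ext_wedge \<theta> \<alpha> (v # vs)"
  using ext_wedge_cong[of vs "\<lambda>ws. \<alpha> (v' # ws)" "\<lambda>ws. c * \<alpha> (v # ws)" \<theta>]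
  by (simp add: ext_wedge_scale algebra_simps)

lemma ext_wedge_degree:
  "(\<And>ws. length ws \<noteq> p \<Longrightarrow> \<alpha> ws = 0) \<Longrightarrow> length vs \<noteq> Suc p \<Longrightarrow> ext_wedge \<theta> \<alpha> vs = 0"
proof (induction vs arbitrary: \<alpha> p)
  case (Cons v vs)
  show ?case
  proof (cases p)
    case 0
    then have "\<alpha> (v # ws) = 0" for ws using Cons.prems(1) by simp
    with 0 Cons.prems show ?thesis by simp
  next
    case (Suc q)
    then have "ext_wedge \<theta> (\<lambda>ws. \<alpha> (v # ws)) vs = 0"
      using Cons.prems by (intro Cons.IH[of q "\<lambda>ws. \<alpha> (v # ws)"]) auto
    then show ?thesis using Cons.prems by simp
  qed
qed simp

lemma ext_wedge_killed:
  "(\<And>ws. v \<in> set ws \<Longrightarrow> \<alpha> ws = 0) \<Longrightarrow> \<theta> v = 0 \<Longrightarrow> v \<in> set vs \<Longrightarrow> ext_wedge \<theta> \<alpha> vs = 0"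
proof (induction vs arbitrary: \<alpha>)
  case (Cons w vs)
  show ?case
  proof (cases "w = v")
    case True
    then show ?thesis using Cons.prems by simp
  next
    case False
    then show ?thesis using Cons by auto
  qed
qed simp

lemma ext_wedge_annihilated: "(\<And>v. v \<in> set vs \<Longrightarrow> \<theta> v = 0) \<Longrightarrow> ext_wedge \<theta> \<alpha> vs = 0"
  by (induction vs arbitrary: \<alpha>) auto

fun dual_form :: "('i \<Rightarrow> 'a \<Rightarrow> 'r::comm_ring_1) \<Rightarrow> 'i list \<Rightarrow> 'a list \<Rightarrow> 'r" where
  "dual_form \<theta> [] = (\<lambda>vs. if vs = [] then 1 else 0)"
| "dual_form \<theta> (i # I) = ext_wedge (\<theta> i) (dual_form \<theta> I)"

lemma dual_form_killed: "(\<And>i. i \<in> set I \<Longrightarrow> \<theta> i v = 0) \<Longrightarrow> v \<in> set vs \<Longrightarrow> dual_form \<theta> I vs = 0"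
proof (induction I arbitrary: vs)
  case (Cons i I)
  then show ?case using ext_wedge_killed[of v "dual_form \<theta> I" "\<theta> i" vs] by simp
qed auto

lemma dual_form_degree: "length vs \<noteq> length I \<Longrightarrow> dual_form \<theta> I vs = 0"
proof (induction I arbitrary: vs)
  case (Cons i I)
  then show ?case using ext_wedge_degree[of "length I" "dual_form \<theta> I" vs] by simp
qed auto

text \<open>Both lists are increasing, so a comparison of the first entries decides. The common
  value \<open>u\<close> is kept because the cut-off covectors and cut-off frame sections used later
  are dual only up to the square of the cutoff function.\<close>

lemma dual_form_basis:
  fixes u :: "'r::comm_ring_1" and K :: "'i::linorder set"
  assumes \<theta>: "\<And>i j. i \<in> K \<Longrightarrow> j \<in> K \<Longrightarrow> \<theta> i (b j) = (if i = j then u else 0)"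
  shows "\<lbrakk>sorted_wrt (<) I; set I \<subseteq> K; sorted_wrt (<) J; set J \<subseteq> K\<rbrakk> \<Longrightarrow>
    dual_form \<theta> I (map b J) = (if I = J then u ^ length I else 0)"
proof (induction I arbitrary: J)
  case Nil
  then show ?case by auto
next
  case (Cons i I)
  show ?case
  proof (cases J)
    case Nil
    then show ?thesis by simp
  next
    case J: (Cons j J')
    consider "i \<le> j" | "j < i" by fastforce
    then show ?thesis
    proof cases
      \<comment> \<open>Here \<open>i\<close> does not occur in \<open>J'\<close>, so only the term
        in which \<open>\<theta> i\<close> meets the first vector survives.\<close>
      case 1
      have "ext_wedge (\<theta> i) (\<lambda>ws. dual_form \<theta> I (b j # ws)) (map b J') = 0"
        using Cons.prems J 1 by (intro ext_wedge_annihilated) (auto simp: \<theta> subset_iff)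
      then show ?thesis using Cons.prems J Cons.IH[of J'] by (auto simp: \<theta>)
    next
      \<comment> \<open>Here \<open>b j\<close> is annihilated by every factor, since
        \<open>j\<close> precedes \<open>i\<close> and hence all of \<open>I\<close>.\<close>
      case 2
      have "dual_form \<theta> I (b j # ws) = 0" for ws
        using Cons.prems J 2 by (intro dual_form_killed[of I \<theta> "b j"]) (auto simp: \<theta> subset_iff)
      then show ?thesis using Cons.prems J 2 by (auto simp: \<theta>)
    qed
  qed
qed

section \<open>Smooth functions\<close>

lemma openin_Euclidean_space_iff:
  "openin (Euclidean_space n) S \<longleftrightarrow> (\<exists>T. open T \<and> S = T \<inter> {x. \<forall>i\<ge>n. x i = 0})"
  by (simp add: Euclidean_space_def openin_subtopology euclidean_product_topology)

text \<open>For \<open>i < n\<close> changing the coordinate \<open>i\<close> stays in the model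
  space, and openness does the rest. Partial derivatives at a point of \<open>S\<close> thus see
  only values on \<open>S\<close>.\<close>

lemma Euclidean_line_eventually:
  assumes "openin (Euclidean_space n) S" "x \<in> S" "i < n"
  shows "\<forall>\<^sub>F t in nhds (x i). x(i := t) \<in> S"
proof -
  obtain T where T: "open T" "S = T \<inter> {x. \<forall>i\<ge>n. x i = 0}"
    using assms(1) unfolding openin_Euclidean_space_iff by blast
  have "continuous_on UNIV (\<lambda>t. x(i := t))"
  proof (rule continuous_on_coordinatewise_then_product)
    show "continuous_on UNIV (\<lambda>t. (x(i := t)) j)" for j by (cases "j = i") auto
  qed
  then have "open ((\<lambda>t. x(i := t)) -` T)" using T(1) by (simp add: open_vimage)
  moreover have "x i \<in> (\<lambda>t. x(i := t)) -` T" using assms T by auto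
  ultimately have "\<forall>\<^sub>F t in nhds (x i). t \<in> (\<lambda>t. x(i := t)) -` T"
    by (rule eventually_nhds_in_open)
  then show ?thesis
  proof (rule eventually_mono)
    fix t assume "t \<in> (\<lambda>t. x(i := t)) -` T"
    then show "x(i := t) \<in> S" using T assms by auto
  qed
qed

lemma openin_Euclidean_Int:
  assumes "openin (Euclidean_space n) S" "open T"
  shows "openin (Euclidean_space n) (S \<inter> T)"
proof -
  obtain R where "open R" "S = R \<inter> {x. \<forall>i\<ge>n. x i = 0}"
    using assms(1) unfolding openin_Euclidean_space_iff by blast
  then have "open (R \<inter> T)" "S \<inter> T = (R \<inter> T) \<inter> {x. \<forall>i\<ge>n. x i = 0}" using assms(2) by auto
  then show ?thesis unfolding openin_Euclidean_space_iff by blast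
qed

lemma Ck_on_SucI:
  "\<lbrakk>continuous_on S f;
    \<And>i x. i < n \<Longrightarrow> x \<in> S \<Longrightarrow> ((\<lambda>t. f (x(i := t))) has_real_derivative D i x) (at (x i));
    \<And>i. i < n \<Longrightarrow> Ck_on n k S (D i)\<rbrakk> \<Longrightarrow> Ck_on n (Suc k) S f"
  by (subst Ck_on.simps(2)) blast

lemma Ck_on_SucE:
  assumes "Ck_on n (Suc k) S f"
  obtains D where "continuous_on S f"
    "\<And>i x. i < n \<Longrightarrow> x \<in> S \<Longrightarrow> ((\<lambda>t. f (x(i := t))) has_real_derivative D i x) (at (x i))"
    "\<And>i. i < n \<Longrightarrow> Ck_on n k S (D i)"
  using assms unfolding Ck_on.simps(2) by (elim conjE exE) blast

lemma Ck_on_continuous: "Ck_on n k S f \<Longrightarrow> continuous_on S f"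
  by (cases k) auto

lemma Ck_on_cong:
  assumes "openin (Euclidean_space n) S" "\<And>x. x \<in> S \<Longrightarrow> f x = g x" "Ck_on n k S f"
  shows "Ck_on n k S g"
proof (cases k)
  case 0
  then show ?thesis using assms continuous_on_cong[of S S f g] by simp
next
  case (Suc l)
  obtain D where D: "continuous_on S f"
    "\<And>i x. i < n \<Longrightarrow> x \<in> S \<Longrightarrow> ((\<lambda>t. f (x(i := t))) has_real_derivative D i x) (at (x i))"
    "\<And>i. i < n \<Longrightarrow> Ck_on n l S (D i)"
    using assms(3)[unfolded Suc] by (rule Ck_on_SucE) blast
  have "((\<lambda>t. g (x(i := t))) has_real_derivative D i x) (at (x i))" if "i < n" "x \<in> S" for i x
  proof -
    have "\<forall>\<^sub>F t in nhds (x i). f (x(i := t)) = g (x(i := t))"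
      using Euclidean_line_eventually[OF assms(1) that(2,1)] by eventually_elim (use assms in auto)
    from DERIV_cong_ev[OF refl this refl] D(2)[OF that] show ?thesis by simp
  qed
  moreover have "continuous_on S g" using D(1) assms(2) continuous_on_cong[of S S f g] by simp
  ultimately show ?thesis unfolding Suc using D(3) by (intro Ck_on_SucI)
qed

text \<open>The partial derivatives in \<open>Ck_on\<close> are taken along full coordinate lines
  and not within the set, so the same derivatives serve on every subset.\<close>

lemma Ck_on_subset: "\<lbrakk>Ck_on n k S f; T \<subseteq> S\<rbrakk> \<Longrightarrow> Ck_on n k T f"
proof (induction k arbitrary: f)
  case 0
  then show ?case using continuous_on_subset by auto
next
  case (Suc k)
  from Suc.prems(1) obtain D where D: "continuous_on S f"
    "\<And>i x. i < n \<Longrightarrow> x \<in> S \<Longrightarrow> ((\<lambda>t. f (x(i := t))) has_real_derivative D i x) (at (x i))"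
    "\<And>i. i < n \<Longrightarrow> Ck_on n k S (D i)"
    by (rule Ck_on_SucE) blast
  show ?case
  proof (rule Ck_on_SucI)
    show "continuous_on T f" using D(1) Suc.prems(2) by (rule continuous_on_subset)
    show "((\<lambda>t. f (x(i := t))) has_real_derivative D i x) (at (x i))" if "i < n" "x \<in> T" for i x
      using D(2) that Suc.prems(2) by blast
    show "Ck_on n k T (D i)" if "i < n" for i using Suc.IH[OF D(3)[OF that] Suc.prems(2)] .
  qed
qed

lemma Ck_on_SucD: "Ck_on n (Suc k) S f \<Longrightarrow> Ck_on n k S f"
proof (induction k arbitrary: f)
  case 0
  then show ?case by (simp add: Ck_on_continuous del: Ck_on.simps(2))
next
  case (Suc k)
  from Suc.prems obtain D where D: "continuous_on S f"
    "\<And>i x. i < n \<Longrightarrow> x \<in> S \<Longrightarrow> ((\<lambda>t. f (x(i := t))) has_real_derivative D i x) (at (x i))"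
    "\<And>i. i < n \<Longrightarrow> Ck_on n (Suc k) S (D i)"
    by (rule Ck_on_SucE) blast
  show ?case by (rule Ck_on_SucI[OF D(1,2) Suc.IH[OF D(3)]])
qed

lemma Ck_on_local:
  assumes "openin (Euclidean_space n) S" "\<And>x. x \<in> S \<Longrightarrow> \<exists>T. open T \<and> x \<in> T \<and> Ck_on n k (S \<inter> T) f"
  shows "Ck_on n k S f"
  using assms(2)
proof (induction k arbitrary: f)
  have cont: "continuous_on S f"
    if *: "\<And>x. x \<in> S \<Longrightarrow> \<exists>T. open T \<and> x \<in> T \<and> Ck_on n k (S \<inter> T) f" for k f
  proof -
    have "continuous (at x within S) f" if x: "x \<in> S" for x
    proof -
      obtain T where T: "open T" "x \<in> T" "Ck_on n k (S \<inter> T) f" using *[OF x] by auto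
      then have "continuous (at x within S \<inter> T) f"
        using x Ck_on_continuous[of n k "S \<inter> T" f] by (simp add: continuous_on_eq_continuous_within)
      moreover have "at x within S \<inter> T = at x within S"
        by (rule at_within_nhd[of x T]) (use T in auto)
      ultimately show ?thesis by simp
    qed
    then show ?thesis by (simp add: continuous_on_eq_continuous_within)
  qed
  {
    case 0
    from cont[OF this] show ?case by simp
  next
    case (Suc k)
    \<comment> \<open>\<open>deriv\<close> fixes one candidate in advance; the witnesses coming from
      different neighbourhoods all coincide with it by uniqueness of derivatives.\<close>
    define D where "D i x = deriv (\<lambda>t. f (x(i := t))) (x i)" for i x
    have 1: "\<exists>T. open T \<and> x \<in> T \<and> (\<forall>i<n. Ck_on n k (S \<inter> T) (D i)) \<and>
      (\<forall>i<n. ((\<lambda>t. f (x(i := t))) has_real_derivative D i x) (at (x i)))" if x: "x \<in> S" for x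
    proof -
      obtain T where T: "open T" "x \<in> T" "Ck_on n (Suc k) (S \<inter> T) f" using Suc.prems[OF x] by blast
      from T(3) obtain E where E:
        "\<And>i x. i < n \<Longrightarrow> x \<in> S \<inter> T \<Longrightarrow>
          ((\<lambda>t. f (x(i := t))) has_real_derivative E i x) (at (x i))"
        "\<And>i. i < n \<Longrightarrow> Ck_on n k (S \<inter> T) (E i)"
        by (rule Ck_on_SucE) blast
      have eq: "E i y = D i y" if "i < n" "y \<in> S \<inter> T" for i y
        using DERIV_imp_deriv[OF E(1)[OF that]] by (simp add: D_def)
      have "Ck_on n k (S \<inter> T) (D i)" if "i < n" for i
        using openin_Euclidean_Int[OF assms(1) T(1)] eq[OF that] E(2)[OF that] by (rule Ck_on_cong)
      moreover have "((\<lambda>t. f (x(i := t))) has_real_derivative D i x) (at (x i))" if "i < n" for i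
        using E(1)[OF that, of x] eq[OF that, of x] x T by simp
      ultimately show ?thesis using T by blast
    qed
    show ?case
    proof (rule Ck_on_SucI)
      show "continuous_on S f" using cont[OF Suc.prems] .
      show "((\<lambda>t. f (x(i := t))) has_real_derivative D i x) (at (x i))" if "i < n" "x \<in> S" for i x
        using 1[OF that(2)] that by blast
      show "Ck_on n k S (D i)" if "i < n" for i
        by (rule Suc.IH) (use 1 that in blast)
    qed
  }
qed

lemma Ck_on_const: "Ck_on n k S (\<lambda>_. c)"
proof (induction k arbitrary: c)
  case (Suc k)
  show ?case by (rule Ck_on_SucI[of _ _ _ "\<lambda>_ _. 0"]) (auto intro: Suc)
qed auto

lemma Ck_on_add: "\<lbrakk>Ck_on n k S f; Ck_on n k S g\<rbrakk> \<Longrightarrow> Ck_on n k S (\<lambda>x. f x + g x)"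
proof (induction k arbitrary: f g)
  case 0
  then show ?case by (auto intro: continuous_on_add)
next
  case (Suc k)
  from Suc.prems(1) obtain D where D: "continuous_on S f"
    "\<And>i x. i < n \<Longrightarrow> x \<in> S \<Longrightarrow> ((\<lambda>t. f (x(i := t))) has_real_derivative D i x) (at (x i))"
    "\<And>i. i < n \<Longrightarrow> Ck_on n k S (D i)"
    by (rule Ck_on_SucE) blast
  from Suc.prems(2) obtain E where E: "continuous_on S g"
    "\<And>i x. i < n \<Longrightarrow> x \<in> S \<Longrightarrow> ((\<lambda>t. g (x(i := t))) has_real_derivative E i x) (at (x i))"
    "\<And>i. i < n \<Longrightarrow> Ck_on n k S (E i)"
    by (rule Ck_on_SucE) blast
  show ?case
  proof (rule Ck_on_SucI[of _ _ _ "\<lambda>i x. D i x + E i x"])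
    show "continuous_on S (\<lambda>x. f x + g x)" using D(1) E(1) by (rule continuous_on_add)
    show "((\<lambda>t. f (x(i := t)) + g (x(i := t))) has_real_derivative D i x + E i x) (at (x i))"
      if "i < n" "x \<in> S" for i x
      using DERIV_add[OF D(2)[OF that] E(2)[OF that]] .
    show "Ck_on n k S (\<lambda>x. D i x + E i x)" if "i < n" for i
      using Suc.IH[OF D(3)[OF that] E(3)[OF that]] .
  qed
qed

lemma Ck_on_mult: "\<lbrakk>Ck_on n k S f; Ck_on n k S g\<rbrakk> \<Longrightarrow> Ck_on n k S (\<lambda>x. f x * g x)"
proof (induction k arbitrary: f g)
  case 0
  then show ?case by (auto intro: continuous_on_mult)
next
  case (Suc k)
  from Suc.prems(1) obtain D where D: "continuous_on S f"
    "\<And>i x. i < n \<Longrightarrow> x \<in> S \<Longrightarrow> ((\<lambda>t. f (x(i := t))) has_real_derivative D i x) (at (x i))"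
    "\<And>i. i < n \<Longrightarrow> Ck_on n k S (D i)"
    by (rule Ck_on_SucE) blast
  from Suc.prems(2) obtain E where E: "continuous_on S g"
    "\<And>i x. i < n \<Longrightarrow> x \<in> S \<Longrightarrow> ((\<lambda>t. g (x(i := t))) has_real_derivative E i x) (at (x i))"
    "\<And>i. i < n \<Longrightarrow> Ck_on n k S (E i)"
    by (rule Ck_on_SucE) blast
  show ?case
  proof (rule Ck_on_SucI[of _ _ _ "\<lambda>i x. D i x * g x + E i x * f x"])
    show "continuous_on S (\<lambda>x. f x * g x)" using D(1) E(1) by (rule continuous_on_mult)
    show "((\<lambda>t. f (x(i := t)) * g (x(i := t))) has_real_derivative D i x * g x + E i x *
        f x) (at (x i))"
      if "i < n" "x \<in> S" for i x
      using DERIV_mult[OF D(2)[OF that] E(2)[OF that]] by simp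
    show "Ck_on n k S (\<lambda>x. D i x * g x + E i x * f x)" if "i < n" for i
      by (rule Ck_on_add[OF Suc.IH[OF D(3)[OF that] Ck_on_SucD[OF Suc.prems(2)]]
        Suc.IH[OF E(3)[OF that] Ck_on_SucD[OF Suc.prems(1)]]])
  qed
qed

lemma Ck_on_inverse:
  "\<lbrakk>Ck_on n k S f; \<And>x. x \<in> S \<Longrightarrow> f x \<noteq> 0\<rbrakk> \<Longrightarrow> Ck_on n k S (\<lambda>x. inverse (f x))"
proof (induction k)
  case 0
  then show ?case by (auto intro: continuous_on_inverse)
next
  case (Suc k)
  from Suc.prems(1) obtain D where D: "continuous_on S f"
    "\<And>i x. i < n \<Longrightarrow> x \<in> S \<Longrightarrow> ((\<lambda>t. f (x(i := t))) has_real_derivative D i x) (at (x i))"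
    "\<And>i. i < n \<Longrightarrow> Ck_on n k S (D i)"
    by (rule Ck_on_SucE) blast
  have IH: "Ck_on n k S (\<lambda>x. inverse (f x))"
    using Suc.IH[OF Ck_on_SucD[OF Suc.prems(1)] Suc.prems(2)] .
  show ?case
  proof (rule Ck_on_SucI[of _ _ _ "\<lambda>i x. -1 * (inverse (f x) * D i x * inverse (f x))"])
    show "continuous_on S (\<lambda>x. inverse (f x))"
      using D(1) Suc.prems(2) by (intro continuous_on_inverse) auto
    show "((\<lambda>t. inverse (f (x(i := t)))) has_real_derivative
        -1 * (inverse (f x) * D i x * inverse (f x))) (at (x i))"
      if "i < n" "x \<in> S" for i x
      using DERIV_inverse'[OF D(2)[OF that]] Suc.prems(2)[OF that(2)] by simp
    show "Ck_on n k S (\<lambda>x. -1 * (inverse (f x) * D i x * inverse (f x)))" if "i < n" for i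
      using Ck_on_mult[OF Ck_on_const Ck_on_mult[OF Ck_on_mult[OF IH D(3)[OF that]] IH]] .
  qed
qed

text \<open>The functions \<open>p(1/t) exp(-1/t)\<close>, extended by 0 to \<open>t \<le> 0\<close>, are closed under derivatives.\<close>

definition flat :: "real poly \<Rightarrow> real \<Rightarrow> real"
  where "flat p t = (if t > 0 then poly p (1 / t) * exp (- (1 / t)) else 0)"

definition flat_pderiv :: "real poly \<Rightarrow> real poly"
  where "flat_pderiv p = [:0, 0, 1:] * (p - pderiv p)"

lemma poly_exp_tendsto_0: "((\<lambda>s. poly p s * exp (- s)) \<longlongrightarrow> 0) (at_top :: real filter)"
proof -
  have "((\<lambda>s. \<Sum>i\<le>degree p. coeff p i * (s ^ i / exp s)) \<longlongrightarrow> (\<Sum>i\<le>degree p. coeff p i * 0)) at_top"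
    by (intro tendsto_sum tendsto_mult tendsto_const tendsto_power_div_exp_0)
  then show ?thesis
    by (simp add: poly_altdef sum_distrib_right exp_minus divide_inverse mult.assoc)
qed

text \<open>With s = 1/t, differentiating p(s) exp(-s) in t gives s^2 (p(s) - p'(s)) exp(-s), whence
  \<open>flat_pderiv\<close>. At 0 the difference quotient is again of the form q(s) exp(-s), with
  q(s) = s p(s), and tends to 0.\<close>

lemma flat_has_derivative: "(flat p has_real_derivative flat (flat_pderiv p) t) (at t)"
proof -
  consider "t > 0" | "t < 0" | "t = 0" by linarith
  then show ?thesis
  proof cases
    case 1
    have "((\<lambda>t. poly p (1 / t) * exp (- (1 / t))) has_real_derivative flat (flat_pderiv p) t)
        (at t)"
      using 1 by (auto intro!: derivative_eq_intros poly_DERIV[THEN DERIV_chain2]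
          simp: flat_def flat_pderiv_def field_simps power2_eq_square)
    then have ?thesis if "\<forall>\<^sub>F s in nhds t. poly p (1 / s) * exp (- (1 / s)) = flat p s"
      using DERIV_cong_ev[OF refl that refl] by simp
    moreover have "\<forall>\<^sub>F s in nhds t. s \<in> {0<..}" using 1 by (intro eventually_nhds_in_open) auto
    then have "\<forall>\<^sub>F s in nhds t. poly p (1 / s) * exp (- (1 / s)) = flat p s"
      by eventually_elim (auto simp: flat_def)
    ultimately show ?thesis by blast
  next
    case 2
    have "\<forall>\<^sub>F s in nhds t. s \<in> {..<0}" using 2 by (intro eventually_nhds_in_open) auto
    then have "\<forall>\<^sub>F s in nhds t. 0 = flat p s" by eventually_elim (auto simp: flat_def)
    from iffD1[OF DERIV_cong_ev[OF refl this refl] DERIV_const] 2 show ?thesis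
      by (simp add: flat_def[of _ t])
  next
    case 3
    have "((\<lambda>h. flat p h / h) \<longlongrightarrow> 0) (at_right 0)"
    proof -
      have "((\<lambda>h. poly ([:0, 1:] * p) (1 / h) * exp (- (1 / h))) \<longlongrightarrow> 0) (at_right (0::real))"
        using filterlim_compose[OF poly_exp_tendsto_0[of "[:0, 1:] * p"]
            filterlim_inverse_at_top_right]
        by (simp add: inverse_eq_divide)
      moreover have "\<forall>\<^sub>F h in at_right (0::real). poly ([:0, 1:] * p) (1 / h) * exp (- (1 / h)) =
          flat p h / h"
        using eventually_at_right_less by eventually_elim (simp add: flat_def)
      ultimately show ?thesis by (rule Lim_transform_eventually)
    qed
    moreover have "((\<lambda>h. flat p h / h) \<longlongrightarrow> 0) (at_left 0)"
      by (rule tendsto_eventually) (auto simp: flat_def eventually_at_filter)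
    ultimately have "((\<lambda>h. flat p h / h) \<longlongrightarrow> 0) (at 0)" by (intro filterlim_split_at)
    then show ?thesis using 3 by (simp add: DERIV_def flat_def)
  qed
qed

text \<open>The polynomial is arbitrary in the induction, since differentiating replaces
  \<open>p\<close> by \<open>flat_pderiv p\<close>.\<close>

lemma Ck_on_flat: "Ck_on n k S f \<Longrightarrow> Ck_on n k S (\<lambda>x. flat p (f x))"
proof (induction k arbitrary: p)
  have cont: "continuous_on S (\<lambda>x. flat p (f x))" if "continuous_on S f" for p
  proof (rule continuous_on_compose2[OF _ that])
    show "continuous_on UNIV (flat p)" using flat_has_derivative DERIV_continuous_on by blast
  qed simp
  {
    case 0
    then show ?case using cont by simp
  next
    case (Suc k)
    from Suc.prems(1) obtain D where D: "continuous_on S f"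
      "\<And>i x. i < n \<Longrightarrow> x \<in> S \<Longrightarrow> ((\<lambda>t. f (x(i := t))) has_real_derivative D i x) (at (x i))"
      "\<And>i. i < n \<Longrightarrow> Ck_on n k S (D i)"
      by (rule Ck_on_SucE) blast
    show ?case
    proof (rule Ck_on_SucI[of _ _ _ "\<lambda>i x. flat (flat_pderiv p) (f x) * D i x"])
      show "continuous_on S (\<lambda>x. flat p (f x))" using cont[OF D(1)] .
      show "((\<lambda>t. flat p (f (x(i := t)))) has_real_derivative
        flat (flat_pderiv p) (f x) * D i x) (at (x i))" if "i < n" "x \<in> S" for i x
        using DERIV_chain2[OF flat_has_derivative D(2)[OF that], of p] by simp
      show "Ck_on n k S (\<lambda>x. flat (flat_pderiv p) (f x) * D i x)" if "i < n" for i
        using Ck_on_mult[OF Suc.IH[OF Ck_on_SucD[OF Suc.prems]] D(3)[OF that]] .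
    qed
  }
qed

section \<open>Smooth functions on the manifold\<close>

context smooth_manifold
begin

lemma chart_inj: "(U, \<phi>) \<in> charts M \<Longrightarrow> inj_on \<phi> U"
  using homeomorphic_imp_injective_map[OF chart_homeomorphic] by fastforce

lemma chart_inverse: "\<lbrakk>(U, \<phi>) \<in> charts M; x \<in> U\<rbrakk> \<Longrightarrow> the_inv_into U \<phi> (\<phi> x) = x"
  by (rule the_inv_into_f_f[OF chart_inj])

lemma chart_at: obtains U \<phi> where "(U, \<phi>) \<in> charts M" "x \<in> U"
proof -
  have "x \<in> (\<Union>(U, \<phi>)\<in>charts M. U)" using chart_cover by simp
  then show ?thesis using that by auto
qed

lemma chart_openin:
  assumes "(U, \<phi>) \<in> charts M" "open W"
  shows "openin (Euclidean_space (mdim M)) (\<phi> ` (U \<inter> W))"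
proof -
  have "openin (subtopology (Euclidean_space (mdim M)) (\<phi> ` U)) (\<phi> ` (U \<inter> W)) \<longleftrightarrow>
      openin (top_of_set U) (U \<inter> W)"
    by (rule homeomorphic_map_openness[OF chart_homeomorphic[OF assms(1)]]) simp
  moreover have "openin (top_of_set U) (U \<inter> W)" using assms(2) by (simp add: openin_open_Int)
  ultimately show ?thesis using chart_image[OF assms(1)] openin_open_subtopology by blast
qed

lemma smooth_onI:
  "(\<And>U \<phi> k. (U, \<phi>) \<in> charts M \<Longrightarrow> Ck_on (mdim M) k (\<phi> ` (U \<inter> W)) (\<lambda>y. f (the_inv_into U \<phi> y))) \<Longrightarrow>
    smooth_on M W f"
  unfolding smooth_on_def Cinf_on_def by (auto simp: comp_def)

lemma smooth_onD:
  "\<lbrakk>smooth_on M W f; (U, \<phi>) \<in> charts M\<rbrakk> \<Longrightarrow>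
    Ck_on (mdim M) k (\<phi> ` (U \<inter> W)) (\<lambda>y. f (the_inv_into U \<phi> y))"
  unfolding smooth_on_def Cinf_on_def by (auto simp: comp_def)

lemma smooth_on_iff: "smooth_on M W f \<longleftrightarrow> (\<forall>U \<phi> k. (U, \<phi>) \<in> charts M \<longrightarrow>
    Ck_on (mdim M) k (\<phi> ` (U \<inter> W)) (\<lambda>y. f (the_inv_into U \<phi> y)))"
  by (auto intro: smooth_onI smooth_onD)

lemma smooth_on_const [simp]: "smooth_on M W (\<lambda>_. c)"
  by (auto simp: smooth_on_iff Ck_on_const)

lemma smooth_on_add: "\<lbrakk>smooth_on M W f; smooth_on M W g\<rbrakk> \<Longrightarrow> smooth_on M W (\<lambda>x. f x + g x)"
  by (auto simp: smooth_on_iff intro: Ck_on_add)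

lemma smooth_on_mult: "\<lbrakk>smooth_on M W f; smooth_on M W g\<rbrakk> \<Longrightarrow> smooth_on M W (\<lambda>x. f x * g x)"
  by (auto simp: smooth_on_iff intro: Ck_on_mult)

lemma smooth_on_uminus: "smooth_on M W f \<Longrightarrow> smooth_on M W (\<lambda>x. - f x)"
  using smooth_on_mult[OF smooth_on_const, of W f "-1"] by simp

lemma smooth_on_diff: "\<lbrakk>smooth_on M W f; smooth_on M W g\<rbrakk> \<Longrightarrow> smooth_on M W (\<lambda>x. f x - g x)"
  using smooth_on_add[OF _ smooth_on_uminus, of W f g] by simp

lemma smooth_on_sum:
  "(\<And>i. i \<in> I \<Longrightarrow> smooth_on M W (f i)) \<Longrightarrow> smooth_on M W (\<lambda>x. \<Sum>i\<in>I. f i x)"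
  by (induction I rule: infinite_finite_induct) (auto intro: smooth_on_add)

lemma smooth_on_prod:
  "(\<And>i. i \<in> I \<Longrightarrow> smooth_on M W (f i)) \<Longrightarrow> smooth_on M W (\<lambda>x. \<Prod>i\<in>I. f i x)"
  by (induction I rule: infinite_finite_induct) (auto intro: smooth_on_mult)

lemma smooth_on_flat: "smooth_on M W f \<Longrightarrow> smooth_on M W (\<lambda>x. flat p (f x))"
  by (auto simp: smooth_on_iff intro: Ck_on_flat)

lemma smooth_on_inverse:
  assumes "smooth_on M W f" "\<And>x. x \<in> W \<Longrightarrow> f x \<noteq> 0"
  shows "smooth_on M W (\<lambda>x. inverse (f x))"
proof (rule smooth_onI, rule Ck_on_inverse[OF smooth_onD[OF assms(1)]])
  fix U \<phi> y assume "(U, \<phi>) \<in> charts M" "y \<in> \<phi> ` (U \<inter> W)"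
  then show "f (the_inv_into U \<phi> y) \<noteq> 0" using assms(2) by (auto simp: chart_inverse)
qed

lemma smooth_on_subset: "\<lbrakk>smooth_on M W f; W' \<subseteq> W\<rbrakk> \<Longrightarrow> smooth_on M W' f"
  unfolding smooth_on_iff by (meson Ck_on_subset Int_mono image_mono order_refl)

lemma smooth_on_UNIV: "f \<in> C\<^sup>\<infinity> M \<Longrightarrow> smooth_on M W f"
  using smooth_on_subset by auto

lemma smooth_on_cong:
  assumes "open W" "\<And>x. x \<in> W \<Longrightarrow> f x = g x" "smooth_on M W f"
  shows "smooth_on M W g"
proof (rule smooth_onI)
  fix U \<phi> k assume U: "(U, \<phi>) \<in> charts M"
  show "Ck_on (mdim M) k (\<phi> ` (U \<inter> W)) (\<lambda>y. g (the_inv_into U \<phi> y))"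
    by (rule Ck_on_cong[OF chart_openin[OF U assms(1)] _ smooth_onD[OF assms(3) U]])
      (use assms(2) U in \<open>auto simp: chart_inverse\<close>)
qed

lemma smooth_on_local:
  assumes "open W" "\<And>x. x \<in> W \<Longrightarrow> \<exists>N. open N \<and> x \<in> N \<and> smooth_on M (W \<inter> N) f"
  shows "smooth_on M W f"
proof (rule smooth_onI)
  fix U \<phi> k assume U: "(U, \<phi>) \<in> charts M"
  show "Ck_on (mdim M) k (\<phi> ` (U \<inter> W)) (\<lambda>y. f (the_inv_into U \<phi> y))"
  proof (rule Ck_on_local[OF chart_openin[OF U assms(1)]])
    fix y assume "y \<in> \<phi> ` (U \<inter> W)"
    then obtain x where x: "y = \<phi> x" "x \<in> U" "x \<in> W" by auto
    then obtain N where N: "open N" "x \<in> N" "smooth_on M (W \<inter> N) f" using assms(2) by blast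
    then obtain T where T: "open T" "\<phi> ` (U \<inter> (W \<inter> N)) = T \<inter> {x. \<forall>i\<ge>mdim M. x i = 0}"
      using chart_openin[OF U, of "W \<inter> N"] assms(1) unfolding openin_Euclidean_space_iff by blast
    have "\<phi> ` U \<subseteq> {x. \<forall>i\<ge>mdim M. x i = 0}"
      using openin_subset[OF chart_image[OF U]] by (simp add: topspace_Euclidean_space)
    then have eq: "\<phi> ` (U \<inter> W) \<inter> T = \<phi> ` (U \<inter> (W \<inter> N))" using T by blast
    show "\<exists>T. open T \<and> y \<in> T \<and> Ck_on (mdim M) k (\<phi> ` (U \<inter> W) \<inter> T) (\<lambda>y. f (the_inv_into U \<phi> y))"
      using smooth_onD[OF N(3) U] T x N(2) eq by (intro exI[of _ T]) auto
  qed
qed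

section \<open>Chart coordinates, extension by zero and cutoff functions\<close>

lemma smooth_on_chart_coord: "\<lbrakk>(U, \<phi>) \<in> charts M; i < mdim M\<rbrakk> \<Longrightarrow> smooth_on M U (\<lambda>x. \<phi> x i)"
  using chart_transition by (intro smooth_onI) (auto simp: Cinf_on_def)

text \<open>The open sets \<open>V \<inter> W\<close> and \<open>V - C\<close> cover
  \<open>V\<close>, and smoothness is local. The passage from local to global functions and sections
  rests on this.\<close>

lemma smooth_on_extend_zero:
  assumes "open V" "open W" "closed C" "V \<inter> C \<subseteq> W" "smooth_on M (V \<inter> W) f"
    "\<And>x. x \<in> V \<inter> W \<Longrightarrow> g x = f x" "\<And>x. x \<in> V - C \<Longrightarrow> g x = 0"
  shows "smooth_on M V g"
proof (rule smooth_on_local[OF assms(1)])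
  fix x assume x: "x \<in> V"
  show "\<exists>N. open N \<and> x \<in> N \<and> smooth_on M (V \<inter> N) g"
  proof (cases "x \<in> W")
    case True
    have "smooth_on M (V \<inter> W) g"
      by (rule smooth_on_cong[OF _ _ assms(5)]) (use assms in auto)
    then show ?thesis using True assms(2) by blast
  next
    case False
    have "smooth_on M (V \<inter> - C) g"
      by (rule smooth_on_cong[OF _ _ smooth_on_const[of _ 0]]) (use assms in auto)
    then show ?thesis using False assms x by (intro exI[of _ "- C"]) auto
  qed
qed

lemma chart_continuous:
  assumes "(U, \<phi>) \<in> charts M"
  shows "continuous_on U \<phi>"
proof -
  have "continuous_map (top_of_set U) (subtopology (Euclidean_space (mdim M)) (\<phi> ` U)) \<phi>"
    using chart_homeomorphic[OF assms] by (rule homeomorphic_imp_continuous_map)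
  then show ?thesis
    by (simp add: Euclidean_space_def euclidean_product_topology continuous_map_in_subtopology)
qed

lemma smooth_on_continuous:
  assumes "open W" "smooth_on M W f"
  shows "continuous_on W f"
proof -
  have "isCont f x" if x: "x \<in> W" for x
  proof -
    obtain U \<phi> where U: "(U, \<phi>) \<in> charts M" "x \<in> U" by (rule chart_at)
    have "continuous_on (U \<inter> W) (\<lambda>x. f (the_inv_into U \<phi> (\<phi> x)))"
      by (rule continuous_on_compose2[OF Ck_on_continuous[OF smooth_onD[OF assms(2) U(1), of 0]]
          continuous_on_subset[OF chart_continuous[OF U(1)]]]) auto
    then have "continuous_on (U \<inter> W) f"
      by (rule continuous_on_eq) (use U in \<open>simp add: chart_inverse\<close>)
    then show ?thesis
      using x U assms(1) chart_domain[OF U(1)] continuous_on_eq_continuous_at[of "U \<inter> W" f] by auto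
  qed
  then show ?thesis using assms(1) by (simp add: continuous_on_eq_continuous_at)
qed

text \<open>The box is compact in the chart, and a compact subset of a Hausdorff space is closed.
  Closedness in the whole manifold, not merely in \<open>U\<close>, is what permits extension by
  zero.\<close>

lemma compact_chart_box:
  assumes U: "(U, \<phi>) \<in> charts M" "x \<in> U" "open W" "x \<in> W"
  obtains \<epsilon> where "\<epsilon> > 0" "closed {y \<in> U. \<forall>i<mdim M. \<bar>\<phi> y i - \<phi> x i\<bar> \<le> \<epsilon>}"
    "{y \<in> U. \<forall>i<mdim M. \<bar>\<phi> y i - \<phi> x i\<bar> \<le> \<epsilon>} \<subseteq> W"
proof -
  let ?n = "mdim M" and ?X = "{x :: nat \<Rightarrow> real. \<forall>i\<ge>mdim M. x i = 0}"
  have sub: "\<phi> ` U \<subseteq> ?X"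
    using openin_subset[OF chart_image[OF U(1)]] by (simp add: topspace_Euclidean_space)
  obtain T where T: "open T" "\<phi> ` (U \<inter> W) = T \<inter> ?X"
    using chart_openin[OF U(1,3)] unfolding openin_Euclidean_space_iff by blast
  have "\<phi> x \<in> T" using T U by blast
  \<comment> \<open>The product topology on sequences provides a basic open box around the image of
    \<open>x\<close> inside \<open>T\<close>. Only the first \<open>mdim M\<close> factors restrict
    anything, the other coordinates being 0 on the model space.\<close>
  then obtain X where X: "\<phi> x \<in> (\<Pi>\<^sub>E i\<in>UNIV. X i)" "\<And>i. open (X i)" "(\<Pi>\<^sub>E i\<in>UNIV. X i) \<subseteq> T"
    using product_topology_open_contains_basis[of "\<lambda>_. euclideanreal" UNIV T "\<phi> x"] T(1)
    by (auto simp: euclidean_product_topology)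
  have "\<exists>e>0. cball (\<phi> x i) e \<subseteq> X i" for i
    using X(1) X(2)[of i] by (auto simp: open_contains_cball)
  then obtain e where e: "\<And>i. e i > 0" "\<And>i. cball (\<phi> x i) (e i) \<subseteq> X i" by metis
  \<comment> \<open>The inserted 1 keeps the minimum meaningful in dimension 0.\<close>
  define \<epsilon> where "\<epsilon> = Min (insert 1 (e ` {..<?n}))"
  have \<epsilon>: "\<epsilon> > 0" "\<And>i. i < ?n \<Longrightarrow> \<epsilon> \<le> e i" using e(1) by (auto simp: \<epsilon>_def)
  define B where "B = (\<Pi>\<^sub>E i\<in>UNIV. if i < ?n then cball (\<phi> x i) \<epsilon> else {0})"
  have BX: "B \<subseteq> ?X" by (auto simp: B_def PiE_iff) (metis less_le_not_le singletonD)
  have "y i \<in> X i" if "y \<in> B" for y i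
  proof (cases "i < ?n")
    case True
    then have "y i \<in> cball (\<phi> x i) \<epsilon>" using that by (auto simp: B_def PiE_iff split: if_splits)
    then show ?thesis using e(2)[of i] \<epsilon>(2)[OF True] by auto
  next
    case False
    then have "y i = \<phi> x i" using that BX sub U(2) by (auto simp: subset_iff)
    then show ?thesis using X(1) by auto
  qed
  then have "B \<subseteq> T" using X(3) by (auto simp: PiE_iff subset_iff)
  then have B: "B \<subseteq> \<phi> ` (U \<inter> W)" using T BX by auto
  obtain g where g: "homeomorphic_maps (top_of_set U)
      (subtopology (Euclidean_space ?n) (\<phi> ` U)) \<phi> g"
    using chart_homeomorphic[OF U(1)] homeomorphic_map_maps by blast
  \<comment> \<open>A product of compact intervals and singletons, compact by Tychonoff's theorem;
    the inverse chart then carries compactness to the manifold.\<close>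
  have "compactin (powertop_real UNIV) B" by (auto simp: B_def compactin_PiE)
  then have "compactin (subtopology (Euclidean_space ?n) (\<phi> ` U)) B"
    using B BX by (auto simp: Euclidean_space_def compactin_subtopology)
  then have "compactin (top_of_set U) (g ` B)"
    using g image_compactin unfolding homeomorphic_maps_def by blast
  then have "closed (g ` B)" by (simp add: compactin_subtopology compact_imp_closed)
  moreover have gx: "g (\<phi> y) = y" if "y \<in> U" for y using g that
    by (auto simp: homeomorphic_maps_def)
  have eq: "g ` B = {y \<in> U. \<forall>i<?n. \<bar>\<phi> y i - \<phi> x i\<bar> \<le> \<epsilon>}"
  proof (intro set_eqI iffI)
    fix y assume "y \<in> g ` B"
    then obtain b z where "b \<in> B" "y = g b" "b = \<phi> z" "z \<in> U" using B by blast
    then show "y \<in> {y \<in> U. \<forall>i<?n. \<bar>\<phi> y i - \<phi> x i\<bar> \<le> \<epsilon>}"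
      by (auto simp: gx B_def PiE_iff dist_real_def abs_minus_commute split: if_splits)
  next
    fix y assume y: "y \<in> {y \<in> U. \<forall>i<?n. \<bar>\<phi> y i - \<phi> x i\<bar> \<le> \<epsilon>}"
    then have "\<phi> y \<in> B" using sub by (auto simp: B_def dist_real_def abs_minus_commute)
    then show "y \<in> g ` B" using y gx by force
  qed
  moreover have "g ` B \<subseteq> W" using B gx by auto
  ultimately show ?thesis using that[OF \<epsilon>(1)] by simp
qed

text \<open>The function is a product over the coordinates of exp(-1/t), with t equal to \<epsilon>
  squared minus the squared coordinate difference: in the chart it is positive where all differences
  are less than \<epsilon> and 0 elsewhere. In dimension 0 the empty product is 1 and the box is the
  whole chart domain.\<close>

lemma bump_function:
  assumes "open W" "x \<in> W"
  obtains u C where "u \<in> C\<^sup>\<infinity> M" "closed C" "C \<subseteq> W" "u x > 0" "\<And>y. u y \<ge> 0" "\<And>y. y \<notin> C \<Longrightarrow> u y = 0"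
proof -
  let ?n = "mdim M"
  obtain U \<phi> where U: "(U, \<phi>) \<in> charts M" "x \<in> U" by (rule chart_at)
  obtain \<epsilon> where \<epsilon>: "\<epsilon> > 0" "closed {y \<in> U. \<forall>i<?n. \<bar>\<phi> y i - \<phi> x i\<bar> \<le> \<epsilon>}"
    "{y \<in> U. \<forall>i<?n. \<bar>\<phi> y i - \<phi> x i\<bar> \<le> \<epsilon>} \<subseteq> W"
    using compact_chart_box[OF U assms] by blast
  define C where "C = {y \<in> U. \<forall>i<?n. \<bar>\<phi> y i - \<phi> x i\<bar> \<le> \<epsilon>}"
  define v where "v y = (\<Prod>i<?n. flat 1 (\<epsilon>\<^sup>2 - (\<phi> y i - \<phi> x i) * (\<phi> y i - \<phi> x i)))" for y
  define u where "u y = (if y \<in> U then v y else 0)" for y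
  have v: "smooth_on M U v" unfolding v_def
    by (intro smooth_on_prod smooth_on_flat smooth_on_diff smooth_on_mult smooth_on_const
        smooth_on_chart_coord[OF U(1)]) auto
  have zero: "u y = 0" if yC: "y \<notin> C" for y
  proof (cases "y \<in> U")
    case True
    then obtain i where i: "i < ?n" "\<bar>\<phi> y i - \<phi> x i\<bar> > \<epsilon>" using yC by (auto simp: C_def not_le)
    then have "\<epsilon>\<^sup>2 < \<bar>\<phi> y i - \<phi> x i\<bar>\<^sup>2" using \<epsilon>(1) by (intro power_strict_mono) auto
    then have "flat 1 (\<epsilon>\<^sup>2 - (\<phi> y i - \<phi> x i) * (\<phi> y i - \<phi> x i)) = 0"
      by (simp add: flat_def power2_eq_square)
    then show ?thesis using i by (auto simp: u_def v_def intro!: bexI[of _ i])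
  qed (simp add: u_def)
  have "smooth_on M UNIV u"
    by (rule smooth_on_extend_zero[of UNIV U C v])
      (use \<epsilon>(2) v zero chart_domain[OF U(1)] in \<open>auto simp: C_def u_def\<close>)
  moreover have "u x > 0" using U(2) \<epsilon>(1) by (auto simp: u_def v_def flat_def intro!: prod_pos)
  moreover have "u y \<ge> 0" for y by (auto simp: u_def v_def flat_def intro!: prod_nonneg)
  ultimately show ?thesis using that[of u C] zero \<epsilon>(2,3) by (simp add: C_def)
qed

text \<open>The quotient of \<open>flat 1 u\<close> by \<open>flat 1 u + flat 1 (c - u)\<close> is 1
  where \<open>u\<close> exceeds \<open>c\<close> and 0 where \<open>u\<close> is 0; the denominator
  has no zeros because \<open>c\<close> is positive. A whole neighbourhood on which \<open>h\<close>
  is 1, rather than the value at \<open>x\<close> alone, is what derivatives at \<open>x\<close>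
  require.\<close>

lemma plateau_function:
  assumes "open W" "x \<in> W"
  obtains h N C where "h \<in> C\<^sup>\<infinity> M" "open N" "x \<in> N" "closed C" "C \<subseteq> W" "N \<subseteq> C"
    "\<And>y. y \<in> N \<Longrightarrow> h y = 1" "\<And>y. y \<notin> C \<Longrightarrow> h y = 0"
proof -
  obtain u C where u: "u \<in> C\<^sup>\<infinity> M" "closed C" "C \<subseteq> W" "u x > 0" "\<And>y. u y \<ge> 0" "\<And>y. y \<notin> C \<Longrightarrow> u y = 0"
    using bump_function[OF assms] by metis
  define c where "c = u x / 2"
  define N where "N = u -` {c<..}"
  define h where "h y = flat 1 (u y) * inverse (flat 1 (u y) + flat 1 (c - u y))" for y
  have c: "c > 0" using u(4) by (simp add: c_def)
  have pos: "flat 1 (u y) + flat 1 (c - u y) \<noteq> 0" for y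
  proof (cases "u y = 0")
    case False
    then have "u y > 0" using u(5)[of y] by simp
    then have "flat 1 (u y) > 0" "flat 1 (c - u y) \<ge> 0" by (auto simp: flat_def)
    then show ?thesis by simp
  qed (use c in \<open>auto simp: flat_def\<close>)
  have "smooth_on M UNIV h" unfolding h_def
    using u(1) pos by (intro smooth_on_mult smooth_on_inverse smooth_on_flat smooth_on_add
        smooth_on_diff) auto
  moreover have "open N" unfolding N_def
    using smooth_on_continuous[of UNIV u] u(1) by (intro open_vimage) auto
  moreover have "h y = 1" if "y \<in> N" for y using that c by (auto simp: h_def N_def flat_def)
  moreover have "h y = 0" if "y \<notin> C" for y using u(6)[OF that] by (simp add: h_def flat_def)
  moreover have "x \<in> N" using u(4) by (simp add: N_def c_def)
  moreover have "N \<subseteq> C" using u(6) c by (fastforce simp: N_def)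
  ultimately show ?thesis using that[of h N C] u(2,3) by simp
qed

end

section \<open>Sections and the anchor\<close>

lemma sum_fun_apply: "(\<Sum>i\<in>I. F i) x = (\<Sum>i\<in>I. F i x)"
  by (induction I rule: infinite_finite_induct) auto

text \<open>One operation serves sections, forms and multivector fields, since all three are
  functions on the manifold with values in a real vector space.\<close>

definition smul :: "('m \<Rightarrow> real) \<Rightarrow> ('m \<Rightarrow> 'v::real_vector) \<Rightarrow> 'm \<Rightarrow> 'v" (infixr \<open>\<odot>\<close> 75)
  where "f \<odot> V = (\<lambda>x. f x *\<^sub>R V x)"

lemma smul_apply [simp]: "(f \<odot> V) x = f x *\<^sub>R V x"
  by (simp add: smul_def)

context smooth_manifold
begin

lemma smooth_functions_closed:
  shows smooth_fun_add: "\<lbrakk>f \<in> C\<^sup>\<infinity> M; g \<in> C\<^sup>\<infinity> M\<rbrakk> \<Longrightarrow> f + g \<in> C\<^sup>\<infinity> M"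
    and smooth_fun_mult: "\<lbrakk>f \<in> C\<^sup>\<infinity> M; g \<in> C\<^sup>\<infinity> M\<rbrakk> \<Longrightarrow> f * g \<in> C\<^sup>\<infinity> M"
    and smooth_fun_diff: "\<lbrakk>f \<in> C\<^sup>\<infinity> M; g \<in> C\<^sup>\<infinity> M\<rbrakk> \<Longrightarrow> f - g \<in> C\<^sup>\<infinity> M"
    and smooth_fun_uminus: "f \<in> C\<^sup>\<infinity> M \<Longrightarrow> - f \<in> C\<^sup>\<infinity> M"
    and smooth_fun_const: "(\<lambda>_. c) \<in> C\<^sup>\<infinity> M"
    and smooth_fun_0: "0 \<in> C\<^sup>\<infinity> M"
    and smooth_fun_1: "1 \<in> C\<^sup>\<infinity> M"
  by (auto simp: plus_fun_def times_fun_def fun_diff_def fun_Compl_def zero_fun_def one_fun_def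
      intro: smooth_on_add smooth_on_mult smooth_on_diff smooth_on_uminus)

lemma sections_fibre: "s \<in> sections M E \<Longrightarrow> s x \<in> fibre E x"
  by (simp add: sections_def)

lemma sectionsE:
  assumes "s \<in> sections M E" "(W, e) \<in> frames E"
  obtains c where "\<And>i. i \<in> indices E \<Longrightarrow> smooth_on M W (c i)"
    "\<And>x. x \<in> W \<Longrightarrow> s x = (\<Sum>i\<in>indices E. c i x *\<^sub>R e i x)"
proof -
  have "\<exists>c. (\<forall>i\<in>indices E. smooth_on M W (c i)) \<and>
      (\<forall>x\<in>W. s x = (\<Sum>i\<in>indices E. c i x *\<^sub>R e i x))"
    using assms unfolding sections_def by fast
  then show ?thesis using that by blast
qed

lemma sectionsI:
  assumes "\<And>x. s x \<in> fibre E x"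
    "\<And>W e. (W, e) \<in> frames E \<Longrightarrow> \<exists>c. (\<forall>i\<in>indices E. smooth_on M W (c i)) \<and>
      (\<forall>x\<in>W. s x = (\<Sum>i\<in>indices E. c i x *\<^sub>R e i x))"
  shows "s \<in> sections M E"
  using assms unfolding sections_def by auto

lemma sections_add:
  assumes "\<And>x. subspace (fibre E x)" "s \<in> sections M E" "t \<in> sections M E"
  shows "s + t \<in> sections M E"
proof (rule sectionsI)
  show "(s + t) x \<in> fibre E x" for x
    using assms by (simp add: sections_fibre subspace_add)
next
  fix W e assume W: "(W, e) \<in> frames E"
  obtain c where c: "\<And>i. i \<in> indices E \<Longrightarrow> smooth_on M W (c i)"
    "\<And>x. x \<in> W \<Longrightarrow> s x = (\<Sum>i\<in>indices E. c i x *\<^sub>R e i x)"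
    by (rule sectionsE[OF assms(2) W]) blast
  obtain d where d: "\<And>i. i \<in> indices E \<Longrightarrow> smooth_on M W (d i)"
    "\<And>x. x \<in> W \<Longrightarrow> t x = (\<Sum>i\<in>indices E. d i x *\<^sub>R e i x)"
    by (rule sectionsE[OF assms(3) W]) blast
  show "\<exists>c. (\<forall>i\<in>indices E. smooth_on M W (c i)) \<and>
      (\<forall>x\<in>W. (s + t) x = (\<Sum>i\<in>indices E. c i x *\<^sub>R e i x))"
    using c d by (intro exI[of _ "\<lambda>i x. c i x + d i x"])
      (auto simp: scaleR_add_left sum.distrib intro: smooth_on_add)
qed

lemma sections_smul:
  assumes "\<And>x. subspace (fibre E x)" "f \<in> C\<^sup>\<infinity> M" "s \<in> sections M E"
  shows "f \<odot> s \<in> sections M E"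
proof (rule sectionsI)
  show "(f \<odot> s) x \<in> fibre E x" for x
    using assms by (simp add: sections_fibre subspace_scale)
next
  fix W e assume W: "(W, e) \<in> frames E"
  obtain c where c: "\<And>i. i \<in> indices E \<Longrightarrow> smooth_on M W (c i)"
    "\<And>x. x \<in> W \<Longrightarrow> s x = (\<Sum>i\<in>indices E. c i x *\<^sub>R e i x)"
    by (rule sectionsE[OF assms(3) W]) blast
  show "\<exists>c. (\<forall>i\<in>indices E. smooth_on M W (c i)) \<and>
      (\<forall>x\<in>W. (f \<odot> s) x = (\<Sum>i\<in>indices E. c i x *\<^sub>R e i x))"
    using c smooth_on_UNIV[OF assms(2), of W] by (intro exI[of _ "\<lambda>i x. f x * c i x"])
      (auto simp: scaleR_sum_right intro: smooth_on_mult)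
qed

lemma sections_zero:
  assumes "\<And>x. subspace (fibre E x)"
  shows "0 \<in> sections M E"
proof (rule sectionsI)
  show "0 x \<in> fibre E x" for x using assms by (simp add: subspace_0)
qed (intro exI[of _ "\<lambda>_ _. 0"], simp)

end

section \<open>Local frames, their coordinates and global sections\<close>

context vector_bundle
begin

lemma frame_at: obtains W e where "(W, e) \<in> frames E" "x \<in> W"
proof -
  have "x \<in> (\<Union>(W, e)\<in>frames E. W)" using frame_cover by simp
  then show ?thesis using that by auto
qed

lemma frame_fibre: "\<lbrakk>(W, e) \<in> frames E; x \<in> W; i \<in> indices E\<rbrakk> \<Longrightarrow> e i x \<in> fibre E x"
  using frame_span[of W e x] by (auto intro: span_base)

text \<open>A coordinate defined for every vector of the fibre, in contrast to the coefficient
  functions in \<open>sections\<close>, which are merely asserted to exist. Linear independence of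
  the frame identifies the two.\<close>

definition frame_coord :: "('i \<Rightarrow> 'm \<Rightarrow> 'v) \<Rightarrow> 'i \<Rightarrow> 'm \<Rightarrow> 'v \<Rightarrow> real"
  where "frame_coord e i x v = representation ((\<lambda>i. e i x) ` indices E) v (e i x)"

lemma frame_coord_add:
  "\<lbrakk>(W, e) \<in> frames E; x \<in> W; v \<in> fibre E x; w \<in> fibre E x\<rbrakk> \<Longrightarrow>
    frame_coord e i x (v + w) = frame_coord e i x v + frame_coord e i x w"
  using frame_independent[of W e x] frame_span[of W e x]
  by (simp add: frame_coord_def representation_add)

lemma frame_coord_scale:
  "\<lbrakk>(W, e) \<in> frames E; x \<in> W; v \<in> fibre E x\<rbrakk> \<Longrightarrow>
    frame_coord e i x (a *\<^sub>R v) = a * frame_coord e i x v"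
  using frame_independent[of W e x] frame_span[of W e x]
  by (simp add: frame_coord_def representation_scale)

lemma frame_coord_basis:
  "\<lbrakk>(W, e) \<in> frames E; x \<in> W; i \<in> indices E; j \<in> indices E\<rbrakk> \<Longrightarrow>
    frame_coord e i x (e j x) = (if i = j then 1 else 0)"
  using frame_independent[of W e x] frame_inj[of W e x]
  by (auto simp: frame_coord_def representation_basis inj_on_def)

lemma frame_coord_sum:
  assumes "(W, e) \<in> frames E" "x \<in> W" "i \<in> indices E"
  shows "frame_coord e i x (\<Sum>j\<in>indices E. c j *\<^sub>R e j x) = c i"
proof -
  have "frame_coord e i x (\<Sum>j\<in>J. c j *\<^sub>R e j x) = (\<Sum>j\<in>J. c j * (if i = j then 1 else 0))"
    if "finite J" "J \<subseteq> indices E" for J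
    using that
  proof (induction J)
    case empty
    show ?case using frame_coord_scale[OF assms(1,2) subspace_0[OF fibre_subspace], of i 0] by simp
  next
    case (insert j J)
    then have "(\<Sum>j\<in>J. c j *\<^sub>R e j x) \<in> fibre E x"
      using frame_fibre[OF assms(1,2)] fibre_subspace
      by (intro subspace_sum subspace_scale) auto
    with insert show ?case
      using assms frame_fibre[OF assms(1,2)] fibre_subspace[of x]
      by (simp add: frame_coord_add frame_coord_scale frame_coord_basis subspace_scale)
  qed
  from this[of "indices E"] assms(3) finite_rank show ?thesis
    by (simp add: if_distrib sum.delta' cong: if_cong)
qed

lemma frame_coord_smooth:
  assumes "(W, e) \<in> frames E" "s \<in> sections M E" "i \<in> indices E"
  shows "smooth_on M W (\<lambda>x. frame_coord e i x (s x))"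
proof -
  obtain c where c: "\<And>i. i \<in> indices E \<Longrightarrow> smooth_on M W (c i)"
    "\<And>x. x \<in> W \<Longrightarrow> s x = (\<Sum>i\<in>indices E. c i x *\<^sub>R e i x)"
    by (rule sectionsE[OF assms(2,1)]) blast
  show ?thesis
    by (rule smooth_on_cong[OF frame_domain[OF assms(1)] _ c(1)[OF assms(3)]])
      (simp add: c(2) frame_coord_sum[OF assms(1) _ assms(3)])
qed

lemma frame_expansion:
  assumes "(W, e) \<in> frames E" "x \<in> W" "v \<in> fibre E x"
  shows "v = (\<Sum>i\<in>indices E. frame_coord e i x v *\<^sub>R e i x)"
proof -
  have "v = (\<Sum>b\<in>(\<lambda>i. e i x) ` indices E. representation ((\<lambda>i. e i x) ` indices E) v b *\<^sub>R b)"
    using assms frame_span[OF assms(1,2)] frame_independent[OF assms(1,2)] finite_rank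
    by (intro sum_representation_eq[symmetric]) auto
  then show ?thesis
    by (simp add: sum.reindex[OF frame_inj[OF assms(1,2)]] frame_coord_def)
qed

lemmas sec_add = sections_add[OF fibre_subspace]
  and sec_smul = sections_smul[OF fibre_subspace]
  and sec_zero = sections_zero[OF fibre_subspace]

lemma sec_scaleR: "s \<in> sections M E \<Longrightarrow> c *\<^sub>R s \<in> sections M E"
  using sec_smul[OF smooth_fun_const, of s c] by (simp add: smul_def scaleR_fun_def)

lemma sec_uminus: "s \<in> sections M E \<Longrightarrow> - s \<in> sections M E"
  using sec_scaleR[of s "-1"] by simp

lemma sec_diff: "\<lbrakk>s \<in> sections M E; t \<in> sections M E\<rbrakk> \<Longrightarrow> s - t \<in> sections M E"
  using sec_add[OF _ sec_uminus, of s t] by simp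

lemma sec_sum: "(\<And>i. i \<in> I \<Longrightarrow> s i \<in> sections M E) \<Longrightarrow> (\<Sum>i\<in>I. s i) \<in> sections M E"
  by (induction I rule: infinite_finite_induct) (auto intro: sec_add sec_zero)

lemma smooth_fun_extend:
  assumes "h \<in> C\<^sup>\<infinity> M" "open W" "closed C" "C \<subseteq> W" "\<And>x. x \<notin> C \<Longrightarrow> h x = 0" "smooth_on M W f"
  shows "(\<lambda>x. h x * f x) \<in> C\<^sup>\<infinity> M"
  using smooth_on_extend_zero[of UNIV W C "\<lambda>x. h x * f x"] assms
    smooth_on_mult[OF smooth_on_UNIV[OF assms(1)] assms(6)] by simp

text \<open>Off \<open>W\<close> the frame is an arbitrary function, but there the cutoff is 0. In
  another frame the coefficients are the transition coefficients times the cutoff, which are smooth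
  by extension by zero.\<close>

lemma sec_frame_extend:
  assumes W: "(W, e) \<in> frames E" "i \<in> indices E" and h: "h \<in> C\<^sup>\<infinity> M" "closed C" "C \<subseteq> W"
      "\<And>x. x \<notin> C \<Longrightarrow> h x = 0"
  shows "h \<odot> e i \<in> sections M E"
proof (rule sectionsI)
  show "(h \<odot> e i) x \<in> fibre E x" for x
    using frame_fibre[OF W(1) _ W(2), of x] h fibre_subspace[of x]
    by (cases "x \<in> C") (auto simp: subspace_scale subspace_0)
next
  fix W' e' assume W': "(W', e') \<in> frames E"
  obtain a where a: "\<And>i j. \<lbrakk>i \<in> indices E; j \<in> indices E\<rbrakk> \<Longrightarrow> smooth_on M (W' \<inter> W) (a i j)"
    "\<And>x j. \<lbrakk>x \<in> W' \<inter> W; j \<in> indices E\<rbrakk> \<Longrightarrow> e j x = (\<Sum>i\<in>indices E. a i j x *\<^sub>R e' i x)"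
    using frame_transition[OF W' W(1)] by metis
  have "smooth_on M W' (\<lambda>x. if x \<in> W then h x * a k i x else 0)" if "k \<in> indices E" for k
    by (rule smooth_on_extend_zero[of W' W C "\<lambda>x. h x * a k i x"])
      (use that frame_domain[OF W'] frame_domain[OF W(1)] h a(1)[OF that W(2)]
        smooth_on_UNIV[OF h(1)] in
        \<open>auto intro: smooth_on_mult\<close>)
  then show "\<exists>c. (\<forall>k\<in>indices E. smooth_on M W' (c k)) \<and>
      (\<forall>x\<in>W'. (h \<odot> e i) x = (\<Sum>k\<in>indices E. c k x *\<^sub>R e' k x))"
  proof (intro exI[of _ "\<lambda>k x. if x \<in> W then h x * a k i x else 0"] conjI ballI)
    fix x assume x: "x \<in> W'"
    show "(h \<odot> e i) x = (\<Sum>k\<in>indices E. (if x \<in> W then h x * a k i x else 0) *\<^sub>R e' k x)"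
    proof (cases "x \<in> W")
      case True
      then show ?thesis using x a(2)[of x i] W(2) by (simp add: scaleR_sum_right)
    next
      case False
      then have "h x = 0" using h by auto
      then show ?thesis using False by simp
    qed
  qed
qed

lemma sec_through:
  assumes "v \<in> fibre E x"
  obtains s where "s \<in> sections M E" "s x = v"
proof -
  obtain W e where W: "(W, e) \<in> frames E" "x \<in> W" by (rule frame_at)
  obtain h N C where h: "h \<in> C\<^sup>\<infinity> M" "open N" "x \<in> N" "closed C" "C \<subseteq> W"
    "\<And>y. y \<in> N \<Longrightarrow> h y = 1" "\<And>y. y \<notin> C \<Longrightarrow> h y = 0"
    using plateau_function[OF frame_domain[OF W(1)] W(2)] by metis
  define s where "s = (\<Sum>i\<in>indices E. frame_coord e i x v *\<^sub>R (h \<odot> e i))"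
  have "s \<in> sections M E" unfolding s_def
    using sec_frame_extend[OF W(1) _ h(1,4,5,7)] by (intro sec_sum sec_scaleR) auto
  moreover have "s x = v"
    using frame_expansion[OF W assms] h by (simp add: s_def sum_fun_apply)
  ultimately show ?thesis using that by blast
qed

end

section \<open>The anchor as a derivation of smooth functions\<close>

context lie_algebroid
begin

sublocale vector_bundle "base L" "bun L" by (rule is_bundle)

abbreviation \<open>C \<equiv> C\<^sup>\<infinity> (base L)\<close>
abbreviation \<open>D \<equiv> anchor_deriv L\<close>

lemma anchor_derivation: "v \<in> fibre (bun L) x \<Longrightarrow> anchor L x v \<in> derivations_at (base L) x"
  using anchor_map by (simp add: bundle_map_def tangent_bundle_def)

lemma anchor_linear: "\<lbrakk>v \<in> fibre (bun L) x; w \<in> fibre (bun L) x\<rbrakk> \<Longrightarrow>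
    anchor L x (a *\<^sub>R v + b *\<^sub>R w) = a *\<^sub>R anchor L x v + b *\<^sub>R anchor L x w"
  using anchor_map by (simp add: bundle_map_def)

lemma anchor_add: "\<lbrakk>v \<in> fibre (bun L) x; w \<in> fibre (bun L) x\<rbrakk> \<Longrightarrow>
    anchor L x (v + w) = anchor L x v + anchor L x w"
  using anchor_linear[of v x w 1 1] by simp

lemma anchor_scale: "v \<in> fibre (bun L) x \<Longrightarrow> anchor L x (a *\<^sub>R v) = a *\<^sub>R anchor L x v"
  using anchor_linear[of v x v a 0] by simp

lemma anchor_sum:
  "\<lbrakk>finite J; \<And>j. j \<in> J \<Longrightarrow> v j \<in> fibre (bun L) x\<rbrakk> \<Longrightarrow>
    anchor L x (\<Sum>j\<in>J. c j *\<^sub>R v j) = (\<Sum>j\<in>J. c j *\<^sub>R anchor L x (v j))"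
proof (induction J rule: finite_induct)
  case empty
  show ?case using anchor_scale[OF subspace_0[OF fibre_subspace], of x 0] by simp
next
  case (insert j J)
  then have "(\<Sum>j\<in>J. c j *\<^sub>R v j) \<in> fibre (bun L) x"
    using fibre_subspace by (intro subspace_sum subspace_scale) auto
  with insert show ?case
    using fibre_subspace[of x] by (simp add: anchor_add anchor_scale subspace_scale)
qed

lemma D_deriv:
  assumes "V \<in> \<Gamma> L" "f \<in> C" "g \<in> C"
  shows D_lin: "D V (\<lambda>x. a * f x + b * g x) = (\<lambda>x. a * D V f x + b * D V g x)"
    and D_prod: "D V (\<lambda>x. f x * g x) = (\<lambda>x. f x * D V g x + g x * D V f x)"
  using anchor_derivation[OF sections_fibre[OF assms(1)]] assms(2,3)
  unfolding derivations_at_def anchor_deriv_def by blast+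

lemma D_add: "\<lbrakk>V \<in> \<Gamma> L; f \<in> C; g \<in> C\<rbrakk> \<Longrightarrow> D V (f + g) = D V f + D V g"
  using D_lin[of V f g 1 1] by (simp add: plus_fun_def)

lemma D_diff: "\<lbrakk>V \<in> \<Gamma> L; f \<in> C; g \<in> C\<rbrakk> \<Longrightarrow> D V (f - g) = D V f - D V g"
  using D_lin[of V f g 1 "-1"] by (simp add: fun_diff_def)

lemma D_0: "V \<in> \<Gamma> L \<Longrightarrow> D V 0 = 0"
  using D_diff[OF _ smooth_fun_0 smooth_fun_0] by simp

lemma D_uminus: "\<lbrakk>V \<in> \<Gamma> L; f \<in> C\<rbrakk> \<Longrightarrow> D V (- f) = - D V f"
  using D_diff[OF _ smooth_fun_0, of V f] by (simp add: D_0)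

lemma D_mult: "\<lbrakk>V \<in> \<Gamma> L; f \<in> C; g \<in> C\<rbrakk> \<Longrightarrow> D V (f * g) = f * D V g + D V f * g"
  using D_prod[of V f g] by (simp add: plus_fun_def times_fun_def mult.commute)

lemma D_add_left: "\<lbrakk>V \<in> \<Gamma> L; W \<in> \<Gamma> L\<rbrakk> \<Longrightarrow> D (V + W) f = D V f + D W f"
  by (auto simp: anchor_deriv_def anchor_add sections_fibre)

lemma D_smul_left: "V \<in> \<Gamma> L \<Longrightarrow> D (g \<odot> V) f = g * D V f"
  by (auto simp: anchor_deriv_def anchor_scale sections_fibre)

lemma D_const: "V \<in> \<Gamma> L \<Longrightarrow> D V (\<lambda>_. c) = 0"
proof -
  assume V: "V \<in> \<Gamma> L"
  have "D V (1 * 1) = D V 1 + D V 1" using D_mult[OF V smooth_fun_1 smooth_fun_1] by simp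
  then have "D V 1 = 0" by simp
  then show ?thesis using D_lin[OF V smooth_fun_1 smooth_fun_1, of c 0] by (simp add: zero_fun_def)
qed

text \<open>The product of a cutoff \<open>h\<close> supported in \<open>N\<close> with
  \<open>f - g\<close> is 0, and so is its derivative. At \<open>x\<close>, where \<open>h\<close>
  is 1 and \<open>f - g\<close> is 0, the Leibniz rule leaves only the derivative of
  \<open>f - g\<close>.\<close>

lemma D_local:
  assumes "V \<in> \<Gamma> L" "f \<in> C" "g \<in> C" "open N" "x \<in> N" "\<And>y. y \<in> N \<Longrightarrow> f y = g y"
  shows "D V f x = D V g x"
proof -
  obtain h N' K where h: "h \<in> C" "x \<in> N'" "K \<subseteq> N" "\<And>y. y \<in> N' \<Longrightarrow> h y = 1" "\<And>y. y \<notin> K \<Longrightarrow> h y = 0"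
    using plateau_function[OF assms(4,5)] by metis
  have "h * (f - g) = 0"
    using h(3,5) assms(6) by (auto simp: fun_eq_iff)
  then have "h * D V (f - g) + D V h * (f - g) = 0"
    using D_mult[OF assms(1) h(1) smooth_fun_diff[OF assms(2,3)]] D_0[OF assms(1)] by simp
  then have "h x * D V (f - g) x + D V h x * (f x - g x) = 0"
    by (metis (no_types) minus_apply plus_fun_apply times_fun_apply zero_fun_apply)
  then show ?thesis using h assms by (simp add: D_diff)
qed

text \<open>Tangent vectors are abstract derivations, so smoothness has to be read off in a chart:
  in a local frame the anchor is a combination of coordinate fields with smooth coefficients, and
  coordinate fields act by partial derivatives.\<close>

lemma D_smooth:
  assumes V: "V \<in> \<Gamma> L" and f: "f \<in> C"
  shows "D V f \<in> C"
proof -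
  let ?n = "mdim (base L)" and ?K = "indices (bun L)"
  have "smooth_on (base L) UNIV (D V f)"
  proof (rule smooth_onI)
    fix U \<phi> k assume U: "(U, \<phi>) \<in> charts (base L)"
    let ?inv = "the_inv_into U \<phi>"
    \<comment> \<open>One order of differentiability is spent: order \<open>k\<close> for the
      derivative needs order \<open>Suc k\<close> for \<open>f\<close>.\<close>
    have "Ck_on ?n (Suc k) (\<phi> ` U) (\<lambda>y. f (?inv y))"
      using smooth_onD[OF _ U, of UNIV f "Suc k"] f by simp
    then obtain E where E: "\<And>i y. i < ?n \<Longrightarrow> y \<in> \<phi> ` U \<Longrightarrow>
        ((\<lambda>t. f (?inv (y(i := t)))) has_real_derivative E i y) (at (y i))"
      "\<And>i. i < ?n \<Longrightarrow> Ck_on ?n k (\<phi> ` U) (E i)"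
      by (rule Ck_on_SucE) blast
    have coord: "coord_vector (base L) U \<phi> i x f = E i (\<phi> x)" if "i < ?n" "x \<in> U" for i x
      using DERIV_imp_deriv[OF E(1)[OF that(1), of "\<phi> x"]] that f by (simp add: coord_vector_def)
    have "Ck_on ?n k (\<phi> ` U) (\<lambda>y. D V f (?inv y))"
    proof (rule Ck_on_local[OF chart_image[OF U]])
      fix y assume "y \<in> \<phi> ` U"
      then obtain x where x: "x \<in> U" "y = \<phi> x" by auto
      obtain W e where W: "(W, e) \<in> frames (bun L)" "x \<in> W" by (rule frame_at)
      obtain T where T: "open T" "\<phi> ` (U \<inter> W) = T \<inter> {x. \<forall>i\<ge>?n. x i = 0}"
        using chart_openin[OF U frame_domain[OF W(1)]] unfolding openin_Euclidean_space_iff by blast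
      have "\<phi> ` U \<subseteq> {x. \<forall>i\<ge>?n. x i = 0}"
        using openin_subset[OF chart_image[OF U]] by (simp add: topspace_Euclidean_space)
      then have eq: "\<phi> ` U \<inter> T = \<phi> ` (U \<inter> W)" using T by blast
      have UT: "(U, coord_vector (base L) U \<phi>) \<in> frames (tangent_bundle (base L))"
        using U by (auto simp: tangent_bundle_def)
      have "\<exists>a. (\<forall>i\<in>indices (tangent_bundle (base L)). \<forall>j\<in>?K. smooth_on (base L) (W \<inter> U) (a i j)) \<and>
          (\<forall>x\<in>W \<inter> U. \<forall>j\<in>?K. anchor L x (e j x) =
            (\<Sum>i\<in>indices (tangent_bundle (base L)). a i j x *\<^sub>R coord_vector (base L) U \<phi> i x))"
        using anchor_map W(1) UT unfolding bundle_map_def by fast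
      moreover have "indices (tangent_bundle (base L)) = {..<?n}" by (simp add: tangent_bundle_def)
      ultimately obtain a where
        "(\<forall>i\<in>{..<?n}. \<forall>j\<in>?K. smooth_on (base L) (W \<inter> U) (a i j)) \<and>
          (\<forall>x\<in>W \<inter> U. \<forall>j\<in>?K. anchor L x (e j x) =
            (\<Sum>i<?n. a i j x *\<^sub>R coord_vector (base L) U \<phi> i x))"
        by auto
      then have a: "\<And>i j. i < ?n \<Longrightarrow> j \<in> ?K \<Longrightarrow> smooth_on (base L) (W \<inter> U) (a i j)"
        "\<And>x j. x \<in> W \<inter> U \<Longrightarrow> j \<in> ?K \<Longrightarrow>
          anchor L x (e j x) = (\<Sum>i<?n. a i j x *\<^sub>R coord_vector (base L) U \<phi> i x)"
        by auto
      let ?F = "\<lambda>y. \<Sum>j\<in>?K. frame_coord e j (?inv y) (V (?inv y)) * (\<Sum>i<?n. a i j (?inv y) * E i y)"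
      have F1: "Ck_on ?n k (\<phi> ` (U \<inter> W)) ?F"
      proof -
        have sums: "Ck_on ?n k S (\<lambda>y. \<Sum>i\<in>I. G i y)"
          if "\<And>i. i \<in> I \<Longrightarrow> Ck_on ?n k S (G i)" for I :: "nat set" and S G
          using that by (induction I rule: infinite_finite_induct)
              (auto intro: Ck_on_add Ck_on_const)
        show ?thesis
        proof (intro sums Ck_on_mult)
          show "Ck_on ?n k (\<phi> ` (U \<inter> W)) (\<lambda>y. frame_coord e j (?inv y) (V (?inv y)))" if "j \<in> ?K"
              for j
            using smooth_onD[OF frame_coord_smooth[OF W(1) V that] U] .
          show "Ck_on ?n k (\<phi> ` (U \<inter> W)) (\<lambda>y. a i j (?inv y))" if "j \<in> ?K" "i \<in> {..<?n}" for i j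
          proof -
            have "smooth_on (base L) (W \<inter> U) (a i j)" using a(1) that by simp
            from smooth_onD[OF this U, of k] show ?thesis by (simp add: Int_ac)
          qed
          show "Ck_on ?n k (\<phi> ` (U \<inter> W)) (E i)" if "i \<in> {..<?n}" for i
            using that by (intro Ck_on_subset[OF E(2)] image_mono) auto
        qed
      qed
      have F2: "?F y = D V f (?inv y)" if y: "y \<in> \<phi> ` (U \<inter> W)" for y
      proof -
        obtain x where x: "x \<in> U" "x \<in> W" "y = \<phi> x" using y by blast
        then have inv: "?inv y = x" using chart_inverse[OF U] by simp
        have "anchor L x (V x) = (\<Sum>j\<in>?K. frame_coord e j x (V x) *\<^sub>R anchor L x (e j x))"
          using frame_expansion[OF W(1) x(2) sections_fibre[OF V]]
            anchor_sum[OF finite_rank, of "\<lambda>j. e j x" x "\<lambda>j. frame_coord e j x (V x)"]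
            frame_fibre[OF W(1) x(2)] by simp
        then show ?thesis
          unfolding inv using x a(2)[of x] by (simp add: anchor_deriv_def sum_fun_apply coord)
      qed
      have "Ck_on ?n k (\<phi> ` (U \<inter> W)) (\<lambda>y. D V f (?inv y))"
        using chart_openin[OF U frame_domain[OF W(1)]] F2 F1 by (rule Ck_on_cong)
      moreover have "y \<in> T" using T(2) x W(2) by blast
      ultimately show "\<exists>T. open T \<and> y \<in> T \<and> Ck_on ?n k (\<phi> ` U \<inter> T) (\<lambda>y. D V f (?inv y))"
        using T(1) eq by (intro exI[of _ T]) simp
    qed
    then show "Ck_on ?n k (\<phi> ` (U \<inter> UNIV)) (\<lambda>y. D V f (?inv y))" by simp
  qed
  then show ?thesis by simp
qed

lemma D_bracket:
  "\<lbrakk>V \<in> \<Gamma> L; W \<in> \<Gamma> L\<rbrakk> \<Longrightarrow> D (brk L V W) f = D V (D W f) - D W (D V f)"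
  using fun_cong[OF fun_cong[OF anchor_hom[of V W]], of _ f]
  by (auto simp: anchor_deriv_def vf_bracket_def fun_eq_iff)

lemma brk_add_left: "\<lbrakk>V \<in> \<Gamma> L; V' \<in> \<Gamma> L; W \<in> \<Gamma> L\<rbrakk> \<Longrightarrow> brk L (V + V') W = brk L V W + brk L V' W"
  using brk_linear[of V V' W 1 1] by simp

lemma brk_add_right: "\<lbrakk>V \<in> \<Gamma> L; W \<in> \<Gamma> L; W' \<in> \<Gamma> L\<rbrakk> \<Longrightarrow> brk L V (W + W') = brk L V W + brk L V W'"
  using brk_skew[of V "W + W'"] brk_skew[of V W] brk_skew[of V W'] brk_add_left[of W W' V]
  by (simp add: sec_add)

lemma brk_smul_right: "\<lbrakk>V \<in> \<Gamma> L; W \<in> \<Gamma> L; f \<in> C\<rbrakk> \<Longrightarrow> brk L V (f \<odot> W) = f \<odot> brk L V W + D V f \<odot> W"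
  using brk_leibniz[of V W f] by (simp add: smul_def plus_fun_def)

lemma brk_smul_left: "\<lbrakk>V \<in> \<Gamma> L; W \<in> \<Gamma> L; f \<in> C\<rbrakk> \<Longrightarrow> brk L (f \<odot> V) W = f \<odot> brk L V W - D W f \<odot> V"
  using brk_skew[of "f \<odot> V" W] brk_skew[of V W] brk_smul_right[of W V f]
  by (simp add: sec_smul fun_eq_iff)

end

section \<open>Cartan calculus on lists of sections\<close>

context lie_algebroid
begin

text \<open>
  Differential forms are first treated as functions \<open>\<alpha>\<close> of lists of global sections, all degrees
  at once, and all operators are defined by recursion on the list. In this shape
  \<open>i\<^sub>W \<L>\<^sub>V = \<L>\<^sub>V i\<^sub>W - i\<^sub>[\<^sub>V\<^sub>,\<^sub>W\<^sub>]\<close> and \<open>i\<^sub>V d = \<L>\<^sub>V - d i\<^sub>V\<close> hold by definition.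
\<close>

definition list_form :: "(('m \<Rightarrow> 'v) list \<Rightarrow> 'm \<Rightarrow> real) \<Rightarrow> bool"
  where "list_form \<alpha> \<longleftrightarrow> (\<forall>Vs. set Vs \<subseteq> \<Gamma> L \<longrightarrow> \<alpha> Vs \<in> C) \<and> alternating_on (\<Gamma> L) \<alpha> \<and>
    (\<forall>V\<in>\<Gamma> L. \<forall>W\<in>\<Gamma> L. \<forall>Vs. set Vs \<subseteq> \<Gamma> L \<longrightarrow> \<alpha> ((V + W) # Vs) = \<alpha> (V # Vs) + \<alpha> (W # Vs)) \<and>
    (\<forall>f\<in>C. \<forall>V\<in>\<Gamma> L. \<forall>Vs. set Vs \<subseteq> \<Gamma> L \<longrightarrow> \<alpha> ((f \<odot> V) # Vs) = f * \<alpha> (V # Vs))"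

lemma list_formI:
  assumes "\<And>Vs. set Vs \<subseteq> \<Gamma> L \<Longrightarrow> \<alpha> Vs \<in> C" "alternating_on (\<Gamma> L) \<alpha>"
    "\<And>V W Vs. \<lbrakk>V \<in> \<Gamma> L; W \<in> \<Gamma> L; set Vs \<subseteq> \<Gamma> L\<rbrakk> \<Longrightarrow> \<alpha> ((V + W) # Vs) = \<alpha> (V # Vs) + \<alpha> (W # Vs)"
    "\<And>f V Vs. \<lbrakk>f \<in> C; V \<in> \<Gamma> L; set Vs \<subseteq> \<Gamma> L\<rbrakk> \<Longrightarrow> \<alpha> ((f \<odot> V) # Vs) = f * \<alpha> (V # Vs)"
  shows "list_form \<alpha>"
  unfolding list_form_def using assms by blast

lemma list_formD:
  assumes "list_form \<alpha>"
  shows list_form_smooth: "set Vs \<subseteq> \<Gamma> L \<Longrightarrow> \<alpha> Vs \<in> C"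
    and list_form_alt: "alternating_on (\<Gamma> L) \<alpha>"
    and list_form_add: "\<lbrakk>V \<in> \<Gamma> L; W \<in> \<Gamma> L; set Vs \<subseteq> \<Gamma> L\<rbrakk> \<Longrightarrow>
      \<alpha> ((V + W) # Vs) = \<alpha> (V # Vs) + \<alpha> (W # Vs)"
    and list_form_smul: "\<lbrakk>f \<in> C; V \<in> \<Gamma> L; set Vs \<subseteq> \<Gamma> L\<rbrakk> \<Longrightarrow> \<alpha> ((f \<odot> V) # Vs) = f * \<alpha> (V # Vs)"
  using assms unfolding list_form_def by blast+

lemma list_form_cong:
  assumes "list_form \<alpha>" and eq: "\<And>Vs. set Vs \<subseteq> \<Gamma> L \<Longrightarrow> \<alpha> Vs = \<beta> Vs"
  shows "list_form \<beta>"
proof (rule list_formI)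
  show "alternating_on (\<Gamma> L) \<beta>"
    unfolding alternating_on_def
  proof (intro allI impI)
    fix us v w ws assume "set us \<union> {v, w} \<union> set ws \<subseteq> \<Gamma> L"
    then show "\<beta> (us @ w # v # ws) = - \<beta> (us @ v # w # ws)"
      using alternating_onD[OF list_form_alt[OF assms(1)], of us v w ws]
      by (simp flip: eq)
  qed
next
  fix Vs assume "set Vs \<subseteq> \<Gamma> L"
  then show "\<beta> Vs \<in> C" using list_form_smooth[OF assms(1)] by (simp flip: eq)
next
  fix V W Vs assume "V \<in> \<Gamma> L" "W \<in> \<Gamma> L" "set Vs \<subseteq> \<Gamma> L"
  then show "\<beta> ((V + W) # Vs) = \<beta> (V # Vs) + \<beta> (W # Vs)"
    using list_form_add[OF assms(1), of V W Vs] sec_add[of V W] by (simp flip: eq)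
next
  fix f V Vs assume "f \<in> C" "V \<in> \<Gamma> L" "set Vs \<subseteq> \<Gamma> L"
  then show "\<beta> ((f \<odot> V) # Vs) = f * \<beta> (V # Vs)"
    using list_form_smul[OF assms(1), of f V Vs] sec_smul[of f V] by (simp flip: eq)
qed

lemma list_form_swap:
  "\<lbrakk>list_form \<alpha>; V \<in> \<Gamma> L; W \<in> \<Gamma> L; set Vs \<subseteq> \<Gamma> L\<rbrakk> \<Longrightarrow> \<alpha> (W # V # Vs) = - \<alpha> (V # W # Vs)"
  using alternating_onD[OF list_form_alt, of \<alpha> "[]" V W Vs] by simp

lemma list_form_uminus_left:
  assumes "list_form \<alpha>" "V \<in> \<Gamma> L" "set Vs \<subseteq> \<Gamma> L"
  shows "\<alpha> ((- V) # Vs) = - \<alpha> (V # Vs)"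
proof -
  have "(\<lambda>_. -1) \<odot> V = - V" by (auto simp: fun_eq_iff)
  with list_form_smul[OF assms(1) smooth_fun_const assms(2,3), of "-1"]
  have "\<alpha> ((- V) # Vs) = (\<lambda>_. -1) * \<alpha> (V # Vs)" by (simp only:)
  then show ?thesis by (simp add: fun_eq_iff)
qed

lemma list_form_diff_left:
  assumes "list_form \<alpha>" "V \<in> \<Gamma> L" "W \<in> \<Gamma> L" "set Vs \<subseteq> \<Gamma> L"
  shows "\<alpha> ((V - W) # Vs) = \<alpha> (V # Vs) - \<alpha> (W # Vs)"
  unfolding diff_conv_add_uminus[of V W]
  using list_form_add[OF assms(1,2) sec_uminus[OF assms(3)] assms(4)]
    list_form_uminus_left[OF assms(1,3,4)] by simp

abbreviation (input) insert_sec ::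
  "('m \<Rightarrow> 'v) \<Rightarrow> (('m \<Rightarrow> 'v) list \<Rightarrow> 'm \<Rightarrow> real) \<Rightarrow> ('m \<Rightarrow> 'v) list \<Rightarrow> 'm \<Rightarrow> real"
  where "insert_sec V \<alpha> \<equiv> \<lambda>Vs. \<alpha> (V # Vs)"

text \<open>\<open>list_form\<close> postulates linearity in the first argument only; the second
  argument is brought to the front by alternation, with the same sign on both sides. The inductions
  on the list of arguments rest on this.\<close>

lemma list_form_insert:
  assumes \<alpha>: "list_form \<alpha>" and U: "U \<in> \<Gamma> L"
  shows "list_form (insert_sec U \<alpha>)"
proof (rule list_formI)
  show "alternating_on (\<Gamma> L) (insert_sec U \<alpha>)"
    using alternating_on_Cons[OF list_form_alt[OF \<alpha>] U] .
next
  fix Vs assume "set Vs \<subseteq> \<Gamma> L"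
  then show "\<alpha> (U # Vs) \<in> C" using U by (intro list_form_smooth[OF \<alpha>]) auto
next
  fix V W Vs assume "V \<in> \<Gamma> L" "W \<in> \<Gamma> L" "set Vs \<subseteq> \<Gamma> L"
  then show "\<alpha> (U # (V + W) # Vs) = \<alpha> (U # V # Vs) + \<alpha> (U # W # Vs)"
    using list_form_swap[OF \<alpha>, of _ U Vs] U
    by (simp add: sec_add list_form_add[OF \<alpha>, of V W "U # Vs"])
next
  fix f V Vs assume "f \<in> C" "V \<in> \<Gamma> L" "set Vs \<subseteq> \<Gamma> L"
  then show "\<alpha> (U # (f \<odot> V) # Vs) = f * \<alpha> (U # V # Vs)"
    using list_form_swap[OF \<alpha>, of _ U Vs] U
    by (simp add: sec_smul list_form_smul[OF \<alpha>, of f V "U # Vs"])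
qed

lemma list_form_plus:
  assumes "list_form \<alpha>" "list_form \<beta>"
  shows "list_form (\<lambda>Vs. \<alpha> Vs + \<beta> Vs)"
proof (rule list_formI)
  show "alternating_on (\<Gamma> L) (\<lambda>Vs. \<alpha> Vs + \<beta> Vs)"
    unfolding alternating_on_def
  proof (intro allI impI)
    fix us v w ws assume "set us \<union> {v, w} \<union> set ws \<subseteq> \<Gamma> L"
    then show "\<alpha> (us @ w # v # ws) + \<beta> (us @ w # v # ws) =
        - (\<alpha> (us @ v # w # ws) + \<beta> (us @ v # w # ws))"
      using alternating_onD[OF list_form_alt[OF assms(1)], of us v w ws]
        alternating_onD[OF list_form_alt[OF assms(2)], of us v w ws] by simp
  qed
qed (use assms in \<open>simp_all only: list_form_smooth smooth_fun_add list_form_add list_form_smul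
    algebra_simps\<close>)

lemma list_form_times:
  assumes "f \<in> C" "list_form \<alpha>"
  shows "list_form (\<lambda>Vs. f * \<alpha> Vs)"
proof (rule list_formI)
  show "alternating_on (\<Gamma> L) (\<lambda>Vs. f * \<alpha> Vs)"
    unfolding alternating_on_def
  proof (intro allI impI)
    fix us v w ws assume "set us \<union> {v, w} \<union> set ws \<subseteq> \<Gamma> L"
    then show "f * \<alpha> (us @ w # v # ws) = - (f * \<alpha> (us @ v # w # ws))"
      using alternating_onD[OF list_form_alt[OF assms(2)], of us v w ws] by simp
  qed
qed (use assms in \<open>simp_all only: list_form_smooth smooth_fun_mult list_form_add list_form_smul
    algebra_simps\<close>)

lemma list_form_uminus: "list_form \<alpha> \<Longrightarrow> list_form (\<lambda>Vs. - \<alpha> Vs)"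
  using list_form_times[OF smooth_fun_uminus[OF smooth_fun_1]] by simp

section \<open>Lie derivative and differential of list forms\<close>

fun lie_sum :: "('m \<Rightarrow> 'v) \<Rightarrow> (('m \<Rightarrow> 'v) list \<Rightarrow> 'm \<Rightarrow> real) \<Rightarrow> ('m \<Rightarrow> 'v) list \<Rightarrow> 'm \<Rightarrow> real" where
  "lie_sum V \<alpha> [] = 0"
| "lie_sum V \<alpha> (W # Ws) = \<alpha> (brk L V W # Ws) + lie_sum V (insert_sec W \<alpha>) Ws"

definition lie_op :: "('m \<Rightarrow> 'v) \<Rightarrow> (('m \<Rightarrow> 'v) list \<Rightarrow> 'm \<Rightarrow> real) \<Rightarrow> ('m \<Rightarrow> 'v) list \<Rightarrow> 'm \<Rightarrow> real"
  where "lie_op V \<alpha> Vs = D V (\<alpha> Vs) - lie_sum V \<alpha> Vs"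

fun d_op :: "(('m \<Rightarrow> 'v) list \<Rightarrow> 'm \<Rightarrow> real) \<Rightarrow> ('m \<Rightarrow> 'v) list \<Rightarrow> 'm \<Rightarrow> real" where
  "d_op \<alpha> [] = 0"
| "d_op \<alpha> (V # Vs) = lie_op V \<alpha> Vs - d_op (insert_sec V \<alpha>) Vs"

lemma lie_sum_cong:
  assumes "\<And>Vs. set Vs \<subseteq> \<Gamma> L \<Longrightarrow> \<alpha> Vs = \<beta> Vs" "V \<in> \<Gamma> L"
  shows "set Vs \<subseteq> \<Gamma> L \<Longrightarrow> lie_sum V \<alpha> Vs = lie_sum V \<beta> Vs"
  using assms(1)
proof (induction Vs arbitrary: \<alpha> \<beta>)
  case (Cons W Vs)
  have "lie_sum V (insert_sec W \<alpha>) Vs = lie_sum V (insert_sec W \<beta>) Vs"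
    using Cons.prems by (intro Cons.IH) auto
  moreover have "\<alpha> (brk L V W # Vs) = \<beta> (brk L V W # Vs)"
    using Cons.prems assms(2) brk_closed by (intro Cons.prems) auto
  ultimately show ?case by simp
qed simp

lemma lie_op_cong:
  "\<lbrakk>\<And>Vs. set Vs \<subseteq> \<Gamma> L \<Longrightarrow> \<alpha> Vs = \<beta> Vs; V \<in> \<Gamma> L; set Vs \<subseteq> \<Gamma> L\<rbrakk> \<Longrightarrow> lie_op V \<alpha> Vs = lie_op V \<beta> Vs"
  using lie_sum_cong[of \<alpha> \<beta> V Vs] by (simp add: lie_op_def)

lemma d_op_cong:
  "\<lbrakk>\<And>Vs. set Vs \<subseteq> \<Gamma> L \<Longrightarrow> \<alpha> Vs = \<beta> Vs; set Vs \<subseteq> \<Gamma> L\<rbrakk> \<Longrightarrow> d_op \<alpha> Vs = d_op \<beta> Vs"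
proof (induction Vs arbitrary: \<alpha> \<beta>)
  case (Cons W Vs)
  have "d_op (insert_sec W \<alpha>) Vs = d_op (insert_sec W \<beta>) Vs"
    using Cons.prems by (intro Cons.IH) auto
  moreover have "lie_op W \<alpha> Vs = lie_op W \<beta> Vs"
    using Cons.prems by (intro lie_op_cong) auto
  ultimately show ?case by simp
qed simp

lemma lie_op_Cons: "lie_op V \<alpha> (W # Vs) = lie_op V (insert_sec W \<alpha>) Vs - \<alpha> (brk L V W # Vs)"
  by (simp add: lie_op_def algebra_simps)

lemma lie_sum_add: "lie_sum V (\<lambda>Vs. \<alpha> Vs + \<beta> Vs) Vs = lie_sum V \<alpha> Vs + lie_sum V \<beta> Vs"
  by (induction Vs arbitrary: \<alpha> \<beta>) (simp_all add: algebra_simps)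

lemma lie_sum_times: "lie_sum V (\<lambda>Vs. f * \<alpha> Vs) Vs = f * lie_sum V \<alpha> Vs"
  by (induction Vs arbitrary: \<alpha>) (simp_all add: algebra_simps)

lemma lie_op_add:
  "\<lbrakk>V \<in> \<Gamma> L; \<alpha> Vs \<in> C; \<beta> Vs \<in> C\<rbrakk> \<Longrightarrow> lie_op V (\<lambda>Vs. \<alpha> Vs + \<beta> Vs) Vs = lie_op V \<alpha> Vs + lie_op V \<beta> Vs"
  by (simp only: lie_op_def D_add lie_sum_add) (simp add: algebra_simps)

lemma lie_op_times:
  "\<lbrakk>V \<in> \<Gamma> L; f \<in> C; \<alpha> Vs \<in> C\<rbrakk> \<Longrightarrow>
    lie_op V (\<lambda>Vs. f * \<alpha> Vs) Vs = f * lie_op V \<alpha> Vs + D V f * \<alpha> Vs"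
  by (simp only: lie_op_def D_mult lie_sum_times) (simp add: algebra_simps)

lemma lie_op_uminus:
  "\<lbrakk>V \<in> \<Gamma> L; \<alpha> Vs \<in> C\<rbrakk> \<Longrightarrow> lie_op V (\<lambda>Vs. - \<alpha> Vs) Vs = - lie_op V \<alpha> Vs"
  using lie_sum_times[of V "-1" \<alpha> Vs] by (simp add: lie_op_def D_uminus del: mem_Collect_eq)

lemma lie_op_diff:
  assumes "V \<in> \<Gamma> L" "\<alpha> Vs \<in> C" "\<beta> Vs \<in> C"
  shows "lie_op V (\<lambda>Vs. \<alpha> Vs - \<beta> Vs) Vs = lie_op V \<alpha> Vs - lie_op V \<beta> Vs"
  using lie_op_add[of V \<alpha> Vs "\<lambda>Vs. - \<beta> Vs"] assms lie_op_uminus[of V \<beta> Vs]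
      smooth_fun_uminus[OF assms(3)]
  by (simp del: mem_Collect_eq)

lemma lie_op_smooth:
  assumes "list_form \<alpha>" "V \<in> \<Gamma> L" "set Vs \<subseteq> \<Gamma> L"
  shows "lie_op V \<alpha> Vs \<in> C"
proof -
  have "lie_sum V \<alpha> Vs \<in> C"
    using assms
  proof (induction Vs arbitrary: \<alpha>)
    case Nil
    show ?case using smooth_fun_0 by simp
  next
    case (Cons W Vs)
    have "lie_sum V (insert_sec W \<alpha>) Vs \<in> C"
      using Cons.prems by (intro Cons.IH list_form_insert) auto
    moreover have "\<alpha> (brk L V W # Vs) \<in> C"
      using Cons.prems brk_closed by (intro list_form_smooth[OF Cons.prems(1)]) auto
    ultimately show ?case unfolding lie_sum.simps by (rule smooth_fun_add[rotated])
  qed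
  then show ?thesis unfolding lie_op_def
    using D_smooth[OF assms(2) list_form_smooth[OF assms(1,3)]] by (intro smooth_fun_diff)
qed

text \<open>The Lie derivative is linear over functions although neither of its two summands is: the
  Leibniz rule for functions and the one for the bracket produce the same term with the derivative
  of \<open>f\<close>, and these cancel.\<close>

lemma list_form_lie_op:
  assumes \<alpha>: "list_form \<alpha>" and V: "V \<in> \<Gamma> L"
  shows "list_form (lie_op V \<alpha>)"
proof (rule list_formI)
  show "lie_op V \<alpha> Vs \<in> C" if "set Vs \<subseteq> \<Gamma> L" for Vs
    using lie_op_smooth[OF \<alpha> V that] .
  \<comment> \<open>Stated for every list form, since the induction replaces \<alpha> by its
    insertions.\<close>
  have swap: "lie_op V \<alpha> (us @ w # v # ws) = - lie_op V \<alpha> (us @ v # w # ws)"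
    if "list_form \<alpha>" "set us \<subseteq> \<Gamma> L" "v \<in> \<Gamma> L" "w \<in> \<Gamma> L" "set ws \<subseteq> \<Gamma> L" for us v w ws \<alpha>
    using that
  proof (induction us arbitrary: \<alpha>)
    case Nil
    have "lie_op V (insert_sec v (insert_sec w \<alpha>)) ws =
        lie_op V (\<lambda>Vs. - insert_sec w (insert_sec v \<alpha>) Vs) ws"
      using Nil V by (intro lie_op_cong) (auto simp: list_form_swap[of \<alpha> v w])
    also have "\<dots> = - lie_op V (insert_sec w (insert_sec v \<alpha>)) ws"
      using Nil V by (intro lie_op_uminus list_form_smooth[of \<alpha>]) auto
    finally show ?case
      using Nil V list_form_swap[of \<alpha> "brk L V v" w ws] list_form_swap[of \<alpha> "brk L V w" v ws]
          brk_closed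
      by (simp add: lie_op_Cons fun_eq_iff)
  next
    case (Cons u us)
    have "lie_op V (insert_sec u \<alpha>) (us @ w # v # ws) =
        - lie_op V (insert_sec u \<alpha>) (us @ v # w # ws)"
      using Cons.prems by (intro Cons.IH list_form_insert) auto
    moreover have "\<alpha> ((brk L V u # us) @ w # v # ws) = - \<alpha> ((brk L V u # us) @ v # w # ws)"
      using Cons.prems V brk_closed by (intro alternating_onD[OF list_form_alt]) auto
    ultimately show ?case by (simp add: lie_op_Cons)
  qed
  show "alternating_on (\<Gamma> L) (lie_op V \<alpha>)"
    unfolding alternating_on_def by (intro allI impI swap[OF \<alpha>]) auto
next
  fix X Y Vs assume *: "X \<in> \<Gamma> L" "Y \<in> \<Gamma> L" "set Vs \<subseteq> \<Gamma> L"
  have "lie_op V (insert_sec (X + Y) \<alpha>) Vs =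
      lie_op V (\<lambda>Vs. insert_sec X \<alpha> Vs + insert_sec Y \<alpha> Vs) Vs"
    using * V by (intro lie_op_cong) (auto simp: list_form_add[OF \<alpha>])
  also have "\<dots> = lie_op V (insert_sec X \<alpha>) Vs + lie_op V (insert_sec Y \<alpha>) Vs"
    using * V by (intro lie_op_add list_form_smooth[OF \<alpha>]) auto
  finally show "lie_op V \<alpha> ((X + Y) # Vs) = lie_op V \<alpha> (X # Vs) + lie_op V \<alpha> (Y # Vs)"
    using * V brk_closed by (simp add: lie_op_Cons brk_add_right list_form_add[OF \<alpha>])
next
  fix f X Vs assume *: "f \<in> C" "X \<in> \<Gamma> L" "set Vs \<subseteq> \<Gamma> L"
  have "lie_op V (insert_sec (f \<odot> X) \<alpha>) Vs = lie_op V (\<lambda>Vs. f * insert_sec X \<alpha> Vs) Vs"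
    using * V by (intro lie_op_cong) (auto simp: list_form_smul[OF \<alpha>])
  also have "\<dots> = f * lie_op V (insert_sec X \<alpha>) Vs + D V f * \<alpha> (X # Vs)"
    using * V by (intro lie_op_times list_form_smooth[OF \<alpha>]) auto
  finally have 1: "lie_op V (insert_sec (f \<odot> X) \<alpha>) Vs =
    f * lie_op V (insert_sec X \<alpha>) Vs + D V f * \<alpha> (X # Vs)" .
  have "\<alpha> (brk L V (f \<odot> X) # Vs) = f * \<alpha> (brk L V X # Vs) + D V f * \<alpha> (X # Vs)"
    unfolding brk_smul_right[OF V *(2,1)]
    using * V brk_closed[of V X] D_smooth[OF V *(1)]
    by (simp only: list_form_add[OF \<alpha>] list_form_smul[OF \<alpha>] sec_smul)
  with 1 show "lie_op V \<alpha> ((f \<odot> X) # Vs) = f * lie_op V \<alpha> (X # Vs)"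
    unfolding lie_op_Cons by (simp add: algebra_simps)
qed

lemma lie_op_add_left:
  assumes "list_form \<alpha>" "V \<in> \<Gamma> L" "W \<in> \<Gamma> L" "set Vs \<subseteq> \<Gamma> L"
  shows "lie_op (V + W) \<alpha> Vs = lie_op V \<alpha> Vs + lie_op W \<alpha> Vs"
proof -
  have "lie_sum (V + W) \<alpha> Vs = lie_sum V \<alpha> Vs + lie_sum W \<alpha> Vs"
    using assms
  proof (induction Vs arbitrary: \<alpha>)
    case (Cons U Vs)
    have "lie_sum (V + W) (insert_sec U \<alpha>) Vs =
        lie_sum V (insert_sec U \<alpha>) Vs + lie_sum W (insert_sec U \<alpha>) Vs"
      using Cons.prems by (intro Cons.IH list_form_insert) auto
    moreover have "\<alpha> (brk L (V + W) U # Vs) = \<alpha> (brk L V U # Vs) + \<alpha> (brk L W U # Vs)"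
      using Cons.prems by (simp add: brk_add_left brk_closed list_form_add[OF Cons.prems(1)])
    ultimately show "lie_sum (V + W) \<alpha> (U # Vs) = lie_sum V \<alpha> (U # Vs) + lie_sum W \<alpha> (U # Vs)"
      by (simp add: algebra_simps)
  qed simp
  then show ?thesis using assms by (simp add: lie_op_def D_add_left algebra_simps)
qed

text \<open>Each bracket of \<open>f \<odot> V\<close> with an argument \<open>W\<close> contributes
  \<open>V\<close> times the negative of \<open>D W f\<close>; collected over all arguments these
  terms form an exterior product with df. This defect is compensated in
  \<open>list_form_d_op\<close>.\<close>

lemma lie_op_smul_left:
  assumes "list_form \<alpha>" "f \<in> C" "V \<in> \<Gamma> L" "set Vs \<subseteq> \<Gamma> L"
  shows "lie_op (f \<odot> V) \<alpha> Vs = f * lie_op V \<alpha> Vs + ext_wedge (\<lambda>W. D W f) (insert_sec V \<alpha>) Vs"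
proof -
  have "lie_sum (f \<odot> V) \<alpha> Vs = f * lie_sum V \<alpha> Vs - ext_wedge (\<lambda>W. D W f) (insert_sec V \<alpha>) Vs"
    using assms
  proof (induction Vs arbitrary: \<alpha>)
    case (Cons W Vs)
    have "lie_sum (f \<odot> V) (insert_sec W \<alpha>) Vs =
        f * lie_sum V (insert_sec W \<alpha>) Vs - ext_wedge (\<lambda>W. D W f) (insert_sec V (insert_sec W \<alpha>))
          Vs"
      using Cons.prems by (intro Cons.IH list_form_insert) auto
    moreover have "ext_wedge (\<lambda>W. D W f) (insert_sec V (insert_sec W \<alpha>)) Vs =
        ext_wedge (\<lambda>W. D W f) (\<lambda>Vs. - insert_sec W (insert_sec V \<alpha>) Vs) Vs"
      using Cons.prems by (intro ext_wedge_cong list_form_swap) auto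
    moreover have "\<alpha> (brk L (f \<odot> V) W # Vs) = f * \<alpha> (brk L V W # Vs) - D W f * \<alpha> (V # Vs)"
    proof -
      have "D W f \<in> C" using Cons.prems by (intro D_smooth) auto
      then show ?thesis
        using Cons.prems brk_closed[of V W]
        by (simp only: brk_smul_left list_form_diff_left[OF Cons.prems(1)]
            list_form_smul[OF Cons.prems(1)]
            sec_smul list.set insert_subset)
    qed
    ultimately show "lie_sum (f \<odot> V) \<alpha> (W # Vs) =
        f * lie_sum V \<alpha> (W # Vs) - ext_wedge (\<lambda>W. D W f) (insert_sec V \<alpha>) (W # Vs)"
      by (simp add: ext_wedge_uminus algebra_simps)
  qed simp
  then show ?thesis using assms by (simp add: lie_op_def D_smul_left algebra_simps)
qed

lemma d_op_add:
  "\<lbrakk>list_form \<alpha>; list_form \<beta>; set Vs \<subseteq> \<Gamma> L\<rbrakk> \<Longrightarrow> d_op (\<lambda>Vs. \<alpha> Vs + \<beta> Vs) Vs = d_op \<alpha> Vs + d_op \<beta> Vs"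
proof (induction Vs arbitrary: \<alpha> \<beta>)
  case (Cons V Vs)
  have "d_op (\<lambda>Vs. insert_sec V \<alpha> Vs + insert_sec V \<beta> Vs) Vs =
      d_op (insert_sec V \<alpha>) Vs + d_op (insert_sec V \<beta>) Vs"
    using Cons.prems by (intro Cons.IH list_form_insert) auto
  moreover have "lie_op V (\<lambda>Vs. \<alpha> Vs + \<beta> Vs) Vs = lie_op V \<alpha> Vs + lie_op V \<beta> Vs"
    using Cons.prems by (intro lie_op_add list_form_smooth) auto
  ultimately show "d_op (\<lambda>Vs. \<alpha> Vs + \<beta> Vs) (V # Vs) = d_op \<alpha> (V # Vs) + d_op \<beta> (V # Vs)"
    by (simp add: algebra_simps)
qed simp

lemma d_op_times:
  "\<lbrakk>f \<in> C; list_form \<alpha>; set Vs \<subseteq> \<Gamma> L\<rbrakk> \<Longrightarrow>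
    d_op (\<lambda>Vs. f * \<alpha> Vs) Vs = f * d_op \<alpha> Vs + ext_wedge (\<lambda>W. D W f) \<alpha> Vs"
proof (induction Vs arbitrary: \<alpha>)
  case (Cons V Vs)
  have "d_op (\<lambda>Vs. f * insert_sec V \<alpha> Vs) Vs =
      f * d_op (insert_sec V \<alpha>) Vs + ext_wedge (\<lambda>W. D W f) (insert_sec V \<alpha>) Vs"
    using Cons.prems by (intro Cons.IH list_form_insert) auto
  moreover have "lie_op V (\<lambda>Vs. f * \<alpha> Vs) Vs = f * lie_op V \<alpha> Vs + D V f * \<alpha> Vs"
    using Cons.prems by (intro lie_op_times list_form_smooth[of \<alpha>]) auto
  ultimately show "d_op (\<lambda>Vs. f * \<alpha> Vs) (V # Vs) =
      f * d_op \<alpha> (V # Vs) + ext_wedge (\<lambda>W. D W f) \<alpha> (V # Vs)"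
    by (simp add: algebra_simps)
qed simp

lemma d_op_const_times:
  assumes "list_form \<alpha>" "set Vs \<subseteq> \<Gamma> L"
  shows "d_op (\<lambda>Vs. (\<lambda>_. c) * \<alpha> Vs) Vs = (\<lambda>_. c) * d_op \<alpha> Vs"
proof -
  have "ext_wedge (\<lambda>W. D W (\<lambda>_. c)) \<alpha> Vs = 0"
    using assms by (intro ext_wedge_annihilated) (auto simp: D_const subset_iff)
  then show ?thesis using d_op_times[of "\<lambda>_. c" \<alpha> Vs] smooth_fun_const assms by simp
qed

lemma d_op_uminus: "\<lbrakk>list_form \<alpha>; set Vs \<subseteq> \<Gamma> L\<rbrakk> \<Longrightarrow> d_op (\<lambda>Vs. - \<alpha> Vs) Vs = - d_op \<alpha> Vs"
proof (induction Vs arbitrary: \<alpha>)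
  case (Cons V Vs)
  have "d_op (\<lambda>Vs. - insert_sec V \<alpha> Vs) Vs = - d_op (insert_sec V \<alpha>) Vs"
    using Cons.prems by (intro Cons.IH list_form_insert) auto
  moreover have "lie_op V (\<lambda>Vs. - \<alpha> Vs) Vs = - lie_op V \<alpha> Vs"
    using Cons.prems by (intro lie_op_uminus list_form_smooth[of \<alpha>]) auto
  ultimately show "d_op (\<lambda>Vs. - \<alpha> Vs) (V # Vs) = - d_op \<alpha> (V # Vs)" by (simp add: algebra_simps)
qed simp

lemma d_op_diff:
  assumes "list_form \<alpha>" "list_form \<beta>" "set Vs \<subseteq> \<Gamma> L"
  shows "d_op (\<lambda>Vs. \<alpha> Vs - \<beta> Vs) Vs = d_op \<alpha> Vs - d_op \<beta> Vs"
  using d_op_add[of \<alpha> "\<lambda>Vs. - \<beta> Vs" Vs] d_op_uminus[of \<beta> Vs] assms list_form_uminus[of \<beta>] by simp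

text \<open>For linearity over functions, the term df \<and> i(V)\<alpha> occurs once in the Lie
  derivative along \<open>f \<odot> V\<close> and once in the differential of f i(V)\<alpha>, and
  the two cancel. Alternation in the first two arguments comes from the skew symmetry of the
  bracket.\<close>

lemma list_form_d_op:
  assumes \<alpha>: "list_form \<alpha>"
  shows "list_form (d_op \<alpha>)"
proof (rule list_formI)
  show "d_op \<alpha> Vs \<in> C" if "set Vs \<subseteq> \<Gamma> L" for Vs
    using \<alpha> that
  proof (induction Vs arbitrary: \<alpha>)
    case Nil
    show ?case using smooth_fun_0 by simp
  next
    case (Cons V Vs)
    have "d_op (insert_sec V \<alpha>) Vs \<in> C"
      using Cons.prems by (intro Cons.IH list_form_insert) auto
    moreover have "lie_op V \<alpha> Vs \<in> C" using Cons.prems by (intro lie_op_smooth) auto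
    ultimately show ?case unfolding d_op.simps by (rule smooth_fun_diff[rotated])
  qed
  have swap: "d_op \<alpha> (us @ w # v # ws) = - d_op \<alpha> (us @ v # w # ws)"
    if "list_form \<alpha>" "set us \<subseteq> \<Gamma> L" "v \<in> \<Gamma> L" "w \<in> \<Gamma> L" "set ws \<subseteq> \<Gamma> L" for us v w ws \<alpha>
    using that
  proof (induction us arbitrary: \<alpha>)
    case Nil
    have "d_op (insert_sec v (insert_sec w \<alpha>)) ws =
        d_op (\<lambda>Vs. - insert_sec w (insert_sec v \<alpha>) Vs) ws"
      using Nil by (intro d_op_cong) (auto simp: list_form_swap[of \<alpha> v w])
    also have "\<dots> = - d_op (insert_sec w (insert_sec v \<alpha>)) ws"
      using Nil by (intro d_op_uminus list_form_insert) auto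
    finally have 1: "d_op (insert_sec v (insert_sec w \<alpha>)) ws =
        - d_op (insert_sec w (insert_sec v \<alpha>)) ws" .
    have "\<alpha> (brk L w v # ws) = - \<alpha> (brk L v w # ws)"
      using Nil brk_skew[of w v] brk_closed[of v w] list_form_uminus_left[of \<alpha> "brk L v w" ws]
      by simp
    with 1 show ?case by (simp add: lie_op_Cons algebra_simps)
  next
    case (Cons u us)
    have "d_op (insert_sec u \<alpha>) (us @ w # v # ws) = - d_op (insert_sec u \<alpha>) (us @ v # w # ws)"
      using Cons.prems by (intro Cons.IH list_form_insert) auto
    moreover have "lie_op u \<alpha> (us @ w # v # ws) = - lie_op u \<alpha> (us @ v # w # ws)"
      using Cons.prems by (intro alternating_onD[OF list_form_alt[OF list_form_lie_op]]) auto
    ultimately show ?case by simp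
  qed
  show "alternating_on (\<Gamma> L) (d_op \<alpha>)"
    unfolding alternating_on_def by (intro allI impI swap[OF \<alpha>]) auto
next
  fix V W Vs assume *: "V \<in> \<Gamma> L" "W \<in> \<Gamma> L" "set Vs \<subseteq> \<Gamma> L"
  have "d_op (insert_sec (V + W) \<alpha>) Vs = d_op (\<lambda>Vs. insert_sec V \<alpha> Vs + insert_sec W \<alpha> Vs) Vs"
    using * by (intro d_op_cong list_form_add[OF \<alpha>]) auto
  also have "\<dots> = d_op (insert_sec V \<alpha>) Vs + d_op (insert_sec W \<alpha>) Vs"
    using * \<alpha> by (intro d_op_add list_form_insert) auto
  finally show "d_op \<alpha> ((V + W) # Vs) = d_op \<alpha> (V # Vs) + d_op \<alpha> (W # Vs)"
    using lie_op_add_left[OF \<alpha> *] by (simp add: algebra_simps)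
next
  fix f V Vs assume *: "f \<in> C" "V \<in> \<Gamma> L" "set Vs \<subseteq> \<Gamma> L"
  have "d_op (insert_sec (f \<odot> V) \<alpha>) Vs = d_op (\<lambda>Vs. f * insert_sec V \<alpha> Vs) Vs"
    using * by (intro d_op_cong list_form_smul[OF \<alpha>]) auto
  also have "\<dots> = f * d_op (insert_sec V \<alpha>) Vs + ext_wedge (\<lambda>W. D W f) (insert_sec V \<alpha>) Vs"
    using * \<alpha> by (intro d_op_times list_form_insert) auto
  finally show "d_op \<alpha> ((f \<odot> V) # Vs) = f * d_op \<alpha> (V # Vs)"
    using lie_op_smul_left[OF \<alpha> *] by (simp add: algebra_simps)
qed

section \<open>Commutation rules for Lie derivatives and the differential\<close>

lemma brk_uminus_right:
  assumes "V \<in> \<Gamma> L" "W \<in> \<Gamma> L"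
  shows "brk L V (- W) = - brk L V W"
proof -
  have "brk L V 0 = 0" using brk_add_right[OF assms(1) sec_zero sec_zero] by simp
  then have "brk L V W + brk L V (- W) = 0"
    using brk_add_right[OF assms sec_uminus[OF assms(2)]] by simp
  then show ?thesis by (metis add.inverse_unique)
qed

lemma brk_jacobi_left:
  assumes "V \<in> \<Gamma> L" "W \<in> \<Gamma> L" "U \<in> \<Gamma> L"
  shows "brk L (brk L V W) U = brk L V (brk L W U) - brk L W (brk L V U)"
proof -
  have 1: "brk L W (brk L U V) = - brk L W (brk L V U)"
    unfolding brk_skew[OF assms(3,1)]
    by (rule brk_uminus_right[OF assms(2) brk_closed[OF assms(1,3)]])
  have "brk L V (brk L W U) + - brk L W (brk L V U) + - brk L (brk L V W) U = 0"
    using brk_jacobi[OF assms] unfolding 1 brk_skew[OF assms(3) brk_closed[OF assms(1,2)]] .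
  then show ?thesis by (simp add: algebra_simps)
qed

text \<open>On functions this is the compatibility of the anchor with the brackets; each further
  argument adds one instance of the Jacobi identity.\<close>

lemma lie_op_commutator:
  "\<lbrakk>list_form \<alpha>; V \<in> \<Gamma> L; W \<in> \<Gamma> L; set Vs \<subseteq> \<Gamma> L\<rbrakk> \<Longrightarrow>
    lie_op (brk L V W) \<alpha> Vs = lie_op V (lie_op W \<alpha>) Vs - lie_op W (lie_op V \<alpha>) Vs"
proof (induction Vs arbitrary: \<alpha>)
  case Nil
  then show ?case by (simp add: lie_op_def D_bracket)
next
  case (Cons U Vs)
  note closed = brk_closed[of V W] brk_closed[of V U] brk_closed[of W U]
      brk_closed[of V "brk L W U"]
    brk_closed[of W "brk L V U"]
  \<comment> \<open>The two middle terms are exchanged when \<open>X\<close> and \<open>Y\<close>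
    are, so they drop out of the commutator.\<close>
  have exp: "lie_op X (lie_op Y \<alpha>) (U # Vs) = lie_op X (lie_op Y (insert_sec U \<alpha>)) Vs
      - lie_op X (insert_sec (brk L Y U) \<alpha>) Vs - lie_op Y (insert_sec (brk L X U) \<alpha>) Vs
      + \<alpha> (brk L Y (brk L X U) # Vs)" if "X \<in> \<Gamma> L" "Y \<in> \<Gamma> L" for X Y
  proof -
    have "lie_op X (insert_sec U (lie_op Y \<alpha>)) Vs =
        lie_op X (\<lambda>Xs. lie_op Y (insert_sec U \<alpha>) Xs - insert_sec (brk L Y U) \<alpha> Xs) Vs"
      by (simp add: lie_op_Cons)
    also have "\<dots> = lie_op X (lie_op Y (insert_sec U \<alpha>)) Vs - lie_op X (insert_sec (brk L Y U) \<alpha>) Vs"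
    proof (rule lie_op_diff)
      show "X \<in> \<Gamma> L" by fact
      show "lie_op Y (insert_sec U \<alpha>) Vs \<in> C"
        using that Cons.prems by (intro lie_op_smooth list_form_insert) auto
      show "\<alpha> (brk L Y U # Vs) \<in> C"
        using that Cons.prems brk_closed[of Y U] by (intro list_form_smooth[OF Cons.prems(1)]) auto
    qed
    finally have 1: "lie_op X (insert_sec U (lie_op Y \<alpha>)) Vs =
        lie_op X (lie_op Y (insert_sec U \<alpha>)) Vs - lie_op X (insert_sec (brk L Y U) \<alpha>) Vs" .
    have "lie_op X (lie_op Y \<alpha>) (U # Vs) =
        lie_op X (insert_sec U (lie_op Y \<alpha>)) Vs - lie_op Y \<alpha> (brk L X U # Vs)" by (rule lie_op_Cons)
    then show ?thesis unfolding 1 lie_op_Cons[of Y \<alpha> "brk L X U"] by simp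
  qed
  have "lie_op (brk L V W) (insert_sec U \<alpha>) Vs =
      lie_op V (lie_op W (insert_sec U \<alpha>)) Vs - lie_op W (lie_op V (insert_sec U \<alpha>)) Vs"
    using Cons.prems by (intro Cons.IH list_form_insert) auto
  moreover have "\<alpha> (brk L (brk L V W) U # Vs) =
      \<alpha> (brk L V (brk L W U) # Vs) - \<alpha> (brk L W (brk L V U) # Vs)"
    using Cons.prems closed by (simp add: brk_jacobi_left list_form_diff_left[OF Cons.prems(1)])
  ultimately show "lie_op (brk L V W) \<alpha> (U # Vs) =
      lie_op V (lie_op W \<alpha>) (U # Vs) - lie_op W (lie_op V \<alpha>) (U # Vs)"
    unfolding exp[OF Cons.prems(2,3)] exp[OF Cons.prems(3,2)] lie_op_Cons[of "brk L V W"]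
    by (simp add: algebra_simps)
qed

text \<open>Inserting \<open>W\<close> on both sides leaves the commutator of the Lie derivatives
  along \<open>V\<close> and \<open>W\<close>, which accounts for the bracket term by
  \<open>lie_op_commutator\<close>, and the same claim for the insertion of \<open>W\<close> into
  \<alpha>.\<close>

lemma lie_op_d_op:
  "\<lbrakk>list_form \<alpha>; V \<in> \<Gamma> L; set Vs \<subseteq> \<Gamma> L\<rbrakk> \<Longrightarrow> lie_op V (d_op \<alpha>) Vs = d_op (lie_op V \<alpha>) Vs"
proof (induction Vs arbitrary: \<alpha>)
  case Nil
  then show ?case by (simp add: lie_op_def D_0)
next
  case (Cons W Vs)
  note closed = brk_closed[of V W]
  have "lie_op V (insert_sec W (d_op \<alpha>)) Vs =
      lie_op V (\<lambda>Xs. lie_op W \<alpha> Xs - d_op (insert_sec W \<alpha>) Xs) Vs"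
    by simp
  also have "\<dots> = lie_op V (lie_op W \<alpha>) Vs - lie_op V (d_op (insert_sec W \<alpha>)) Vs"
    using Cons.prems by (intro lie_op_diff lie_op_smooth list_form_smooth[OF list_form_d_op]
        list_form_insert) auto
  also have "lie_op V (d_op (insert_sec W \<alpha>)) Vs = d_op (lie_op V (insert_sec W \<alpha>)) Vs"
    using Cons.prems by (intro Cons.IH list_form_insert) auto
  finally have 1: "lie_op V (insert_sec W (d_op \<alpha>)) Vs =
    lie_op V (lie_op W \<alpha>) Vs - d_op (lie_op V (insert_sec W \<alpha>)) Vs" .
  have "d_op (insert_sec W (lie_op V \<alpha>)) Vs =
      d_op (\<lambda>Xs. lie_op V (insert_sec W \<alpha>) Xs - insert_sec (brk L V W) \<alpha> Xs) Vs"
    by (simp add: lie_op_Cons)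
  also have "\<dots> = d_op (lie_op V (insert_sec W \<alpha>)) Vs - d_op (insert_sec (brk L V W) \<alpha>) Vs"
    using Cons.prems closed by (intro d_op_diff list_form_lie_op list_form_insert) auto
  finally have 2: "d_op (insert_sec W (lie_op V \<alpha>)) Vs =
    d_op (lie_op V (insert_sec W \<alpha>)) Vs - d_op (insert_sec (brk L V W) \<alpha>) Vs" .
  have "lie_op (brk L V W) \<alpha> Vs = lie_op V (lie_op W \<alpha>) Vs - lie_op W (lie_op V \<alpha>) Vs"
    using Cons.prems by (intro lie_op_commutator) auto
  then show "lie_op V (d_op \<alpha>) (W # Vs) = d_op (lie_op V \<alpha>) (W # Vs)"
    unfolding lie_op_Cons[of V "d_op \<alpha>"] 1 d_op.simps(2)[of "lie_op V \<alpha>"] 2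
    by (simp add: algebra_simps)
qed

text \<open>Applying i(V) d = L_V - d i(V) twice gives i(V) d d \<alpha> = L_V d \<alpha> - d L_V
  \<alpha> + d d i(V)\<alpha>. The first two terms cancel, and the last one is evaluated on a
  shorter list.\<close>

lemma d_op_d_op: "\<lbrakk>list_form \<alpha>; set Vs \<subseteq> \<Gamma> L\<rbrakk> \<Longrightarrow> d_op (d_op \<alpha>) Vs = 0"
proof (induction Vs arbitrary: \<alpha>)
  case (Cons V Vs)
  have "d_op (insert_sec V (d_op \<alpha>)) Vs = d_op (\<lambda>Xs. lie_op V \<alpha> Xs - d_op (insert_sec V \<alpha>) Xs) Vs"
    by simp
  also have "\<dots> = d_op (lie_op V \<alpha>) Vs - d_op (d_op (insert_sec V \<alpha>)) Vs"
    using Cons.prems by (intro d_op_diff list_form_lie_op list_form_d_op list_form_insert) auto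
  also have "d_op (d_op (insert_sec V \<alpha>)) Vs = 0"
    using Cons.prems by (intro Cons.IH list_form_insert) auto
  finally show ?case using lie_op_d_op[of \<alpha> V Vs] Cons.prems
    by (simp del: d_op.simps add: d_op.simps(2)[of "d_op \<alpha>"])
qed simp

section \<open>Agreement with the explicit sums\<close>

lemma lie_sum_list_update: "lie_sum V \<alpha> Vs = (\<Sum>i<length Vs. \<alpha> (Vs[i := brk L V (Vs ! i)]))"
  by (induction Vs arbitrary: \<alpha>) (simp_all add: sum.lessThan_Suc_shift del: sum.lessThan_Suc)

text \<open>Turns a replacement in place into an insertion at the front, the shape that occurs in
  the formula for the differential; moving the entry to the front costs the sign.\<close>

lemma lie_sum_nths:
  "\<lbrakk>list_form \<alpha>; V \<in> \<Gamma> L; set Vs \<subseteq> \<Gamma> L\<rbrakk> \<Longrightarrow>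
    lie_sum V \<alpha> Vs = (\<Sum>j<length Vs. (-1) ^ j * \<alpha> (brk L V (Vs ! j) # nths Vs (- {j})))"
proof (induction Vs arbitrary: \<alpha>)
  case (Cons W Vs)
  have "lie_sum V (insert_sec W \<alpha>) Vs =
      (\<Sum>j<length Vs. (-1) ^ j * \<alpha> (W # brk L V (Vs ! j) # nths Vs (- {j})))"
    using Cons.prems by (intro Cons.IH list_form_insert) auto
  also have "\<dots> = (\<Sum>j<length Vs. (-1) ^ Suc j * \<alpha> (brk L V (Vs ! j) # W # nths Vs (- {j})))"
  proof (rule sum.cong[OF refl])
    fix j assume "j \<in> {..<length Vs}"
    then have "Vs ! j \<in> \<Gamma> L" "set (nths Vs (- {j})) \<subseteq> \<Gamma> L"
      using Cons.prems set_nths_subset[of Vs "- {j}"] by (auto simp: subset_iff)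
    then show "(-1) ^ j * \<alpha> (W # brk L V (Vs ! j) # nths Vs (- {j})) =
        (-1) ^ Suc j * \<alpha> (brk L V (Vs ! j) # W # nths Vs (- {j}))"
      using list_form_swap[OF Cons.prems(1), of "brk L V (Vs ! j)" W "nths Vs (- {j})"]
        Cons.prems brk_closed by simp
  qed
  finally have IH: "lie_sum V (insert_sec W \<alpha>) Vs =
      (\<Sum>j<length Vs. (-1) ^ Suc j * \<alpha> (brk L V (Vs ! j) # W # nths Vs (- {j})))" .
  have "{j. Suc j \<in> - {0}} = UNIV" "{j. Suc j \<in> - {Suc i}} = - {i}" for i :: nat by auto
  then show "lie_sum V \<alpha> (W # Vs) =
      (\<Sum>j<length (W # Vs). (-1) ^ j * \<alpha> (brk L V ((W # Vs) ! j) # nths (W # Vs) (- {j})))"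
    unfolding lie_sum.simps IH length_Cons sum.lessThan_Suc_shift
    by (simp add: nths_Cons nths_all)
qed simp

text \<open>Reconciles the recursion with the sums in the definition of \<open>ext_deriv\<close>.
  After splitting off the first argument \<open>V\<close>, the terms that involve index 0 make up
  the Lie derivative along \<open>V\<close>, and the others, up to a sign, the differential of the
  insertion of \<open>V\<close>.\<close>

lemma d_op_formula:
  "\<lbrakk>list_form \<alpha>; set Vs \<subseteq> \<Gamma> L\<rbrakk> \<Longrightarrow> d_op \<alpha> Vs =
    (\<Sum>i<length Vs. (-1) ^ i * D (Vs ! i) (\<alpha> (nths Vs (- {i})))) +
    (\<Sum>j<length Vs. \<Sum>i<j. (-1) ^ (i + j) * \<alpha> (brk L (Vs ! i) (Vs ! j) # nths Vs (- {i, j})))"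
proof (induction Vs arbitrary: \<alpha>)
  case (Cons V Vs)
  let ?n = "length Vs"
  let ?A = "\<Sum>i<?n. (-1) ^ i * D (Vs ! i) (\<alpha> (V # nths Vs (- {i})))"
  let ?B = "\<Sum>j<?n. \<Sum>i<j. (-1) ^ (i + j) * \<alpha> (brk L (Vs ! i) (Vs ! j) # V # nths Vs (- {i, j}))"
  let ?S = "\<Sum>j<?n. (-1) ^ j * \<alpha> (brk L V (Vs ! j) # nths Vs (- {j}))"
  \<comment> \<open>These describe how the index sets in \<open>nths\<close> shift when an argument
    is put in front.\<close>
  have sets: "{j. j \<noteq> i} = - {i}" "{j. j \<noteq> k \<and> j \<noteq> i} = - {k, i}" "{j. Suc j \<in> - {0}} = UNIV"
      "{j. Suc j \<in> - {Suc i}} = - {i}"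
    "{j. Suc j \<in> - {0, Suc i}} = - {i}" "{j. Suc j \<in> - {Suc k, Suc i}} = - {k, i}" for i k :: nat
      by auto
  have "d_op (insert_sec V \<alpha>) Vs = ?A +
      (\<Sum>j<?n. \<Sum>i<j. (-1) ^ (i + j) * \<alpha> (V # brk L (Vs ! i) (Vs ! j) # nths Vs (- {i, j})))"
    using Cons.prems by (intro Cons.IH list_form_insert) auto
  also have "(\<Sum>j<?n. \<Sum>i<j. (-1) ^ (i + j) * \<alpha> (V # brk L (Vs ! i) (Vs ! j) # nths Vs (- {i, j}))) =
      - ?B"
    unfolding sum_negf[symmetric]
  proof (intro sum.cong[OF refl])
    fix j i assume "j \<in> {..<?n}" "i \<in> {..<j}"
    then have "Vs ! i \<in> \<Gamma> L" "Vs ! j \<in> \<Gamma> L" "set (nths Vs (- {i, j})) \<subseteq> \<Gamma> L"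
      using Cons.prems set_nths_subset[of Vs "- {i, j}"] by (auto simp: subset_iff)
    then have "\<alpha> (V # brk L (Vs ! i) (Vs ! j) # nths Vs (- {i, j})) =
        - \<alpha> (brk L (Vs ! i) (Vs ! j) # V # nths Vs (- {i, j}))"
      using Cons.prems by (intro list_form_swap brk_closed) auto
    then show "(-1) ^ (i + j) * \<alpha> (V # brk L (Vs ! i) (Vs ! j) # nths Vs (- {i, j})) =
        - ((-1) ^ (i + j) * \<alpha> (brk L (Vs ! i) (Vs ! j) # V # nths Vs (- {i, j})))" by simp
  qed
  finally have 1: "d_op (insert_sec V \<alpha>) Vs = ?A + - ?B" .
  have "lie_sum V \<alpha> Vs = ?S" using Cons.prems by (intro lie_sum_nths) auto
  then have 2: "d_op \<alpha> (V # Vs) = D V (\<alpha> Vs) - ?S - (?A + - ?B)"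
    unfolding d_op.simps 1 lie_op_def by simp
  have 3: "(\<Sum>i<length (V # Vs). (-1) ^ i * D ((V # Vs) ! i) (\<alpha> (nths (V # Vs) (- {i})))) =
      D V (\<alpha> Vs) - ?A"
    unfolding length_Cons sum.lessThan_Suc_shift
    by (simp add: nths_Cons nths_all sets sum_negf)
  \<comment> \<open>The pairs containing index 0 give \<open>- ?S\<close>, the remaining pairs
    \<open>?B\<close>.\<close>
  have 4: "(\<Sum>j<length (V # Vs). \<Sum>i<j. (-1) ^ (i + j) *
      \<alpha> (brk L ((V # Vs) ! i) ((V # Vs) ! j) # nths (V # Vs) (- {i, j}))) = - ?S + ?B"
    unfolding length_Cons sum.lessThan_Suc_shift
    by (simp add: nths_Cons nths_all sets sum_negf sum.distrib sum_subtractf)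
  show "d_op \<alpha> (V # Vs) =
    (\<Sum>i<length (V # Vs). (-1) ^ i * D ((V # Vs) ! i) (\<alpha> (nths (V # Vs) (- {i})))) +
    (\<Sum>j<length (V # Vs). \<Sum>i<j. (-1) ^ (i + j) *
      \<alpha> (brk L ((V # Vs) ! i) ((V # Vs) ! j) # nths (V # Vs) (- {i, j})))"
    unfolding 2 3 4 by (simp add: algebra_simps)
qed simp

section \<open>Locality and degree of the operators\<close>

lemma lie_op_local:
  assumes "list_form \<alpha>" "list_form \<beta>" "V \<in> \<Gamma> L" "set Vs \<subseteq> \<Gamma> L" "open N" "x \<in> N"
    and eq: "\<And>Vs y. \<lbrakk>set Vs \<subseteq> \<Gamma> L; y \<in> N\<rbrakk> \<Longrightarrow> \<alpha> Vs y = \<beta> Vs y"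
  shows "lie_op V \<alpha> Vs x = lie_op V \<beta> Vs x"
proof -
  have "lie_sum V \<alpha> Vs x = lie_sum V \<beta> Vs x"
    using assms(4) eq
  proof (induction Vs arbitrary: \<alpha> \<beta>)
    case (Cons W Vs)
    have "lie_sum V (insert_sec W \<alpha>) Vs x = lie_sum V (insert_sec W \<beta>) Vs x"
      using Cons.prems(1) by (intro Cons.IH Cons.prems(2)) auto
    moreover have "\<alpha> (brk L V W # Vs) x = \<beta> (brk L V W # Vs) x"
      using Cons.prems(1) assms(3,6) brk_closed by (intro Cons.prems(2)) auto
    ultimately show ?case by simp
  qed simp
  moreover have "D V (\<alpha> Vs) x = D V (\<beta> Vs) x"
    using assms by (intro D_local[of V _ _ N] list_form_smooth[of \<alpha>] list_form_smooth[of \<beta>]) auto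
  ultimately show ?thesis by (simp add: lie_op_def)
qed

lemma d_op_local:
  assumes "set Vs \<subseteq> \<Gamma> L" "open N" "x \<in> N" "list_form \<alpha>" "list_form \<beta>"
    and "\<And>Vs y. \<lbrakk>set Vs \<subseteq> \<Gamma> L; y \<in> N\<rbrakk> \<Longrightarrow> \<alpha> Vs y = \<beta> Vs y"
  shows "d_op \<alpha> Vs x = d_op \<beta> Vs x"
  using assms(1,4-)
proof (induction Vs arbitrary: \<alpha> \<beta>)
  case (Cons V Vs)
  have "d_op (insert_sec V \<alpha>) Vs x = d_op (insert_sec V \<beta>) Vs x"
    using Cons.prems(1-3) by (intro Cons.IH Cons.prems(4) list_form_insert) auto
  moreover have "lie_op V \<alpha> Vs x = lie_op V \<beta> Vs x"
    using Cons.prems assms(2,3) by (intro lie_op_local[of \<alpha> \<beta> V Vs N]) auto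
  ultimately show ?case by simp
qed simp

lemma lie_op_degree:
  assumes "\<And>Vs. length Vs > n \<Longrightarrow> \<alpha> Vs = 0" "V \<in> \<Gamma> L" "length Vs > n"
  shows "lie_op V \<alpha> Vs = 0"
proof -
  have "lie_sum V \<alpha> Vs = 0"
    using assms(1,3)
  proof (induction Vs arbitrary: \<alpha> n)
    case (Cons W Vs)
    have "lie_sum V (insert_sec W \<alpha>) Vs = 0"
    \<comment> \<open>The induction hypothesis at \<open>n - 1\<close> asks that the remaining list
      be longer than \<open>n - 1\<close>. For \<open>n = 0\<close> truncation turns this into the
      demand that it be nonempty; on the empty list the sum is 0 by definition.\<close>
    proof (cases Vs)
      case Vs: (Cons U Us)
      show ?thesis
        by (rule Cons.IH[of "n - 1"]) (use Cons.prems Vs in auto)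
    qed simp
    then show ?case using Cons.prems by simp
  qed simp
  then show ?thesis using assms by (simp add: lie_op_def D_0)
qed

lemma d_op_zero: "set Vs \<subseteq> \<Gamma> L \<Longrightarrow> d_op (\<lambda>_ _. 0) Vs = (\<lambda>_. 0)"
proof (induction Vs)
  case (Cons V Vs)
  have "lie_sum V (\<lambda>_ _. 0) Vs = (\<lambda>_. 0)" by (induction Vs) (auto simp: fun_eq_iff)
  with Cons show ?case by (simp add: lie_op_def D_const fun_eq_iff)
qed (simp add: fun_eq_iff)

lemma d_op_degree:
  "\<lbrakk>\<And>Vs. length Vs > n \<Longrightarrow> \<alpha> Vs = 0; set Vs \<subseteq> \<Gamma> L; length Vs > Suc n\<rbrakk> \<Longrightarrow> d_op \<alpha> Vs = 0"
proof (induction Vs arbitrary: \<alpha> n)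
  case (Cons V Vs)
  have "lie_op V \<alpha> Vs = 0" using Cons.prems by (intro lie_op_degree) auto
  moreover have "d_op (insert_sec V \<alpha>) Vs = 0"
  proof (cases n)
    case 0
    then have "d_op (insert_sec V \<alpha>) Vs = d_op (\<lambda>_ _. 0) Vs"
      using Cons.prems by (intro d_op_cong) auto
    then show ?thesis using Cons.prems by (simp add: d_op_zero zero_fun_def)
  next
    case (Suc m)
    then show ?thesis using Cons.prems by (intro Cons.IH[of m]) auto
  qed
  ultimately show ?case by simp
qed simp

end

section \<open>Forms as functions of lists of sections\<close>

lemma power_fun_apply: "(f ^ n) x = (f x :: 'a :: monoid_mult) ^ n"
  by (induction n) auto

lemma alt_forms_alternating:
  assumes "\<alpha> \<in> alt_forms V p"
  shows "alternating_on V \<alpha>"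
proof -
  have swap: "\<And>us v zs w ws. \<alpha> (us @ w # zs @ v # ws) = - \<alpha> (us @ v # zs @ w # ws)"
    using assms unfolding alt_forms_def by blast
  show ?thesis unfolding alternating_on_def
  proof (intro allI impI)
    fix us v w ws
    show "\<alpha> (us @ w # v # ws) = - \<alpha> (us @ v # w # ws)" using swap[of us w "[]" v ws] by simp
  qed
qed

lemma alt_forms_linear:
  assumes "\<alpha> \<in> alt_forms V p" "set us \<union> set ws \<union> {v, w} \<subseteq> V" "subspace V"
  shows "\<alpha> (us @ (a *\<^sub>R v + b *\<^sub>R w) # ws) = a * \<alpha> (us @ v # ws) + b * \<alpha> (us @ w # ws)"
proof (cases "length us + length ws + 1 = p")
  case True
  then show ?thesis using assms unfolding alt_forms_def by blast
next
  case False
  have zero: "\<alpha> vs = 0" if "length vs \<noteq> p" for vs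
    using assms(1) that unfolding alt_forms_def by blast
  show ?thesis using False by (simp add: zero)
qed

lemma alt_forms_sum:
  assumes "\<alpha> \<in> alt_forms V p" "subspace V" "set us \<subseteq> V" "set ws \<subseteq> V"
  shows "\<lbrakk>finite J; \<And>j. j \<in> J \<Longrightarrow> v j \<in> V\<rbrakk> \<Longrightarrow>
    \<alpha> (us @ (\<Sum>j\<in>J. c j *\<^sub>R v j) # ws) = (\<Sum>j\<in>J. c j * \<alpha> (us @ v j # ws))"
proof (induction J rule: finite_induct)
  case empty
  have "\<alpha> (us @ (0 *\<^sub>R 0 + 0 *\<^sub>R 0) # ws) = 0"
    using alt_forms_linear[OF assms(1) _ assms(2), of us ws 0 0 0 0] assms subspace_0 by auto
  then show ?case by simp
next
  case (insert j J)
  then have "(\<Sum>j\<in>J. c j *\<^sub>R v j) \<in> V" using assms(2) by (intro subspace_sum subspace_scale) auto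
  then show ?case
    using insert alt_forms_linear[OF assms(1) _ assms(2), of us ws "v j" "\<Sum>j\<in>J. c j *\<^sub>R v j" "c j"
        1] assms
    by simp
qed

context lie_algebroid
begin

abbreviation \<open>F \<equiv> fibre (bun L)\<close>

lemma sections_values: "set Vs \<subseteq> \<Gamma> L \<Longrightarrow> set (map (\<lambda>V. V x) Vs) \<subseteq> F x"
  by (auto simp: sections_fibre subset_iff)

section \<open>Tensoriality and the passage to the fibres\<close>

lemma list_form_zero_left: "\<lbrakk>list_form \<alpha>; set Vs \<subseteq> \<Gamma> L\<rbrakk> \<Longrightarrow> \<alpha> (0 # Vs) = 0"
  using list_form_add[of \<alpha> 0 0 Vs] sec_zero by simp

lemma list_form_sum_left:
  "\<lbrakk>list_form \<alpha>; set Vs \<subseteq> \<Gamma> L; \<And>i. i \<in> I \<Longrightarrow> s i \<in> \<Gamma> L\<rbrakk> \<Longrightarrow>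
    \<alpha> ((\<Sum>i\<in>I. s i) # Vs) = (\<Sum>i\<in>I. \<alpha> (s i # Vs))"
proof (induction I rule: infinite_finite_induct)
  case (insert i I)
  then have "\<alpha> ((s i + (\<Sum>i\<in>I. s i)) # Vs) = \<alpha> (s i # Vs) + \<alpha> ((\<Sum>i\<in>I. s i) # Vs)"
    by (intro list_form_add sec_sum) auto
  with insert show "\<alpha> ((\<Sum>i\<in>insert i I. s i) # Vs) = (\<Sum>i\<in>insert i I. \<alpha> (s i # Vs))"
    by (simp only: sum.insert) simp
next
  case (infinite I)
  then show "\<alpha> ((\<Sum>i\<in>I. s i) # Vs) = (\<Sum>i\<in>I. \<alpha> (s i # Vs))"
    by (simp add: list_form_zero_left[of \<alpha> Vs])
next
  case empty
  then show "\<alpha> ((\<Sum>i\<in>{}. s i) # Vs) = (\<Sum>i\<in>{}. \<alpha> (s i # Vs))"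
    by (simp add: list_form_zero_left[of \<alpha> Vs])
qed

text \<open>Near \<open>x\<close> the section is a combination of frame sections whose coefficients
  vanish at \<open>x\<close>, and linearity over functions pulls the coefficients out.\<close>

lemma list_form_tensorial:
  assumes "list_form \<alpha>" "V \<in> \<Gamma> L" "set Vs \<subseteq> \<Gamma> L" "V x = 0"
  shows "\<alpha> (V # Vs) x = 0"
proof -
  let ?K = "indices (bun L)"
  obtain W e where W: "(W, e) \<in> frames (bun L)" "x \<in> W" by (rule frame_at)
  obtain h N K where h: "h \<in> C" "open N" "x \<in> N" "closed K" "K \<subseteq> W"
    "\<And>y. y \<in> N \<Longrightarrow> h y = 1" "\<And>y. y \<notin> K \<Longrightarrow> h y = 0"
    using plateau_function[OF frame_domain[OF W(1)] W(2)] by metis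
  define g where "g i = (\<lambda>x. h x * frame_coord e i x (V x))" for i
  have g: "g i \<in> C" if "i \<in> ?K" for i
    unfolding g_def using
        smooth_fun_extend[OF h(1) frame_domain[OF W(1)] h(4,5,7)
          frame_coord_smooth[OF W(1) assms(2) that]] .
  have E: "h \<odot> e i \<in> \<Gamma> L" if "i \<in> ?K" for i
    using sec_frame_extend[OF W(1) that h(1,4,5,7)] .
  \<comment> \<open>Two cutoffs are spent: one makes the coefficient a global function, the other
    makes the frame vector a global section.\<close>
  have "(h * h) \<odot> V = (\<Sum>i\<in>?K. g i \<odot> h \<odot> e i)"
  proof
    fix y
    show "((h * h) \<odot> V) y = (\<Sum>i\<in>?K. g i \<odot> h \<odot> e i) y"
    proof (cases "y \<in> W")
      case True
      have "(h y * h y) *\<^sub>R V y = (h y * h y) *\<^sub>R (\<Sum>i\<in>?K. frame_coord e i y (V y) *\<^sub>R e i y)"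
        using frame_expansion[OF W(1) True sections_fibre[OF assms(2)]] by simp
      then show ?thesis
        by (simp add: sum_fun_apply g_def scaleR_sum_right mult_ac)
    next
      case False
      then have "h y = 0" using h by auto
      then show ?thesis by (simp add: sum_fun_apply)
    qed
  qed
  then have "\<alpha> (((h * h) \<odot> V) # Vs) = (\<Sum>i\<in>?K. \<alpha> ((g i \<odot> h \<odot> e i) # Vs))"
    using list_form_sum_left[OF assms(1,3), of ?K "\<lambda>i. g i \<odot> h \<odot> e i"] g E sec_smul by simp
  also have "\<dots> = (\<Sum>i\<in>?K. g i * \<alpha> ((h \<odot> e i) # Vs))"
  proof (rule sum.cong[OF refl])
    fix i assume "i \<in> ?K"
    then show "\<alpha> ((g i \<odot> h \<odot> e i) # Vs) = g i * \<alpha> ((h \<odot> e i) # Vs)"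
      by (intro list_form_smul[OF assms(1) g E assms(3)])
  qed
  finally have "(h * h) * \<alpha> (V # Vs) = (\<Sum>i\<in>?K. g i * \<alpha> ((h \<odot> e i) # Vs))"
    using list_form_smul[OF assms(1) smooth_fun_mult[OF h(1,1)] assms(2,3)] by simp
  then have "((h * h) * \<alpha> (V # Vs)) x = (\<Sum>i\<in>?K. g i * \<alpha> ((h \<odot> e i) # Vs)) x" by simp
  moreover have "g i x = 0" for i
    using assms(4) frame_coord_scale[OF W subspace_0[OF fibre_subspace], of i 0]
    by (simp add: g_def)
  ultimately show ?thesis using h(3,6) by (simp add: sum_fun_apply)
qed

text \<open>The arguments are exchanged one at a time; the difference of two sections with the same
  value at \<open>x\<close> vanishes there.\<close>

lemma list_form_pointwise:
  assumes "list_form \<alpha>" "set Vs \<subseteq> \<Gamma> L" "set Ws \<subseteq> \<Gamma> L" "map (\<lambda>V. V x) Vs = map (\<lambda>V. V x) Ws"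
  shows "\<alpha> Vs x = \<alpha> Ws x"
  using map_eq_imp_length_eq[OF assms(4)] assms
proof (induction Vs Ws arbitrary: \<alpha> rule: list_induct2)
  case (Cons V Vs W Ws)
  have "\<alpha> ((V - W) # Vs) x = 0"
    using Cons.prems by (intro list_form_tensorial sec_diff) auto
  then have "\<alpha> (V # Vs) x = \<alpha> (W # Vs) x"
    using list_form_diff_left[of \<alpha> V W Vs] Cons.prems by simp
  also have "\<dots> = \<alpha> (W # Ws) x"
    using Cons.prems by (intro Cons.IH list_form_insert) auto
  finally show ?case .
qed simp

text \<open>An arbitrary section through \<open>v\<close>, with no linear or smooth dependence on
  \<open>v\<close>; \<open>list_form_pointwise\<close> makes all choices equivalent.\<close>

definition lift :: "'m \<Rightarrow> 'v \<Rightarrow> 'm \<Rightarrow> 'v"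
  where "lift x v = (SOME V. V \<in> \<Gamma> L \<and> V x = v)"

lemma lift:
  assumes "v \<in> F x"
  shows lift_section: "lift x v \<in> \<Gamma> L" and lift_apply: "lift x v x = v"
proof -
  have "\<exists>V. V \<in> \<Gamma> L \<and> V x = v" using sec_through[OF assms] by blast
  from someI_ex[OF this] show "lift x v \<in> \<Gamma> L" "lift x v x = v" by (auto simp: lift_def)
qed

lemma map_lift: "set vs \<subseteq> F x \<Longrightarrow> set (map (lift x) vs) \<subseteq> \<Gamma> L \<and> map (\<lambda>V. V x) (map (lift x) vs) = vs"
  by (induction vs) (auto simp: lift)

text \<open>Inverse to \<open>eval_form\<close> on list forms. The value 0 outside the fibre is the
  normalization imposed by \<open>alt_forms\<close>, and with it forms are equal as soon as they
  agree on sections.\<close>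

definition real_form :: "(('m \<Rightarrow> 'v) list \<Rightarrow> 'm \<Rightarrow> real) \<Rightarrow> ('m, 'v) formfield"
  where "real_form \<alpha> = (\<lambda>x vs. if set vs \<subseteq> F x then \<alpha> (map (lift x) vs) x else 0)"

lemma eval_real_form:
  assumes "list_form \<alpha>" "set Vs \<subseteq> \<Gamma> L"
  shows "eval_form (real_form \<alpha>) Vs = \<alpha> Vs"
proof
  fix x
  have sub: "set (map (\<lambda>V. V x) Vs) \<subseteq> F x" using assms(2) by (auto simp: sections_fibre subset_iff)
  note ml = map_lift[OF sub]
  have "\<alpha> (map (lift x) (map (\<lambda>V. V x) Vs)) x = \<alpha> Vs x"
    by (rule list_form_pointwise[OF assms(1) conjunct1[OF ml] assms(2) conjunct2[OF ml]])
  with sub show "eval_form (real_form \<alpha>) Vs x = \<alpha> Vs x" by (simp add: eval_form_def real_form_def)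
qed

text \<open>The pointwise counterpart of list forms, with components in possibly infinitely many
  degrees; \<open>all_formfields_iff\<close> adds the bound on the degree.\<close>

definition form_field :: "('m, 'v) formfield \<Rightarrow> bool"
  where "form_field \<eta> \<longleftrightarrow> list_form (eval_form \<eta>) \<and> (\<forall>x vs. \<not> set vs \<subseteq> F x \<longrightarrow> \<eta> x vs = 0)"

lemma form_field_real_form:
  assumes "list_form \<alpha>"
  shows "form_field (real_form \<alpha>)"
  using list_form_cong[OF assms eval_real_form[OF assms, symmetric]]
  by (simp add: form_field_def real_form_def)

lemma form_field_value:
  assumes "form_field \<eta>"
  shows "\<eta> x vs = (if set vs \<subseteq> F x then eval_form \<eta> (map (lift x) vs) x else 0)"
  using assms map_lift[of vs x] by (auto simp: form_field_def eval_form_def)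

lemma form_field_eqI:
  assumes "form_field \<eta>" "form_field \<omega>" "\<And>Vs. set Vs \<subseteq> \<Gamma> L \<Longrightarrow> eval_form \<eta> Vs = eval_form \<omega> Vs"
  shows "\<eta> = \<omega>"
proof (intro ext)
  fix x vs
  show "\<eta> x vs = \<omega> x vs"
  proof (cases "set vs \<subseteq> F x")
    case True
    then have "eval_form \<eta> (map (lift x) vs) = eval_form \<omega> (map (lift x) vs)"
      using map_lift by (intro assms(3)) blast
    then show ?thesis
      unfolding form_field_value[OF assms(1), of x vs] form_field_value[OF assms(2), of x vs]
      by (simp only:)
  next
    case False
    then show ?thesis
      unfolding form_field_value[OF assms(1), of x vs] form_field_value[OF assms(2), of x vs]
      by (simp only: if_False)
  qed
qed

lemma eval_form_Cons: "eval_form \<eta> (V # Vs) x = \<eta> x (V x # map (\<lambda>V. V x) Vs)"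
  by (simp add: eval_form_def)

lemma form_field_alternating:
  assumes "form_field \<eta>"
  shows "alternating_on (F x) (\<eta> x)"
  unfolding alternating_on_def
proof (intro allI impI)
  fix us v w ws assume *: "set us \<union> {v, w} \<union> set ws \<subseteq> F x"
  have "eval_form \<eta> (map (lift x) us @ lift x w # lift x v # map (lift x) ws) =
      - eval_form \<eta> (map (lift x) us @ lift x v # lift x w # map (lift x) ws)"
    using assms * map_lift[of us x] map_lift[of ws x] unfolding form_field_def
    by (intro alternating_onD[OF list_form_alt]) (auto simp: lift_section)
  from fun_cong[OF this, of x] show "\<eta> x (us @ w # v # ws) = - \<eta> x (us @ v # w # ws)"
    using * map_lift[of us x] map_lift[of ws x] by (simp add: eval_form_def lift_apply)
qed

lemma form_field_linear:
  assumes "form_field \<eta>" "v \<in> F x" "w \<in> F x" "set ws \<subseteq> F x"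
  shows "\<eta> x ((a *\<^sub>R v + b *\<^sub>R w) # ws) = a * \<eta> x (v # ws) + b * \<eta> x (w # ws)"
proof -
  note \<alpha> = assms(1)[unfolded form_field_def, THEN conjunct1] and ml = map_lift[OF assms(4)]
  let ?a = "(\<lambda>_. a) :: 'm \<Rightarrow> real" and ?b = "(\<lambda>_. b) :: 'm \<Rightarrow> real"
  have "eval_form \<eta> ((?a \<odot> lift x v + ?b \<odot> lift x w) # map (lift x) ws) =
      ?a * eval_form \<eta> (lift x v # map (lift x) ws) + ?b * eval_form \<eta> (lift x w # map (lift x) ws)"
    using list_form_add[OF \<alpha> sec_smul[OF smooth_fun_const lift_section[OF assms(2)], of a]
        sec_smul[OF smooth_fun_const lift_section[OF assms(3)], of b] conjunct1[OF ml]]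
      list_form_smul[OF \<alpha> smooth_fun_const lift_section[OF assms(2)] conjunct1[OF ml], of a]
      list_form_smul[OF \<alpha> smooth_fun_const lift_section[OF assms(3)] conjunct1[OF ml], of b]
    by (simp only:)
  from fun_cong[OF this, of x] show ?thesis
    using conjunct2[OF ml]
    by (simp add: eval_form_def lift_apply[OF assms(2)] lift_apply[OF assms(3)])
qed

lemma form_field_linear_slot:
  assumes "form_field \<eta>" "v \<in> F x" "w \<in> F x" "set ws \<subseteq> F x" "set us \<subseteq> F x"
  shows "\<eta> x (us @ (a *\<^sub>R v + b *\<^sub>R w) # ws) = a * \<eta> x (us @ v # ws) + b * \<eta> x (us @ w # ws)"
proof -
  have move: "\<eta> x (us @ y # ws) = (-1) ^ length us * \<eta> x (y # us @ ws)" if "y \<in> F x" for y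
    using alternating_on_move[OF form_field_alternating[OF assms(1)] that assms(4), of "[]" us]
        assms(5) by simp
  have "a *\<^sub>R v + b *\<^sub>R w \<in> F x"
    using assms fibre_subspace[of x] by (intro subspace_add subspace_scale) auto
  then show ?thesis
    using assms form_field_linear[OF assms(1-3), of "us @ ws" a b] by (simp add: move algebra_simps)
qed

lemma form_field_alt_forms:
  assumes "form_field \<eta>" "\<And>x vs. length vs \<noteq> p \<Longrightarrow> \<eta> x vs = 0"
  shows "\<eta> x \<in> alt_forms (F x) p"
  unfolding alt_forms_def
proof (intro CollectI conjI allI impI)
  fix vs assume "\<not> (length vs = p \<and> set vs \<subseteq> F x)"
  then show "\<eta> x vs = 0" using assms unfolding form_field_def by blast
next
  fix us v w ws and a b :: real
  assume "length us + length ws + 1 = p \<and> set us \<union> set ws \<union> {v, w} \<subseteq> F x"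
  then show "\<eta> x (us @ (a *\<^sub>R v + b *\<^sub>R w) # ws) = a * \<eta> x (us @ v # ws) + b * \<eta> x (us @ w # ws)"
    using assms by (intro form_field_linear_slot) auto
next
  fix us v zs w ws
  show "\<eta> x (us @ w # zs @ v # ws) = - \<eta> x (us @ v # zs @ w # ws)"
  proof (cases "set us \<union> {v, w} \<union> set zs \<union> set ws \<subseteq> F x")
    case True
    then show ?thesis by (intro alternating_on_swap[OF form_field_alternating[OF assms(1)]]) auto
  next
    case False
    then have "\<not> set (us @ w # zs @ v # ws) \<subseteq> F x" "\<not> set (us @ v # zs @ w # ws) \<subseteq> F x" by auto
    then show ?thesis using assms(1) unfolding form_field_def by (metis neg_0_equal_iff_equal)
  qed
qed

text \<open>On the plateau of a cutoff the frame agrees with global sections, on which the form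
  takes smooth values.\<close>

lemma form_field_frame_smooth:
  assumes "form_field \<eta>" "(W, e) \<in> frames (bun L)" "set I \<subseteq> indices (bun L)"
  shows "smooth_on (base L) W (\<lambda>x. \<eta> x (map (\<lambda>i. e i x) I))"
proof (rule smooth_on_local[OF frame_domain[OF assms(2)]])
  fix x assume x: "x \<in> W"
  obtain h N K where h: "h \<in> C" "open N" "x \<in> N" "closed K" "K \<subseteq> W"
    "\<And>y. y \<in> N \<Longrightarrow> h y = 1" "\<And>y. y \<notin> K \<Longrightarrow> h y = 0"
    using plateau_function[OF frame_domain[OF assms(2)] x] by metis
  have "set (map (\<lambda>i. h \<odot> e i) I) \<subseteq> \<Gamma> L"
    using sec_frame_extend[OF assms(2) _ h(1,4,5,7)] assms(3) by auto
  then have "eval_form \<eta> (map (\<lambda>i. h \<odot> e i) I) \<in> C"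
    by (rule list_form_smooth[OF conjunct1[OF assms(1)[unfolded form_field_def]]])
  then have "smooth_on (base L) (W \<inter> N) (eval_form \<eta> (map (\<lambda>i. h \<odot> e i) I))"
    by (rule smooth_on_UNIV)
  then have "smooth_on (base L) (W \<inter> N) (\<lambda>x. \<eta> x (map (\<lambda>i. e i x) I))"
    using frame_domain[OF assms(2)] h(2,6)
    by (rule_tac smooth_on_cong[of "W \<inter> N" "eval_form \<eta> (map (\<lambda>i. h \<odot> e i) I)"])
      (auto simp: eval_form_def comp_def)
  then show "\<exists>N. open N \<and> x \<in> N \<and> smooth_on (base L) (W \<inter> N) (\<lambda>x. \<eta> x (map (\<lambda>i. e i x) I))"
    using h by blast
qed

lemma form_field_formfields:
  assumes "form_field \<eta>" "\<And>x vs. length vs \<noteq> p \<Longrightarrow> \<eta> x vs = 0"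
  shows "\<eta> \<in> \<Omega>\<^sup>\<bullet> L (int p)"
  using form_field_alt_forms[OF assms] form_field_frame_smooth[OF assms(1)]
  by (auto simp: formfields_def multi_indices_def)

text \<open>Smoothness is given for components with increasing frame indices and has to be
  transferred to evaluation on arbitrary global sections.\<close>

lemma formfields_form_field:
  assumes "\<eta> \<in> \<Omega>\<^sup>\<bullet> L (int p)"
  shows "form_field \<eta>"
proof -
  have alt: "\<eta> x \<in> alt_forms (F x) p" for x using assms by (simp add: formfields_def)
  have comp: "smooth_on (base L) W (\<lambda>x. \<eta> x (map (\<lambda>i. e i x) I))"
    if "(W, e) \<in> frames (bun L)" "I \<in> multi_indices (indices (bun L)) p" for W e I
    using assms that by (auto simp: formfields_def)
  \<comment> \<open>A mixed evaluation, first on frame vectors and then on sections. The induction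
    trades one section for frame vectors with smooth coefficients and thereby lengthens
    \<open>I\<close>, which is why \<open>I\<close> is arbitrary and unsorted.\<close>
  have sm: "smooth_on (base L) W (\<lambda>x. \<eta> x (map (\<lambda>i. e i x) I @ map (\<lambda>V. V x) Vs))"
    if W: "(W, e) \<in> frames (bun L)" and "set I \<subseteq> indices (bun L)" "set Vs \<subseteq> \<Gamma> L" for W e I Vs
    using that(2,3)
  proof (induction Vs arbitrary: I)
    case Nil
    let ?J = "sorted_list_of_set (set I)"
    obtain c :: real where c: "c \<noteq> 0 \<longrightarrow> distinct I" "\<forall>(f :: nat \<Rightarrow> 'v) A \<alpha>. alternating_on A \<alpha> \<longrightarrow>
        f ` set I \<subseteq> A \<longrightarrow> \<alpha> (map f I) = c * \<alpha> (map f ?J)"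
      using alternating_on_sort[of I] by (elim exE conjE)
    have eq: "c * \<eta> x (map (\<lambda>i. e i x) ?J) = \<eta> x (map (\<lambda>i. e i x) I)" if "x \<in> W" for x
    proof -
      have "(\<lambda>i. e i x) ` set I \<subseteq> F x" using frame_fibre[OF W that] Nil by auto
      from c(2)[rule_format, OF alt_forms_alternating[OF alt] this] show ?thesis by simp
    qed
    show ?case
    proof (cases "c = 0 \<or> length I \<noteq> p")
      \<comment> \<open>The component is identically 0: the constant 0 covers repeated indices, and
        a list of the wrong length is killed by the degree of the form.\<close>
      case True
      have "\<eta> x (map (\<lambda>i. e i x) I) = 0" if "x \<in> W" for x
        using True eq[OF that] alt[of x] by (auto simp: alt_forms_def)
      then show ?thesis
        by (intro smooth_on_cong[OF frame_domain[OF W] _ smooth_on_const[of _ 0]]) auto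
    next
      case False
      then have "?J \<in> multi_indices (indices (bun L)) p"
        using c(1) Nil by (auto simp: multi_indices_def distinct_card)
      from smooth_on_mult[OF smooth_on_const comp[OF W this], of c] show ?thesis
        by (rule smooth_on_cong[OF frame_domain[OF W], rotated]) (simp add: eq)
    qed
  next
    case (Cons V Vs)
    let ?K = "indices (bun L)"
    have "smooth_on (base L) W (\<lambda>x. \<Sum>i\<in>?K. frame_coord e i x (V x) *
        \<eta> x (map (\<lambda>i. e i x) (I @ [i]) @ map (\<lambda>V. V x) Vs))"
      using Cons.prems by (intro smooth_on_sum smooth_on_mult frame_coord_smooth[OF W] Cons.IH) auto
    then show ?case
    proof (rule smooth_on_cong[OF frame_domain[OF W], rotated])
      fix x assume x: "x \<in> W"
      have V: "V \<in> \<Gamma> L" using Cons.prems by simp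
      have sub: "set (map (\<lambda>V. V x) Vs) \<subseteq> F x" using Cons.prems
        by (auto simp: sections_fibre subset_iff)
      have "\<eta> x (map (\<lambda>i. e i x) I @ (\<Sum>i\<in>?K. frame_coord e i x (V x) *\<^sub>R e i x) # map (\<lambda>V. V x) Vs)
          =
          (\<Sum>i\<in>?K. frame_coord e i x (V x) * \<eta> x (map (\<lambda>i. e i x) I @ e i x # map (\<lambda>V. V x) Vs))"
        by (rule alt_forms_sum[OF alt fibre_subspace])
          (use Cons.prems frame_fibre[OF W x] finite_rank sub in auto)
      then show "(\<Sum>i\<in>?K. frame_coord e i x (V x) *
          \<eta> x (map (\<lambda>i. e i x) (I @ [i]) @ map (\<lambda>V. V x) Vs)) =
          \<eta> x (map (\<lambda>i. e i x) I @ map (\<lambda>V. V x) (V # Vs))"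
        using frame_expansion[OF W x sections_fibre[OF V]] by simp
    qed
  qed
  have "list_form (eval_form \<eta>)"
  proof (rule list_formI)
    fix Vs assume Vs: "set Vs \<subseteq> \<Gamma> L"
    have "smooth_on (base L) UNIV (eval_form \<eta> Vs)"
    proof (rule smooth_on_local)
      fix x :: 'm
      obtain W e where W: "(W, e) \<in> frames (bun L)" "x \<in> W" by (rule frame_at)
      show "\<exists>N. open N \<and> x \<in> N \<and> smooth_on (base L) (UNIV \<inter> N) (eval_form \<eta> Vs)"
        using sm[OF W(1) _ Vs, of "[]"] frame_domain[OF W(1)] W(2) by (auto simp: eval_form_def)
    qed simp
    then show "eval_form \<eta> Vs \<in> C" by simp
  next
    show "alternating_on (\<Gamma> L) (eval_form \<eta>)"
      unfolding alternating_on_def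
    proof (intro allI impI ext)
      fix us v w ws x assume "set us \<union> {v, w} \<union> set ws \<subseteq> \<Gamma> L"
      then show "eval_form \<eta> (us @ w # v # ws) x = (- eval_form \<eta> (us @ v # w # ws)) x"
        using alternating_onD[OF alt_forms_alternating[OF alt[of x]],
            of "map (\<lambda>V. V x) us" "v x" "w x" "map (\<lambda>V. V x) ws"]
          sections_values[of us x] sections_values[of ws x]
        by (simp add: eval_form_def sections_fibre)
    qed
  next
    fix V W Vs assume *: "V \<in> \<Gamma> L" "W \<in> \<Gamma> L" "set Vs \<subseteq> \<Gamma> L"
    show "eval_form \<eta> ((V + W) # Vs) = eval_form \<eta> (V # Vs) + eval_form \<eta> (W # Vs)"
    proof
      fix x
      have "set [] \<union> set (map (\<lambda>V. V x) Vs) \<union> {V x, W x} \<subseteq> F x" using *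
        by (auto simp: sections_fibre subset_iff)
      from alt_forms_linear[OF alt this fibre_subspace, of 1 1]
      show "eval_form \<eta> ((V + W) # Vs) x = (eval_form \<eta> (V # Vs) + eval_form \<eta> (W # Vs)) x"
        by (simp add: eval_form_Cons)
    qed
  next
    fix f V Vs assume *: "f \<in> C" "V \<in> \<Gamma> L" "set Vs \<subseteq> \<Gamma> L"
    show "eval_form \<eta> ((f \<odot> V) # Vs) = f * eval_form \<eta> (V # Vs)"
    proof
      fix x
      have "set [] \<union> set (map (\<lambda>V. V x) Vs) \<union> {V x, V x} \<subseteq> F x" using *
        by (auto simp: sections_fibre subset_iff)
      from alt_forms_linear[OF alt this fibre_subspace, of "f x" 0]
      show "eval_form \<eta> ((f \<odot> V) # Vs) x = (f * eval_form \<eta> (V # Vs)) x"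
        by (simp add: eval_form_Cons)
    qed
  qed
  then show ?thesis using alt by (auto simp: form_field_def alt_forms_def)
qed

lemma formfields_iff:
  "\<eta> \<in> \<Omega>\<^sup>\<bullet> L (int p) \<longleftrightarrow> form_field \<eta> \<and> (\<forall>x vs. length vs \<noteq> p \<longrightarrow> \<eta> x vs = 0)"
proof (intro iffI conjI)
  assume *: "\<eta> \<in> \<Omega>\<^sup>\<bullet> L (int p)"
  then show "form_field \<eta>" by (rule formfields_form_field)
  show "\<forall>x vs. length vs \<noteq> p \<longrightarrow> \<eta> x vs = 0" using * by (auto simp: formfields_def alt_forms_def)
qed (auto intro: form_field_formfields)

section \<open>Forms of mixed degree\<close>

lemma eval_form_add: "eval_form (\<eta> + \<omega>) Vs = eval_form \<eta> Vs + eval_form \<omega> Vs"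
  by (simp add: eval_form_def fun_eq_iff)

lemma eval_form_scaleR: "eval_form (c *\<^sub>R \<eta>) Vs = (\<lambda>_. c) * eval_form \<eta> Vs"
  by (simp add: eval_form_def fun_eq_iff)

lemma form_field_add: "\<lbrakk>form_field \<eta>; form_field \<omega>\<rbrakk> \<Longrightarrow> form_field (\<eta> + \<omega>)"
  using list_form_plus[of "eval_form \<eta>" "eval_form \<omega>"]
  by (simp add: form_field_def eval_form_add[abs_def])

lemma form_field_scaleR: "form_field \<eta> \<Longrightarrow> form_field (c *\<^sub>R \<eta>)"
  using list_form_times[OF smooth_fun_const, of "eval_form \<eta>" c]
  by (simp add: form_field_def eval_form_scaleR[abs_def])

lemma list_form_zero: "list_form (\<lambda>_. 0)"
  by (rule list_formI) (auto simp: alternating_on_def smooth_fun_0 simp del: mem_Collect_eq)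

lemma form_field_zero: "form_field 0"
  using list_form_zero by (simp add: form_field_def eval_form_def[abs_def] zero_fun_def)

text \<open>An element of the span has finitely many homogeneous parts, hence vanishes on long
  lists. Conversely, a bound on the length makes the form a finite sum of its restrictions to lists
  of fixed length; each restriction is again a form because alternation and linearity compare lists
  of equal length.\<close>

lemma all_formfields_iff:
  "\<eta> \<in> \<Omega> L \<longleftrightarrow> form_field \<eta> \<and> (\<exists>n. \<forall>x vs. length vs > n \<longrightarrow> \<eta> x vs = 0)"
proof
  assume "\<eta> \<in> \<Omega> L"
  then show "form_field \<eta> \<and> (\<exists>n. \<forall>x vs. length vs > n \<longrightarrow> \<eta> x vs = 0)"
    unfolding all_formfields_def
  proof (induction rule: span_induct_alt)
    case base
    show "form_field 0 \<and> (\<exists>n. \<forall>x vs. length vs > n \<longrightarrow> 0 x vs = 0)" using form_field_zero by simp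
  next
    case (step c \<eta> \<omega>)
    then obtain p where p: "\<eta> \<in> \<Omega>\<^sup>\<bullet> L p" by auto
    have \<eta>: "form_field \<eta> \<and> (\<exists>n. \<forall>x vs. length vs > n \<longrightarrow> \<eta> x vs = 0)"
    proof (cases "p < 0")
      case True
      then show ?thesis using p form_field_zero by (simp add: formfields_def)
    next
      case False
      then have "\<eta> \<in> \<Omega>\<^sup>\<bullet> L (int (nat p))" using p by simp
      then show ?thesis unfolding formfields_iff by (metis less_irrefl)
    qed
    then obtain n m where "\<forall>x vs. length vs > n \<longrightarrow> \<eta> x vs = 0" "\<forall>x vs. length vs > m \<longrightarrow> \<omega> x vs = 0"
      using step by blast
    then have "\<forall>x vs. length vs > max n m \<longrightarrow> (c *\<^sub>R \<eta> + \<omega>) x vs = 0" by simp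
    then show ?case using \<eta> step by (blast intro: form_field_add form_field_scaleR)
  qed
next
  assume "form_field \<eta> \<and> (\<exists>n. \<forall>x vs. length vs > n \<longrightarrow> \<eta> x vs = 0)"
  then obtain n where \<eta>: "form_field \<eta>" and n: "\<And>x vs. length vs > n \<Longrightarrow> \<eta> x vs = 0" by blast
  define part where "part k = (\<lambda>x vs. if length vs = k then \<eta> x vs else 0)" for k
  have "part k \<in> \<Omega>\<^sup>\<bullet> L (int k)" for k
  proof -
    note \<alpha> = \<eta>[unfolded form_field_def, THEN conjunct1]
    have "list_form (eval_form (part k))"
    proof (rule list_formI)
      fix Vs assume "set Vs \<subseteq> \<Gamma> L"
      then have "eval_form \<eta> Vs \<in> C" by (rule list_form_smooth[OF \<alpha>])
      moreover have "eval_form (part k) Vs = (if length Vs = k then eval_form \<eta> Vs else 0)"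
        by (auto simp: eval_form_def part_def)
      ultimately show "eval_form (part k) Vs \<in> C" using smooth_fun_0 by simp
    next
      show "alternating_on (\<Gamma> L) (eval_form (part k))"
        unfolding alternating_on_def
      proof (intro allI impI ext)
        fix us v w ws x assume "set us \<union> {v, w} \<union> set ws \<subseteq> \<Gamma> L"
        then have "eval_form \<eta> (us @ w # v # ws) = - eval_form \<eta> (us @ v # w # ws)"
          by (intro alternating_onD[OF list_form_alt[OF \<alpha>]]) auto
        from fun_cong[OF this, of x]
        show "eval_form (part k) (us @ w # v # ws) x = (- eval_form (part k) (us @ v # w # ws)) x"
          by (simp add: eval_form_def part_def)
      qed
    next
      fix V W Vs assume *: "V \<in> \<Gamma> L" "W \<in> \<Gamma> L" "set Vs \<subseteq> \<Gamma> L"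
      show "eval_form (part k) ((V + W) # Vs) =
          eval_form (part k) (V # Vs) + eval_form (part k) (W # Vs)"
        using list_form_add[OF \<alpha> *] by (auto simp: eval_form_def part_def fun_eq_iff)
    next
      fix f V Vs assume *: "f \<in> C" "V \<in> \<Gamma> L" "set Vs \<subseteq> \<Gamma> L"
      show "eval_form (part k) ((f \<odot> V) # Vs) = f * eval_form (part k) (V # Vs)"
        using list_form_smul[OF \<alpha> *] by (auto simp: eval_form_def part_def fun_eq_iff)
    qed
    then have "form_field (part k)" using \<eta> by (simp add: form_field_def part_def)
    then show ?thesis by (rule form_field_formfields) (simp add: part_def)
  qed
  then have "(\<Sum>k\<le>n. part k) \<in> \<Omega> L"
    unfolding all_formfields_def by (intro span_sum span_base) blast
  moreover have "(\<Sum>k\<le>n. part k) = \<eta>"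
  proof (intro ext)
    fix x vs
    show "(\<Sum>k\<le>n. part k) x vs = \<eta> x vs"
      using n[of vs x] by (auto simp: sum_fun_apply part_def)
  qed
  ultimately show "\<eta> \<in> \<Omega> L" by simp
qed

lemma formfields_all: "\<eta> \<in> \<Omega>\<^sup>\<bullet> L p \<Longrightarrow> \<eta> \<in> \<Omega> L"
  unfolding all_formfields_def by (intro span_base) blast

lemma all_formfields_ext_forms:
  assumes "\<eta> \<in> \<Omega> L"
  shows "\<eta> x \<in> ext_forms (F x)"
  using assms unfolding all_formfields_def
proof (induction rule: span_induct_alt)
  case base
  then show ?case using ext_forms_zero by (simp add: zero_fun_def)
next
  case (step c \<eta> \<omega>)
  then obtain p where "\<eta> \<in> \<Omega>\<^sup>\<bullet> L p" by auto
  then have "\<eta> x \<in> ext_forms (F x)"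
    using ext_forms_zero[of "F x"] unfolding formfields_def ext_forms_def
    by (auto simp: zero_fun_def intro!: span_base split: if_splits)
  from ext_forms_lincomb[OF this step(2), of c]
  have "(\<lambda>vs. c * \<eta> x vs + \<omega> x vs) \<in> ext_forms (F x)" .
  moreover have "(c *\<^sub>R \<eta> + \<omega>) x = (\<lambda>vs. c * \<eta> x vs + \<omega> x vs)" by (simp add: fun_eq_iff)
  ultimately show ?case by simp
qed

text \<open>Resolves the definite description: \<open>real_form\<close> applied to
  \<open>d_op\<close> provides a solution, and evaluation on sections determines it.\<close>

lemma ext_deriv_properties:
  assumes "\<eta> \<in> \<Omega> L"
  shows ext_deriv_closed: "ext_deriv L \<eta> \<in> \<Omega> L"
    and eval_ext_deriv: "set Vs \<subseteq> \<Gamma> L \<Longrightarrow> eval_form (ext_deriv L \<eta>) Vs = d_op (eval_form \<eta>) Vs"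
proof -
  have \<eta>: "form_field \<eta>" and \<alpha>: "list_form (eval_form \<eta>)"
    using assms by (auto simp: all_formfields_iff form_field_def)
  obtain n where n: "\<And>x vs. length vs > n \<Longrightarrow> \<eta> x vs = 0" using assms
    by (auto simp: all_formfields_iff)
  define \<omega> where "\<omega> = real_form (d_op (eval_form \<eta>))"
  have \<omega>: "eval_form \<omega> Vs = d_op (eval_form \<eta>) Vs" if "set Vs \<subseteq> \<Gamma> L" for Vs
    unfolding \<omega>_def using eval_real_form[OF list_form_d_op[OF \<alpha>] that] .
  have "\<omega> x vs = 0" if "length vs > Suc n" for x vs
  proof -
    have "d_op (eval_form \<eta>) (map (lift x) vs) = 0" if "set vs \<subseteq> F x"
      using n \<open>length vs > Suc n\<close> map_lift[OF that]
      by (intro d_op_degree[of n]) (auto simp: eval_form_def fun_eq_iff)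
    then show ?thesis by (simp add: \<omega>_def real_form_def)
  qed
  then have \<omega>\<Omega>: "\<omega> \<in> \<Omega> L"
    using form_field_real_form[OF list_form_d_op[OF \<alpha>]] unfolding all_formfields_iff \<omega>_def by blast
  have formula: "d_op (eval_form \<eta>) Vs = (\<lambda>x.
      (\<Sum>i<length Vs. (-1) ^ i * D (Vs ! i) (eval_form \<eta> (nths Vs (- {i}))) x) +
      (\<Sum>j<length Vs. \<Sum>i<j. (-1) ^ (i + j) *
         eval_form \<eta> (brk L (Vs ! i) (Vs ! j) # nths Vs (- {i, j})) x))" if "set Vs \<subseteq> \<Gamma> L" for Vs
    unfolding d_op_formula[OF \<alpha> that] by (simp add: fun_eq_iff sum_fun_apply power_fun_apply)
  have "ext_deriv L \<eta> = \<omega>"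
    unfolding ext_deriv_def
  proof (rule the_equality, intro conjI allI impI \<omega>\<Omega>)
    fix Vs assume "set Vs \<subseteq> \<Gamma> L"
    then show "eval_form \<omega> Vs = (\<lambda>x.
      (\<Sum>i<length Vs. (-1) ^ i * D (Vs ! i) (eval_form \<eta> (nths Vs (- {i}))) x) +
      (\<Sum>j<length Vs. \<Sum>i<j. (-1) ^ (i + j) *
         eval_form \<eta> (brk L (Vs ! i) (Vs ! j) # nths Vs (- {i, j})) x))"
      unfolding \<omega>[OF \<open>set Vs \<subseteq> \<Gamma> L\<close>] by (rule formula)
  next
    fix \<theta> assume \<theta>: "\<theta> \<in> \<Omega> L \<and> (\<forall>Vs. set Vs \<subseteq> \<Gamma> L \<longrightarrow> eval_form \<theta> Vs = (\<lambda>x.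
      (\<Sum>i<length Vs. (-1) ^ i * D (Vs ! i) (eval_form \<eta> (nths Vs (- {i}))) x) +
      (\<Sum>j<length Vs. \<Sum>i<j. (-1) ^ (i + j) *
         eval_form \<eta> (brk L (Vs ! i) (Vs ! j) # nths Vs (- {i, j})) x)))"
    show "\<theta> = \<omega>"
    proof (rule form_field_eqI)
      show "form_field \<theta>" "form_field \<omega>" using \<theta> \<omega>\<Omega> by (simp_all add: all_formfields_iff)
      fix Vs assume "set Vs \<subseteq> \<Gamma> L"
      then show "eval_form \<theta> Vs = eval_form \<omega> Vs"
        using \<theta> unfolding \<omega>[OF \<open>set Vs \<subseteq> \<Gamma> L\<close>] formula[OF \<open>set Vs \<subseteq> \<Gamma> L\<close>] by blast
    qed
  qed
  then show "ext_deriv L \<eta> \<in> \<Omega> L"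
      "set Vs \<subseteq> \<Gamma> L \<Longrightarrow> eval_form (ext_deriv L \<eta>) Vs = d_op (eval_form \<eta>) Vs"
    using \<omega>\<Omega> \<omega> by auto
qed

end

section \<open>Exterior algebra of a fibre\<close>

lemma ext_forms_alternating: "\<eta> \<in> ext_forms V \<Longrightarrow> alternating_on V \<eta>"
proof (induction rule: ext_forms_induct)
  case zero
  show ?case by (simp add: alternating_on_def)
next
  case (step c p \<alpha> \<beta>)
  show ?case unfolding alternating_on_def
  proof (intro allI impI)
    fix us v w ws assume "set us \<union> {v, w} \<union> set ws \<subseteq> V"
    then show "c * \<alpha> (us @ w # v # ws) + \<beta> (us @ w # v # ws) =
        - (c * \<alpha> (us @ v # w # ws) + \<beta> (us @ v # w # ws))"
      using alternating_onD[OF alt_forms_alternating[OF step(1)], of us v w ws]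
        alternating_onD[OF step(2), of us v w ws] by simp
  qed
qed

lemma ext_forms_linear:
  assumes "\<eta> \<in> ext_forms V" "subspace V" "v \<in> V" "w \<in> V" "set ws \<subseteq> V"
  shows "\<eta> ((a *\<^sub>R v + b *\<^sub>R w) # ws) = a * \<eta> (v # ws) + b * \<eta> (w # ws)"
  using assms(1)
proof (induction rule: ext_forms_induct)
  case (step c p \<alpha> \<beta>)
  then show ?case
    using alt_forms_linear[OF step(1) _ assms(2), of "[]" ws v w a b] assms
    by (simp add: algebra_simps)
qed simp

text \<open>For a list of length p the exponent is p(p-1)/2, written as the sum that the induction
  produces. Reversal matters because contraction with
  \<open>v\<^sub>1 \<and> ... \<and> v\<^sub>p\<close> puts \<open>v\<^sub>p\<close> into the first
  slot of the form.\<close>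

lemma alternating_on_rev:
  "\<lbrakk>alternating_on A \<alpha>; set vs \<subseteq> A\<rbrakk> \<Longrightarrow> \<alpha> (rev vs) = (-1) ^ (\<Sum>i<length vs. i) * \<alpha> vs"
proof (induction vs arbitrary: \<alpha>)
  case (Cons v vs)
  have "\<alpha> ([] @ rev vs @ v # []) = (-1) ^ length (rev vs) * \<alpha> ([] @ v # rev vs @ [])"
    using Cons.prems by (intro alternating_on_move) auto
  moreover have "\<alpha> (v # rev vs) = (-1) ^ (\<Sum>i<length vs. i) * \<alpha> (v # vs)"
    using Cons.prems by (intro Cons.IH alternating_on_Cons) auto
  ultimately show ?case by (simp add: power_add mult_ac)
qed simp

text \<open>Membership of the remainder \<open>R\<close> is carried along, since several of the
  linearity rules used in such inductions hold only on \<open>ext_power\<close>.\<close>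

lemma ext_power_induct [consumes 1, case_names zero step]:
  assumes "P \<in> ext_power V p" and "Q 0"
    and "\<And>c vs R. \<lbrakk>length vs = p; set vs \<subseteq> V; R \<in> ext_power V p; Q R\<rbrakk> \<Longrightarrow>
        Q (c *\<^sub>R wedge_list V vs + R)"
  shows "Q P"
proof -
  have "P \<in> ext_power V p \<and> Q P"
    using assms(1) unfolding ext_power_def
  proof (induction rule: span_induct_alt)
    case base
    show "0 \<in> span {wedge_list V vs |vs. length vs = p \<and> set vs \<subseteq> V} \<and> Q 0"
      using assms(2) by (simp add: span_zero)
  next
    case (step c x y)
    then obtain vs where vs: "x = wedge_list V vs" "length vs = p" "set vs \<subseteq> V" by blast
    have "c *\<^sub>R x + y \<in> span {wedge_list V vs |vs. length vs = p \<and> set vs \<subseteq> V}"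
    proof (intro span_add span_scale)
      show "x \<in> span {wedge_list V vs |vs. length vs = p \<and> set vs \<subseteq> V}"
        using vs by (intro span_base) blast
    qed (use step in blast)
    moreover have "Q (c *\<^sub>R x + y)"
      using assms(3)[OF vs(2,3), of y c] step(2) by (simp add: vs(1) ext_power_def)
    ultimately show ?case by blast
  qed
  then show ?thesis by blast
qed

lemma wedge_list_ext_power: "\<lbrakk>length vs = p; set vs \<subseteq> V\<rbrakk> \<Longrightarrow> wedge_list V vs \<in> ext_power V p"
  unfolding ext_power_def by (intro span_base) blast

lemma subspace_ext_power: "subspace (ext_power V p)"
  by (simp add: ext_power_def)

text \<open>A multivector is a functional on all functions of lists but behaves linearly only on
  \<open>ext_forms\<close>, being 0 elsewhere. This is the reason for the closure conditions on
  partially evaluated forms below.\<close>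

lemma ext_power_lincomb:
  assumes "P \<in> ext_power V p" "\<eta> \<in> ext_forms V" "\<omega> \<in> ext_forms V"
  shows "P (\<lambda>vs. c * \<eta> vs + \<omega> vs) = c * P \<eta> + P \<omega>"
  using assms(1)
proof (induction rule: ext_power_induct)
  case (step a vs R)
  then show ?case using ext_forms_lincomb[OF assms(2,3), of c] assms(2,3)
    by (simp add: wedge_list_def algebra_simps)
qed simp

lemma ext_power_zero_form: "P \<in> ext_power V p \<Longrightarrow> P (\<lambda>_. 0) = 0"
  using ext_power_lincomb[OF _ ext_forms_zero ext_forms_zero, of P V p 1] by simp

lemma ext_power_outside:
  assumes "P \<in> ext_power V p" "\<eta> \<notin> ext_forms V"
  shows "P \<eta> = 0"
  using assms(1) by (induction rule: ext_power_induct) (auto simp: wedge_list_def assms(2))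

lemma ext_power_degree:
  assumes "P \<in> ext_power V p" "\<eta> \<in> ext_forms V" "\<omega> \<in> ext_forms V"
    "\<And>vs. length vs = p \<Longrightarrow> set vs \<subseteq> V \<Longrightarrow> \<eta> vs = \<omega> vs"
  shows "P \<eta> = P \<omega>"
  using assms(1) by (induction rule: ext_power_induct) (auto simp: wedge_list_def assms)

lemma contract_lincomb: "contract (c *\<^sub>R P + Q) \<eta> = (\<lambda>ws. c * contract P \<eta> ws + contract Q \<eta> ws)"
  by (simp add: contract_def)

lemma contract_0: "contract 0 \<eta> = (\<lambda>_. 0)"
  by (simp add: contract_def)

lemma contract_wedge_list_apply:
  "\<eta> \<in> ext_forms V \<Longrightarrow> contract (wedge_list V vs) \<eta> = (\<lambda>ws. \<eta> (rev vs @ ws))"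
  by (simp add: contract_wedge_list fun_eq_iff foldr_contract_vec)

lemma contract_ext_forms:
  assumes "P \<in> ext_power V p" "\<eta> \<in> ext_forms V"
  shows "contract P \<eta> \<in> ext_forms V"
  using assms(1)
proof (induction rule: ext_power_induct)
  case zero
  show "contract 0 \<eta> \<in> ext_forms V" by (simp add: contract_0 ext_forms_zero)
next
  case (step c vs R)
  show ?case
    unfolding contract_lincomb contract_wedge_list_apply[OF assms(2)]
    by (rule ext_forms_lincomb[OF ext_forms_contract(1)[OF assms(2)] step(4)])
qed

lemma contract_form_lincomb:
  assumes "P \<in> ext_power V p" "\<eta> \<in> ext_forms V" "\<omega> \<in> ext_forms V"
  shows "contract P (\<lambda>vs. c * \<eta> vs + \<omega> vs) = (\<lambda>ws. c * contract P \<eta> ws + contract P \<omega> ws)"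
proof
  fix ws
  have "P (\<lambda>vs. c * \<eta> (rev vs @ ws) + \<omega> (rev vs @ ws)) =
      c * P (\<lambda>vs. \<eta> (rev vs @ ws)) + P (\<lambda>vs. \<omega> (rev vs @ ws))"
    using ext_power_lincomb[OF assms(1) ext_forms_contract(3)[OF assms(2), of ws]
        ext_forms_contract(3)[OF assms(3), of ws], of c] by simp
  then show "contract P (\<lambda>vs. c * \<eta> vs + \<omega> vs) ws = c * contract P \<eta> ws + contract P \<omega> ws"
    by (simp add: contract_def foldr_contract_vec)
qed

lemma wedge_lincomb_left:
  "\<eta> \<in> ext_forms V \<Longrightarrow> wedge V (c *\<^sub>R P + Q) R \<eta> = c * wedge V P R \<eta> + wedge V Q R \<eta>"
  by (simp add: wedge_def)

text \<open>\<open>wedge\<close> applies its left factor to this function, and linearity of that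
  factor is available only on \<open>ext_forms\<close>.\<close>

lemma ext_forms_partial:
  assumes "Q \<in> ext_power V q" "\<eta> \<in> ext_forms V"
  shows "(\<lambda>vs. Q (\<lambda>ws. \<eta> (vs @ ws))) \<in> ext_forms V"
  using assms(1)
proof (induction rule: ext_power_induct)
  case zero
  show ?case by (simp add: ext_forms_zero)
next
  case (step c us R)
  have "(\<lambda>vs. (c *\<^sub>R wedge_list V us + R) (\<lambda>ws. \<eta> (vs @ ws))) =
      (\<lambda>vs. c * \<eta> (vs @ us) + R (\<lambda>ws. \<eta> (vs @ ws)))"
    by (simp add: wedge_list_def ext_forms_contract(1)[OF assms(2)])
  then show ?case using ext_forms_lincomb[OF ext_forms_contract(2)[OF assms(2)] step(4)] by simp
qed

lemma wedge_lincomb_right: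
  assumes "P \<in> ext_power V p" "Q \<in> ext_power V q" "R \<in> ext_power V q" "\<eta> \<in> ext_forms V"
  shows "wedge V P (c *\<^sub>R Q + R) \<eta> = c * wedge V P Q \<eta> + wedge V P R \<eta>"
  using ext_power_lincomb[OF assms(1) ext_forms_partial[OF assms(2,4)]
      ext_forms_partial[OF assms(3,4)]] assms(4)
  by (simp add: wedge_def)

lemma wedge_0_left: "wedge V 0 Q = 0"
  by (auto simp: wedge_def)

lemma wedge_0_right: "P \<in> ext_power V p \<Longrightarrow> wedge V P 0 = 0"
  by (auto simp: wedge_def ext_power_zero_form)

lemma wedge_outside: "\<eta> \<notin> ext_forms V \<Longrightarrow> wedge V P Q \<eta> = 0"
  by (simp add: wedge_def)

lemma wedge_lincomb_left': "wedge V (c *\<^sub>R P + Q) R = c *\<^sub>R wedge V P R + wedge V Q R"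
  by (rule ext, rename_tac \<eta>, case_tac "\<eta> \<in> ext_forms V")
    (simp_all add: wedge_lincomb_left wedge_outside)

lemma wedge_lincomb_right':
  assumes "P \<in> ext_power V p" "Q \<in> ext_power V q" "R \<in> ext_power V q"
  shows "wedge V P (c *\<^sub>R Q + R) = c *\<^sub>R wedge V P Q + wedge V P R"
proof
  fix \<eta>
  show "wedge V P (c *\<^sub>R Q + R) \<eta> = (c *\<^sub>R wedge V P Q + wedge V P R) \<eta>"
    by (cases "\<eta> \<in> ext_forms V") (simp_all add: wedge_lincomb_right[OF assms] wedge_outside)
qed

lemma wedge_ext_power:
  assumes "P \<in> ext_power V p" "Q \<in> ext_power V q"
  shows "wedge V P Q \<in> ext_power V (p + q)"
  using assms(1)
proof (induction rule: ext_power_induct)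
  case zero
  show "wedge V 0 Q \<in> ext_power V (p + q)" using subspace_0[OF subspace_ext_power]
    by (simp add: wedge_0_left)
next
  case (step c us R)
  have "wedge V (wedge_list V us) Q \<in> ext_power V (p + q)"
    using assms(2)
  proof (induction rule: ext_power_induct)
    case zero
    show "wedge V (wedge_list V us) 0 \<in> ext_power V (p + q)"
      using subspace_0[OF subspace_ext_power]
      by (simp add: wedge_0_right[OF wedge_list_ext_power[OF step(1,2)]])
  next
    case (step a vs S)
    show ?case
      unfolding wedge_lincomb_right'[OF wedge_list_ext_power[OF \<open>length us = p\<close> \<open>set us \<subseteq> V\<close>]
          wedge_list_ext_power[OF step(1,2)] step(3)] wedge_wedge_list
      using step \<open>length us = p\<close> \<open>set us \<subseteq> V\<close>
      by (intro subspace_add[OF subspace_ext_power] subspace_scale[OF subspace_ext_power]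
          wedge_list_ext_power) auto
  qed
  then show ?case unfolding wedge_lincomb_left'
    using step by (intro subspace_add[OF subspace_ext_power] subspace_scale[OF subspace_ext_power])
qed

text \<open>On products of vectors both sides evaluate the form on
  \<open>rev vs @ rev us @ ws\<close>; the reversal built into the contraction makes the order of
  composition come out right.\<close>

lemma contract_wedge:
  assumes "P \<in> ext_power V p" "Q \<in> ext_power V q" "\<eta> \<in> ext_forms V"
  shows "contract (wedge V P Q) \<eta> = contract P (contract Q \<eta>)"
  using assms(1)
proof (induction rule: ext_power_induct)
  case zero
  show "contract (wedge V 0 Q) \<eta> = contract 0 (contract Q \<eta>)" by (simp add: wedge_0_left contract_0)
next
  case (step c us R)
  have "contract (wedge V (wedge_list V us) Q) \<eta> = contract (wedge_list V us) (contract Q \<eta>)"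
    using assms(2)
  proof (induction rule: ext_power_induct)
    case zero
    show "contract (wedge V (wedge_list V us) 0) \<eta> = contract (wedge_list V us) (contract 0 \<eta>)"
      by (simp add: wedge_0_right[OF wedge_list_ext_power[OF step(1,2)]] contract_0
          contract_wedge_list_apply ext_forms_zero)
  next
    case (step a vs S)
    note U = wedge_list_ext_power[OF \<open>length us = p\<close> \<open>set us \<subseteq> V\<close>]
    show ?case
      unfolding wedge_lincomb_right'[OF U wedge_list_ext_power[OF step(1,2)] step(3)]
          wedge_wedge_list
        contract_lincomb step(4) contract_form_lincomb[OF U
          contract_ext_forms[OF wedge_list_ext_power[OF step(1,2)] assms(3)]
            contract_ext_forms[OF step(3) assms(3)]]
      by (simp add: contract_wedge_list_apply assms(3) ext_forms_contract)
  qed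
  then show ?case unfolding wedge_lincomb_left' contract_lincomb step(4) by simp
qed

text \<open>For products of vectors the two sides differ by an exchange of blocks of
  \<open>p\<close> and \<open>q\<close> arguments.\<close>

lemma contract_commute:
  assumes "P \<in> ext_power V p" "Q \<in> ext_power V q" "\<eta> \<in> ext_forms V"
  shows "contract P (contract Q \<eta>) = (\<lambda>ws. (-1) ^ (p * q) * contract Q (contract P \<eta>) ws)"
  using assms(1)
proof (induction rule: ext_power_induct)
  case zero
  have "contract Q (\<lambda>_. 0) = (\<lambda>_. 0)"
    by (simp add: contract_def foldr_contract_vec ext_power_zero_form[OF assms(2)])
  then show "contract 0 (contract Q \<eta>) = (\<lambda>ws. (-1) ^ (p * q) * contract Q (contract 0 \<eta>) ws)"
    by (simp add: contract_0)
next
  case (step c us R)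
  note U = wedge_list_ext_power[OF step(1,2)]
  have "contract (wedge_list V us) (contract Q \<eta>) =
      (\<lambda>ws. (-1) ^ (p * q) * contract Q (contract (wedge_list V us) \<eta>) ws)"
    using assms(2)
  proof (induction rule: ext_power_induct)
    case zero
    show "contract (wedge_list V us) (contract 0 \<eta>) =
        (\<lambda>ws. (-1) ^ (p * q) * contract 0 (contract (wedge_list V us) \<eta>) ws)"
      by (simp add: contract_0 contract_wedge_list_apply ext_forms_zero)
  next
    case (step a vs S)
    have vsus: "\<eta> (rev vs @ rev us @ ws) = (-1) ^ (p * q) * \<eta> (rev us @ rev vs @ ws)" for ws
    proof (cases "set ws \<subseteq> V")
      case True
      have "\<eta> ([] @ rev vs @ rev us @ ws) =
          (-1) ^ (length (rev vs) * length (rev us)) * \<eta> ([] @ rev us @ rev vs @ ws)"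
        using step \<open>set us \<subseteq> V\<close> True
        by (intro alternating_on_block[OF ext_forms_alternating[OF assms(3)]]) auto
      then show ?thesis using step \<open>length us = p\<close> by (simp add: mult.commute)
    next
      case False
      then show ?thesis by (simp add: ext_forms_outside[OF assms(3)])
    qed
    show ?case
      unfolding contract_lincomb contract_form_lincomb[OF U
          contract_ext_forms[OF wedge_list_ext_power[OF step(1,2)] assms(3)]
            contract_ext_forms[OF step(3) assms(3)]] step(4)
      by (simp add: contract_wedge_list_apply assms(3) ext_forms_contract vsus algebra_simps)
  qed
  then show ?case
    unfolding contract_lincomb step(4)
        contract_form_lincomb[OF assms(2) contract_ext_forms[OF U assms(3)]
        contract_ext_forms[OF step(3) assms(3)]]
    by (simp add: algebra_simps)
qed

lemma contract_Nil:
  assumes "P \<in> ext_power V p" "\<eta> \<in> ext_forms V"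
  shows "contract P \<eta> [] = (-1) ^ (\<Sum>i<p. i) * P \<eta>"
  using assms(1)
proof (induction rule: ext_power_induct)
  case zero
  show "contract 0 \<eta> [] = (-1) ^ (\<Sum>i<p. i) * 0 \<eta>" by (simp add: contract_0)
next
  case (step c vs R)
  then show ?case
    using alternating_on_rev[OF ext_forms_alternating[OF assms(2)] step(2)] assms(2)
    unfolding contract_lincomb contract_wedge_list_apply[OF assms(2)]
    by (simp add: wedge_list_def algebra_simps)
qed

text \<open>Contraction followed by evaluation on the empty list is, up to a sign, the pairing
  itself, and off \<open>ext_forms\<close> both functionals are 0.\<close>

lemma contract_inject:
  assumes "P \<in> ext_power V p" "Q \<in> ext_power V p"
      "\<And>\<eta>. \<eta> \<in> ext_forms V \<Longrightarrow> contract P \<eta> = contract Q \<eta>"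
  shows "P = Q"
proof
  fix \<eta>
  show "P \<eta> = Q \<eta>"
  proof (cases "\<eta> \<in> ext_forms V")
    case True
    then show ?thesis
      using contract_Nil[OF assms(1) True] contract_Nil[OF assms(2) True] assms(3)[OF True] by simp
  qed (simp add: ext_power_outside[OF assms(1)] ext_power_outside[OF assms(2)])
qed

text \<open>Contraction turns exterior products into compositions, which are associative, and it is
  injective in each degree.\<close>

lemma wedge_assoc:
  assumes "P \<in> ext_power V p" "Q \<in> ext_power V q" "R \<in> ext_power V r"
  shows "wedge V (wedge V P Q) R = wedge V P (wedge V Q R)"
proof (rule contract_inject)
  show "wedge V (wedge V P Q) R \<in> ext_power V (p + q + r)"
    using assms by (intro wedge_ext_power)
  show "wedge V P (wedge V Q R) \<in> ext_power V (p + q + r)"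
    unfolding add.assoc using assms by (intro wedge_ext_power)
  show "contract (wedge V (wedge V P Q) R) \<eta> = contract (wedge V P (wedge V Q R)) \<eta>"
    if "\<eta> \<in> ext_forms V" for \<eta>
    unfolding contract_wedge[OF wedge_ext_power[OF assms(1,2)] assms(3) that]
      contract_wedge[OF assms(1,2) contract_ext_forms[OF assms(3) that]]
      contract_wedge[OF assms(1) wedge_ext_power[OF assms(2,3)] that]
        contract_wedge[OF assms(2,3) that] ..
qed

lemma wedge_list_singleton_sum:
  assumes "subspace V" "finite J" "\<And>j. j \<in> J \<Longrightarrow> v j \<in> V"
  shows "wedge_list V [\<Sum>j\<in>J. c j *\<^sub>R v j] = (\<Sum>j\<in>J. c j *\<^sub>R wedge_list V [v j])"
  using assms(2,3)
proof (induction J rule: finite_induct)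
  case empty
  have "\<eta> [0] = 0" if "\<eta> \<in> ext_forms V" for \<eta> :: "'a form"
    using ext_forms_linear[OF that assms(1), of 0 0 "[]" 0 0] subspace_0[OF assms(1)] by simp
  then show ?case by (auto simp: wedge_list_def)
next
  case (insert j J)
  have "(\<Sum>j\<in>J. c j *\<^sub>R v j) \<in> V" using insert assms(1) by (intro subspace_sum subspace_scale) auto
  then have "wedge_list V [c j *\<^sub>R v j + (\<Sum>j\<in>J. c j *\<^sub>R v j)] =
      c j *\<^sub>R wedge_list V [v j] + wedge_list V [\<Sum>j\<in>J. c j *\<^sub>R v j]"
    using ext_forms_linear[OF _ assms(1), of _ "v j" "\<Sum>j\<in>J. c j *\<^sub>R v j" "[]" "c j" 1] insert.prems
    by (intro ext) (simp add: wedge_list_def)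
  moreover have "wedge_list V [\<Sum>j\<in>J. c j *\<^sub>R v j] = (\<Sum>j\<in>J. c j *\<^sub>R wedge_list V [v j])"
    using insert.IH insert.prems by blast
  ultimately show "wedge_list V [\<Sum>j\<in>insert j J. c j *\<^sub>R v j] =
      (\<Sum>j\<in>insert j J. c j *\<^sub>R wedge_list V [v j])"
    by (simp only: sum.insert[OF insert(1,2)])
qed

section \<open>Multivector fields\<close>

context lie_algebroid
begin

lemma list_form_ext_wedge:
  assumes \<alpha>: "list_form \<alpha>"
    and \<theta>: "\<And>V. V \<in> \<Gamma> L \<Longrightarrow> \<theta> V \<in> C" "\<And>V W. \<lbrakk>V \<in> \<Gamma> L; W \<in> \<Gamma> L\<rbrakk> \<Longrightarrow> \<theta> (V + W) = \<theta> V + \<theta> W"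
      "\<And>f V. \<lbrakk>f \<in> C; V \<in> \<Gamma> L\<rbrakk> \<Longrightarrow> \<theta> (f \<odot> V) = f * \<theta> V"
  shows "list_form (ext_wedge \<theta> \<alpha>)"
proof (rule list_formI)
  show "ext_wedge \<theta> \<alpha> Vs \<in> C" if "set Vs \<subseteq> \<Gamma> L" for Vs
    using \<alpha> that
  proof (induction Vs arbitrary: \<alpha>)
    case Nil
    show ?case using smooth_fun_0 by simp
  next
    case (Cons V Vs)
    have "ext_wedge \<theta> (insert_sec V \<alpha>) Vs \<in> C"
      using Cons.prems by (intro Cons.IH list_form_insert) auto
    moreover have "\<theta> V * \<alpha> Vs \<in> C"
      using Cons.prems by (intro smooth_fun_mult \<theta> list_form_smooth[of \<alpha>]) auto
    ultimately show ?case unfolding ext_wedge.simps by (rule smooth_fun_diff[rotated])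
  qed
  show "alternating_on (\<Gamma> L) (ext_wedge \<theta> \<alpha>)"
    by (rule alternating_on_ext_wedge[OF list_form_alt[OF \<alpha>]])
next
  fix V W Vs assume "V \<in> \<Gamma> L" "W \<in> \<Gamma> L" "set Vs \<subseteq> \<Gamma> L"
  then show "ext_wedge \<theta> \<alpha> ((V + W) # Vs) = ext_wedge \<theta> \<alpha> (V # Vs) + ext_wedge \<theta> \<alpha> (W # Vs)"
    by (intro ext_wedge_head_add \<theta> list_form_add[OF \<alpha>]) auto
next
  fix f V Vs assume "f \<in> C" "V \<in> \<Gamma> L" "set Vs \<subseteq> \<Gamma> L"
  then show "ext_wedge \<theta> \<alpha> ((f \<odot> V) # Vs) = f * ext_wedge \<theta> \<alpha> (V # Vs)"
    by (intro ext_wedge_head_scale \<theta> list_form_smul[OF \<alpha>]) auto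
qed

lemma list_form_dual_form:
  assumes "\<And>i V. V \<in> \<Gamma> L \<Longrightarrow> i \<in> set I \<Longrightarrow> \<theta> i V \<in> C"
    "\<And>i V W. \<lbrakk>V \<in> \<Gamma> L; W \<in> \<Gamma> L; i \<in> set I\<rbrakk> \<Longrightarrow> \<theta> i (V + W) = \<theta> i V + \<theta> i W"
    "\<And>i f V. \<lbrakk>f \<in> C; V \<in> \<Gamma> L; i \<in> set I\<rbrakk> \<Longrightarrow> \<theta> i (f \<odot> V) = f * \<theta> i V"
  shows "list_form (dual_form \<theta> I)"
  using assms
proof (induction I)
  case Nil
  show ?case
    by (rule list_formI) (auto simp: alternating_on_def smooth_fun_0 smooth_fun_1 simp del:
        mem_Collect_eq)
next
  case (Cons i I)
  have "list_form (dual_form \<theta> I)" using Cons.prems by (intro Cons.IH) auto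
  then show ?case unfolding dual_form.simps
  proof (rule list_form_ext_wedge)
    show "\<theta> i V \<in> C" if "V \<in> \<Gamma> L" for V by (rule Cons.prems(1)) (use that in simp_all)
    show "\<theta> i (V + W) = \<theta> i V + \<theta> i W" if "V \<in> \<Gamma> L" "W \<in> \<Gamma> L" for V W
      by (rule Cons.prems(2)) (use that in simp_all)
    show "\<theta> i (f \<odot> V) = f * \<theta> i V" if "f \<in> C" "V \<in> \<Gamma> L" for f V
      by (rule Cons.prems(3)) (use that in simp_all)
  qed
qed

text \<open>The covectors are frame coordinates multiplied by a cutoff \<open>h\<close>, hence
  global. On the cut-off frame sections they give \<open>h * h\<close> on the diagonal and 0
  elsewhere, so \<open>dual_form_basis\<close> applies, and \<open>h\<close> is 1 at
  \<open>x\<close>.\<close>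

lemma dual_form_field:
  assumes W: "(W, e) \<in> frames (bun L)" "x \<in> W" and I: "I \<in> multi_indices (indices (bun L)) p"
  obtains \<eta> where "\<eta> \<in> \<Omega>\<^sup>\<bullet> L (int p)"
    "\<And>J. J \<in> multi_indices (indices (bun L)) p \<Longrightarrow> \<eta> x (map (\<lambda>i. e i x) J) = (if J = I then 1 else 0)"
proof -
  let ?K = "indices (bun L)"
  obtain h N K where h: "h \<in> C" "open N" "x \<in> N" "closed K" "K \<subseteq> W"
    "\<And>y. y \<in> N \<Longrightarrow> h y = 1" "\<And>y. y \<notin> K \<Longrightarrow> h y = 0"
    using plateau_function[OF frame_domain[OF W(1)] W(2)] by metis
  have h0: "h y = 0" if "y \<notin> W" for y using h that by auto
  define \<theta> where "\<theta> i V = (\<lambda>y. h y * frame_coord e i y (V y))" for i V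
  define \<alpha> where "\<alpha> = dual_form \<theta> I"
  have IK: "set I \<subseteq> ?K" "sorted_wrt (<) I" "length I = p" using I by (auto simp: multi_indices_def)
  have "list_form \<alpha>"
    unfolding \<alpha>_def
  proof (rule list_form_dual_form)
    show "\<theta> i V \<in> C" if "V \<in> \<Gamma> L" "i \<in> set I" for i V
      unfolding \<theta>_def using that IK
      by (intro smooth_fun_extend[OF h(1) frame_domain[OF W(1)] h(4,5,7)]
          frame_coord_smooth[OF W(1)]) auto
    show "\<theta> i (U + V) = \<theta> i U + \<theta> i V" if "U \<in> \<Gamma> L" "V \<in> \<Gamma> L" for i U V
    proof
      fix y show "\<theta> i (U + V) y = (\<theta> i U + \<theta> i V) y"
        using that h0[of y] frame_coord_add[OF W(1), of y "U y" "V y" i]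
        by (cases "y \<in> W") (simp_all add: \<theta>_def sections_fibre algebra_simps)
    qed
    show "\<theta> i (f \<odot> V) = f * \<theta> i V" if "V \<in> \<Gamma> L" for i f V
    proof
      fix y show "\<theta> i (f \<odot> V) y = (f * \<theta> i V) y"
        using that h0[of y] frame_coord_scale[OF W(1), of y "V y" i "f y"]
        by (cases "y \<in> W") (simp_all add: \<theta>_def sections_fibre)
    qed
  qed
  have E: "h \<odot> e i \<in> \<Gamma> L" if "i \<in> ?K" for i
    using sec_frame_extend[OF W(1) that h(1,4,5,7)] .
  have \<theta>e: "\<theta> i (h \<odot> e j) = (if i = j then h * h else 0)" if "i \<in> ?K" "j \<in> ?K" for i j
  proof
    fix y show "\<theta> i (h \<odot> e j) y = (if i = j then h * h else 0) y"
      using that h0[of y] frame_coord_scale[OF W(1) _ frame_fibre[OF W(1) _ that(2)], of y i "h y"]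
        frame_coord_basis[OF W(1) _ that, of y]
      by (cases "y \<in> W") (simp_all add: \<theta>_def)
  qed
  show ?thesis
  proof (rule that)
    show "real_form \<alpha> \<in> \<Omega>\<^sup>\<bullet> L (int p)"
      unfolding formfields_iff using form_field_real_form[OF \<open>list_form \<alpha>\<close>] IK(3)
      by (auto simp: real_form_def \<alpha>_def dual_form_degree)
    fix J assume "J \<in> multi_indices ?K p"
    then have J: "set J \<subseteq> ?K" "sorted_wrt (<) J" by (auto simp: multi_indices_def)
    have "set (map (\<lambda>i. h \<odot> e i) J) \<subseteq> \<Gamma> L" using J E by auto
    from eval_real_form[OF \<open>list_form \<alpha>\<close> this]
    have "eval_form (real_form \<alpha>) (map (\<lambda>i. h \<odot> e i) J) = (if I = J then (h * h) ^ length I else 0)"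
      using dual_form_basis[of ?K \<theta> "\<lambda>i. h \<odot> e i", OF \<theta>e IK(2,1) J(2,1)] by (simp only: \<alpha>_def)
    from fun_cong[OF this, of x]
    show "real_form \<alpha> x (map (\<lambda>i. e i x) J) = (if J = I then 1 else 0)"
      using h(3,6) by (auto simp: eval_form_def comp_def power_fun_apply)
  qed
qed

abbreviation ext_frame :: "(nat \<Rightarrow> 'm \<Rightarrow> 'v) \<Rightarrow> nat list \<Rightarrow> ('m, 'v) mvfield"
  where "ext_frame e I \<equiv> (\<lambda>x. wedge_list (F x) (map (\<lambda>i. e i x) I))"

lemma finite_multi_indices: "finite K \<Longrightarrow> finite (multi_indices K p)"
  by (rule finite_subset[OF _ finite_lists_length_eq[of K p]]) (auto simp: multi_indices_def)

text \<open>Pairing with the global form that is dual to the index \<open>I\<close> at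
  \<open>x\<close> reads off the coefficient.\<close>

lemma ext_frame_coefficient:
  assumes W: "(W, e) \<in> frames (bun L)" "x \<in> W" and I: "I \<in> multi_indices (indices (bun L)) p"
    and eq: "\<And>\<eta>. \<eta> \<in> \<Omega>\<^sup>\<bullet> L (int p) \<Longrightarrow>
      (\<Sum>J\<in>multi_indices (indices (bun L)) p. c J *\<^sub>R ext_frame e J x) (\<eta> x) =
      (\<Sum>J\<in>multi_indices (indices (bun L)) p. d J *\<^sub>R ext_frame e J x) (\<eta> x)"
  shows "c I = d I"
proof -
  let ?M = "multi_indices (indices (bun L)) p"
  obtain \<eta> where \<eta>: "\<eta> \<in> \<Omega>\<^sup>\<bullet> L (int p)"
    "\<And>J. J \<in> ?M \<Longrightarrow> \<eta> x (map (\<lambda>i. e i x) J) = (if J = I then 1 else 0)"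
    by (rule dual_form_field[OF W I]) blast
  have "\<eta> x \<in> ext_forms (F x)" by (rule all_formfields_ext_forms[OF formfields_all[OF \<eta>(1)]])
  then have "(\<Sum>J\<in>?M. c J *\<^sub>R ext_frame e J x) (\<eta> x) = (\<Sum>J\<in>?M. if J = I then c J else 0)" for c
    by (auto simp: sum_fun_apply wedge_list_def \<eta>(2) intro!: sum.cong)
  then have "(\<Sum>J\<in>?M. c J *\<^sub>R ext_frame e J x) (\<eta> x) = c I" for c
    using I by (simp add: finite_multi_indices[OF finite_rank])
  with eq[OF \<eta>(1)] show ?thesis by simp
qed

abbreviation \<open>one_mv \<equiv> mv_of_fun L 1\<close>

section \<open>Algebra of multivector fields and interior products\<close>

lemma one_mv: "one_mv = (\<lambda>x. wedge_list (F x) [])"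
  by (simp add: mv_of_fun_def fun_eq_iff)

lemma mv_of_fun: "mv_of_fun L f = f \<odot> one_mv"
  by (simp add: mv_of_fun_def fun_eq_iff)

text \<open>The pointwise part of membership in \<open>A\<^sup>\<bullet>\<close>, without
  smoothness: it suffices for the algebraic identities, which are used before products are known to
  be smooth.\<close>

definition mv_degree :: "int \<Rightarrow> ('m, 'v) mvfield \<Rightarrow> bool"
  where "mv_degree p P \<longleftrightarrow> (if p < 0 then P = 0 else \<forall>x. P x \<in> ext_power (F x) (nat p))"

lemma mv_degree_0: "mv_degree p 0"
  by (simp add: mv_degree_def subspace_0[OF subspace_ext_power])

lemma mv_degree_add: "\<lbrakk>mv_degree p P; mv_degree p Q\<rbrakk> \<Longrightarrow> mv_degree p (P + Q)"
  by (auto simp: mv_degree_def subspace_add[OF subspace_ext_power])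

lemma mv_degree_smul: "mv_degree p P \<Longrightarrow> mv_degree p (f \<odot> P)"
  by (auto simp: mv_degree_def subspace_scale[OF subspace_ext_power] fun_eq_iff split: if_splits)

lemma mv_degree_one: "mv_degree 0 one_mv"
  by (simp add: mv_degree_def one_mv wedge_list_ext_power)

lemma mv_degree_sec: "V \<in> \<Gamma> L \<Longrightarrow> mv_degree 1 (mv_of_sec L V)"
  by (simp add: mv_degree_def mv_of_sec_def wedge_list_ext_power sections_fibre)

lemma mv_degreeE:
  assumes "mv_degree p P"
  obtains "P = 0" | k where "p = int k" "\<And>x. P x \<in> ext_power (F x) k"
  using assms by (cases p rule: int_cases2) (auto simp: mv_degree_def split: if_splits)

lemma mv_wedge_apply: "mv_wedge L P Q x = wedge (F x) (P x) (Q x)"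
  by (simp add: mv_wedge_def)

lemma mv_wedge_0_left: "mv_wedge L 0 Q = 0"
  by (rule ext) (simp add: mv_wedge_apply wedge_0_left)

lemma mv_wedge_0_right:
  assumes "mv_degree p P"
  shows "mv_wedge L P 0 = 0"
  using assms
proof (cases rule: mv_degreeE)
  case 1
  then show ?thesis by (simp only: mv_wedge_0_left)
next
  case (2 k)
  show ?thesis by (rule ext) (simp add: mv_wedge_apply wedge_0_right[OF 2(2)])
qed

lemma mv_degree_wedge:
  assumes "mv_degree p P" "mv_degree q Q"
  shows "mv_degree (p + q) (mv_wedge L P Q)"
  using assms(1)
proof (cases rule: mv_degreeE)
  case 1
  then show ?thesis by (simp add: mv_wedge_0_left mv_degree_0)
next
  case p: (2 k)
  from assms(2) show ?thesis
  proof (cases rule: mv_degreeE)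
    case 1
    then show ?thesis by (simp add: mv_wedge_0_right[OF assms(1)] mv_degree_0)
  next
    case (2 l)
    then show ?thesis using p
      by (simp add: mv_degree_def mv_wedge_def wedge_ext_power nat_add_distrib)
  qed
qed

lemma mv_wedge_assoc:
  assumes "mv_degree p P" "mv_degree q Q" "mv_degree r R"
  shows "mv_wedge L (mv_wedge L P Q) R = mv_wedge L P (mv_wedge L Q R)"
proof -
  consider "P = 0" | "Q = 0" | "R = 0" | k l m where "\<And>x. P x \<in> ext_power (F x) k"
    "\<And>x. Q x \<in> ext_power (F x) l" "\<And>x. R x \<in> ext_power (F x) m"
    using assms by (metis mv_degreeE)
  then show ?thesis
  proof cases
    case (4 k l m)
    show ?thesis by (rule ext) (simp add: mv_wedge_apply wedge_assoc[OF 4])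
  qed (simp_all only: mv_wedge_0_left mv_wedge_0_right[OF assms(1)] mv_wedge_0_right[OF assms(2)]
      mv_wedge_0_right[OF mv_degree_wedge[OF assms(1,2)]])
qed

lemma wedge_one_left:
  assumes "P \<in> ext_power V p"
  shows "wedge V (wedge_list V []) P = P"
proof
  fix \<eta> show "wedge V (wedge_list V []) P \<eta> = P \<eta>"
    using ext_forms_partial[OF assms, of \<eta>] ext_power_outside[OF assms, of \<eta>]
    by (cases "\<eta> \<in> ext_forms V") (simp_all add: wedge_def wedge_list_def)
qed

lemma mv_wedge_add_left: "mv_wedge L (P + P') Q = mv_wedge L P Q + mv_wedge L P' Q"
proof
  fix x show "mv_wedge L (P + P') Q x = (mv_wedge L P Q + mv_wedge L P' Q) x"
    using wedge_lincomb_left'[of "F x" 1 "P x" "P' x" "Q x"] by (simp add: mv_wedge_apply)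
qed

lemma mv_wedge_smul_left: "mv_wedge L (f \<odot> P) Q = f \<odot> mv_wedge L P Q"
proof
  fix x show "mv_wedge L (f \<odot> P) Q x = (f \<odot> mv_wedge L P Q) x"
    using wedge_lincomb_left'[of "F x" "f x" "P x" 0 "Q x"]
    by (simp add: mv_wedge_apply wedge_0_left)
qed

lemma mv_wedge_fun_left: "mv_degree p P \<Longrightarrow> mv_wedge L (mv_of_fun L f) P = f \<odot> P"
proof -
  assume "mv_degree p P"
  then have "mv_wedge L one_mv P = P"
  proof (cases rule: mv_degreeE)
    case 1
    then show ?thesis by (simp only: mv_wedge_0_right[OF mv_degree_one])
  next
    case (2 k)
    show ?thesis unfolding one_mv by (rule ext) (simp add: mv_wedge_apply wedge_one_left[OF 2(2)])
  qed
  then show ?thesis by (simp only: mv_of_fun[of f] mv_wedge_smul_left)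
qed

lemma interior_prod_0: "interior_prod 0 \<eta> = 0"
  by (simp add: interior_prod_def contract_0 fun_eq_iff)

lemma interior_prod_add: "interior_prod (P + Q) \<eta> = interior_prod P \<eta> + interior_prod Q \<eta>"
  by (simp add: interior_prod_def contract_def fun_eq_iff)

lemma interior_prod_smul: "interior_prod (f \<odot> P) \<eta> = f \<odot> interior_prod P \<eta>"
  by (simp add: interior_prod_def contract_def fun_eq_iff)

lemma interior_prod_scaleR: "interior_prod (c *\<^sub>R P) \<eta> = c *\<^sub>R interior_prod P \<eta>"
  by (simp add: interior_prod_def contract_def fun_eq_iff)

lemma interior_prod_form_lincomb:
  assumes "mv_degree p P" "\<eta> \<in> \<Omega> L" "\<omega> \<in> \<Omega> L"
  shows "interior_prod P (c *\<^sub>R \<eta> + \<omega>) = c *\<^sub>R interior_prod P \<eta> + interior_prod P \<omega>"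
  using assms(1)
proof (cases rule: mv_degreeE)
  case 1
  then show ?thesis by (simp add: interior_prod_0)
next
  case (2 k)
  from contract_form_lincomb[OF 2(2) all_formfields_ext_forms[OF assms(2)]
      all_formfields_ext_forms[OF assms(3)], of _ c]
  show ?thesis by (simp add: interior_prod_def fun_eq_iff plus_fun_def scaleR_fun_def)
qed

lemma interior_prod_wedge:
  assumes "mv_degree p P" "mv_degree q Q" "\<eta> \<in> \<Omega> L"
  shows "interior_prod (mv_wedge L P Q) \<eta> = interior_prod P (interior_prod Q \<eta>)"
  using assms(1)
proof (cases rule: mv_degreeE)
  case 1
  then show ?thesis by (simp add: interior_prod_0 mv_wedge_0_left)
next
  case p: (2 k)
  from assms(2) show ?thesis
  proof (cases rule: mv_degreeE)
    case 1
    have "contract (P x) (\<lambda>_. 0) = (\<lambda>_. 0)" for x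
      by (simp add: contract_def foldr_contract_vec ext_power_zero_form[OF p(2)])
    with 1 show ?thesis
      by (simp add: interior_prod_0 mv_wedge_0_right[OF assms(1)])
          (simp add: interior_prod_def zero_fun_def)
  next
    case (2 l)
    from contract_wedge[OF p(2) 2(2) all_formfields_ext_forms[OF assms(3)]] show ?thesis
      by (simp add: interior_prod_def mv_wedge_def fun_eq_iff)
  qed
qed

lemma interior_prod_commute:
  assumes "mv_degree p P" "mv_degree q Q" "\<eta> \<in> \<Omega> L"
  shows "interior_prod P (interior_prod Q \<eta>) =
      ((-1) powi (p * q)) *\<^sub>R interior_prod Q (interior_prod P \<eta>)"
proof -
  have zero: "interior_prod P 0 = 0" if "mv_degree p P" for p P
    using that
  proof (cases rule: mv_degreeE)
    case (2 k)
    have "contract (P x) (\<lambda>_. 0) = (\<lambda>_. 0)" for x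
      by (simp add: contract_def foldr_contract_vec ext_power_zero_form[OF 2(2)])
    then show ?thesis by (simp add: interior_prod_def zero_fun_def)
  qed (simp add: interior_prod_0)
  from assms(1) show ?thesis
  proof (cases rule: mv_degreeE)
    case 1
    then show ?thesis by (simp add: interior_prod_0 zero[OF assms(2)])
  next
    case p: (2 k)
    from assms(2) show ?thesis
    proof (cases rule: mv_degreeE)
      case 1
      then show ?thesis by (simp add: interior_prod_0 zero[OF assms(1)])
    next
      case q: (2 l)
      have "(-1 :: real) powi (p * q) = (-1) ^ (k * l)"
        by (simp add: p(1) q(1) flip: power_int_of_nat of_nat_mult)
      with contract_commute[OF p(2) q(2) all_formfields_ext_forms[OF assms(3)]] show ?thesis
        by (simp add: interior_prod_def fun_eq_iff)
    qed
  qed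
qed

end

lemma wedge_sum_left: "wedge V (\<Sum>i\<in>I. c i *\<^sub>R P i) Q = (\<Sum>i\<in>I. c i *\<^sub>R wedge V (P i) Q)"
proof (induction I rule: infinite_finite_induct)
  case (insert i I)
  then show ?case by (simp only: sum.insert[OF insert(1,2)] wedge_lincomb_left')
qed (simp_all only: sum.infinite sum.empty not_False_eq_True wedge_0_left)

lemma wedge_sum_right:
  assumes "P \<in> ext_power V p" "\<And>i. i \<in> I \<Longrightarrow> Q i \<in> ext_power V q"
  shows "wedge V P (\<Sum>i\<in>I. c i *\<^sub>R Q i) = (\<Sum>i\<in>I. c i *\<^sub>R wedge V P (Q i))"
  using assms(2)
proof (induction I rule: infinite_finite_induct)
  case (insert i I)
  have 1: "(\<Sum>i\<in>I. c i *\<^sub>R Q i) \<in> ext_power V q"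
    using insert.prems by
        (intro subspace_sum[OF subspace_ext_power] subspace_scale[OF subspace_ext_power]) auto
  have 2: "Q i \<in> ext_power V q" using insert.prems by simp
  have 3: "wedge V P (\<Sum>i\<in>I. c i *\<^sub>R Q i) = (\<Sum>i\<in>I. c i *\<^sub>R wedge V P (Q i))"
    using insert.prems by (intro insert.IH) auto
  show ?case
    by (simp only: sum.insert[OF insert(1,2)] wedge_lincomb_right'[OF assms(1) 2 1] 3)
qed (simp_all only: sum.infinite sum.empty not_False_eq_True wedge_0_right[OF assms(1)])

section \<open>Fields generated by functions and sections\<close>

context lie_algebroid
begin

text \<open>The degree is an index of the predicate and not a function of the field, since 0 belongs
  to every degree, including the degree -1 in which the bracket of two functions lies. Sections are
  attached on the left one at a time, so that inductions meet a single kind of exterior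
  product.\<close>

inductive decomposable :: "int \<Rightarrow> ('m, 'v) mvfield \<Rightarrow> bool" where
  dec_zero: "decomposable p 0"
| dec_one: "decomposable 0 one_mv"
| dec_smul: "\<lbrakk>f \<in> C; decomposable p P\<rbrakk> \<Longrightarrow> decomposable p (f \<odot> P)"
| dec_sec_wedge: "\<lbrakk>V \<in> \<Gamma> L; decomposable p P\<rbrakk> \<Longrightarrow> decomposable (p + 1) (mv_wedge L (mv_of_sec L V) P)"
| dec_add: "\<lbrakk>decomposable p P; decomposable p Q\<rbrakk> \<Longrightarrow> decomposable p (P + Q)"

lemma dec_degree: "decomposable p P \<Longrightarrow> mv_degree p P"
proof (induction rule: decomposable.induct)
  case (dec_sec_wedge V p P)
  then show ?case using mv_degree_wedge[OF mv_degree_sec, of V p P] by (simp add: add.commute)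
qed (simp_all only: mv_degree_0 mv_degree_one mv_degree_smul mv_degree_add)

lemma dec_wedge:
  assumes "decomposable p P" "decomposable q Q"
  shows "decomposable (p + q) (mv_wedge L P Q)"
  using assms(1)
proof (induction rule: decomposable.induct)
  case (dec_zero p)
  then show ?case by (simp only: mv_wedge_0_left decomposable.dec_zero)
next
  case dec_one
  have "1 \<odot> Q = Q" by (simp add: fun_eq_iff)
  then show ?case using assms(2) mv_wedge_fun_left[OF dec_degree[OF assms(2)], of 1] by simp
next
  case (dec_smul f p P)
  then show ?case by (simp only: mv_wedge_smul_left decomposable.dec_smul)
next
  case (dec_sec_wedge V p P)
  have "mv_wedge L (mv_wedge L (mv_of_sec L V) P) Q = mv_wedge L (mv_of_sec L V) (mv_wedge L P Q)"
    by (rule mv_wedge_assoc[OF mv_degree_sec[OF dec_sec_wedge(1)] dec_degree[OF dec_sec_wedge(2)]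
        dec_degree[OF assms(2)]])
  then show ?case using decomposable.dec_sec_wedge[OF dec_sec_wedge(1,3)]
    by (simp add: algebra_simps)
next
  case (dec_add p P P')
  then show ?case by (simp only: mv_wedge_add_left decomposable.dec_add)
qed

lemma dec_scaleR: "decomposable p P \<Longrightarrow> decomposable p (c *\<^sub>R P)"
  using dec_smul[OF smooth_fun_const, of p P c] by (simp add: smul_def scaleR_fun_def)

lemma dec_sum: "(\<And>i. i \<in> I \<Longrightarrow> decomposable p (P i)) \<Longrightarrow> decomposable p (\<Sum>i\<in>I. P i)"
proof (induction I rule: infinite_finite_induct)
  case (insert i I)
  then show ?case by (simp only: sum.insert[OF insert(1,2)] dec_add insertI1 insertI2)
qed (simp_all only: sum.infinite sum.empty not_False_eq_True dec_zero)

lemma dec_fun: "f \<in> C \<Longrightarrow> decomposable 0 (mv_of_fun L f)"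
  using dec_smul[OF _ dec_one, of f] mv_of_fun[of f] by (simp del: mem_Collect_eq)

lemma mv_of_sec_wedge_one: "mv_wedge L (mv_of_sec L V) one_mv = mv_of_sec L V"
  by (rule ext) (simp add: mv_wedge_apply mv_of_sec_def one_mv wedge_wedge_list)

lemma dec_sec: "V \<in> \<Gamma> L \<Longrightarrow> decomposable 1 (mv_of_sec L V)"
  using dec_sec_wedge[OF _ dec_one, of V] by (simp add: mv_of_sec_wedge_one)

section \<open>Smoothness of multivector fields\<close>

lemma mvfields_int: "A\<^sup>\<bullet> L (int p) = sections (base L) (ext_bundle (bun L) p)"
  by (simp add: mvfields_def)

lemma mvfields_neg: "p < 0 \<Longrightarrow> A\<^sup>\<bullet> L p = {0}"
  by (simp add: mvfields_def)

lemma mvfields_degree: "P \<in> A\<^sup>\<bullet> L p \<Longrightarrow> mv_degree p P"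
  by (auto simp: mvfields_def mv_degree_def sections_def ext_bundle_def split: if_splits)

lemma ext_bundle_subspace: "subspace (fibre (ext_bundle (bun L) p) x)"
  by (simp add: ext_bundle_def subspace_ext_power)

lemma mvfields_add: "\<lbrakk>P \<in> A\<^sup>\<bullet> L p; Q \<in> A\<^sup>\<bullet> L p\<rbrakk> \<Longrightarrow> P + Q \<in> A\<^sup>\<bullet> L p"
  using sections_add[OF ext_bundle_subspace] by (auto simp: mvfields_def)

lemma mvfields_smul: "\<lbrakk>f \<in> C; P \<in> A\<^sup>\<bullet> L p\<rbrakk> \<Longrightarrow> f \<odot> P \<in> A\<^sup>\<bullet> L p"
  using sections_smul[OF ext_bundle_subspace] by (auto simp: mvfields_def fun_eq_iff)

lemma mvfields_scaleR: "P \<in> A\<^sup>\<bullet> L p \<Longrightarrow> c *\<^sub>R P \<in> A\<^sup>\<bullet> L p"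
  using mvfields_smul[OF smooth_fun_const, of P p c] by (simp add: smul_def scaleR_fun_def)

lemma mvfields_0: "0 \<in> A\<^sup>\<bullet> L p"
  using sections_zero[OF ext_bundle_subspace] by (auto simp: mvfields_def)

lemma mvfields_frame:
  assumes "P \<in> A\<^sup>\<bullet> L (int p)" "(W, e) \<in> frames (bun L)"
  obtains c where "\<And>I. I \<in> multi_indices (indices (bun L)) p \<Longrightarrow> smooth_on (base L) W (c I)"
    "\<And>x. x \<in> W \<Longrightarrow> P x = (\<Sum>I\<in>multi_indices (indices (bun L)) p. c I x *\<^sub>R ext_frame e I x)"
proof -
  have "(W, ext_frame e) \<in> frames (ext_bundle (bun L) p)"
    using assms(2) by (auto simp: ext_bundle_def)
  from sectionsE[OF assms(1)[unfolded mvfields_int] this] obtain c where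
    "\<And>I. I \<in> indices (ext_bundle (bun L) p) \<Longrightarrow> smooth_on (base L) W (c I)"
    "\<And>x. x \<in> W \<Longrightarrow> P x = (\<Sum>I\<in>indices (ext_bundle (bun L) p). c I x *\<^sub>R ext_frame e I x)"
    by blast
  then show ?thesis by (intro that[of c]) (simp_all add: ext_bundle_def)
qed

lemma mvfieldsI:
  assumes "mv_degree (int p) P"
    "\<And>W e. (W, e) \<in> frames (bun L) \<Longrightarrow>
        \<exists>c. (\<forall>I\<in>multi_indices (indices (bun L)) p. smooth_on (base L) W (c I)) \<and>
      (\<forall>x\<in>W. P x = (\<Sum>I\<in>multi_indices (indices (bun L)) p. c I x *\<^sub>R ext_frame e I x))"
  shows "P \<in> A\<^sup>\<bullet> L (int p)"
  unfolding mvfields_int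
proof (rule sectionsI)
  show "P x \<in> fibre (ext_bundle (bun L) p) x" for x
    using assms(1) by (simp add: mv_degree_def ext_bundle_def)
  fix W E assume "(W, E) \<in> frames (ext_bundle (bun L) p)"
  then obtain e where "E = ext_frame e" "(W, e) \<in> frames (bun L)" by (auto simp: ext_bundle_def)
  with assms(2) show "\<exists>c. (\<forall>i\<in>indices (ext_bundle (bun L) p). smooth_on (base L) W (c i)) \<and>
      (\<forall>x\<in>W. P x = (\<Sum>i\<in>indices (ext_bundle (bun L) p). c i x *\<^sub>R E i x))"
    by (simp add: ext_bundle_def)
qed

text \<open>Every point has its own local coefficients with respect to the frame \<open>e\<close>.
  They agree on overlaps because dual forms determine them, so they can be glued.\<close>

lemma mvfields_local:
  assumes "mv_degree p P" "\<And>x. \<exists>N Q. open N \<and> x \<in> N \<and> Q \<in> A\<^sup>\<bullet> L p \<and> (\<forall>y\<in>N. P y = Q y)"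
  shows "P \<in> A\<^sup>\<bullet> L p"
proof (cases "p < 0")
  case True
  then show ?thesis using assms(1) by (simp add: mv_degree_def mvfields_neg)
next
  case False
  define k where "k = nat p"
  with False have p: "p = int k" by simp
  show ?thesis unfolding p
  proof (rule mvfieldsI)
    show "mv_degree (int k) P" using assms(1) p by simp
    fix W e assume W: "(W, e) \<in> frames (bun L)"
    let ?M = "multi_indices (indices (bun L)) k"
    define R where "R x N c \<longleftrightarrow> open N \<and> x \<in> N \<and> (\<forall>I\<in>?M. smooth_on (base L) W (c I)) \<and>
        (\<forall>y\<in>N \<inter> W. P y = (\<Sum>I\<in>?M. c I y *\<^sub>R ext_frame e I y))" for x N c
    have "\<forall>x. \<exists>N c. R x N c"
    proof
      fix x
      obtain N Q where N: "open N" "x \<in> N" "Q \<in> A\<^sup>\<bullet> L (int k)" "\<And>y. y \<in> N \<Longrightarrow> P y = Q y"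
        using assms(2)[of x] p by blast
      obtain c where "\<And>I. I \<in> ?M \<Longrightarrow> smooth_on (base L) W (c I)"
        "\<And>x. x \<in> W \<Longrightarrow> Q x = (\<Sum>I\<in>?M. c I x *\<^sub>R ext_frame e I x)"
        by (rule mvfields_frame[OF N(3) W]) blast
      then have "R x N c" using N by (simp add: R_def)
      then show "\<exists>N c. R x N c" by blast
    qed
    then obtain N c where R: "\<And>x. R x (N x) (c x)" by metis
    have N: "open (N x)" "x \<in> N x" for x using R[of x] by (simp_all add: R_def)
    have Nsm: "smooth_on (base L) W (c x I)" if "I \<in> ?M" for x I using R[of x] that
      by (simp add: R_def)
    have NP: "P y = (\<Sum>I\<in>?M. c x I y *\<^sub>R ext_frame e I y)" if "y \<in> N x \<inter> W" for x y
      using R[of x] that unfolding R_def by blast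
    have eq: "c y I y = c x I y" if "I \<in> ?M" "y \<in> N x \<inter> W" for x y I
    proof -
      have "y \<in> W" "y \<in> N y \<inter> W" using that N(2)[of y] by auto
      have "(\<Sum>I\<in>?M. c y I y *\<^sub>R ext_frame e I y) = (\<Sum>I\<in>?M. c x I y *\<^sub>R ext_frame e I y)"
        using NP[OF \<open>y \<in> N y \<inter> W\<close>] NP[OF that(2)] by (rule trans[OF sym])
      then show ?thesis
        by (intro ext_frame_coefficient[where c = "\<lambda>I. c y I y" and d = "\<lambda>I. c x I y",
            OF W \<open>y \<in> W\<close> that(1)]) (simp only:)
    qed
    show "\<exists>c. (\<forall>I\<in>?M. smooth_on (base L) W (c I)) \<and>
        (\<forall>x\<in>W. P x = (\<Sum>I\<in>?M. c I x *\<^sub>R ext_frame e I x))"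
    \<comment> \<open>At each point the coefficients belonging to that very point are used; near
      \<open>x\<close> they coincide with \<open>c x\<close>, which makes them smooth.\<close>
    proof (intro exI[of _ "\<lambda>I x. c x I x"] conjI ballI)
      fix I assume I: "I \<in> ?M"
      show "smooth_on (base L) W (\<lambda>x. c x I x)"
      proof (rule smooth_on_local[OF frame_domain[OF W]])
        fix x assume x: "x \<in> W"
        have "smooth_on (base L) (W \<inter> N x) (\<lambda>x. c x I x)"
          by (rule smooth_on_cong[OF _ _ smooth_on_subset[OF Nsm[OF I, of x]]])
            (use frame_domain[OF W] N(1) eq[OF I] in auto)
        then show "\<exists>N. open N \<and> x \<in> N \<and> smooth_on (base L) (W \<inter> N) (\<lambda>x. c x I x)" using N by blast
      qed
    next
      fix x assume "x \<in> W"
      then show "P x = (\<Sum>I\<in>?M. c x I x *\<^sub>R ext_frame e I x)" using NP[of x x] N(2)[of x] by simp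
    qed
  qed
qed

lemma mvfields_one: "one_mv \<in> A\<^sup>\<bullet> L 0"
proof -
  have "one_mv \<in> A\<^sup>\<bullet> L (int 0)"
  proof (rule mvfieldsI)
    show "mv_degree (int 0) one_mv" using mv_degree_one by simp
    have M: "multi_indices (indices (bun L)) 0 = {[]}" by (auto simp: multi_indices_def)
    show "\<exists>c. (\<forall>I\<in>multi_indices (indices (bun L)) 0. smooth_on (base L) W (c I)) \<and>
      (\<forall>x\<in>W. one_mv x = (\<Sum>I\<in>multi_indices (indices (bun L)) 0. c I x *\<^sub>R ext_frame e I x))" for W e
      unfolding M by (intro exI[of _ "\<lambda>_ _. 1"]) (simp add: one_mv)
  qed
  then show ?thesis by simp
qed

text \<open>Multiplying out in the frame produces index lists \<open>i # I\<close> that are not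
  increasing in general and have to be sorted.\<close>

lemma mvfields_sec_wedge:
  assumes V: "V \<in> \<Gamma> L" and P: "P \<in> A\<^sup>\<bullet> L (int p)"
  shows "mv_wedge L (mv_of_sec L V) P \<in> A\<^sup>\<bullet> L (int (Suc p))"
proof (rule mvfieldsI)
  show "mv_degree (int (Suc p)) (mv_wedge L (mv_of_sec L V) P)"
    using mv_degree_wedge[OF mv_degree_sec[OF V] mvfields_degree[OF P]] by simp
  fix W e assume W: "(W, e) \<in> frames (bun L)"
  let ?K = "indices (bun L)" let ?M = "multi_indices ?K p" and ?M' = "multi_indices ?K (Suc p)"
  let ?srt = "\<lambda>J :: nat list. sorted_list_of_set (set J)"
  obtain c where c: "\<And>I. I \<in> ?M \<Longrightarrow> smooth_on (base L) W (c I)"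
    "\<And>x. x \<in> W \<Longrightarrow> P x = (\<Sum>I\<in>?M. c I x *\<^sub>R ext_frame e I x)"
    by (rule mvfields_frame[OF P W]) blast
  define a where "a i x = frame_coord e i x (V x)" for i x
  \<comment> \<open>Chosen once for each index list and independent of the point, as
    \<open>alternating_on_sort\<close> allows.\<close>
  define s where "s J = (SOME c::real. (c \<noteq> 0 \<longrightarrow> distinct J) \<and> (\<forall>(f :: nat \<Rightarrow> 'v) A \<alpha>.
    alternating_on A \<alpha> \<longrightarrow> f ` set J \<subseteq> A \<longrightarrow> \<alpha> (map f J) = c * \<alpha> (map f (?srt J))))" for J
  have s: "(s J \<noteq> 0 \<longrightarrow> distinct J) \<and> (\<forall>(f :: nat \<Rightarrow> 'v) A \<alpha>.
    alternating_on A \<alpha> \<longrightarrow> f ` set J \<subseteq> A \<longrightarrow> \<alpha> (map f J) = s J * \<alpha> (map f (?srt J)))" for J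
    unfolding s_def by (rule someI_ex[OF alternating_on_sort])
  have sort: "ext_frame e J x = s J *\<^sub>R ext_frame e (?srt J) x" if "x \<in> W" "set J \<subseteq> ?K" for J x
  proof
    fix \<eta>
    have sub: "(\<lambda>i. e i x) ` set J \<subseteq> F x" using frame_fibre[OF W that(1)] that(2) by auto
    show "ext_frame e J x \<eta> = (s J *\<^sub>R ext_frame e (?srt J) x) \<eta>"
      using conjunct2[OF s, rule_format, OF ext_forms_alternating sub] by (simp add: wedge_list_def)
  qed
  \<comment> \<open>All pairs whose sorted index list is \<open>J\<close> contribute to the
    coefficient at \<open>J\<close>; the sums below are a regrouping.\<close>
  define c' where "c' J x =
    (\<Sum>i\<in>?K. \<Sum>I\<in>?M. if ?srt (i # I) = J then s (i # I) * (a i x * c I x) else 0)" for J x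
  have "smooth_on (base L) W (c' J)" for J
  proof -
    have "smooth_on (base L) W (\<lambda>x. if ?srt (i # I) = J then s (i # I) * (a i x * c I x) else 0)"
      if "i \<in> ?K" "I \<in> ?M" for i I
      using that c(1) frame_coord_smooth[OF W V]
      by (cases "?srt (i # I) = J") (auto simp: a_def intro!: smooth_on_mult)
    then show ?thesis unfolding c'_def by (intro smooth_on_sum)
  qed
  moreover have "mv_wedge L (mv_of_sec L V) P x = (\<Sum>J\<in>?M'. c' J x *\<^sub>R ext_frame e J x)"
      if x: "x \<in> W" for x
  proof -
    have Vx: "V x = (\<Sum>i\<in>?K. a i x *\<^sub>R e i x)"
      unfolding a_def by (rule frame_expansion[OF W x sections_fibre[OF V]])
    have "wedge_list (F x) [V x] = (\<Sum>i\<in>?K. a i x *\<^sub>R wedge_list (F x) [e i x])"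
      unfolding Vx by (rule
          wedge_list_singleton_sum[OF fibre_subspace finite_rank frame_fibre[OF W x]])
    then have "mv_wedge L (mv_of_sec L V) P x =
        wedge (F x) (\<Sum>i\<in>?K. a i x *\<^sub>R wedge_list (F x) [e i x]) (\<Sum>I\<in>?M. c I x *\<^sub>R ext_frame e I x)"
      by (simp only: mv_wedge_apply mv_of_sec_def c(2)[OF x])
    also have "\<dots> = (\<Sum>i\<in>?K.
        a i x *\<^sub>R wedge (F x) (wedge_list (F x) [e i x]) (\<Sum>I\<in>?M. c I x *\<^sub>R ext_frame e I x))"
      by (rule wedge_sum_left)
    also have "\<dots> = (\<Sum>i\<in>?K. \<Sum>I\<in>?M. (s (i # I) * (a i x * c I x)) *\<^sub>R ext_frame e (?srt (i # I)) x)"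
    proof (rule sum.cong[OF refl])
      fix i assume i: "i \<in> ?K"
      have "wedge (F x) (wedge_list (F x) [e i x]) (\<Sum>I\<in>?M. c I x *\<^sub>R ext_frame e I x) =
          (\<Sum>I\<in>?M. c I x *\<^sub>R wedge (F x) (wedge_list (F x) [e i x]) (ext_frame e I x))"
        by (rule wedge_sum_right[where p = 1 and q = p])
          (use i frame_fibre[OF W x] in
            \<open>auto intro!: wedge_list_ext_power simp: multi_indices_def subset_iff\<close>)
      also have "\<dots> = (\<Sum>I\<in>?M. c I x *\<^sub>R s (i # I) *\<^sub>R ext_frame e (?srt (i # I)) x)"
      proof (rule sum.cong[OF refl])
        fix I assume "I \<in> ?M"
        then have "set (i # I) \<subseteq> ?K" using i by (auto simp: multi_indices_def)
        from sort[OF x this] show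
            "c I x *\<^sub>R wedge (F x) (wedge_list (F x) [e i x]) (ext_frame e I x) =
            c I x *\<^sub>R s (i # I) *\<^sub>R ext_frame e (?srt (i # I)) x"
          by (simp only: wedge_wedge_list list.map append_Cons append_Nil)
      qed
      finally show "a i x *\<^sub>R wedge (F x) (wedge_list (F x) [e i x]) (\<Sum>I\<in>?M.
          c I x *\<^sub>R ext_frame e I x) =
          (\<Sum>I\<in>?M. (s (i # I) * (a i x * c I x)) *\<^sub>R ext_frame e (?srt (i # I)) x)"
        by (simp only: scaleR_sum_right scaleR_scaleR) (simp only: mult_ac)
    qed
    also have "\<dots> = (\<Sum>i\<in>?K. \<Sum>I\<in>?M. \<Sum>J\<in>?M'.
        (if ?srt (i # I) = J then s (i # I) * (a i x * c I x) else 0) *\<^sub>R ext_frame e J x)"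
    proof (intro sum.cong[OF refl])
      fix i I assume iI: "i \<in> ?K" "I \<in> ?M"
      have fin: "finite ?M'" by (rule finite_multi_indices[OF finite_rank])
      have "(\<Sum>J\<in>?M'. (if ?srt (i # I) =
          J then s (i # I) * (a i x * c I x) else 0) *\<^sub>R ext_frame e J x) =
          (\<Sum>J\<in>?M'. if ?srt (i # I) = J then (s (i # I) * (a i x * c I x)) *\<^sub>R ext_frame e J x else
            0)"
        by (rule sum.cong[OF refl]) simp
      also have "\<dots> = (if ?srt (i # I) \<in>
          ?M' then (s (i # I) * (a i x * c I x)) *\<^sub>R ext_frame e (?srt (i # I)) x else 0)"
        by (rule sum.delta'[OF fin])
      also have "\<dots> = (s (i # I) * (a i x * c I x)) *\<^sub>R ext_frame e (?srt (i # I)) x"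
      proof (cases "?srt (i # I) \<in> ?M'")
        case False
        \<comment> \<open>If \<open>i\<close> occurs in \<open>I\<close>, sorting shortens the list
          and leads out of \<open>?M'\<close>, but then the constant is 0.\<close>
        have "s (i # I) = 0"
        proof (rule ccontr)
          assume "s (i # I) \<noteq> 0"
          then have "distinct (i # I)" using s[of "i # I"] by blast
          then have "length (?srt (i # I)) = length (i # I)"
            by (simp only: length_sorted_list_of_set distinct_card)
          then have "?srt (i # I) \<in> ?M'" using iI
            by (simp add: multi_indices_def del: sorted_list_of_set_insert_remove)
          with False show False ..
        qed
        then show ?thesis by simp
      qed simp
      finally show "(s (i # I) * (a i x * c I x)) *\<^sub>R ext_frame e (?srt (i # I)) x = (\<Sum>J\<in>?M'.
        (if ?srt (i # I) = J then s (i # I) * (a i x * c I x) else 0) *\<^sub>R ext_frame e J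
          x)" by (rule sym)
    qed
    also have "\<dots> = (\<Sum>i\<in>?K. \<Sum>J\<in>?M'. \<Sum>I\<in>?M.
        (if ?srt (i # I) = J then s (i # I) * (a i x * c I x) else 0) *\<^sub>R ext_frame e J x)"
      by (rule sum.cong[OF refl], rule sum.swap)
    also have "\<dots> = (\<Sum>J\<in>?M'. \<Sum>i\<in>?K. \<Sum>I\<in>?M.
        (if ?srt (i # I) = J then s (i # I) * (a i x * c I x) else 0) *\<^sub>R ext_frame e J x)"
      by (rule sum.swap)
    also have "\<dots> = (\<Sum>J\<in>?M'. c' J x *\<^sub>R ext_frame e J x)"
      unfolding c'_def scaleR_sum_left ..
    finally show ?thesis .
  qed
  ultimately show "\<exists>c. (\<forall>I\<in>?M'. smooth_on (base L) W (c I)) \<and>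
      (\<forall>x\<in>W. mv_wedge L (mv_of_sec L V) P x = (\<Sum>I\<in>?M'. c I x *\<^sub>R ext_frame e I x))" by blast
qed

lemma dec_mvfields: "decomposable p P \<Longrightarrow> P \<in> A\<^sup>\<bullet> L p"
proof (induction rule: decomposable.induct)
  case (dec_sec_wedge V p P)
  show ?case
  proof (cases "p < 0")
    case True
    then have "P = 0" using dec_sec_wedge(3) by (simp add: mvfields_neg)
    then show ?thesis by (simp only: mv_wedge_0_right[OF mv_degree_sec[OF dec_sec_wedge(1)]]
        mvfields_0)
  next
    case False
    then show ?thesis using mvfields_sec_wedge[OF dec_sec_wedge(1), of P "nat p"] dec_sec_wedge(3)
      by (simp add: add.commute)
  qed
qed (simp_all only: mvfields_0 mvfields_one mvfields_smul mvfields_add)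

text \<open>Cut-off coefficients and cut-off frame sections are global, and they agree with the
  original ones where the cutoff is 1.\<close>

lemma mvfields_local_dec:
  assumes "P \<in> A\<^sup>\<bullet> L p"
  obtains N Q where "open N" "x \<in> N" "decomposable p Q" "\<And>y. y \<in> N \<Longrightarrow> P y = Q y"
proof (cases "p < 0")
  case True
  then have "P = 0" using assms by (simp add: mvfields_neg)
  then show ?thesis using that[of UNIV 0] dec_zero by simp
next
  case False
  define k where "k = nat p"
  with False have p: "p = int k" by simp
  let ?M = "multi_indices (indices (bun L)) k"
  obtain W e where W: "(W, e) \<in> frames (bun L)" "x \<in> W" by (rule frame_at)
  obtain h N K where h: "h \<in> C" "open N" "x \<in> N" "closed K" "K \<subseteq> W" "N \<subseteq> K"
    "\<And>y. y \<in> N \<Longrightarrow> h y = 1" "\<And>y. y \<notin> K \<Longrightarrow> h y = 0"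
    using plateau_function[OF frame_domain[OF W(1)] W(2)] by metis
  obtain c where c: "\<And>I. I \<in> ?M \<Longrightarrow> smooth_on (base L) W (c I)"
    "\<And>x. x \<in> W \<Longrightarrow> P x = (\<Sum>I\<in>?M. c I x *\<^sub>R ext_frame e I x)"
    by (rule mvfields_frame[OF assms[unfolded p] W(1)]) blast
  have ext: "decomposable (int (length I)) (ext_frame (\<lambda>i. h \<odot> e i) I)" if "set I \<subseteq> indices (bun L)"
      for I
    using that
  proof (induction I)
    case Nil
    show ?case using dec_one by (simp add: one_mv)
  next
    case (Cons i I)
    have "decomposable (int (length I) +
        1) (mv_wedge L (mv_of_sec L (h \<odot> e i)) (ext_frame (\<lambda>i. h \<odot> e i) I))"
      using Cons sec_frame_extend[OF W(1) _ h(1,4,5,8), of i] by (intro dec_sec_wedge) auto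
    moreover have "mv_wedge L (mv_of_sec L (h \<odot> e i)) (ext_frame (\<lambda>i. h \<odot> e i) I) =
        ext_frame (\<lambda>i. h \<odot> e i) (i # I)"
      by (rule ext) (simp add: mv_wedge_apply mv_of_sec_def wedge_wedge_list)
    ultimately show ?case by (simp add: add.commute)
  qed
  define Q where "Q = (\<Sum>I\<in>?M. (\<lambda>x. h x * c I x) \<odot> ext_frame (\<lambda>i. h \<odot> e i) I)"
  have "decomposable p Q" unfolding Q_def p
  proof (rule dec_sum)
    fix I assume I: "I \<in> ?M"
    then have "int k = int (length I)" "set I \<subseteq> indices (bun L)" by (auto simp: multi_indices_def)
    then have "decomposable (int k) (ext_frame (\<lambda>i. h \<odot> e i) I)" using ext[of I] by (simp only:)
    then show "decomposable (int k) ((\<lambda>x. h x * c I x) \<odot> ext_frame (\<lambda>i. h \<odot> e i) I)"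
    proof (rule dec_smul[rotated])
      show "(\<lambda>x. h x * c I x) \<in> C"
        using smooth_fun_extend[OF h(1) frame_domain[OF W(1)] h(4,5,8) c(1)[OF I]] .
    qed
  qed
  moreover have "P y = Q y" if "y \<in> N" for y
    using c(2)[of y] h(5,6) h(7)[OF that] that by (auto simp: Q_def sum_fun_apply comp_def)
  ultimately show ?thesis using that[of N Q] h by blast
qed

text \<open>Smoothness is local and decomposable fields are closed under products, so the only
  computation with coefficients is the one for a single section in
  \<open>mvfields_sec_wedge\<close>.\<close>

lemma mvfields_wedge:
  assumes "P \<in> A\<^sup>\<bullet> L p" "Q \<in> A\<^sup>\<bullet> L q"
  shows "mv_wedge L P Q \<in> A\<^sup>\<bullet> L (p + q)"
proof (rule mvfields_local)
  show "mv_degree (p + q) (mv_wedge L P Q)"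
    using mvfields_degree[OF assms(1)] mvfields_degree[OF assms(2)] by (rule mv_degree_wedge)
  fix x
  obtain N P' where P': "open N" "x \<in> N" "decomposable p P'" "\<And>y. y \<in> N \<Longrightarrow> P y = P' y"
    by (rule mvfields_local_dec[OF assms(1)]) blast
  obtain N' Q' where Q': "open N'" "x \<in> N'" "decomposable q Q'" "\<And>y. y \<in> N' \<Longrightarrow> Q y = Q' y"
    by (rule mvfields_local_dec[OF assms(2)]) blast
  show "\<exists>N R. open N \<and> x \<in> N \<and> R \<in> A\<^sup>\<bullet> L (p + q) \<and> (\<forall>y\<in>N. mv_wedge L P Q y = R y)"
    using P' Q' dec_mvfields[OF dec_wedge[OF P'(3) Q'(3)]]
    by (intro exI[of _ "N \<inter> N'"] exI[of _ "mv_wedge L P' Q'"]) (auto simp: mv_wedge_apply)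
qed

lemma mvfields_eqI_pairing:
  assumes "P \<in> A\<^sup>\<bullet> L p" "Q \<in> A\<^sup>\<bullet> L p" "\<And>\<eta>. \<eta> \<in> \<Omega>\<^sup>\<bullet> L p \<Longrightarrow> P x (\<eta> x) = Q x (\<eta> x)"
  shows "P x = Q x"
proof (cases "p < 0")
  case True
  then show ?thesis using assms by (simp add: mvfields_neg)
next
  case False
  define k where "k = nat p"
  with False have p: "p = int k" by simp
  let ?M = "multi_indices (indices (bun L)) k"
  obtain W e where W: "(W, e) \<in> frames (bun L)" "x \<in> W" by (rule frame_at)
  obtain c where c: "\<And>x. x \<in> W \<Longrightarrow> P x = (\<Sum>I\<in>?M. c I x *\<^sub>R ext_frame e I x)"
    by (rule mvfields_frame[OF assms(1)[unfolded p] W(1)]) blast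
  obtain d where d: "\<And>x. x \<in> W \<Longrightarrow> Q x = (\<Sum>I\<in>?M. d I x *\<^sub>R ext_frame e I x)"
    by (rule mvfields_frame[OF assms(2)[unfolded p] W(1)]) blast
  have "c I x = d I x" if "I \<in> ?M" for I
    using c[OF W(2)] d[OF W(2)] assms(3) p
    by (intro ext_frame_coefficient[OF W that, of "\<lambda>I. c I x" "\<lambda>I. d I x"]) simp
  then show ?thesis using c[OF W(2)] d[OF W(2)] by simp
qed

text \<open>By \<open>contract_Nil\<close> the contraction determines the pairing. Everything is
  stated at one point \<open>x\<close>, because brackets constructed on different open sets are
  compared only on their overlap.\<close>

lemma mvfields_eqI:
  assumes "P \<in> A\<^sup>\<bullet> L p" "Q \<in> A\<^sup>\<bullet> L p" "\<And>\<eta>. \<eta> \<in> \<Omega> L \<Longrightarrow> interior_prod P \<eta> x = interior_prod Q \<eta> x"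
  shows "P x = Q x"
proof (rule mvfields_eqI_pairing[OF assms(1,2)])
  fix \<eta> assume "\<eta> \<in> \<Omega>\<^sup>\<bullet> L p"
  then have \<eta>: "\<eta> \<in> \<Omega> L" by (rule formfields_all)
  show "P x (\<eta> x) = Q x (\<eta> x)"
  proof (cases "p < 0")
    case True
    then show ?thesis using assms by (simp add: mvfields_neg)
  next
    case False
    then have "P x \<in> ext_power (F x) (nat p)" "Q x \<in> ext_power (F x) (nat p)"
      using mvfields_degree[OF assms(1)] mvfields_degree[OF assms(2)] by (auto simp: mv_degree_def)
    then show ?thesis
      using contract_Nil[of "P x" "F x" "nat p" "\<eta> x"] contract_Nil[of "Q x" "F x" "nat p" "\<eta> x"]
        all_formfields_ext_forms[OF \<eta>, of x] assms(3)[OF \<eta>] by (simp add: interior_prod_def)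
  qed
qed

end

section \<open>The bracket as an operator identity\<close>

text \<open>Reduces signs to parities; the graded identities below are then checked by cases on the
  parities of the degrees.\<close>

lemma minus_one_powi: "(-1 :: real) powi m = (if even m then 1 else -1)"
  by (cases "even m") (simp_all add: power_int_minus_left_even power_int_minus_left_odd)

context lie_algebroid
begin

lemma all_formfields_subspace: "subspace (\<Omega> L)"
  by (simp add: all_formfields_def)

lemma form_field_smul:
  assumes "f \<in> C" "form_field \<eta>"
  shows "form_field (f \<odot> \<eta>)"
proof -
  have "eval_form (f \<odot> \<eta>) = (\<lambda>Vs. f * eval_form \<eta> Vs)" by (intro ext) (simp add: eval_form_def)
  moreover have "list_form (\<lambda>Vs. f * eval_form \<eta> Vs)"
    using assms(2) list_form_times[OF assms(1)] by (simp add: form_field_def)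
  ultimately show ?thesis using assms(2) by (simp add: form_field_def)
qed

lemma eval_form_smul: "eval_form (f \<odot> \<eta>) Vs = f * eval_form \<eta> Vs"
  by (intro ext) (simp add: eval_form_def)

lemma all_formfields_smul: "\<lbrakk>f \<in> C; \<eta> \<in> \<Omega> L\<rbrakk> \<Longrightarrow> f \<odot> \<eta> \<in> \<Omega> L"
  unfolding all_formfields_iff using form_field_smul
  by (metis scaleR_fun_apply smul_apply scaleR_zero_right)

lemma interior_one: "\<eta> \<in> \<Omega> L \<Longrightarrow> interior_prod one_mv \<eta> = \<eta>"
  using contract_wedge_list_apply[OF all_formfields_ext_forms[of \<eta>], of _ "[]"]
  by (intro ext) (simp add: interior_prod_def one_mv)

lemma interior_fun: "\<eta> \<in> \<Omega> L \<Longrightarrow> interior_prod (mv_of_fun L f) \<eta> = f \<odot> \<eta>"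
  by (simp only: mv_of_fun[of f] interior_prod_smul interior_one)

lemma interior_sec: "\<eta> \<in> \<Omega> L \<Longrightarrow> interior_prod (mv_of_sec L V) \<eta> = (\<lambda>x ws. \<eta> x (V x # ws))"
  using contract_wedge_list_apply[OF all_formfields_ext_forms[of \<eta>]]
  by (intro ext) (simp add: interior_prod_def mv_of_sec_def)

lemma eval_interior_sec:
    "\<eta> \<in> \<Omega> L \<Longrightarrow> eval_form (interior_prod (mv_of_sec L V) \<eta>) = insert_sec V (eval_form \<eta>)"
  by (intro ext) (simp add: interior_sec eval_form_def)

lemma interior_sec_closed:
  assumes "V \<in> \<Gamma> L" "\<eta> \<in> \<Omega> L"
  shows "interior_prod (mv_of_sec L V) \<eta> \<in> \<Omega> L"
proof -
  have \<eta>: "list_form (eval_form \<eta>)" "\<And>x vs. \<not> set vs \<subseteq> F x \<Longrightarrow> \<eta> x vs = 0"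
    using assms(2) by (auto simp: all_formfields_iff form_field_def)
  obtain n where n: "\<And>x vs. length vs > n \<Longrightarrow> \<eta> x vs = 0" using assms(2)
    by (auto simp: all_formfields_iff)
  have "form_field (interior_prod (mv_of_sec L V) \<eta>)"
    unfolding form_field_def eval_interior_sec[OF assms(2)]
    using list_form_insert[OF \<eta>(1) assms(1)] \<eta>(2) by (simp add: interior_sec[OF assms(2)])
  moreover have "interior_prod (mv_of_sec L V) \<eta> x vs = 0" if "length vs > n" for x vs
    using n[of "V x # vs" x] that by (simp add: interior_sec[OF assms(2)])
  ultimately show ?thesis unfolding all_formfields_iff by blast
qed

lemma dec_interior: "\<lbrakk>decomposable p P; \<eta> \<in> \<Omega> L\<rbrakk> \<Longrightarrow> interior_prod P \<eta> \<in> \<Omega> L"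
proof (induction rule: decomposable.induct)
  case (dec_zero p)
  then show ?case by (simp only: interior_prod_0 subspace_0[OF all_formfields_subspace])
next
  case dec_one
  then show ?case by (simp only: interior_one)
next
  case (dec_smul f p P)
  then show ?case by (simp only: interior_prod_smul all_formfields_smul)
next
  case (dec_sec_wedge V p P)
  then show ?case
    by (simp only: interior_prod_wedge[OF mv_degree_sec[OF dec_sec_wedge(1)]
        dec_degree[OF dec_sec_wedge(2)]]
        interior_sec_closed)
next
  case (dec_add p P Q)
  then show ?case by (simp only: interior_prod_add subspace_add[OF all_formfields_subspace])
qed

text \<open>Smoothness is local and the algebraic conditions are pointwise. This transfers closure
  under contraction from decomposable fields to arbitrary smooth ones.\<close>

lemma form_field_local:
  assumes "\<And>x. \<exists>N \<omega>. open N \<and> x \<in> N \<and> form_field \<omega> \<and> (\<forall>y\<in>N. \<eta> y = \<omega> y)"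
  shows "form_field \<eta>"
proof -
  have at: "\<exists>\<omega>. form_field \<omega> \<and> \<eta> x = \<omega> x" for x using assms[of x] by blast
  have eval: "eval_form \<eta> Vs x = eval_form \<omega> Vs x" if "\<eta> x = \<omega> x" for \<omega> x Vs
    using that by (simp add: eval_form_def)
  have "list_form (eval_form \<eta>)"
  proof (rule list_formI)
    fix Vs assume Vs: "set Vs \<subseteq> \<Gamma> L"
    have "smooth_on (base L) UNIV (eval_form \<eta> Vs)"
    proof (rule smooth_on_local)
      fix x :: 'm
      obtain N \<omega> where N: "open N" "x \<in> N" "form_field \<omega>" "\<And>y. y \<in> N \<Longrightarrow> \<eta> y = \<omega> y"
        using assms[of x] by blast
      have "eval_form \<omega> Vs \<in> C"
        using N(3) unfolding form_field_def by (intro list_form_smooth[of "eval_form \<omega>"] Vs) blast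
      then have "smooth_on (base L) (UNIV \<inter> N) (eval_form \<eta> Vs)"
        using N by (intro smooth_on_cong[OF _ _ smooth_on_UNIV, of _ "eval_form \<omega> Vs"])
            (simp_all add: eval_form_def)
      then show "\<exists>N. open N \<and> x \<in> N \<and> smooth_on (base L) (UNIV \<inter> N) (eval_form \<eta> Vs)" using N
        by blast
    qed simp
    then show "eval_form \<eta> Vs \<in> C" by simp
  next
    show "alternating_on (\<Gamma> L) (eval_form \<eta>)"
      unfolding alternating_on_def
    proof (intro allI impI ext)
      fix us v w ws x assume *: "set us \<union> {v, w} \<union> set ws \<subseteq> \<Gamma> L"
      obtain \<omega> where \<omega>: "form_field \<omega>" "\<eta> x = \<omega> x" using at by blast
      have "eval_form \<omega> (us @ w # v # ws) = - eval_form \<omega> (us @ v # w # ws)"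
        using * \<omega>(1) unfolding form_field_def by (intro alternating_onD[OF list_form_alt]) auto
      from fun_cong[OF this, of x]
      show "eval_form \<eta> (us @ w # v # ws) x = (- eval_form \<eta> (us @ v # w # ws)) x"
        by (simp add: eval[of x \<omega>, OF \<omega>(2)])
    qed
  next
    fix V W Vs assume *: "V \<in> \<Gamma> L" "W \<in> \<Gamma> L" "set Vs \<subseteq> \<Gamma> L"
    show "eval_form \<eta> ((V + W) # Vs) = eval_form \<eta> (V # Vs) + eval_form \<eta> (W # Vs)"
    proof
      fix x
      obtain \<omega> where \<omega>: "form_field \<omega>" "\<eta> x = \<omega> x" using at by blast
      show "eval_form \<eta> ((V + W) # Vs) x = (eval_form \<eta> (V # Vs) + eval_form \<eta> (W # Vs)) x"
        using \<omega>(1) list_form_add[of "eval_form \<omega>", OF _ *] unfolding form_field_def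
        by (simp add: eval[of x \<omega>, OF \<omega>(2)])
    qed
  next
    fix f V Vs assume *: "f \<in> C" "V \<in> \<Gamma> L" "set Vs \<subseteq> \<Gamma> L"
    show "eval_form \<eta> ((f \<odot> V) # Vs) = f * eval_form \<eta> (V # Vs)"
    proof
      fix x
      obtain \<omega> where \<omega>: "form_field \<omega>" "\<eta> x = \<omega> x" using at by blast
      show "eval_form \<eta> ((f \<odot> V) # Vs) x = (f * eval_form \<eta> (V # Vs)) x"
        using \<omega>(1) list_form_smul[of "eval_form \<omega>", OF _ *] unfolding form_field_def
        by (simp add: eval[of x \<omega>, OF \<omega>(2)])
    qed
  qed
  moreover have "\<eta> x vs = 0" if "\<not> set vs \<subseteq> F x" for x vs
    using at[of x] that unfolding form_field_def by metis
  ultimately show ?thesis by (simp add: form_field_def)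
qed

lemma interior_closed:
  assumes "P \<in> A\<^sup>\<bullet> L p" "\<eta> \<in> \<Omega> L"
  shows "interior_prod P \<eta> \<in> \<Omega> L"
proof -
  obtain n where n: "\<And>x vs. length vs > n \<Longrightarrow> \<eta> x vs = 0" using assms(2)
    by (auto simp: all_formfields_iff)
  have "form_field (interior_prod P \<eta>)"
  proof (rule form_field_local)
    fix x
    obtain N Q where Q: "open N" "x \<in> N" "decomposable p Q" "\<And>y. y \<in> N \<Longrightarrow> P y = Q y"
      by (rule mvfields_local_dec[OF assms(1)]) blast
    have "form_field (interior_prod Q \<eta>)"
      using dec_interior[OF Q(3) assms(2)] by (simp add: all_formfields_iff)
    then show "\<exists>N \<omega>. open N \<and> x \<in> N \<and> form_field \<omega> \<and> (\<forall>y\<in>N. interior_prod P \<eta> y = \<omega> y)"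
      using Q by (intro exI[of _ N] exI[of _ "interior_prod Q \<eta>"]) (simp add: interior_prod_def)
  qed
  moreover have "interior_prod P \<eta> x vs = 0" if "length vs > n" for x vs
  proof -
    have "P x (\<lambda>_. 0) = 0"
      using mvfields_degree[OF assms(1)]
    proof (cases rule: mv_degreeE)
      case (2 k)
      show ?thesis by (rule ext_power_zero_form[OF 2(2)])
    qed simp
    then show ?thesis using n that by (simp add: interior_prod_def contract_def foldr_contract_vec)
  qed
  ultimately show ?thesis unfolding all_formfields_iff by blast
qed

section \<open>Linear operators on forms\<close>

abbreviation \<open>d \<equiv> ext_deriv L\<close>

lemma all_formfields_eqI:
  "\<lbrakk>\<eta> \<in> \<Omega> L; \<omega> \<in> \<Omega> L; \<And>Vs. set Vs \<subseteq> \<Gamma> L \<Longrightarrow> eval_form \<eta> Vs = eval_form \<omega> Vs\<rbrakk> \<Longrightarrow> \<eta> = \<omega>"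
  using form_field_eqI by (simp add: all_formfields_iff)

lemma list_form_eval: "\<eta> \<in> \<Omega> L \<Longrightarrow> list_form (eval_form \<eta>)"
  by (simp add: all_formfields_iff form_field_def)

text \<open>The conditions concern \<open>\<Omega> L\<close> only: there the description behind
  \<open>ext_deriv\<close> is known to have a solution, and multivectors act linearly.\<close>

definition form_operator :: "(('m, 'v) formfield \<Rightarrow> ('m, 'v) formfield) \<Rightarrow> bool"
  where "form_operator G \<longleftrightarrow> (\<forall>\<eta>\<in>\<Omega> L. G \<eta> \<in> \<Omega> L) \<and>
    (\<forall>c. \<forall>\<eta>\<in>\<Omega> L. \<forall>\<omega>\<in>\<Omega> L. G (c *\<^sub>R \<eta> + \<omega>) = c *\<^sub>R G \<eta> + G \<omega>)"

lemma form_operator_closed: "\<lbrakk>form_operator G; \<eta> \<in> \<Omega> L\<rbrakk> \<Longrightarrow> G \<eta> \<in> \<Omega> L"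
  by (simp add: form_operator_def)

lemma form_operator_add: "\<lbrakk>form_operator G; \<eta> \<in> \<Omega> L; \<omega> \<in> \<Omega> L\<rbrakk> \<Longrightarrow> G (\<eta> + \<omega>) = G \<eta> + G \<omega>"
  unfolding form_operator_def by (metis scaleR_one)

lemma form_operator_0: "form_operator G \<Longrightarrow> G 0 = 0"
  using form_operator_add[of G 0 0] subspace_0[OF all_formfields_subspace] by simp

lemma form_operator_scale: "\<lbrakk>form_operator G; \<eta> \<in> \<Omega> L\<rbrakk> \<Longrightarrow> G (c *\<^sub>R \<eta>) = c *\<^sub>R G \<eta>"
  using form_operator_0[of G] subspace_0[OF all_formfields_subspace] unfolding form_operator_def
  by (metis add.right_neutral)

lemma form_operator_uminus: "\<lbrakk>form_operator G; \<eta> \<in> \<Omega> L\<rbrakk> \<Longrightarrow> G (- \<eta>) = - G \<eta>"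
  using form_operator_scale[of G \<eta> "-1"] by (simp only: scaleR_minus1_left)

lemma form_operator_diff: "\<lbrakk>form_operator G; \<eta> \<in> \<Omega> L; \<omega> \<in> \<Omega> L\<rbrakk> \<Longrightarrow> G (\<eta> - \<omega>) = G \<eta> - G \<omega>"
  using form_operator_add[of G \<eta> "- \<omega>"] subspace_neg[OF all_formfields_subspace, of \<omega>]
  by (simp only: form_operator_uminus diff_conv_add_uminus)

lemma form_operator_interior: "P \<in> A\<^sup>\<bullet> L p \<Longrightarrow> form_operator (interior_prod P)"
  unfolding form_operator_def using interior_closed interior_prod_form_lincomb[OF mvfields_degree]
  by blast

lemma form_operator_d: "form_operator d"
  unfolding form_operator_def
proof (intro conjI ballI allI)
  fix \<eta> assume "\<eta> \<in> \<Omega> L"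
  then show "d \<eta> \<in> \<Omega> L" by (rule ext_deriv_closed)
next
  fix c \<eta> \<omega> assume *: "\<eta> \<in> \<Omega> L" "\<omega> \<in> \<Omega> L"
  note closed = subspace_add[OF all_formfields_subspace] subspace_scale[OF all_formfields_subspace]
  show "d (c *\<^sub>R \<eta> + \<omega>) = c *\<^sub>R d \<eta> + d \<omega>"
  proof (rule all_formfields_eqI)
    show "d (c *\<^sub>R \<eta> + \<omega>) \<in> \<Omega> L" "c *\<^sub>R d \<eta> + d \<omega> \<in> \<Omega> L"
      using * by (auto intro!: closed ext_deriv_closed)
    fix Vs assume Vs: "set Vs \<subseteq> \<Gamma> L"
    have sum: "c *\<^sub>R \<eta> + \<omega> \<in> \<Omega> L" using * by (intro closed)
    have "d_op (eval_form (c *\<^sub>R \<eta> + \<omega>)) Vs =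
        d_op (\<lambda>Vs. (\<lambda>_. c) * eval_form \<eta> Vs + eval_form \<omega> Vs) Vs"
      using Vs by (intro d_op_cong) (simp_all only: eval_form_add eval_form_scaleR)
    also have "\<dots> = d_op (\<lambda>Vs. (\<lambda>_. c) * eval_form \<eta> Vs) Vs + d_op (eval_form \<omega>) Vs"
      using * Vs by (intro d_op_add list_form_times smooth_fun_const list_form_eval)
    also have "\<dots> = (\<lambda>_. c) * d_op (eval_form \<eta>) Vs + d_op (eval_form \<omega>) Vs"
      using d_op_const_times[OF list_form_eval[OF *(1)] Vs] by (simp only:)
    finally show "eval_form (d (c *\<^sub>R \<eta> + \<omega>)) Vs = eval_form (c *\<^sub>R d \<eta> + d \<omega>) Vs"
      using * sum Vs by (simp only: eval_form_add eval_form_scaleR eval_ext_deriv)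
  qed
qed

lemma d_d:
  assumes "\<eta> \<in> \<Omega> L"
  shows "d (d \<eta>) = 0"
proof (rule all_formfields_eqI)
  show "d (d \<eta>) \<in> \<Omega> L" "0 \<in> \<Omega> L"
    using assms by (auto intro!: ext_deriv_closed subspace_0[OF all_formfields_subspace])
  fix Vs assume Vs: "set Vs \<subseteq> \<Gamma> L"
  have "eval_form (d (d \<eta>)) Vs = d_op (eval_form (d \<eta>)) Vs"
    using assms Vs by (intro eval_ext_deriv ext_deriv_closed)
  also have "\<dots> = d_op (d_op (eval_form \<eta>)) Vs"
    using assms Vs by (intro d_op_cong eval_ext_deriv)
  also have "\<dots> = 0" using assms Vs by (intro d_op_d_op list_form_eval)
  finally show "eval_form (d (d \<eta>)) Vs = eval_form 0 Vs" by (simp add: eval_form_def zero_fun_def)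
qed

lemma d_local:
  assumes "\<eta> \<in> \<Omega> L" "\<omega> \<in> \<Omega> L" "open N" "x \<in> N" "\<And>y. y \<in> N \<Longrightarrow> \<eta> y = \<omega> y"
  shows "d \<eta> x = d \<omega> x"
proof
  fix vs
  have ff: "form_field (d \<eta>)" "form_field (d \<omega>)"
    using ext_deriv_closed[OF assms(1)] ext_deriv_closed[OF assms(2)]
    by (auto simp: all_formfields_iff)
  show "d \<eta> x vs = d \<omega> x vs"
  proof (cases "set vs \<subseteq> F x")
    case True
    then have Vs: "set (map (lift x) vs) \<subseteq> \<Gamma> L" using map_lift by blast
    have "d_op (eval_form \<eta>) (map (lift x) vs) x = d_op (eval_form \<omega>) (map (lift x) vs) x"
      by (rule d_op_local[OF Vs assms(3,4) list_form_eval[OF assms(1)] list_form_eval[OF assms(2)]])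
        (simp add: eval_form_def assms(5))
    then show ?thesis
      unfolding form_field_value[OF ff(1), of x vs] form_field_value[OF ff(2), of x vs]
        eval_ext_deriv[OF assms(1) Vs] eval_ext_deriv[OF assms(2) Vs] by simp
  next
    case False
    then show ?thesis using ff by (simp add: form_field_def)
  qed
qed

text \<open>For a section this is the Lie derivative, for a function \<open>f\<close> it is exterior
  multiplication by -df.\<close>

definition lie_operator :: "int \<Rightarrow> ('m, 'v) mvfield \<Rightarrow> ('m, 'v) formfield \<Rightarrow> ('m, 'v) formfield"
  where "lie_operator p P = graded_commutator (- p) 1 (interior_prod P) d"

lemma lie_operator: "lie_operator p P \<eta> =
    interior_prod P (d \<eta>) - ((-1) powi p) *\<^sub>R d (interior_prod P \<eta>)"
  by (simp add: lie_operator_def graded_commutator_def minus_one_powi)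

lemma form_operator_lie:
  assumes "P \<in> A\<^sup>\<bullet> L p"
  shows "form_operator (lie_operator p P)"
  unfolding form_operator_def
proof (intro conjI ballI allI)
  note i = form_operator_interior[OF assms]
  note closed = subspace_add[OF all_formfields_subspace] subspace_scale[OF all_formfields_subspace]
    subspace_diff[OF all_formfields_subspace] form_operator_closed[OF i]
      form_operator_closed[OF form_operator_d]
  fix \<eta> assume \<eta>: "\<eta> \<in> \<Omega> L"
  then show "lie_operator p P \<eta> \<in> \<Omega> L" unfolding lie_operator by (intro closed)
  fix c \<omega> assume \<omega>: "\<omega> \<in> \<Omega> L"
  have "d (c *\<^sub>R \<eta> + \<omega>) = c *\<^sub>R d \<eta> + d \<omega>"
      "interior_prod P (c *\<^sub>R \<eta> + \<omega>) = c *\<^sub>R interior_prod P \<eta> + interior_prod P \<omega>"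
    "interior_prod P (c *\<^sub>R d \<eta> + d \<omega>) = c *\<^sub>R interior_prod P (d \<eta>) + interior_prod P (d \<omega>)"
    "d (c *\<^sub>R interior_prod P \<eta> + interior_prod P \<omega>) =
        c *\<^sub>R d (interior_prod P \<eta>) + d (interior_prod P \<omega>)"
    using \<eta> \<omega> i form_operator_d form_operator_closed[OF i] form_operator_closed[OF form_operator_d]
    unfolding form_operator_def by blast+
  then show "lie_operator p P (c *\<^sub>R \<eta> + \<omega>) = c *\<^sub>R lie_operator p P \<eta> + lie_operator p P \<omega>"
    unfolding lie_operator by (simp add: scaleR_add_right scaleR_diff_right algebra_simps)
qed

text \<open>The defining condition of the bracket without the definite description, so that
  solutions can be combined before uniqueness is invoked. The degrees are parameters because the
  signs depend on them, while the zero field has every degree.\<close>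

definition is_bracket :: "int \<Rightarrow> int \<Rightarrow> ('m, 'v) mvfield \<Rightarrow> ('m, 'v) mvfield \<Rightarrow> ('m, 'v) mvfield \<Rightarrow> bool"
  where "is_bracket p q P Q R \<longleftrightarrow> (\<forall>\<eta>\<in>\<Omega> L. interior_prod R \<eta> =
    graded_commutator (1 - p) (- q) (graded_commutator (- p) 1 (interior_prod P) d)
      (interior_prod Q) \<eta>)"

lemma is_bracket_iff: "is_bracket p q P Q R \<longleftrightarrow> (\<forall>\<eta>\<in>\<Omega> L. interior_prod R \<eta> =
    lie_operator p P (interior_prod Q \<eta>) - ((-1) powi ((p - 1) * q)) *\<^sub>R interior_prod Q
      (lie_operator p P \<eta>))"
  unfolding is_bracket_def lie_operator_def[symmetric]
  by (simp add: graded_commutator_def minus_one_powi)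

section \<open>Brackets of functions and sections\<close>

lemma mvfields_fun: "f \<in> C \<Longrightarrow> mv_of_fun L f \<in> A\<^sup>\<bullet> L 0"
  by (rule dec_mvfields[OF dec_fun])

lemma mvfields_sec: "V \<in> \<Gamma> L \<Longrightarrow> mv_of_sec L V \<in> A\<^sup>\<bullet> L 1"
  by (rule dec_mvfields[OF dec_sec])

lemma lie_operator_local:
  assumes "P \<in> A\<^sup>\<bullet> L p" "P' \<in> A\<^sup>\<bullet> L p" "\<eta> \<in> \<Omega> L" "\<eta>' \<in> \<Omega> L" "open N" "x \<in> N"
    "\<And>y. y \<in> N \<Longrightarrow> P y = P' y" "\<And>y. y \<in> N \<Longrightarrow> \<eta> y = \<eta>' y"
  shows "lie_operator p P \<eta> x = lie_operator p P' \<eta>' x"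
proof -
  have "d (interior_prod P \<eta>) x = d (interior_prod P' \<eta>') x"
    using assms by (intro d_local[of _ _ N] interior_closed) (auto simp: interior_prod_def)
  moreover have "d \<eta> x = d \<eta>' x" using assms by (intro d_local[of _ _ N]) auto
  ultimately show ?thesis
    using assms by (simp add: lie_operator interior_prod_def)
qed

text \<open>Cartan's formula: the recursion for \<open>d_op\<close> says precisely that i(V) d + d
  i(V) is the Lie derivative.\<close>

lemma eval_lie_sec:
  assumes "V \<in> \<Gamma> L" "\<eta> \<in> \<Omega> L" "set Vs \<subseteq> \<Gamma> L"
  shows "eval_form (lie_operator 1 (mv_of_sec L V) \<eta>) Vs = lie_op V (eval_form \<eta>) Vs"
proof -
  have "eval_form (interior_prod (mv_of_sec L V) (d \<eta>)) Vs = d_op (eval_form \<eta>) (V # Vs)"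
    using eval_interior_sec[OF ext_deriv_closed[OF assms(2)], of V]
        eval_ext_deriv[OF assms(2), of "V # Vs"] assms
    by simp
  moreover have "eval_form (d (interior_prod (mv_of_sec L V) \<eta>)) Vs =
      d_op (insert_sec V (eval_form \<eta>)) Vs"
    using eval_ext_deriv[OF interior_sec_closed[OF assms(1,2)] assms(3)]
        eval_interior_sec[OF assms(2), of V] by simp
  ultimately show ?thesis
    by (simp add: lie_operator minus_one_powi eval_form_add)
qed

lemma eval_form_diff: "eval_form (\<eta> - \<omega>) Vs = eval_form \<eta> Vs - eval_form \<omega> Vs"
  by (simp add: eval_form_def fun_eq_iff)

lemma eval_lie_fun:
  assumes "f \<in> C" "\<eta> \<in> \<Omega> L" "set Vs \<subseteq> \<Gamma> L"
  shows "eval_form (lie_operator 0 (mv_of_fun L f) \<eta>) Vs = - ext_wedge (\<lambda>W. D W f) (eval_form \<eta>) Vs"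
proof -
  have 1: "lie_operator 0 (mv_of_fun L f) \<eta> = f \<odot> d \<eta> - d (f \<odot> \<eta>)"
    unfolding lie_operator using assms by (simp add: interior_fun ext_deriv_closed)
  have "eval_form (d (f \<odot> \<eta>)) Vs = d_op (eval_form (f \<odot> \<eta>)) Vs"
    using assms by (intro eval_ext_deriv all_formfields_smul)
  also have "\<dots> = d_op (\<lambda>Vs. f * eval_form \<eta> Vs) Vs"
    using assms by (intro d_op_cong) (simp_all only: eval_form_smul)
  also have "\<dots> = f * d_op (eval_form \<eta>) Vs + ext_wedge (\<lambda>W. D W f) (eval_form \<eta>) Vs"
    using assms by (intro d_op_times list_form_eval)
  finally have 2: "eval_form (d (f \<odot> \<eta>)) Vs =
      f * d_op (eval_form \<eta>) Vs + ext_wedge (\<lambda>W. D W f) (eval_form \<eta>) Vs" .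
  show ?thesis unfolding 1 eval_form_diff eval_form_smul 2 eval_ext_deriv[OF assms(2,3)] by simp
qed

text \<open>By \<open>eval_lie_fun\<close> the operator [i(f), d] is exterior multiplication by -df,
  which is linear over functions and so commutes with multiplication by \<open>g\<close>.\<close>

lemma is_bracket_fun_fun:
  assumes "f \<in> C" "g \<in> C"
  shows "is_bracket 0 0 (mv_of_fun L f) (mv_of_fun L g) 0"
  unfolding is_bracket_iff
proof
  fix \<eta> assume \<eta>: "\<eta> \<in> \<Omega> L"
  note l = form_operator_closed[OF form_operator_lie[OF mvfields_fun[OF assms(1)]]]
  have "g \<odot> lie_operator 0 (mv_of_fun L f) \<eta> = lie_operator 0 (mv_of_fun L f) (g \<odot> \<eta>)"
  proof (rule all_formfields_eqI)
    show "g \<odot> lie_operator 0 (mv_of_fun L f) \<eta> \<in> \<Omega> L" "lie_operator 0 (mv_of_fun L f) (g \<odot> \<eta>) \<in> \<Omega> L"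
      using assms \<eta> by (auto intro!: l all_formfields_smul simp del: mem_Collect_eq)
    fix Vs assume Vs: "set Vs \<subseteq> \<Gamma> L"
    have "ext_wedge (\<lambda>W. D W f) (eval_form (g \<odot> \<eta>)) Vs =
        ext_wedge (\<lambda>W. D W f) (\<lambda>Vs. g * eval_form \<eta> Vs) Vs"
      by (intro ext_wedge_cong) (simp only: eval_form_smul)
    then show "eval_form (g \<odot> lie_operator 0 (mv_of_fun L f) \<eta>) Vs =
        eval_form (lie_operator 0 (mv_of_fun L f) (g \<odot> \<eta>)) Vs"
      unfolding eval_form_smul eval_lie_fun[OF assms(1) \<eta> Vs]
          eval_lie_fun[OF assms(1) all_formfields_smul[OF assms(2) \<eta>] Vs]
      by (simp add: ext_wedge_scale)
  qed
  then show "interior_prod 0 \<eta> = lie_operator 0 (mv_of_fun L f) (interior_prod (mv_of_fun L g) \<eta>) -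
      ((-1) powi ((0 - 1) * 0)) *\<^sub>R interior_prod (mv_of_fun L g)
        (lie_operator 0 (mv_of_fun L f) \<eta>)"
    by (simp add: interior_prod_0 interior_fun[OF \<eta>] interior_fun[OF l[OF \<eta>]])
qed

text \<open>This is the Leibniz rule for the Lie derivative of a function times a form.\<close>

lemma is_bracket_sec_fun:
  assumes "V \<in> \<Gamma> L" "f \<in> C"
  shows "is_bracket 1 0 (mv_of_sec L V) (mv_of_fun L f) (mv_of_fun L (D V f))"
  unfolding is_bracket_iff
proof
  fix \<eta> assume \<eta>: "\<eta> \<in> \<Omega> L"
  note l = form_operator_closed[OF form_operator_lie[OF mvfields_sec[OF assms(1)]]]
  have "D V f \<odot> \<eta> + f \<odot> lie_operator 1 (mv_of_sec L V) \<eta> = lie_operator 1 (mv_of_sec L V) (f \<odot> \<eta>)"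
  proof (rule all_formfields_eqI)
    show "D V f \<odot> \<eta> + f \<odot> lie_operator 1 (mv_of_sec L V) \<eta> \<in> \<Omega> L"
        "lie_operator 1 (mv_of_sec L V) (f \<odot> \<eta>) \<in> \<Omega> L"
      using assms \<eta> D_smooth[OF assms]
      by (auto intro!: subspace_add[OF all_formfields_subspace] l all_formfields_smul simp del:
          mem_Collect_eq)
    fix Vs assume Vs: "set Vs \<subseteq> \<Gamma> L"
    have "lie_op V (eval_form (f \<odot> \<eta>)) Vs = lie_op V (\<lambda>Vs. f * eval_form \<eta> Vs) Vs"
      using assms Vs by (intro lie_op_cong) (simp_all only: eval_form_smul)
    also have "\<dots> = f * lie_op V (eval_form \<eta>) Vs + D V f * eval_form \<eta> Vs"
      using assms \<eta> Vs by (intro lie_op_times list_form_smooth[OF list_form_eval])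
    finally show "eval_form (D V f \<odot> \<eta> + f \<odot> lie_operator 1 (mv_of_sec L V) \<eta>) Vs =
        eval_form (lie_operator 1 (mv_of_sec L V) (f \<odot> \<eta>)) Vs"
      unfolding eval_form_add eval_form_smul eval_lie_sec[OF assms(1) \<eta> Vs]
        eval_lie_sec[OF assms(1) all_formfields_smul[OF assms(2) \<eta>] Vs] by (simp add: add.commute)
  qed
  then show "interior_prod (mv_of_fun L (D V f)) \<eta> =
      lie_operator 1 (mv_of_sec L V) (interior_prod (mv_of_fun L f) \<eta>) -
      ((-1) powi ((1 - 1) * 0)) *\<^sub>R interior_prod (mv_of_fun L f)
        (lie_operator 1 (mv_of_sec L V) \<eta>)"
    by (simp add: interior_fun[OF \<eta>] interior_fun[OF l[OF \<eta>]] eq_diff_eq)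
qed

text \<open>The commutator of the Lie derivative along \<open>V\<close> with i(W), read off from
  \<open>lie_op_Cons\<close>.\<close>

lemma is_bracket_sec_sec:
  assumes "V \<in> \<Gamma> L" "W \<in> \<Gamma> L"
  shows "is_bracket 1 1 (mv_of_sec L V) (mv_of_sec L W) (mv_of_sec L (brk L V W))"
  unfolding is_bracket_iff
proof
  fix \<eta> assume \<eta>: "\<eta> \<in> \<Omega> L"
  note l = form_operator_closed[OF form_operator_lie[OF mvfields_sec[OF assms(1)]]]
  let ?i = "\<lambda>V. interior_prod (mv_of_sec L V)" and ?l = "lie_operator 1 (mv_of_sec L V)"
  have "?i (brk L V W) \<eta> + ?i W (?l \<eta>) = ?l (?i W \<eta>)"
  proof (rule all_formfields_eqI)
    show "?i (brk L V W) \<eta> + ?i W (?l \<eta>) \<in> \<Omega> L" "?l (?i W \<eta>) \<in> \<Omega> L"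
      using assms \<eta> by (auto intro!: subspace_add[OF all_formfields_subspace] l interior_sec_closed
          brk_closed)
    fix Vs assume Vs: "set Vs \<subseteq> \<Gamma> L"
    have 1: "eval_form (?i W (?l \<eta>)) Vs = lie_op V (eval_form \<eta>) (W # Vs)"
      using eval_interior_sec[OF l[OF \<eta>], of W] eval_lie_sec[OF assms(1) \<eta>, of "W # Vs"] assms Vs
      by simp
    have 2: "eval_form (?l (?i W \<eta>)) Vs = lie_op V (insert_sec W (eval_form \<eta>)) Vs"
      using eval_lie_sec[OF assms(1) interior_sec_closed[OF assms(2) \<eta>] Vs]
          eval_interior_sec[OF \<eta>, of W] by simp
    show "eval_form (?i (brk L V W) \<eta> + ?i W (?l \<eta>)) Vs = eval_form (?l (?i W \<eta>)) Vs"
      unfolding eval_form_add 1 2 eval_interior_sec[OF \<eta>] lie_op_Cons by simp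
  qed
  then show "?i (brk L V W) \<eta> = ?l (?i W \<eta>) - ((-1) powi ((1 - 1) * 1)) *\<^sub>R ?i W (?l \<eta>)"
    by (simp add: eq_diff_eq)
qed

section \<open>Uniqueness, skew symmetry and the Leibniz rule\<close>

lemma is_bracket_unique:
  assumes "is_bracket p q P Q R" "is_bracket p q P Q R'" "R \<in> A\<^sup>\<bullet> L r" "R' \<in> A\<^sup>\<bullet> L r"
  shows "R = R'"
proof
  fix x show "R x = R' x"
    using assms(1,2) by (intro mvfields_eqI[OF assms(3,4)]) (simp add: is_bracket_iff)
qed

text \<open>The graded Jacobi identity for the operators i(P), d and i(Q), in which the graded
  commutator of i(P) and i(Q) vanishes. The contractions are exchanged twice, on \<eta> and on d
  \<eta>; the other terms match as they stand.\<close>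

lemma is_bracket_skew:
  assumes P: "P \<in> A\<^sup>\<bullet> L p" and Q: "Q \<in> A\<^sup>\<bullet> L q" and R: "is_bracket p q P Q R"
  shows "is_bracket q p Q P (- (((-1) powi ((p - 1) * (q - 1))) *\<^sub>R R))"
  unfolding is_bracket_iff
proof
  fix \<eta> assume \<eta>: "\<eta> \<in> \<Omega> L"
  let ?P = "interior_prod P" and ?Q = "interior_prod Q"
  note iP = form_operator_interior[OF P] and iQ = form_operator_interior[OF Q] and dd =
      form_operator_d
  note closed = form_operator_closed[OF iP] form_operator_closed[OF iQ] form_operator_closed[OF dd]
    subspace_scale[OF all_formfields_subspace]
  have comm: "?P (?Q \<omega>) = ((-1) powi (p * q)) *\<^sub>R ?Q (?P \<omega>)" if "\<omega> \<in> \<Omega> L" for \<omega>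
    by (rule interior_prod_commute[OF mvfields_degree[OF P] mvfields_degree[OF Q] that])
  have 1: "interior_prod R \<eta> = (?P (d (?Q \<eta>)) - ((-1) powi p) *\<^sub>R d (?P (?Q \<eta>))) -
      ((-1) powi ((p - 1) * q)) *\<^sub>R (?Q (?P (d \<eta>)) - ((-1) powi p) *\<^sub>R ?Q (d (?P \<eta>)))"
    using R \<eta> by (simp add: is_bracket_iff lie_operator form_operator_diff[OF iQ]
        form_operator_scale[OF iQ] closed)
  have 2: "lie_operator q Q (?P \<eta>) - ((-1) powi ((q - 1) * p)) *\<^sub>R ?P (lie_operator q Q \<eta>) =
      (?Q (d (?P \<eta>)) - ((-1) powi q) *\<^sub>R d (?Q (?P \<eta>))) -
      ((-1) powi ((q - 1) * p)) *\<^sub>R (?P (?Q (d \<eta>)) - ((-1) powi q) *\<^sub>R ?P (d (?Q \<eta>)))"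
    using \<eta> by (simp add: lie_operator form_operator_diff[OF iP] form_operator_scale[OF iP] closed)
  have 3: "interior_prod (- (((-1) powi ((p - 1) * (q - 1))) *\<^sub>R R)) \<eta> =
      - (((-1) powi ((p - 1) * (q - 1))) *\<^sub>R interior_prod R \<eta>)"
    using interior_prod_scaleR[of "- ((-1) powi ((p - 1) * (q - 1)))" R \<eta>]
    by (simp only: scaleR_minus_left)
  show "interior_prod (- (((-1) powi ((p - 1) * (q - 1))) *\<^sub>R R)) \<eta> =
      lie_operator q Q (?P \<eta>) - ((-1) powi ((q - 1) * p)) *\<^sub>R ?P (lie_operator q Q \<eta>)"
    unfolding 1 2 3 comm[OF \<eta>] comm[OF closed(3)[OF \<eta>]]
    using form_operator_uminus[OF dd, of "?Q (?P \<eta>)"] closed(1,2) \<eta>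
    by (cases "even p"; cases "even q") (simp_all add: minus_one_powi algebra_simps)
qed

text \<open>The graded commutator with [i(P), d] is a derivation for composition, and contraction
  with an exterior product is a composition. The latter is available for fields of a definite
  degree, hence the assumptions on \<open>R\<close> and \<open>R'\<close>.\<close>

lemma is_bracket_wedge:
  assumes P: "P \<in> A\<^sup>\<bullet> L p" and Q: "Q \<in> A\<^sup>\<bullet> L q" "Q' \<in> A\<^sup>\<bullet> L q'"
    and R: "is_bracket p q P Q R" "R \<in> A\<^sup>\<bullet> L (p + q - 1)"
    and R': "is_bracket p q' P Q' R'" "R' \<in> A\<^sup>\<bullet> L (p + q' - 1)"
  shows "is_bracket p (q + q') P (mv_wedge L Q Q')
    (mv_wedge L R Q' + ((-1) powi ((p - 1) * q)) *\<^sub>R mv_wedge L Q R')"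
  unfolding is_bracket_iff
proof
  fix \<eta> assume \<eta>: "\<eta> \<in> \<Omega> L"
  let ?X = "lie_operator p P" and ?Q = "interior_prod Q" and ?Q' = "interior_prod Q'"
  note iX = form_operator_lie[OF P] and iQ = form_operator_interior[OF Q(1)] and iQ' =
      form_operator_interior[OF Q(2)]
  note closed = form_operator_closed[OF iX] form_operator_closed[OF iQ] form_operator_closed[OF iQ']
    subspace_scale[OF all_formfields_subspace]
  note deg = mvfields_degree[OF Q(1)] mvfields_degree[OF Q(2)] mvfields_degree[OF R(2)]
      mvfields_degree[OF R'(2)]
  have 1: "interior_prod R (?Q' \<eta>) =
      ?X (?Q (?Q' \<eta>)) - ((-1) powi ((p - 1) * q)) *\<^sub>R ?Q (?X (?Q' \<eta>))"
    using R(1) closed(3)[OF \<eta>] by (simp add: is_bracket_iff)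
  have 2: "?Q (interior_prod R' \<eta>) =
      ?Q (?X (?Q' \<eta>)) - ((-1) powi ((p - 1) * q')) *\<^sub>R ?Q (?Q' (?X \<eta>))"
    using R'(1) \<eta> by (simp add: is_bracket_iff form_operator_diff[OF iQ] form_operator_scale[OF iQ]
        closed)
  have 3: "interior_prod (mv_wedge L R Q' + ((-1) powi ((p - 1) * q)) *\<^sub>R mv_wedge L Q R') \<eta> =
      interior_prod R (?Q' \<eta>) + ((-1) powi ((p - 1) * q)) *\<^sub>R ?Q (interior_prod R' \<eta>)"
    unfolding interior_prod_add interior_prod_scaleR interior_prod_wedge[OF deg(3,2) \<eta>]
        interior_prod_wedge[OF deg(1,4) \<eta>] ..
  have 4: "interior_prod (mv_wedge L Q Q') \<omega> = ?Q (?Q' \<omega>)" if "\<omega> \<in> \<Omega> L" for \<omega>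
    by (rule interior_prod_wedge[OF deg(1,2) that])
  show "interior_prod (mv_wedge L R Q' + ((-1) powi ((p - 1) * q)) *\<^sub>R mv_wedge L Q R') \<eta> =
      ?X (interior_prod (mv_wedge L Q Q') \<eta>) -
      ((-1) powi ((p - 1) * (q + q'))) *\<^sub>R interior_prod (mv_wedge L Q Q') (?X \<eta>)"
    unfolding 3 4[OF \<eta>] 4[OF closed(1)[OF \<eta>]] 1 2
    by (cases "even p"; cases "even q"; cases "even q'")
        (simp_all add: minus_one_powi algebra_simps)
qed

section \<open>Linearity and existence of brackets\<close>

lemma is_bracket_zero_right:
  assumes "P \<in> A\<^sup>\<bullet> L p"
  shows "is_bracket p q P 0 0"
  unfolding is_bracket_iff
  by (simp add: interior_prod_0 form_operator_0[OF form_operator_lie[OF assms]])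

lemma is_bracket_lincomb_right:
  assumes "P \<in> A\<^sup>\<bullet> L p" "Q \<in> A\<^sup>\<bullet> L q" "Q' \<in> A\<^sup>\<bullet> L q" "is_bracket p q P Q R" "is_bracket p q P Q' R'"
  shows "is_bracket p q P (c *\<^sub>R Q + Q') (c *\<^sub>R R + R')"
  unfolding is_bracket_iff
proof
  fix \<eta> assume \<eta>: "\<eta> \<in> \<Omega> L"
  note iX = form_operator_lie[OF assms(1)] and iQ = form_operator_interior[OF assms(2)] and iQ' =
      form_operator_interior[OF assms(3)]
  have lin: "lie_operator p P (c *\<^sub>R interior_prod Q \<eta> + interior_prod Q' \<eta>) =
      c *\<^sub>R lie_operator p P (interior_prod Q \<eta>) + lie_operator p P (interior_prod Q' \<eta>)"
    using iX form_operator_closed[OF iQ \<eta>] form_operator_closed[OF iQ' \<eta>]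
    unfolding form_operator_def by blast
  have r: "interior_prod R \<eta> = lie_operator p P (interior_prod Q \<eta>) -
      ((-1) powi ((p - 1) * q)) *\<^sub>R interior_prod Q (lie_operator p P \<eta>)"
    "interior_prod R' \<eta> = lie_operator p P (interior_prod Q' \<eta>) -
      ((-1) powi ((p - 1) * q)) *\<^sub>R interior_prod Q' (lie_operator p P \<eta>)"
    using assms(4,5) \<eta> by (simp_all only: is_bracket_iff)
  show "interior_prod (c *\<^sub>R R + R') \<eta> = lie_operator p P (interior_prod (c *\<^sub>R Q + Q') \<eta>) -
      ((-1) powi ((p - 1) * q)) *\<^sub>R interior_prod (c *\<^sub>R Q + Q') (lie_operator p P \<eta>)"
    unfolding interior_prod_add interior_prod_scaleR lin r
    by (simp add: scaleR_add_right scaleR_diff_right)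
qed

text \<open>With \<open>P\<close> fixed, the Leibniz rule reduces \<open>Q\<close> to its factors.
  The solution is again decomposable, which lets the same reduction be applied a second time after
  the arguments are exchanged.\<close>

lemma bracket_exists_dec_right:
  assumes P: "P \<in> A\<^sup>\<bullet> L p"
    and f: "\<And>f. f \<in> C \<Longrightarrow> \<exists>R. decomposable (p - 1) R \<and> is_bracket p 0 P (mv_of_fun L f) R"
    and V: "\<And>V. V \<in> \<Gamma> L \<Longrightarrow> \<exists>R. decomposable p R \<and> is_bracket p 1 P (mv_of_sec L V) R"
    and Q: "decomposable q Q"
  shows "\<exists>R. decomposable (p + q - 1) R \<and> is_bracket p q P Q R"
  using Q
proof (induction rule: decomposable.induct)
  case (dec_zero q)
  show ?case using is_bracket_zero_right[OF P, of q] decomposable.dec_zero by blast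
next
  case dec_one
  show ?case using f[OF smooth_fun_1] by simp
next
  \<comment> \<open>\<open>g \<odot> Q\<close> is treated as the exterior product of the function
    \<open>g\<close> with \<open>Q\<close>.\<close>
  case (dec_smul g q Q)
  obtain R where R: "decomposable (p - 1) R" "is_bracket p 0 P (mv_of_fun L g) R"
    using f[OF dec_smul(1)] by blast
  obtain R' where R': "decomposable (p + q - 1) R'" "is_bracket p q P Q R'" using dec_smul by blast
  have "decomposable (p - 1 + q) (mv_wedge L R Q)" by (rule dec_wedge[OF R(1) dec_smul(2)])
  moreover have "decomposable (0 + (p + q - 1)) (mv_wedge L (mv_of_fun L g) R')"
    by (rule dec_wedge[OF dec_fun[OF dec_smul(1)] R'(1)])
  ultimately have "decomposable (p + q - 1)
      (mv_wedge L R Q + ((-1) powi ((p - 1) * 0)) *\<^sub>R mv_wedge L (mv_of_fun L g) R')"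
    by (intro dec_add dec_scaleR) (simp_all add: algebra_simps)
  moreover have "R \<in> A\<^sup>\<bullet> L (p + 0 - 1)" using dec_mvfields[OF R(1)] by simp
  ultimately show "\<exists>R. decomposable (p + q - 1) R \<and> is_bracket p q P (g \<odot> Q) R"
    using is_bracket_wedge[OF P mvfields_fun[OF dec_smul(1)] dec_mvfields[OF dec_smul(2)] R(2) _
        R'(2) dec_mvfields[OF R'(1)]]
      mv_wedge_fun_left[OF dec_degree[OF dec_smul(2)], of g]
    by auto
next
  case (dec_sec_wedge V q Q)
  obtain R where R: "decomposable p R" "is_bracket p 1 P (mv_of_sec L V) R"
    using V[OF dec_sec_wedge(1)] by blast
  obtain R' where R': "decomposable (p + q - 1) R'" "is_bracket p q P Q R'" using dec_sec_wedge
    by blast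
  have "decomposable (p + q) (mv_wedge L R Q)" by (rule dec_wedge[OF R(1) dec_sec_wedge(2)])
  moreover have "decomposable (1 + (p + q - 1)) (mv_wedge L (mv_of_sec L V) R')"
    by (rule dec_wedge[OF dec_sec[OF dec_sec_wedge(1)] R'(1)])
  ultimately have "decomposable (p + (q + 1) - 1)
      (mv_wedge L R Q + ((-1) powi ((p - 1) * 1)) *\<^sub>R mv_wedge L (mv_of_sec L V) R')"
    by (intro dec_add dec_scaleR) (simp_all add: algebra_simps)
  moreover have "R \<in> A\<^sup>\<bullet> L (p + 1 - 1)" using dec_mvfields[OF R(1)] by simp
  ultimately show ?case
    using is_bracket_wedge[OF P mvfields_sec[OF dec_sec_wedge(1)] dec_mvfields[OF dec_sec_wedge(2)]
        R(2) _ R'(2) dec_mvfields[OF R'(1)]]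
    by (auto simp: add.commute)
next
  case (dec_add q Q Q')
  then obtain R R' where "decomposable (p + q - 1) R" "is_bracket p q P Q R"
    "decomposable (p + q - 1) R'" "is_bracket p q P Q' R'" by blast
  then show "\<exists>R. decomposable (p + q - 1) R \<and> is_bracket p q P (Q + Q') R"
    using is_bracket_lincomb_right[OF P dec_mvfields[OF dec_add(1)] dec_mvfields[OF dec_add(2)], of
        R R' 1]
      decomposable.dec_add[of "p + q - 1" R R'] by auto
qed

lemma bracket_exists_skew:
  assumes "decomposable p P" "decomposable q Q"
      "\<exists>R. decomposable (p + q - 1) R \<and> is_bracket p q P Q R"
  shows "\<exists>R. decomposable (q + p - 1) R \<and> is_bracket q p Q P R"
proof -
  obtain R where R: "decomposable (p + q - 1) R" "is_bracket p q P Q R" using assms(3) by blast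
  have "decomposable (q + p - 1) ((- ((-1) powi ((p - 1) * (q - 1)))) *\<^sub>R R)"
    unfolding add.commute[of q p] by (rule dec_scaleR[OF R(1)])
  then show ?thesis
    using is_bracket_skew[OF dec_mvfields[OF assms(1)] dec_mvfields[OF assms(2)] R(2)]
    unfolding scaleR_minus_left by blast
qed

text \<open>The Leibniz rule acts on the second argument. It extends the brackets of two generators
  to a generator against an arbitrary decomposable field; skew symmetry then moves the generator
  into second place, and the Leibniz rule applies again.\<close>

lemma bracket_exists_dec:
  assumes "decomposable p P" "decomposable q Q"
  shows "\<exists>R. decomposable (p + q - 1) R \<and> is_bracket p q P Q R"
proof -
  have VW: "\<exists>R. decomposable 1 R \<and> is_bracket 1 1 (mv_of_sec L V) (mv_of_sec L W) R"
    if "V \<in> \<Gamma> L" "W \<in> \<Gamma> L" for V W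
    using is_bracket_sec_sec[OF that] dec_sec[OF brk_closed[OF that]] by blast
  have Vf: "\<exists>R. decomposable 0 R \<and> is_bracket 1 0 (mv_of_sec L V) (mv_of_fun L f) R"
    if "V \<in> \<Gamma> L" "f \<in> C" for V f
    using is_bracket_sec_fun[OF that] dec_fun[OF D_smooth[OF that]] by blast
  have fV: "\<exists>R. decomposable 0 R \<and> is_bracket 0 1 (mv_of_fun L f) (mv_of_sec L V) R"
    if "V \<in> \<Gamma> L" "f \<in> C" for V f
    using bracket_exists_skew[OF dec_sec[OF that(1)] dec_fun[OF that(2)]] Vf[OF that] by simp
  have fg: "\<exists>R. decomposable (-1) R \<and> is_bracket 0 0 (mv_of_fun L f) (mv_of_fun L g) R"
    if "f \<in> C" "g \<in> C" for f g
    using is_bracket_fun_fun[OF that] dec_zero by blast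
  have VQ: "\<exists>R. decomposable (1 + q - 1) R \<and> is_bracket 1 q (mv_of_sec L V) Q R"
    if V: "V \<in> \<Gamma> L" and Q: "decomposable q Q" for V q Q
  proof (rule bracket_exists_dec_right[OF mvfields_sec[OF V] _ _ Q])
    show "\<exists>R. decomposable (1 - 1) R \<and> is_bracket 1 0 (mv_of_sec L V) (mv_of_fun L f) R" if "f \<in> C"
        for f
      using Vf[OF V that] by simp
  qed (rule VW[OF V])
  have fQ: "\<exists>R. decomposable (0 + q - 1) R \<and> is_bracket 0 q (mv_of_fun L f) Q R"
    if f: "f \<in> C" and Q: "decomposable q Q" for f q Q
  proof (rule bracket_exists_dec_right[OF mvfields_fun[OF f] _ _ Q])
    show "\<exists>R. decomposable (0 - 1) R \<and> is_bracket 0 0 (mv_of_fun L f) (mv_of_fun L g) R" if "g \<in> C"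
        for g
      using fg[OF f that] by simp
  qed (rule fV[OF _ f])
  show ?thesis
  proof (rule bracket_exists_dec_right[OF dec_mvfields[OF assms(1)] _ _ assms(2)])
    fix f assume "f \<in> C"
    from bracket_exists_skew[OF dec_fun[OF this] assms(1) fQ[OF this assms(1)]]
    show "\<exists>R. decomposable (p - 1) R \<and> is_bracket p 0 P (mv_of_fun L f) R" by simp
  next
    fix V assume "V \<in> \<Gamma> L"
    from bracket_exists_skew[OF dec_sec[OF this] assms(1) VQ[OF this assms(1)]]
    show "\<exists>R. decomposable p R \<and> is_bracket p 1 P (mv_of_sec L V) R" by simp
  qed
qed

text \<open>At a point, the operator to be represented depends only on \<open>P\<close>,
  \<open>Q\<close> and the form near that point. Decomposable replacements therefore give solutions
  on neighbourhoods, and pointwise uniqueness makes these agree on overlaps.\<close>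

lemma bracket_exists:
  assumes P: "P \<in> A\<^sup>\<bullet> L p" and Q: "Q \<in> A\<^sup>\<bullet> L q"
  obtains R where "R \<in> A\<^sup>\<bullet> L (p + q - 1)" "is_bracket p q P Q R"
proof -
  let ?B = "\<lambda>\<eta>. lie_operator p P (interior_prod Q \<eta>) -
    ((-1) powi ((p - 1) * q)) *\<^sub>R interior_prod Q (lie_operator p P \<eta>)"
  define loc where "loc x N R \<longleftrightarrow> open N \<and> x \<in> N \<and> R \<in> A\<^sup>\<bullet> L (p + q - 1) \<and>
    (\<forall>\<eta>\<in>\<Omega> L. \<forall>y\<in>N. interior_prod R \<eta> y = ?B \<eta> y)" for x N R
  have "\<forall>x. \<exists>N R. loc x N R"
  proof
    fix x
    obtain N P' where P': "open N" "x \<in> N" "decomposable p P'" "\<And>y. y \<in> N \<Longrightarrow> P y = P' y"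
      by (rule mvfields_local_dec[OF P]) blast
    obtain N' Q' where Q': "open N'" "x \<in> N'" "decomposable q Q'" "\<And>y. y \<in> N' \<Longrightarrow> Q y = Q' y"
      by (rule mvfields_local_dec[OF Q]) blast
    obtain R where R: "decomposable (p + q - 1) R" "is_bracket p q P' Q' R"
      using bracket_exists_dec[OF P'(3) Q'(3)] by blast
    note mP' = dec_mvfields[OF P'(3)] and mQ' = dec_mvfields[OF Q'(3)]
    have "interior_prod R \<eta> y = ?B \<eta> y" if \<eta>: "\<eta> \<in> \<Omega> L" and y: "y \<in> N \<inter> N'" for \<eta> y
    proof -
      have "lie_operator p P (interior_prod Q \<eta>) y = lie_operator p P' (interior_prod Q' \<eta>) y"
        by (rule lie_operator_local[OF P mP' interior_closed[OF Q \<eta>] interior_closed[OF mQ' \<eta>], of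
            "N \<inter> N'"])
          (use P' Q' y in \<open>auto simp: interior_prod_def\<close>)
      moreover have "lie_operator p P \<eta> y = lie_operator p P' \<eta> y"
        by (rule lie_operator_local[OF P mP' \<eta> \<eta>, of "N \<inter> N'"]) (use P' Q' y in auto)
      ultimately have "?B \<eta> y = (lie_operator p P' (interior_prod Q' \<eta>) -
          ((-1) powi ((p - 1) * q)) *\<^sub>R interior_prod Q' (lie_operator p P' \<eta>)) y"
        using Q'(4) y by (simp add: interior_prod_def)
      then show ?thesis using R(2) \<eta> by (simp add: is_bracket_iff)
    qed
    then have "loc x (N \<inter> N') R" using P' Q' dec_mvfields[OF R(1)] by (simp add: loc_def open_Int)
    then show "\<exists>N R. loc x N R" by blast
  qed
  then obtain N R where loc: "\<And>x. loc x (N x) (R x)" by metis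
  have N: "open (N x)" "x \<in> N x" "R x \<in> A\<^sup>\<bullet> L (p + q - 1)" for x using loc[of x]
    by (simp_all add: loc_def)
  have B: "interior_prod (R x) \<eta> y = ?B \<eta> y" if "\<eta> \<in> \<Omega> L" "y \<in> N x" for x y \<eta>
    using loc[of x] that unfolding loc_def by blast
  \<comment> \<open>The value at \<open>y\<close> is taken from the solution belonging to
    \<open>y\<close>; by \<open>SR\<close> below this is \<open>R x\<close> throughout the
    neighbourhood of \<open>x\<close>.\<close>
  define S where "S y = R y y" for y
  have S: "interior_prod S \<eta> y = ?B \<eta> y" if "\<eta> \<in> \<Omega> L" for \<eta> y
    using B[OF that N(2)[of y]] by (simp add: interior_prod_def S_def)
  have SR: "S y = R x y" if "y \<in> N x" for x y
    unfolding S_def by (rule mvfields_eqI[OF N(3) N(3)]) (simp only: B[OF _ N(2)] B[OF _ that])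
  have "mv_degree (p + q - 1) S"
  proof (cases "p + q - 1 < 0")
    case True
    then have "R y = 0" for y using N(3)[of y] by (simp add: mvfields_neg)
    then have "S = 0" by (intro ext) (simp add: S_def)
    then show ?thesis by (simp only: mv_degree_0)
  next
    case False
    then show ?thesis using mvfields_degree[OF N(3)] by (simp add: mv_degree_def S_def)
  qed
  then have "S \<in> A\<^sup>\<bullet> L (p + q - 1)"
  proof (rule mvfields_local)
    fix x
    show "\<exists>N Q. open N \<and> x \<in> N \<and> Q \<in> A\<^sup>\<bullet> L (p + q - 1) \<and> (\<forall>y\<in>N. S y = Q y)"
      using N[of x] SR[of _ x] by (intro exI[of _ "N x"] exI[of _ "R x"]) blast
  qed
  moreover have "is_bracket p q P Q S" unfolding is_bracket_iff using S by (simp add: fun_eq_iff)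
  ultimately show ?thesis using that by blast
qed

lemma schouten_hom:
  assumes "P \<in> A\<^sup>\<bullet> L p" "Q \<in> A\<^sup>\<bullet> L q"
  shows schouten_hom_closed: "schouten_hom L p q P Q \<in> A\<^sup>\<bullet> L (p + q - 1)"
    and schouten_hom_is_bracket: "is_bracket p q P Q (schouten_hom L p q P Q)"
proof -
  obtain R where R: "R \<in> A\<^sup>\<bullet> L (p + q - 1)" "is_bracket p q P Q R"
    by (rule bracket_exists[OF assms])
  have "schouten_hom L p q P Q = R"
    unfolding schouten_hom_def is_bracket_def[symmetric]
  proof (rule the_equality)
    show "R \<in> A\<^sup>\<bullet> L (p + q - 1) \<and> is_bracket p q P Q R" using R by blast
    show "S = R" if "S \<in> A\<^sup>\<bullet> L (p + q - 1) \<and> is_bracket p q P Q S" for S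
      by (rule is_bracket_unique[OF conjunct2[OF that] R(2) conjunct1[OF that] R(1)])
  qed
  with R show "schouten_hom L p q P Q \<in> A\<^sup>\<bullet> L (p + q - 1)"
      "is_bracket p q P Q (schouten_hom L p q P Q)" by auto
qed

lemma schouten_hom_eq:
  assumes "P \<in> A\<^sup>\<bullet> L p" "Q \<in> A\<^sup>\<bullet> L q" "R \<in> A\<^sup>\<bullet> L (p + q - 1)" "is_bracket p q P Q R"
  shows "schouten_hom L p q P Q = R"
  using is_bracket_unique[OF schouten_hom_is_bracket[OF assms(1,2)] assms(4)
      schouten_hom_closed[OF assms(1,2)] assms(3)] .

end

section \<open>The Schouten-Nijenhuis bracket\<close>

lemma ext_forms_part: "\<eta> \<in> ext_forms V \<Longrightarrow> (\<lambda>vs. if length vs = k then \<eta> vs else 0) \<in> ext_forms V"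
proof (induction rule: ext_forms_induct)
  case zero
  show ?case using ext_forms_zero by simp
next
  case (step c p \<alpha> \<beta>)
  have zero: "\<alpha> vs = 0" if "length vs \<noteq> p" for vs using step(1) that unfolding alt_forms_def
    by blast
  have \<alpha>: "\<alpha> \<in> ext_forms V" using step(1) unfolding ext_forms_def by (intro span_base) blast
  show ?case
  proof (cases "p = k")
    case True
    have "(\<lambda>vs. if length vs = k then c * \<alpha> vs + \<beta> vs else 0) =
        (\<lambda>vs. c * \<alpha> vs + (if length vs = k then \<beta> vs else 0))" using zero True by (intro ext) auto
    then show ?thesis using ext_forms_lincomb[OF \<alpha> step(2), of c] by (simp only:)
  next
    case False
    have "(\<lambda>vs. if length vs = k then c * \<alpha> vs + \<beta> vs else 0) =
        (\<lambda>vs. if length vs = k then \<beta> vs else 0)" using zero False by (intro ext) auto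
    then show ?thesis using step(2) by (simp only:)
  qed
qed

context lie_algebroid
begin

lemma mv_part_lincomb: "mv_part L k (a *\<^sub>R P + b *\<^sub>R Q) = a *\<^sub>R mv_part L k P + b *\<^sub>R mv_part L k Q"
  by (intro ext) (simp add: mv_part_def)

lemma mv_part_0: "mv_part L k 0 = 0"
  by (intro ext) (simp add: mv_part_def)

text \<open>A p-vector sees only the values of a form on lists of length p.\<close>

lemma mv_part_mvfields:
  assumes "P \<in> A\<^sup>\<bullet> L (int p)"
  shows "mv_part L k P = (if k = p then P else 0)"
proof (intro ext)
  fix x \<eta>
  have P: "P x \<in> ext_power (F x) p" using mvfields_degree[OF assms] by (simp add: mv_degree_def)
  show "mv_part L k P x \<eta> = (if k = p then P else 0) x \<eta>"
  proof (cases "\<eta> \<in> ext_forms (F x)")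
    case True
    note part = ext_forms_part[OF True, of k]
    show ?thesis
    proof (cases "k = p")
      case True
      have "P x (\<lambda>vs. if length vs = k then \<eta> vs else 0) = P x \<eta>"
        by (rule ext_power_degree[OF P part \<open>\<eta> \<in> ext_forms (F x)\<close>]) (simp add: True)
      then show ?thesis using True \<open>\<eta> \<in> ext_forms (F x)\<close> by (simp add: mv_part_def)
    next
      case False
      have "P x (\<lambda>vs. if length vs = k then \<eta> vs else 0) = P x (\<lambda>_. 0)"
        by (rule ext_power_degree[OF P part ext_forms_zero]) (use False in simp)
      then show ?thesis using False by (simp add: mv_part_def ext_power_zero_form[OF P])
    qed
  next
    case False
    then show ?thesis using ext_power_outside[OF P False] by (simp add: mv_part_def)
  qed
qed

lemma is_bracket_zero_left:
  assumes "Q \<in> A\<^sup>\<bullet> L q"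
  shows "is_bracket p q 0 Q 0"
proof -
  have "lie_operator p 0 \<eta> = 0" for \<eta>
    by (simp add: lie_operator interior_prod_0 form_operator_0[OF form_operator_d])
  then show ?thesis
    unfolding is_bracket_iff
    by (simp add: interior_prod_0 form_operator_0[OF form_operator_interior[OF assms]])
qed

lemma mvfields_eq_0_or_nat:
  assumes "P \<in> A\<^sup>\<bullet> L p"
  obtains "P = 0" | k where "p = int k"
proof (cases "p < 0")
  case True
  then show ?thesis using assms that(1) by (simp add: mvfields_neg)
next
  case False
  then show ?thesis using that(2)[of "nat p"] by simp
qed

text \<open>The sums in \<open>schouten\<close> run over the nonzero parts; were there infinitely
  many of them, the sum would be 0 by convention.\<close>

lemma all_mvfields_parts:
  assumes "Q \<in> \<A> L"
  shows "finite {k. mv_part L k Q \<noteq> 0}" "\<And>k. mv_part L k Q \<in> A\<^sup>\<bullet> L (int k)"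
proof -
  have "finite {k. mv_part L k Q \<noteq> 0} \<and> (\<forall>k. mv_part L k Q \<in> A\<^sup>\<bullet> L (int k))"
    using assms unfolding all_mvfields_def
  proof (induction rule: span_induct_alt)
    case base
    show "finite {k. mv_part L k 0 \<noteq> 0} \<and> (\<forall>k. mv_part L k 0 \<in> A\<^sup>\<bullet> L (int k))"
      by (simp add: mv_part_0 mvfields_0)
  next
    case (step c P Q)
    have lin: "mv_part L k (c *\<^sub>R P + Q) = c *\<^sub>R mv_part L k P + mv_part L k Q" for k
      using mv_part_lincomb[of k c P 1 Q] by simp
    have IH: "finite {k. mv_part L k Q \<noteq> 0} \<and> (\<forall>k. mv_part L k Q \<in> A\<^sup>\<bullet> L (int k))" by (rule step(2))
    obtain p where P: "P \<in> A\<^sup>\<bullet> L p" using step(1) by blast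
    have "finite {k. mv_part L k P \<noteq> 0} \<and> (\<forall>k. mv_part L k P \<in> A\<^sup>\<bullet> L (int k))"
    proof (cases rule: mvfields_eq_0_or_nat[OF P])
      case 1
      then show ?thesis by (simp add: mv_part_0 mvfields_0)
    next
      case (2 n)
      have "mv_part L k P = (if k = n then P else 0)" for k using mv_part_mvfields[of P n] P 2
        by simp
      then show ?thesis using P 2 by (simp add: mvfields_0)
    qed
    moreover have "{k. mv_part L k (c *\<^sub>R P + Q) \<noteq> 0} \<subseteq>
        {k. mv_part L k P \<noteq> 0} \<union> {k. mv_part L k Q \<noteq> 0}"
      by (auto simp: lin)
    ultimately show "finite {k. mv_part L k (c *\<^sub>R P + Q) \<noteq> 0} \<and>
        (\<forall>k. mv_part L k (c *\<^sub>R P + Q) \<in> A\<^sup>\<bullet> L (int k))"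
      using IH by (auto simp: lin intro!: mvfields_add mvfields_scaleR dest: finite_subset)
  qed
  then show "finite {k. mv_part L k Q \<noteq> 0}" "\<And>k. mv_part L k Q \<in> A\<^sup>\<bullet> L (int k)" by auto
qed

lemma mvfields_all: "Q \<in> A\<^sup>\<bullet> L q \<Longrightarrow> Q \<in> \<A> L"
  unfolding all_mvfields_def by (intro span_base) blast

lemma schouten_hom_0:
  shows schouten_hom_0_left: "Q \<in> A\<^sup>\<bullet> L q \<Longrightarrow> schouten_hom L p q 0 Q = 0"
    and schouten_hom_0_right: "P \<in> A\<^sup>\<bullet> L p \<Longrightarrow> schouten_hom L p q P 0 = 0"
  by (rule schouten_hom_eq; simp add: mvfields_0 is_bracket_zero_left is_bracket_zero_right)+

lemma schouten_0_left: "schouten L 0 Q = 0"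
  by (simp add: schouten_def mv_part_0)

text \<open>The index set may be enlarged so that two fields can be handled over a common one; the
  additional summands are brackets with 0.\<close>

lemma schouten_sum:
  assumes P: "P \<in> A\<^sup>\<bullet> L (int p)" and Q: "Q \<in> \<A> L" and K: "finite K" "{k. mv_part L k Q \<noteq> 0} \<subseteq> K"
  shows "schouten L P Q = (\<Sum>k\<in>K. schouten_hom L (int p) (int k) P (mv_part L k Q))"
proof (cases "P = 0")
  case True
  then show ?thesis using schouten_hom_0_left[OF all_mvfields_parts(2)[OF Q]]
    by (simp add: schouten_0_left)
next
  case False
  then have "{k. mv_part L k P \<noteq> 0} = {p}" "mv_part L p P = P"
    by (auto simp: mv_part_mvfields[OF P])
  then have "schouten L P Q =
      (\<Sum>k | mv_part L k Q \<noteq> 0. schouten_hom L (int p) (int k) P (mv_part L k Q))"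
    by (simp add: schouten_def)
  also have "\<dots> = (\<Sum>k\<in>K. schouten_hom L (int p) (int k) P (mv_part L k Q))"
    using K by (intro sum.mono_neutral_left) (auto simp: schouten_hom_0_right[OF P])
  finally show ?thesis .
qed

text \<open>Reconciles integer degrees with parts indexed by natural numbers: in a negative degree
  the field is 0, and a bracket with 0 is 0 whatever degrees are attached to it.\<close>

lemma schouten_eq_hom:
  assumes P: "P \<in> A\<^sup>\<bullet> L p" and Q: "Q \<in> A\<^sup>\<bullet> L q"
  shows "schouten L P Q = schouten_hom L p q P Q"
proof (cases rule: mvfields_eq_0_or_nat[OF P])
  case 1
  then show ?thesis using schouten_hom_0_left[OF Q] by (simp add: schouten_0_left)
next
  case p: (2 m)
  show ?thesis
  proof (cases rule: mvfields_eq_0_or_nat[OF Q])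
    case 1
    then show ?thesis using schouten_hom_0_right[OF P] by (simp add: schouten_def mv_part_0)
  next
    case q: (2 n)
    have parts: "mv_part L k Q = (if k = n then Q else 0)" for k using mv_part_mvfields[of Q n] Q q
      by simp
    then have "schouten L P Q = (\<Sum>k\<in>{n}. schouten_hom L (int m) (int k) P (mv_part L k Q))"
      using P p by (intro schouten_sum mvfields_all[OF Q]) auto
    then show ?thesis using p q parts by simp
  qed
qed

section \<open>Algebraic properties of the bracket\<close>

lemma schouten_closed: "\<lbrakk>P \<in> A\<^sup>\<bullet> L p; Q \<in> A\<^sup>\<bullet> L q\<rbrakk> \<Longrightarrow> schouten L P Q \<in> A\<^sup>\<bullet> L (p + q - 1)"
  by (simp add: schouten_eq_hom schouten_hom_closed)

lemma schouten_is_bracket: "\<lbrakk>P \<in> A\<^sup>\<bullet> L p; Q \<in> A\<^sup>\<bullet> L q\<rbrakk> \<Longrightarrow> is_bracket p q P Q (schouten L P Q)"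
  by (simp add: schouten_eq_hom schouten_hom_is_bracket)

lemma schouten_eqI:
  "\<lbrakk>P \<in> A\<^sup>\<bullet> L p; Q \<in> A\<^sup>\<bullet> L q; R \<in> A\<^sup>\<bullet> L (p + q - 1); is_bracket p q P Q R\<rbrakk> \<Longrightarrow> schouten L P Q = R"
  by (simp add: schouten_eq_hom schouten_hom_eq)

lemma schouten_fun_fun: "\<lbrakk>f \<in> C; g \<in> C\<rbrakk> \<Longrightarrow> schouten L (mv_of_fun L f) (mv_of_fun L g) = 0"
  by (rule schouten_eqI[OF mvfields_fun mvfields_fun _ is_bracket_fun_fun])
      (simp_all only: mvfields_0)

lemma schouten_sec_sec:
  assumes "V \<in> \<Gamma> L" "W \<in> \<Gamma> L"
  shows "schouten L (mv_of_sec L V) (mv_of_sec L W) = mv_of_sec L (brk L V W)"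
  using schouten_eqI[OF mvfields_sec[OF assms(1)] mvfields_sec[OF assms(2)] _
      is_bracket_sec_sec[OF assms]]
    mvfields_sec[OF brk_closed[OF assms]] by simp

lemma schouten_skew:
  assumes P: "P \<in> A\<^sup>\<bullet> L p" and Q: "Q \<in> A\<^sup>\<bullet> L q"
  shows "schouten L P Q = - (((-1) powi ((p - 1) * (q - 1))) *\<^sub>R schouten L Q P)"
proof (rule schouten_eqI[OF P Q])
  have "(- ((-1) powi ((p - 1) * (q - 1)))) *\<^sub>R schouten L Q P \<in> A\<^sup>\<bullet> L (q + p - 1)"
    by (rule mvfields_scaleR[OF schouten_closed[OF Q P]])
  then show "- (((-1) powi ((p - 1) * (q - 1))) *\<^sub>R schouten L Q P) \<in> A\<^sup>\<bullet> L (p + q - 1)"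
    by (simp only: scaleR_minus_left add.commute)
  show "is_bracket p q P Q (- (((-1) powi ((p - 1) * (q - 1))) *\<^sub>R schouten L Q P))"
    using is_bracket_skew[OF Q P schouten_is_bracket[OF Q P]] by (simp only: mult.commute)
qed

lemma schouten_wedge:
  assumes P: "P \<in> A\<^sup>\<bullet> L p" and Q: "Q \<in> A\<^sup>\<bullet> L q" "Q' \<in> A\<^sup>\<bullet> L q'"
  shows "schouten L P (mv_wedge L Q Q') =
    mv_wedge L (schouten L P Q) Q' + ((-1) powi ((p - 1) * q)) *\<^sub>R mv_wedge L Q (schouten L P Q')"
proof (rule schouten_eqI[OF P mvfields_wedge[OF Q]])
  note c = schouten_closed[OF P Q(1)] schouten_closed[OF P Q(2)]
  have "mv_wedge L (schouten L P Q) Q' \<in> A\<^sup>\<bullet> L (p + q - 1 + q')"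
    "mv_wedge L Q (schouten L P Q') \<in> A\<^sup>\<bullet> L (q + (p + q' - 1))"
    by (intro mvfields_wedge c Q)+
  moreover have "p + q - 1 + q' = p + (q + q') - 1" "q + (p + q' - 1) = p + (q + q') - 1"
    by simp_all
  ultimately show "mv_wedge L (schouten L P Q) Q' +
      ((-1) powi ((p - 1) * q)) *\<^sub>R mv_wedge L Q (schouten L P Q')
      \<in> A\<^sup>\<bullet> L (p + (q + q') - 1)"
    by (intro mvfields_add mvfields_scaleR) (simp_all only:)
  show "is_bracket p (q + q') P (mv_wedge L Q Q')
      (mv_wedge L (schouten L P Q) Q' + ((-1) powi ((p - 1) * q)) *\<^sub>R mv_wedge L Q
        (schouten L P Q'))"
    by (intro is_bracket_wedge P Q c schouten_is_bracket)
qed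

lemma schouten_hom_lincomb:
  assumes "P \<in> A\<^sup>\<bullet> L p" "Q \<in> A\<^sup>\<bullet> L q" "Q' \<in> A\<^sup>\<bullet> L q"
  shows "schouten_hom L p q P (a *\<^sub>R Q + b *\<^sub>R Q') =
      a *\<^sub>R schouten_hom L p q P Q + b *\<^sub>R schouten_hom L p q P Q'"
proof -
  have "schouten_hom L p q P (c *\<^sub>R R + S) = c *\<^sub>R schouten_hom L p q P R + schouten_hom L p q P S"
    if "R \<in> A\<^sup>\<bullet> L q" "S \<in> A\<^sup>\<bullet> L q" for c R S
    using assms(1) that
    by (intro schouten_hom_eq mvfields_add mvfields_scaleR schouten_hom_closed
        is_bracket_lincomb_right schouten_hom_is_bracket)
  note this[OF assms(2) mvfields_scaleR[OF assms(3)], of a b] this[OF assms(3) mvfields_0, of b]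
  then show ?thesis by (simp add: schouten_hom_0_right[OF assms(1)])
qed

lemma schouten_lincomb:
  assumes P: "P \<in> A\<^sup>\<bullet> L p" and Q: "Q \<in> \<A> L" "R \<in> \<A> L"
  shows "schouten L P (a *\<^sub>R Q + b *\<^sub>R R) = a *\<^sub>R schouten L P Q + b *\<^sub>R schouten L P R"
proof (cases rule: mvfields_eq_0_or_nat[OF P])
  case 1
  then show ?thesis by (simp add: schouten_0_left)
next
  case (2 n)
  let ?K = "{k. mv_part L k Q \<noteq> 0} \<union> {k. mv_part L k R \<noteq> 0}"
  have P': "P \<in> A\<^sup>\<bullet> L (int n)" using P 2 by simp
  have K: "finite ?K" using all_mvfields_parts(1)[OF Q(1)] all_mvfields_parts(1)[OF Q(2)] by simp
  have S: "a *\<^sub>R Q + b *\<^sub>R R \<in> \<A> L" using Q unfolding all_mvfields_def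
    by (intro span_add span_scale)
  have "schouten L P (a *\<^sub>R Q + b *\<^sub>R R) =
      (\<Sum>k\<in>?K. schouten_hom L (int n) (int k) P (mv_part L k (a *\<^sub>R Q + b *\<^sub>R R)))"
    by (rule schouten_sum[OF P' S K]) (auto simp: mv_part_lincomb)
  also have "\<dots> = (\<Sum>k\<in>?K. a *\<^sub>R schouten_hom L (int n) (int k) P (mv_part L k Q) +
      b *\<^sub>R schouten_hom L (int n) (int k) P (mv_part L k R))"
    unfolding mv_part_lincomb
    by (intro sum.cong refl schouten_hom_lincomb P' all_mvfields_parts(2) Q)
  also have "\<dots> = a *\<^sub>R schouten L P Q + b *\<^sub>R schouten L P R"
    unfolding schouten_sum[OF P' Q(1) K Un_upper1] schouten_sum[OF P' Q(2) K Un_upper2]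
    by (simp add: sum.distrib scaleR_sum_right)
  finally show ?thesis .
qed

lemma graded_derivation_schouten:
  assumes P: "P \<in> A\<^sup>\<bullet> L p"
  shows "graded_derivation L (p - 1) (schouten L P)"
  unfolding graded_derivation_def
proof (intro conjI ballI allI)
  fix q show "schouten L P ` A\<^sup>\<bullet> L q \<subseteq> A\<^sup>\<bullet> L (q + (p - 1))"
    using schouten_closed[OF P, of _ q] by (auto simp: algebra_simps)
qed (rule schouten_lincomb[OF P] schouten_wedge[OF P]; assumption)+

text \<open>The graded commutator of d with [i(P), d] vanishes because d squares to 0.\<close>

lemma lie_operator_d:
  assumes P: "P \<in> A\<^sup>\<bullet> L p" and \<eta>: "\<eta> \<in> \<Omega> L"
  shows "d (lie_operator p P \<eta>) = - (((-1) powi p) *\<^sub>R lie_operator p P (d \<eta>))"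
proof -
  note c = form_operator_closed[OF form_operator_interior[OF P]]
      form_operator_closed[OF form_operator_d]
    subspace_scale[OF all_formfields_subspace]
  have "d (lie_operator p P \<eta>) = d (interior_prod P (d \<eta>))"
    using \<eta> by (simp add: lie_operator c form_operator_diff[OF form_operator_d]
        form_operator_scale[OF form_operator_d] d_d)
  moreover have "lie_operator p P (d \<eta>) = - (((-1) powi p) *\<^sub>R d (interior_prod P (d \<eta>)))"
    using \<eta> by (simp add: lie_operator d_d form_operator_0[OF form_operator_interior[OF P]])
  ultimately show ?thesis by (simp add: minus_one_powi)
qed

text \<open>Take the graded commutator of i([P, Q]) = [L_P, i(Q)] with d, writing L_P for [i(P), d]:
  since L_P commutes with d in the graded sense, it passes to [i(Q), d].\<close>

lemma lie_operator_schouten: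
  assumes P: "P \<in> A\<^sup>\<bullet> L p" and Q: "Q \<in> A\<^sup>\<bullet> L q" and \<eta>: "\<eta> \<in> \<Omega> L"
  shows "lie_operator (p + q - 1) (schouten L P Q) \<eta> = lie_operator p P (lie_operator q Q \<eta>) -
    ((-1) powi ((p - 1) * (q - 1))) *\<^sub>R lie_operator q Q (lie_operator p P \<eta>)"
proof -
  let ?X = "lie_operator p P" and ?Q = "interior_prod Q"
  note dd = form_operator_d and iQ = form_operator_interior[OF Q] and X = form_operator_lie[OF P]
  note c = form_operator_closed[OF dd] form_operator_closed[OF iQ] form_operator_closed[OF X]
    subspace_scale[OF all_formfields_subspace]
  have b: "interior_prod (schouten L P Q) \<omega> = ?X (?Q \<omega>) - ((-1) powi ((p - 1) * q)) *\<^sub>R ?Q (?X \<omega>)"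
    if "\<omega> \<in> \<Omega> L" for \<omega>
    using schouten_is_bracket[OF P Q] that by (simp add: is_bracket_iff)
  have 1: "?X (?Q (d \<eta>) - ((-1) powi q) *\<^sub>R d (?Q \<eta>)) =
      ?X (?Q (d \<eta>)) - ((-1) powi q) *\<^sub>R ?X (d (?Q \<eta>))"
    using \<eta> by (simp add: form_operator_diff[OF X] form_operator_scale[OF X] c)
  have 2: "d (?X (?Q \<eta>) - ((-1) powi ((p - 1) * q)) *\<^sub>R ?Q (?X \<eta>)) =
      - (((-1) powi p) *\<^sub>R ?X (d (?Q \<eta>))) - ((-1) powi ((p - 1) * q)) *\<^sub>R d (?Q (?X \<eta>))"
    using \<eta> by (simp add: form_operator_diff[OF dd] form_operator_scale[OF dd] c
        lie_operator_d[OF P])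
  have 3: "?Q (d (?X \<eta>)) = - (((-1) powi p) *\<^sub>R ?Q (?X (d \<eta>)))"
    using \<eta> by (simp add: lie_operator_d[OF P] form_operator_uminus[OF iQ]
        form_operator_scale[OF iQ] c)
  show ?thesis
    unfolding lie_operator[of "p + q - 1"] lie_operator[of q] b[OF c(1)[OF \<eta>]] b[OF \<eta>] 1 2 3
    by (cases "even p"; cases "even q") (simp_all add: minus_one_powi algebra_simps)
qed

text \<open>The Jacobi identity in derivation form. On forms it is the graded Jacobi identity for
  composition of L_P, L_Q and i(S), once \<open>lie_operator_schouten\<close> identifies the
  operator of \<open>schouten L P Q\<close> with the commutator of L_P and L_Q.\<close>

lemma schouten_derivation_schouten:
  assumes P: "P \<in> A\<^sup>\<bullet> L p" and Q: "Q \<in> A\<^sup>\<bullet> L q" and S: "S \<in> A\<^sup>\<bullet> L s"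
  shows "schouten L (schouten L P Q) S = schouten L P (schouten L Q S) -
    ((-1) powi ((p - 1) * (q - 1))) *\<^sub>R schouten L Q (schouten L P S)" (is "?l = ?r")
proof (rule is_bracket_unique)
  note PQ = schouten_closed[OF P Q] and QS = schouten_closed[OF Q S] and PS =
      schouten_closed[OF P S]
  show "?l \<in> A\<^sup>\<bullet> L (p + q - 1 + s - 1)" by (rule schouten_closed[OF PQ S])
  have "schouten L P (schouten L Q S) \<in> A\<^sup>\<bullet> L (p + q - 1 + s - 1)"
    using schouten_closed[OF P QS] by (simp add: algebra_simps)
  moreover have "schouten L Q (schouten L P S) \<in> A\<^sup>\<bullet> L (p + q - 1 + s - 1)"
    using schouten_closed[OF Q PS] by (simp add: algebra_simps)
  ultimately have "(- ((-1) powi ((p - 1) * (q - 1)))) *\<^sub>R schouten L Q (schouten L P S) +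
      schouten L P (schouten L Q S)
      \<in> A\<^sup>\<bullet> L (p + q - 1 + s - 1)"
    by (intro mvfields_add mvfields_scaleR)
  then show "?r \<in> A\<^sup>\<bullet> L (p + q - 1 + s - 1)" by simp
  show "is_bracket (p + q - 1) s (schouten L P Q) S ?l" by (rule schouten_is_bracket[OF PQ S])
  show "is_bracket (p + q - 1) s (schouten L P Q) S ?r"
    unfolding is_bracket_iff
  proof
    fix \<eta> assume \<eta>: "\<eta> \<in> \<Omega> L"
    let ?X = "lie_operator p P" and ?Y = "lie_operator q Q" and ?S = "interior_prod S"
    note X = form_operator_lie[OF P] and Y = form_operator_lie[OF Q] and iS =
        form_operator_interior[OF S]
    note c = form_operator_closed[OF X] form_operator_closed[OF Y] form_operator_closed[OF iS]
      subspace_scale[OF all_formfields_subspace] subspace_add[OF all_formfields_subspace]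
    note lin = form_operator_add[OF X] form_operator_add[OF Y] form_operator_add[OF iS]
        form_operator_diff[OF X] form_operator_diff[OF Y] form_operator_diff[OF iS]
      form_operator_scale[OF X] form_operator_scale[OF Y] form_operator_scale[OF iS]
    have qs: "interior_prod (schouten L Q S) \<omega> =
        ?Y (?S \<omega>) - ((-1) powi ((q - 1) * s)) *\<^sub>R ?S (?Y \<omega>)"
      and ps: "interior_prod (schouten L P S) \<omega> =
          ?X (?S \<omega>) - ((-1) powi ((p - 1) * s)) *\<^sub>R ?S (?X \<omega>)"
      and pqs: "interior_prod (schouten L P (schouten L Q S)) \<omega> =
          ?X (interior_prod (schouten L Q S) \<omega>) -
        ((-1) powi ((p - 1) * (q + s - 1))) *\<^sub>R interior_prod (schouten L Q S) (?X \<omega>)"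
      and qps: "interior_prod (schouten L Q (schouten L P S)) \<omega> =
          ?Y (interior_prod (schouten L P S) \<omega>) -
        ((-1) powi ((q - 1) * (p + s - 1))) *\<^sub>R interior_prod (schouten L P S) (?Y \<omega>)"
      if "\<omega> \<in> \<Omega> L" for \<omega>
      using schouten_is_bracket[OF Q S] schouten_is_bracket[OF P S] schouten_is_bracket[OF P QS]
        schouten_is_bracket[OF Q PS] that by (simp_all add: is_bracket_iff)
    have r: "interior_prod ?r \<eta> = interior_prod (schouten L P (schouten L Q S)) \<eta> -
        ((-1) powi ((p - 1) * (q - 1))) *\<^sub>R interior_prod (schouten L Q (schouten L P S)) \<eta>"
      using interior_prod_add[of "schouten L P (schouten L Q S)"
          "(- ((-1) powi ((p - 1) * (q - 1)))) *\<^sub>R schouten L Q (schouten L P S)" \<eta>]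
      unfolding interior_prod_scaleR by simp
    show "interior_prod ?r \<eta> = lie_operator (p + q - 1) (schouten L P Q) (?S \<eta>) -
        ((-1) powi ((p + q - 1 - 1) * s)) *\<^sub>R ?S (lie_operator (p + q - 1) (schouten L P Q) \<eta>)"
      unfolding r pqs[OF \<eta>] qps[OF \<eta>] lie_operator_schouten[OF P Q \<eta>]
          lie_operator_schouten[OF P Q c(3)[OF \<eta>]]
        qs[OF \<eta>] ps[OF \<eta>] qs[OF c(1)[OF \<eta>]] ps[OF c(2)[OF \<eta>]]
      using \<eta> by (cases "even p"; cases "even q"; cases "even s")
          (simp_all add: c lin minus_one_powi algebra_simps)
  qed
qed

text \<open>The cyclic form follows from the derivation form: skew symmetry turns the last two
  double brackets into nested brackets on the right, which cancel against the expansion of the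
  first.\<close>

lemma schouten_jacobi:
  assumes P: "P \<in> A\<^sup>\<bullet> L p" and Q: "Q \<in> A\<^sup>\<bullet> L q" and R: "R \<in> A\<^sup>\<bullet> L r"
  shows "((-1) powi ((p - 1) * (r - 1))) *\<^sub>R schouten L (schouten L P Q) R +
    ((-1) powi ((q - 1) * (p - 1))) *\<^sub>R schouten L (schouten L Q R) P +
    ((-1) powi ((r - 1) * (q - 1))) *\<^sub>R schouten L (schouten L R P) Q = 0"
proof -
  have QR: "schouten L (schouten L Q R) P =
      - (((-1) powi ((q + r - 1 - 1) * (p - 1))) *\<^sub>R schouten L P (schouten L Q R))"
    by (rule schouten_skew[OF schouten_closed[OF Q R] P])
  have RP: "schouten L (schouten L R P) Q =
      - (((-1) powi ((r + p - 1 - 1) * (q - 1))) *\<^sub>R schouten L Q (schouten L R P))"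
    by (rule schouten_skew[OF schouten_closed[OF R P] Q])
  \<comment> \<open>The summand with coefficient 0 merely brings the expression into the shape of
    \<open>schouten_lincomb\<close>.\<close>
  have "schouten L Q (schouten L R P) =
      schouten L Q ((- ((-1) powi ((r - 1) * (p - 1)))) *\<^sub>R schouten L P R + 0 *\<^sub>R schouten L P R)"
    using schouten_skew[OF R P] by simp
  also have "\<dots> = - (((-1) powi ((r - 1) * (p - 1))) *\<^sub>R schouten L Q (schouten L P R))"
    using mvfields_all[OF schouten_closed[OF P R]] by (subst schouten_lincomb[OF Q]) simp_all
  finally have PR: "schouten L Q (schouten L R P) =
      - (((-1) powi ((r - 1) * (p - 1))) *\<^sub>R schouten L Q (schouten L P R))" .
  show ?thesis
    unfolding schouten_derivation_schouten[OF P Q R] QR RP PR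
    by (cases "even p"; cases "even q"; cases "even r") (simp_all add: minus_one_powi algebra_simps)
qed

section \<open>The bracket with a section as a Lie derivative\<close>

lemma pairing_interior:
  assumes "P \<in> A\<^sup>\<bullet> L (int k)" "\<eta> \<in> \<Omega> L"
  shows "pairing \<eta> P = (\<lambda>x. (-1) ^ (\<Sum>i<k. i) * eval_form (interior_prod P \<eta>) [] x)"
proof
  fix x
  have "P x \<in> ext_power (F x) k" using mvfields_degree[OF assms(1)] by (simp add: mv_degree_def)
  then have "eval_form (interior_prod P \<eta>) [] x = (-1) ^ (\<Sum>i<k. i) * P x (\<eta> x)"
    using contract_Nil[OF _ all_formfields_ext_forms[OF assms(2)]]
    by (simp add: eval_form_def interior_prod_def)
  then show "pairing \<eta> P x = (-1) ^ (\<Sum>i<k. i) * eval_form (interior_prod P \<eta>) [] x"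
    by (simp add: pairing_def power_mult_distrib[symmetric])
qed

lemma pairing_smooth:
  assumes "P \<in> A\<^sup>\<bullet> L (int k)" "\<eta> \<in> \<Omega> L"
  shows "pairing \<eta> P \<in> C"
  unfolding pairing_interior[OF assms]
  by (intro smooth_fun_mult[unfolded times_fun_def] smooth_fun_const
      list_form_smooth[OF list_form_eval[OF interior_closed[OF assms]]]) simp

text \<open>Resolves the definite description: by Cartan's formula both sides take the same values
  on sections, and these values determine a form.\<close>

lemma lie_form_lie_operator:
  assumes "V \<in> \<Gamma> L" "\<eta> \<in> \<Omega> L"
  shows "lie_form L V \<eta> = lie_operator 1 (mv_of_sec L V) \<eta>"
  unfolding lie_form_def
proof (rule the_equality)
  let ?f = "\<lambda>Vs x. D V (eval_form \<eta> Vs) x -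
    (\<Sum>i<length Vs. eval_form \<eta> (Vs[i := brk L V (Vs ! i)]) x)"
  have f: "lie_op V (eval_form \<eta>) Vs = ?f Vs" for Vs
    by (simp add: lie_op_def lie_sum_list_update fun_eq_iff sum_fun_apply)
  have l: "lie_operator 1 (mv_of_sec L V) \<eta> \<in> \<Omega> L"
    by (rule form_operator_closed[OF form_operator_lie[OF mvfields_sec[OF assms(1)]] assms(2)])
  show "lie_operator 1 (mv_of_sec L V) \<eta> \<in> \<Omega> L \<and>
      (\<forall>Vs. set Vs \<subseteq> \<Gamma> L \<longrightarrow> eval_form (lie_operator 1 (mv_of_sec L V) \<eta>) Vs = ?f Vs)"
    using l eval_lie_sec[OF assms] by (simp add: f)
  show "\<omega> = lie_operator 1 (mv_of_sec L V) \<eta>"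
    if "\<omega> \<in> \<Omega> L \<and> (\<forall>Vs. set Vs \<subseteq> \<Gamma> L \<longrightarrow> eval_form \<omega> Vs = ?f Vs)" for \<omega>
    using that l eval_lie_sec[OF assms] by (intro all_formfields_eqI) (simp_all add: f)
qed

text \<open>Evaluate i([V, Q])\<eta> = L_V i(Q)\<eta> - i(Q) L_V \<eta> on the empty list, where L_V
  acts on a function. All three contractions are by fields of degree \<open>k\<close>, so they
  become pairings with one common sign.\<close>

lemma pairing_schouten_sec:
  assumes V: "V \<in> \<Gamma> L" and Q: "Q \<in> A\<^sup>\<bullet> L (int k)" and \<eta>: "\<eta> \<in> \<Omega> L"
  shows "pairing \<eta> (schouten L (mv_of_sec L V) Q) =
    (\<lambda>x. D V (pairing \<eta> Q) x - pairing (lie_form L V \<eta>) Q x)"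
proof
  fix x
  let ?X = "lie_operator 1 (mv_of_sec L V)" and ?e = "\<lambda>\<omega>. eval_form \<omega> []" and ?\<sigma> =
    "(-1) ^ (\<Sum>i<k. i) :: real"
  have R: "schouten L (mv_of_sec L V) Q \<in> A\<^sup>\<bullet> L (int k)"
    using schouten_closed[OF mvfields_sec[OF V] Q] by simp
  have l: "?X \<eta> \<in> \<Omega> L" by (rule form_operator_closed[OF form_operator_lie[OF mvfields_sec[OF V]] \<eta>])
  note iQ = interior_closed[OF Q \<eta>]
  have "?e (interior_prod Q \<eta>) \<in> C" by (rule list_form_smooth[OF list_form_eval[OF iQ]]) simp
  then have D: "D V (\<lambda>x. ?\<sigma> * ?e (interior_prod Q \<eta>) x) x = ?\<sigma> * D V (?e (interior_prod Q \<eta>)) x"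
    using D_lin[OF V, of "?e (interior_prod Q \<eta>)" "?e (interior_prod Q \<eta>)" ?\<sigma> 0] by simp
  have "interior_prod (schouten L (mv_of_sec L V) Q) \<eta> =
      ?X (interior_prod Q \<eta>) - interior_prod Q (?X \<eta>)"
    using schouten_is_bracket[OF mvfields_sec[OF V] Q] \<eta> by (simp add: is_bracket_iff)
  then have "?e (interior_prod (schouten L (mv_of_sec L V) Q) \<eta>) x =
      D V (?e (interior_prod Q \<eta>)) x - ?e (interior_prod Q (?X \<eta>)) x"
    using eval_lie_sec[OF V iQ, of "[]"] by (simp add: eval_form_diff lie_op_def)
  then show "pairing \<eta> (schouten L (mv_of_sec L V) Q) x =
      D V (pairing \<eta> Q) x - pairing (lie_form L V \<eta>) Q x"
    unfolding lie_form_lie_operator[OF V \<eta>] pairing_interior[OF R \<eta>] pairing_interior[OF Q \<eta>]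
        pairing_interior[OF Q l] D
    by (simp add: right_diff_distrib)
qed

lemma unit_form_formfields: "unit_form \<in> \<Omega>\<^sup>\<bullet> L 0"
  using smooth_fun_const
  by (auto simp: formfields_def alt_forms_def unit_form_def multi_indices_def smooth_fun_const)

text \<open>A 0-vector is a multiple of the empty product, and pairing with the constant form 1
  finds the factor. In degree 0 \<open>lie_mv\<close> is defined through this function.\<close>

lemma mvfields_0_eq_fun:
  assumes "Q \<in> A\<^sup>\<bullet> L 0"
  shows "pairing unit_form Q \<in> C" "Q = mv_of_fun L (pairing unit_form Q)"
proof -
  have Q: "Q \<in> A\<^sup>\<bullet> L (int 0)" using assms by simp
  show g: "pairing unit_form Q \<in> C"
    by (rule pairing_smooth[OF Q formfields_all[OF unit_form_formfields]])
  show "Q = mv_of_fun L (pairing unit_form Q)"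
  proof
    fix x
    show "Q x = mv_of_fun L (pairing unit_form Q) x"
    proof (rule mvfields_eqI_pairing[OF assms mvfields_fun[OF g]])
      fix \<eta> :: "('m, 'v) formfield" assume \<eta>: "\<eta> \<in> \<Omega>\<^sup>\<bullet> L 0"
      then have "\<eta> x vs = 0" if "vs \<noteq> []" for vs using that
        by (simp add: formfields_def alt_forms_def)
      then have \<eta>x: "\<eta> x = (\<lambda>vs. \<eta> x [] * unit_form x vs + 0)"
        by (auto simp: unit_form_def fun_eq_iff)
      have Qx: "Q x \<in> ext_power (F x) 0" using mvfields_degree[OF Q] by (simp add: mv_degree_def)
      have "Q x (\<eta> x) = \<eta> x [] * Q x (unit_form x) + Q x (\<lambda>_. 0)"
        by (subst \<eta>x, rule ext_power_lincomb[OF Qx _ ext_forms_zero])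
          (rule all_formfields_ext_forms[OF formfields_all[OF unit_form_formfields]])
      then have "Q x (\<eta> x) = \<eta> x [] * Q x (unit_form x)" by (simp add: ext_power_zero_form[OF Qx])
      then show "Q x (\<eta> x) = mv_of_fun L (pairing unit_form Q) x (\<eta> x)"
        using all_formfields_ext_forms[OF formfields_all[OF \<eta>]]
        by (simp add: mv_of_fun_def wedge_list_def pairing_def)
    qed
  qed
qed

text \<open>Degree 0 is the bracket of a section and a function. In the other degrees
  \<open>lie_mv\<close> is a definite description, which the bracket satisfies and which has one
  solution because global forms separate multivectors at each point.\<close>

lemma schouten_sec:
  assumes V: "V \<in> \<Gamma> L" and Q: "Q \<in> A\<^sup>\<bullet> L q"
  shows "schouten L (mv_of_sec L V) Q = lie_mv L V q Q"
proof (cases "q = 0")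
  case True
  define g where "g = pairing unit_form Q"
  have g: "g \<in> C" "Q = mv_of_fun L g" using mvfields_0_eq_fun[of Q] Q True by (simp_all add: g_def)
  have "schouten L (mv_of_sec L V) (mv_of_fun L g) = mv_of_fun L (D V g)"
    by (rule schouten_eqI[OF mvfields_sec[OF V] mvfields_fun[OF g(1)] _
        is_bracket_sec_fun[OF V g(1)]])
      (simp add: mvfields_fun[OF D_smooth[OF V g(1)]])
  then show ?thesis using True by (simp add: lie_mv_def flip: g_def g(2))
next
  case False
  let ?c = "\<lambda>R. \<forall>\<eta>\<in>\<Omega>\<^sup>\<bullet> L q. pairing \<eta> R = (\<lambda>x. D V (pairing \<eta> Q) x - pairing (lie_form L V \<eta>) Q x)"
  have R: "schouten L (mv_of_sec L V) Q \<in> A\<^sup>\<bullet> L q" using schouten_closed[OF mvfields_sec[OF V] Q]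
    by simp
  have unique: "R = S" if "R \<in> A\<^sup>\<bullet> L q" "S \<in> A\<^sup>\<bullet> L q" "?c R" "?c S" for R S
  proof
    fix x show "R x = S x"
    proof (rule mvfields_eqI_pairing[OF that(1,2)])
      fix \<eta> assume "\<eta> \<in> \<Omega>\<^sup>\<bullet> L q"
      then have "pairing \<eta> R x = pairing \<eta> S x" using that(3,4) by simp
      then show "R x (\<eta> x) = S x (\<eta> x)" by (simp add: pairing_def)
    qed
  qed
  have c: "?c (schouten L (mv_of_sec L V) Q)"
  proof (cases "q < 0")
    case True
    have "schouten L (mv_of_sec L V) Q = 0" "Q = 0" using R Q True by (simp_all add: mvfields_neg)
    moreover have "D V (\<lambda>_. 0) x = 0" for x using D_0[OF V] by (simp add: zero_fun_def)
    ultimately show ?thesis by (simp add: pairing_def)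
  next
    case False
    then have "Q \<in> A\<^sup>\<bullet> L (int (nat q))" using Q by simp
    then show ?thesis using pairing_schouten_sec[OF V _ formfields_all] by blast
  qed
  have "lie_mv L V q Q = (THE R. R \<in> A\<^sup>\<bullet> L q \<and> ?c R)" using False by (simp add: lie_mv_def)
  also have "\<dots> = schouten L (mv_of_sec L V) Q"
  proof (rule the_equality)
    show "schouten L (mv_of_sec L V) Q \<in> A\<^sup>\<bullet> L q \<and> ?c (schouten L (mv_of_sec L V) Q)"
      by (intro conjI R c)
    show "R = schouten L (mv_of_sec L V) Q" if "R \<in> A\<^sup>\<bullet> L q \<and> ?c R" for R
      by (rule unique[OF conjunct1[OF that] R conjunct2[OF that] c])
  qed
  finally show ?thesis by simp
qed

end

theorem proposition4p4p9:
  fixes L :: "('m::{t2_space, second_countable_topology}, 'v::real_vector) algebroid"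
  assumes "lie_algebroid L"
  shows
    "(\<forall>f\<in>C\<^sup>\<infinity> (base L). \<forall>g\<in>C\<^sup>\<infinity> (base L). schouten L (mv_of_fun L f) (mv_of_fun L g) = 0) \<and>
     (\<forall>V\<in>\<Gamma> L. \<forall>q::int. \<forall>Q\<in>A\<^sup>\<bullet> L q. schouten L (mv_of_sec L V) Q = lie_mv L V q Q) \<and>
     (\<forall>V\<in>\<Gamma> L. \<forall>W\<in>\<Gamma> L.
        schouten L (mv_of_sec L V) (mv_of_sec L W) = mv_of_sec L (brk L V W)) \<and>
     (\<forall>(p::int) (q::int). \<forall>P\<in>A\<^sup>\<bullet> L p. \<forall>Q\<in>A\<^sup>\<bullet> L q.
        schouten L P Q = - (((-1) powi ((p - 1) * (q - 1))) *\<^sub>R schouten L Q P)) \<and>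
     (\<forall>p::int. \<forall>P\<in>A\<^sup>\<bullet> L p.
        graded_derivation L (p - 1) (schouten L P) \<and>
        (\<forall>(q\<^sub>1::int) (q\<^sub>2::int). \<forall>Q\<^sub>1\<in>A\<^sup>\<bullet> L q\<^sub>1. \<forall>Q\<^sub>2\<in>A\<^sup>\<bullet> L q\<^sub>2.
           schouten L P (mv_wedge L Q\<^sub>1 Q\<^sub>2) =
           mv_wedge L (schouten L P Q\<^sub>1) Q\<^sub>2 +
           ((-1) powi ((p - 1) * q\<^sub>1)) *\<^sub>R mv_wedge L Q\<^sub>1 (schouten L P Q\<^sub>2))) \<and>
     (\<forall>(p::int) (q::int) (r::int). \<forall>P\<in>A\<^sup>\<bullet> L p. \<forall>Q\<in>A\<^sup>\<bullet> L q. \<forall>R\<in>A\<^sup>\<bullet> L r.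
        ((-1) powi ((p - 1) * (r - 1))) *\<^sub>R schouten L (schouten L P Q) R +
        ((-1) powi ((q - 1) * (p - 1))) *\<^sub>R schouten L (schouten L Q R) P +
        ((-1) powi ((r - 1) * (q - 1))) *\<^sub>R schouten L (schouten L R P) Q = 0)"
proof -
  interpret lie_algebroid L by (rule assms)
  show ?thesis
    by (intro conjI ballI allI schouten_fun_fun schouten_sec schouten_sec_sec schouten_skew graded_derivation_schouten
        schouten_wedge schouten_jacobi)
qed

end
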